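(* Assume that $f,M\in C^1([0,T);L^2(\Omega))$, that $w_0=(u_0,\dot u_0,P_0,\dot P_0)\in\mathcal{D}(\mathcal{A})$, and that the fourth order elasticity tensors $\mathbb{C},\mathbb{L}_c,\mathbb{H}$ are positive definite and satisfy the symmetries $\mathbb{C}_{ijrs}=\mathbb{C}_{rsij}=\mathbb{C}_{jirs}$, $\mathbb{H}_{ijrs}=\mathbb{H}_{rsij}=\mathbb{H}_{jirs}$, $(\mathbb{L}_c)_{ijrs}=(\mathbb{L}_c)_{rsij}$. Then there exists a unique solution $$w\in C^1((0,T);\mathcal{X})\cap C^0([0,T);\mathcal{D}(\mathcal{A}))$$ of the Cauchy problem $$\frac{dw}{dt}(t)=\mathcal{A}w(t)+\mathcal{F}(t),\qquad w(0)=w_0,\qquad\text{where }\mathcal{F}(t)=(0,f(t),0,M(t)).$$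
   Context: $\Omega\subset\mathbb{R}^3$ is a bounded domain with piecewise smooth boundary; $T>0$. On $\mathbb{R}^{3\times3}$: $\langle X,Y\rangle=\mathrm{tr}(XY^T)$, $\|X\|^2=\langle X,X\rangle$, $\mathrm{sym}\,X=\frac12(X+X^T)$; $\mathrm{Sym}(3)$ is the set of symmetric matrices. $\nabla u$ is the matrix field whose $i$-th row is the gradient of $u_i$; $\mathrm{Curl}$ and $\mathrm{Div}$ act row-wise on matrix fields. All derivatives in space are distributional. $H^1_0(\Omega)$ is the closure of $C_0^\infty(\Omega)$ in $H^1(\Omega)$ (vector-valued); $H_0(\mathrm{Curl};\Omega)$ is the closure of $C_0^\infty(\Omega)$ matrix fields for the norm $(\|P\|^2_{L^2(\Omega)}+\|\mathrm{Curl}\,P\|_{L^2(\Omega)}^2)^{1/2}$. $\mathbb{C},\mathbb{H},\mathbb{L}_c$ are fourth order tensor fields of class $C^1(\Omega)$, acting by $(\mathbb{C}.X)_{ij}=\sum_{k,l}\mathbb{C}_{ijkl}X_{kl}$. Positive definite means: there are positive constants such that at every point of $\Omega$, $c_m\|X\|^2\le\langle\mathbb{C}.X,X\rangle\le c_M\|X\|^2$ and $h_m\|X\|^2\le\langle\mathbb{H}.X,X\rangle\le h_M\|X\|^2$ for all $X\in\mathrm{Sym}(3)$, and $(L_c)_m\|X\|^2\le\langle\mathbb{L}_c.X,X\rangle\le (L_c)_M\|X\|^2$ for all $X\in\mathbb{R}^{3\times3}$. $\mathcal{X}=\{w=(u,v,P,K): u\in H_0^1(\Omega),\ v\in L^2(\Omega),\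 P\in H_0(\mathrm{Curl};\Omega),\ K\in L^2(\Omega)\}$ ($u,v$ vector fields, $P,K$ matrix fields), a Hilbert space with inner product $$(w_1,w_2)=\int_\Omega\big(\langle v_1,v_2\rangle+\langle K_1,K_2\rangle+\langle\mathbb{C}.\mathrm{sym}(\nabla u_1-P_1),\mathrm{sym}(\nabla u_2-P_2)\rangle+\langle\mathbb{H}.\mathrm{sym}P_1,\mathrm{sym}P_2\rangle+\langle\mathbb{L}_c.\mathrm{Curl}P_1,\mathrm{Curl}P_2\rangle\big)dv,$$ whose norm is equivalent to the usual product norm. The operator $\mathcal{A}$ is $$\mathcal{A}w=\big(v,\ \mathrm{Div}[\mathbb{C}.\mathrm{sym}(\nabla u-P)],\ K,\ -\mathrm{Curl}[\mathbb{L}_c.\mathrm{Curl}\,P]+\mathbb{C}.\mathrm{sym}(\nabla u-P)-\mathbb{H}.\mathrm{sym}\,P\big),$$ with domain $\mathcal{D}(\mathcal{A})=\{w\in\mathcal{X}:\mathcal{A}w\in\mathcal{X}\}$, endowed with the graph norm. The Cauchy problem is the abstract form of the relaxed micromorphic system with $v=u_{,t}$, $K=P_{,t}$. *)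

theory Defs
  imports "HOL-Analysis.Analysis"
begin

section \<open>Smooth functions and test functions\<close>

definition pd :: "'a::euclidean_space \<Rightarrow> ('a \<Rightarrow> 'b::real_normed_vector) \<Rightarrow> 'a \<Rightarrow> 'b" where
  "pd b f = (\<lambda>x. frechet_derivative f (at x) b)"

text \<open>Class \<open>C\<^sup>k\<close> on \<open>S\<close>; meant for open sets \<open>S\<close> only, since derivatives are taken in the
  full neighbourhood filter.\<close>

primrec Ck_on :: "nat \<Rightarrow> 'a::euclidean_space set \<Rightarrow> ('a \<Rightarrow> 'b::real_normed_vector) \<Rightarrow> bool" where
  "Ck_on 0 S f \<longleftrightarrow> continuous_on S f"
| "Ck_on (Suc k) S f \<longleftrightarrow> (\<forall>x\<in>S. f differentiable (at x)) \<and> (\<forall>b\<in>Basis. Ck_on k S (pd b f))"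

definition smooth_on :: "'a::euclidean_space set \<Rightarrow> ('a \<Rightarrow> 'b::real_normed_vector) \<Rightarrow> bool" where
  "smooth_on S f \<longleftrightarrow> (\<forall>k. Ck_on k S f)"

text \<open>\<open>C\<^sub>0\<^sup>\<infinity>(\<Omega>)\<close>, for scalar, vector and matrix fields; the functions are extended by zero to the
  whole space.\<close>

definition test_funs :: "'a::euclidean_space set \<Rightarrow> ('a \<Rightarrow> 'b::real_normed_vector) set" where
  "test_funs \<Omega> = {\<phi>. smooth_on UNIV \<phi> \<and> compact (closure {x. \<phi> x \<noteq> 0}) \<and> closure {x. \<phi> x \<noteq> 0} \<subseteq> \<Omega>}"

section \<open>Domains\<close>

definition bounded_domain :: "'a::euclidean_space set \<Rightarrow> bool" where
  "bounded_domain \<Omega> \<longleftrightarrow> open \<Omega> \<and> connected \<Omega> \<and> \<Omega> \<noteq> {} \<and> bounded \<Omega>"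

text \<open>The boundary is a finite union of non-overlapping smooth surface patches, parametrised over
  the closed unit square. Regularity and injectivity of a parametrisation are required on the open
  square only, so that edges, corners and conical points are allowed.\<close>

definition smooth_patch :: "(real^2 \<Rightarrow> real^3) \<Rightarrow> bool" where
  "smooth_patch p \<longleftrightarrow>
     (\<exists>U. open U \<and> cbox 0 One \<subseteq> U \<and> smooth_on U p) \<and>
     inj_on p (box 0 One) \<and>
     (\<forall>y\<in>box 0 One. inj (frechet_derivative p (at y)))"

definition piecewise_smooth_boundary :: "(real^3) set \<Rightarrow> bool" where
  "piecewise_smooth_boundary \<Omega> \<longleftrightarrow>
     (\<exists>\<P>. finite \<P> \<and> (\<forall>p\<in>\<P>. smooth_patch p) \<and>
          (\<forall>p\<in>\<P>. \<forall>q\<in>\<P>. p \<noteq> q \<longrightarrow> p ` box 0 One \<inter> q ` box 0 One = {}) \<and>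
          frontier \<Omega> = (\<Union>p\<in>\<P>. p ` cbox 0 One))"

section \<open>Square integrable fields\<close>

text \<open>Fields are represented by functions on the whole space whose values outside \<open>\<Omega>\<close> are
  irrelevant; equality of elements of a function space over \<open>\<Omega>\<close> is equality a.e. in \<open>\<Omega>\<close>.\<close>

definition L2 :: "'a::euclidean_space set \<Rightarrow> ('a \<Rightarrow> 'b::euclidean_space) set" where
  "L2 \<Omega> = {f. f \<in> borel_measurable (lebesgue_on \<Omega>) \<and>
              integrable (lebesgue_on \<Omega>) (\<lambda>x. (norm (f x))\<^sup>2)}"

definition L2_norm :: "'a::euclidean_space set \<Rightarrow> ('a \<Rightarrow> 'b::euclidean_space) \<Rightarrow> real" where
  "L2_norm \<Omega> f = sqrt (LINT x|lebesgue_on \<Omega>. (norm (f x))\<^sup>2)"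

section \<open>Distributions\<close>

type_synonym vec3 = "real^3"
type_synonym mat3 = "real^3^3"
type_synonym tensor4 = "real^3^3^3^3"

text \<open>A distribution with values in \<open>'b\<close> acts on scalar test functions; only its values on
  \<open>test_funs \<Omega>\<close> matter.\<close>

type_synonym 'b distribution = "(vec3 \<Rightarrow> real) \<Rightarrow> 'b"

definition regular_dist :: "vec3 set \<Rightarrow> (vec3 \<Rightarrow> 'b::euclidean_space) \<Rightarrow> 'b distribution" where
  "regular_dist \<Omega> f = (\<lambda>\<phi>. LINT x|lebesgue_on \<Omega>. \<phi> x *\<^sub>R f x)"

definition represents :: "vec3 set \<Rightarrow> (vec3 \<Rightarrow> 'b::euclidean_space) \<Rightarrow> 'b distribution \<Rightarrow> bool" where
  "represents \<Omega> f D \<longleftrightarrow> (\<forall>\<phi>\<in>test_funs \<Omega>. D \<phi> = regular_dist \<Omega> f \<phi>)"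

definition dpd :: "3 \<Rightarrow> 'b::real_vector distribution \<Rightarrow> 'b distribution" where
  "dpd j D = (\<lambda>\<phi>. - D (pd (axis j 1) \<phi>))"

definition dGrad :: "vec3 distribution \<Rightarrow> mat3 distribution" where
  "dGrad D = (\<lambda>\<phi>. \<chi> i j. dpd j D \<phi> $ i)"

definition dDiv :: "mat3 distribution \<Rightarrow> vec3 distribution" where
  "dDiv D = (\<lambda>\<phi>. \<chi> i. \<Sum>j\<in>UNIV. dpd j D \<phi> $ i $ j)"

definition dCurl :: "mat3 distribution \<Rightarrow> mat3 distribution" where
  "dCurl D = (\<lambda>\<phi>. \<chi> i. vector
     [dpd 2 D \<phi> $ i $ 3 - dpd 3 D \<phi> $ i $ 2,
      dpd 3 D \<phi> $ i $ 1 - dpd 1 D \<phi> $ i $ 3,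
      dpd 1 D \<phi> $ i $ 2 - dpd 2 D \<phi> $ i $ 1])"

text \<open>\<open>in_L2 \<Omega> D\<close>: the distribution \<open>D\<close> belongs to \<open>L\<^sup>2(\<Omega>)\<close>. In that case \<open>L2_density \<Omega> D\<close> is the
  (a.e. unique) function representing it.\<close>

definition in_L2 :: "vec3 set \<Rightarrow> 'b::euclidean_space distribution \<Rightarrow> bool" where
  "in_L2 \<Omega> D \<longleftrightarrow> (\<exists>f\<in>L2 \<Omega>. represents \<Omega> f D)"

definition L2_density :: "vec3 set \<Rightarrow> 'b::euclidean_space distribution \<Rightarrow> vec3 \<Rightarrow> 'b" where
  "L2_density \<Omega> D = (SOME f. f \<in> L2 \<Omega> \<and> represents \<Omega> f D)"

section \<open>Sobolev spaces\<close>

definition Grad :: "vec3 set \<Rightarrow> (vec3 \<Rightarrow> vec3) \<Rightarrow> vec3 \<Rightarrow> mat3" where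
  "Grad \<Omega> u = L2_density \<Omega> (dGrad (regular_dist \<Omega> u))"

definition Curl :: "vec3 set \<Rightarrow> (vec3 \<Rightarrow> mat3) \<Rightarrow> vec3 \<Rightarrow> mat3" where
  "Curl \<Omega> P = L2_density \<Omega> (dCurl (regular_dist \<Omega> P))"

definition H1 :: "vec3 set \<Rightarrow> (vec3 \<Rightarrow> vec3) set" where
  "H1 \<Omega> = {u \<in> L2 \<Omega>. in_L2 \<Omega> (dGrad (regular_dist \<Omega> u))}"

definition H1_norm :: "vec3 set \<Rightarrow> (vec3 \<Rightarrow> vec3) \<Rightarrow> real" where
  "H1_norm \<Omega> u = sqrt ((L2_norm \<Omega> u)\<^sup>2 + (L2_norm \<Omega> (Grad \<Omega> u))\<^sup>2)"

definition H1_0 :: "vec3 set \<Rightarrow> (vec3 \<Rightarrow> vec3) set" where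
  "H1_0 \<Omega> = {u \<in> H1 \<Omega>. \<forall>\<epsilon>>0. \<exists>\<phi>\<in>test_funs \<Omega>. H1_norm \<Omega> (\<lambda>x. u x - \<phi> x) < \<epsilon>}"

definition HCurl :: "vec3 set \<Rightarrow> (vec3 \<Rightarrow> mat3) set" where
  "HCurl \<Omega> = {P \<in> L2 \<Omega>. in_L2 \<Omega> (dCurl (regular_dist \<Omega> P))}"

definition HCurl_norm :: "vec3 set \<Rightarrow> (vec3 \<Rightarrow> mat3) \<Rightarrow> real" where
  "HCurl_norm \<Omega> P = sqrt ((L2_norm \<Omega> P)\<^sup>2 + (L2_norm \<Omega> (Curl \<Omega> P))\<^sup>2)"

definition HCurl_0 :: "vec3 set \<Rightarrow> (vec3 \<Rightarrow> mat3) set" where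
  "HCurl_0 \<Omega> = {P \<in> HCurl \<Omega>. \<forall>\<epsilon>>0. \<exists>\<Phi>\<in>test_funs \<Omega>. HCurl_norm \<Omega> (\<lambda>x. P x - \<Phi> x) < \<epsilon>}"

section \<open>Elasticity tensors\<close>

text \<open>The inner product and the norm of \<^typ>\<open>real^3^3\<close> are those of Frobenius:\<close>

lemma inner_mat3_eq_trace: "X \<bullet> Y = trace (X ** transpose Y)" for X Y :: mat3
  by (simp add: inner_vec_def trace_def matrix_matrix_mult_def transpose_def)

definition tensor_act :: "tensor4 \<Rightarrow> mat3 \<Rightarrow> mat3" where
  "tensor_act A X = (\<chi> i j. \<Sum>k\<in>UNIV. \<Sum>l\<in>UNIV. A $ i $ j $ k $ l * X $ k $ l)"

definition sym_part :: "mat3 \<Rightarrow> mat3" where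
  "sym_part X = (1/2) *\<^sub>R (X + transpose X)"

definition Sym3 :: "mat3 set" where
  "Sym3 = {X. transpose X = X}"

definition pos_def_on :: "mat3 set \<Rightarrow> vec3 set \<Rightarrow> (vec3 \<Rightarrow> tensor4) \<Rightarrow> bool" where
  "pos_def_on V \<Omega> A \<longleftrightarrow>
     (\<exists>m>0. \<exists>M>0. \<forall>x\<in>\<Omega>. \<forall>X\<in>V.
        m * (norm X)\<^sup>2 \<le> tensor_act (A x) X \<bullet> X \<and> tensor_act (A x) X \<bullet> X \<le> M * (norm X)\<^sup>2)"

definition major_sym :: "vec3 set \<Rightarrow> (vec3 \<Rightarrow> tensor4) \<Rightarrow> bool" where
  "major_sym \<Omega> A \<longleftrightarrow> (\<forall>x\<in>\<Omega>. \<forall>i j r s. A x $ i $ j $ r $ s = A x $ r $ s $ i $ j)"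

definition minor_sym :: "vec3 set \<Rightarrow> (vec3 \<Rightarrow> tensor4) \<Rightarrow> bool" where
  "minor_sym \<Omega> A \<longleftrightarrow> (\<forall>x\<in>\<Omega>. \<forall>i j r s. A x $ i $ j $ r $ s = A x $ j $ i $ r $ s)"

section \<open>The state space and the operator\<close>

text \<open>A state \<open>w = (u, v, P, K)\<close> is one field with values in a product space, so that linear
  combinations of states are formed pointwise.\<close>

type_synonym state_val = "vec3 \<times> vec3 \<times> mat3 \<times> mat3"
type_synonym state = "vec3 \<Rightarrow> state_val"

definition u_of :: "state \<Rightarrow> vec3 \<Rightarrow> vec3" where "u_of w x = fst (w x)"
definition v_of :: "state \<Rightarrow> vec3 \<Rightarrow> vec3" where "v_of w x = fst (snd (w x))"
definition P_of :: "state \<Rightarrow> vec3 \<Rightarrow> mat3" where "P_of w x = fst (snd (snd (w x)))"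
definition K_of :: "state \<Rightarrow> vec3 \<Rightarrow> mat3" where "K_of w x = snd (snd (snd (w x)))"

definition XX :: "vec3 set \<Rightarrow> state set" where
  "XX \<Omega> = {w. u_of w \<in> H1_0 \<Omega> \<and> v_of w \<in> L2 \<Omega> \<and> P_of w \<in> HCurl_0 \<Omega> \<and> K_of w \<in> L2 \<Omega>}"

definition strain :: "vec3 set \<Rightarrow> state \<Rightarrow> vec3 \<Rightarrow> mat3" where
  "strain \<Omega> w x = sym_part (Grad \<Omega> (u_of w) x - P_of w x)"

definition X_inner :: "vec3 set \<Rightarrow> (vec3 \<Rightarrow> tensor4) \<Rightarrow> (vec3 \<Rightarrow> tensor4) \<Rightarrow> (vec3 \<Rightarrow> tensor4)
    \<Rightarrow> state \<Rightarrow> state \<Rightarrow> real" where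
  "X_inner \<Omega> CC HH LL w1 w2 = (LINT x|lebesgue_on \<Omega>.
      v_of w1 x \<bullet> v_of w2 x + K_of w1 x \<bullet> K_of w2 x
      + tensor_act (CC x) (strain \<Omega> w1 x) \<bullet> strain \<Omega> w2 x
      + tensor_act (HH x) (sym_part (P_of w1 x)) \<bullet> sym_part (P_of w2 x)
      + tensor_act (LL x) (Curl \<Omega> (P_of w1) x) \<bullet> Curl \<Omega> (P_of w2) x)"

definition X_norm :: "vec3 set \<Rightarrow> (vec3 \<Rightarrow> tensor4) \<Rightarrow> (vec3 \<Rightarrow> tensor4) \<Rightarrow> (vec3 \<Rightarrow> tensor4)
    \<Rightarrow> state \<Rightarrow> real" where
  "X_norm \<Omega> CC HH LL w = sqrt (X_inner \<Omega> CC HH LL w w)"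

text \<open>\<open>\<A>w\<close> for \<open>w \<in> \<X>\<close>, as a distribution with values in the product space.\<close>

definition A_dist :: "vec3 set \<Rightarrow> (vec3 \<Rightarrow> tensor4) \<Rightarrow> (vec3 \<Rightarrow> tensor4) \<Rightarrow> (vec3 \<Rightarrow> tensor4)
    \<Rightarrow> state \<Rightarrow> state_val distribution" where
  "A_dist \<Omega> CC HH LL w = (\<lambda>\<phi>.
     (regular_dist \<Omega> (v_of w) \<phi>,
      dDiv (regular_dist \<Omega> (\<lambda>x. tensor_act (CC x) (strain \<Omega> w x))) \<phi>,
      regular_dist \<Omega> (K_of w) \<phi>,
      - dCurl (regular_dist \<Omega> (\<lambda>x. tensor_act (LL x) (Curl \<Omega> (P_of w) x))) \<phi>
      + regular_dist \<Omega> (\<lambda>x. tensor_act (CC x) (strain \<Omega> w x)) \<phi>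
      - regular_dist \<Omega> (\<lambda>x. tensor_act (HH x) (sym_part (P_of w x))) \<phi>))"

definition A_dom :: "vec3 set \<Rightarrow> (vec3 \<Rightarrow> tensor4) \<Rightarrow> (vec3 \<Rightarrow> tensor4) \<Rightarrow> (vec3 \<Rightarrow> tensor4)
    \<Rightarrow> state set" where
  "A_dom \<Omega> CC HH LL = {w \<in> XX \<Omega>. \<exists>z\<in>XX \<Omega>. represents \<Omega> z (A_dist \<Omega> CC HH LL w)}"

text \<open>\<open>A_op\<close> is meaningful on \<open>A_dom\<close> only, where its value is unique a.e. in \<open>\<Omega>\<close>.\<close>

definition A_op :: "vec3 set \<Rightarrow> (vec3 \<Rightarrow> tensor4) \<Rightarrow> (vec3 \<Rightarrow> tensor4) \<Rightarrow> (vec3 \<Rightarrow> tensor4)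
    \<Rightarrow> state \<Rightarrow> state" where
  "A_op \<Omega> CC HH LL w = (SOME z. z \<in> XX \<Omega> \<and> represents \<Omega> z (A_dist \<Omega> CC HH LL w))"

definition graph_norm :: "vec3 set \<Rightarrow> (vec3 \<Rightarrow> tensor4) \<Rightarrow> (vec3 \<Rightarrow> tensor4) \<Rightarrow> (vec3 \<Rightarrow> tensor4)
    \<Rightarrow> state \<Rightarrow> real" where
  "graph_norm \<Omega> CC HH LL w =
     sqrt ((X_norm \<Omega> CC HH LL w)\<^sup>2 + (X_norm \<Omega> CC HH LL (A_op \<Omega> CC HH LL w))\<^sup>2)"

section \<open>Curves in function spaces\<close>

text \<open>A function space is given by its set \<open>V\<close> of functions and its norm \<open>N\<close>. Derivatives at an end
  point of the interval \<open>I\<close> are one-sided.\<close>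

definition C0_curve :: "real set \<Rightarrow> ('a \<Rightarrow> 'b::real_normed_vector) set \<Rightarrow> (('a \<Rightarrow> 'b) \<Rightarrow> real)
    \<Rightarrow> (real \<Rightarrow> 'a \<Rightarrow> 'b) \<Rightarrow> bool" where
  "C0_curve I V N w \<longleftrightarrow>
     (\<forall>t\<in>I. w t \<in> V \<and> ((\<lambda>s. N (\<lambda>x. w s x - w t x)) \<longlongrightarrow> 0) (at t within I))"

definition has_curve_deriv :: "real set \<Rightarrow> ('a \<Rightarrow> 'b::real_normed_vector) set \<Rightarrow> (('a \<Rightarrow> 'b) \<Rightarrow> real)
    \<Rightarrow> (real \<Rightarrow> 'a \<Rightarrow> 'b) \<Rightarrow> ('a \<Rightarrow> 'b) \<Rightarrow> real \<Rightarrow> bool" where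
  "has_curve_deriv I V N w d t \<longleftrightarrow> d \<in> V \<and>
     ((\<lambda>s. N (\<lambda>x. (w s x - w t x) /\<^sub>R (s - t) - d x)) \<longlongrightarrow> 0) (at t within I)"

definition C1_curve :: "real set \<Rightarrow> ('a \<Rightarrow> 'b::real_normed_vector) set \<Rightarrow> (('a \<Rightarrow> 'b) \<Rightarrow> real)
    \<Rightarrow> (real \<Rightarrow> 'a \<Rightarrow> 'b) \<Rightarrow> bool" where
  "C1_curve I V N w \<longleftrightarrow> (\<forall>t\<in>I. w t \<in> V) \<and>
     (\<exists>w'. (\<forall>t\<in>I. has_curve_deriv I V N w (w' t) t) \<and> C0_curve I V N w')"

section \<open>The Cauchy problem\<close>

definition is_solution :: "vec3 set \<Rightarrow> (vec3 \<Rightarrow> tensor4) \<Rightarrow> (vec3 \<Rightarrow> tensor4) \<Rightarrow> (vec3 \<Rightarrow> tensor4)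
    \<Rightarrow> real \<Rightarrow> (real \<Rightarrow> state) \<Rightarrow> state \<Rightarrow> (real \<Rightarrow> state) \<Rightarrow> bool" where
  "is_solution \<Omega> CC HH LL T F w0 w \<longleftrightarrow>
     C1_curve {0<..<T} (XX \<Omega>) (X_norm \<Omega> CC HH LL) w \<and>
     C0_curve {0..<T} (A_dom \<Omega> CC HH LL) (graph_norm \<Omega> CC HH LL) w \<and>
     (\<forall>t\<in>{0<..<T}. has_curve_deriv {0<..<T} (XX \<Omega>) (X_norm \<Omega> CC HH LL) w
                     (\<lambda>x. A_op \<Omega> CC HH LL (w t) x + F t x) t) \<and>
     (AE x in lebesgue_on \<Omega>. w 0 x = w0 x)"

end

theory Submission imports Defs begin

text \<open>
  Put \<open>U = (u, P)\<close>. The system is a second order equation \<open>U'' = - L U + (f, M)\<close>, where \<open>L\<close> is the operator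
  of the elastic energy
  \<open>a(U, U') = \<integral> \<langle>C.sym(\<nabla>u - P), sym(\<nabla>u' - P')\<rangle> + \<langle>H.sym P, sym P'\<rangle> + \<langle>L\<^sub>c.Curl P, Curl P'\<rangle>\<close>.
  Written for \<open>(U, W)\<close> with \<open>W = U'\<close>, its generator sends \<open>(U, W)\<close> to \<open>(Z, Y)\<close> precisely when \<open>W\<close> is \<open>Z\<close>,
  seen as a square integrable field, and \<open>a(U, \<phi>) = - \<langle>Y, \<phi>\<rangle>\<close> for all \<open>\<phi>\<close> in the energy space
  (\<open>wave_graph\<close>). The distributional definition of \<open>\<A>\<close> says just this: testing with \<open>C\<^sub>0\<^sup>\<infinity>\<close> fields in the
  second and fourth component gives the weak equation on a dense subspace of the energy space (\<open>A_dist_iff\<close>).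

  Uniqueness is conservation of energy. Inserting \<open>\<phi> = Z\<close> shows that the generator is skew for the inner
  product of \<open>\<X>\<close> (\<open>energy_conservation\<close>), so the difference of two solutions has constant energy, which
  vanishes initially; and the energy is definite. Indeed, if it vanishes then \<open>sym P = 0\<close> and \<open>Curl P = 0\<close>; each
  entry of the skew symmetric \<open>P\<close>, extended by zero, then has a vanishing weak derivative in some direction
  and bounded support, so \<open>P = 0\<close> (\<open>curl_sym_zero\<close>). What remains is \<open>sym(\<nabla>u) = 0\<close>, and Korn's inequality in
  \<open>H\<^sub>0\<^sup>1\<close> (\<open>korn\<close>) gives \<open>\<nabla>u = 0\<close>, hence \<open>u = 0\<close>.

  Existence is proved with the product norm of \<open>H\<^sub>0\<^sup>1 \<times> H\<^sub>0(Curl) \<times> L\<^sup>2 \<times> L\<^sup>2\<close>, by which the norm of \<open>\<X>\<close> is bounded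
  (\<open>X_norm_le\<close>). Here \<open>a(U, U) + \<parallel>U\<parallel>\<^sup>2\<close> is coercive (\<open>aform_coercive\<close>): \<open>P\<close> and \<open>Curl P\<close> are controlled
  directly, \<open>sym(\<nabla>u) = sym(\<nabla>u - P) + sym P\<close> as well, and Korn's inequality does the rest. For the inner
  product belonging to this form the generator is dissipative up to a multiple of the identity, and the Riesz
  theorem solves the resolvent equation (\<open>wave_graph_dissipative\<close>, \<open>wave_graph_range\<close>). The theorem of
  Hille and Yosida then applies. Its inhomogeneous version is proved for linear graphs in a Hilbert space
  (\<open>inhomogeneous_problem\<close>): the equations with the bounded Yosida approximations are solved by Picard iteration,
  and their solutions and the time derivatives of these converge locally uniformly. The existence result for
  abstract second order equations is \<open>wave_problem\<close>.

  The fields themselves live in a quotient type \<open>l2\<close> of the square integrable functions, and \<open>H\<^sub>0\<^sup>1\<close> and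
  \<open>H\<^sub>0(Curl)\<close> become closed subspaces of products of such types, as the closure of the pairs of a test function
  and its derivative (\<open>W0\<close>, \<open>H0_iff\<close>). That the weak derivatives are determined by the field is the fundamental lemma
  of the calculus of variations.
\<close>

section \<open>Symmetric coercive forms and the Riesz representation\<close>

locale coercive_form =
  fixes S :: "'h::banach set" and B :: "'h \<Rightarrow> 'h \<Rightarrow> real" and c :: real
  assumes sub: "subspace S" and clos: "closed S"
    and bil: "bounded_bilinear B" and symm: "\<And>x y. B x y = B y x"
    and c_pos: "c > 0" and coer: "\<And>x. x \<in> S \<Longrightarrow> c * (norm x)\<^sup>2 \<le> B x x"
begin

sublocale bounded_bilinear B by (rule bil)

lemma form_add: "B (x + y) (x + y) = B x x + 2 * B x y + B y y"
  using symm[of x y] by (simp add: add_left add_right)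

lemma form_diff: "B (x - y) (x - y) = B x x - 2 * B x y + B y y"
  using symm[of x y] by (simp add: diff_left diff_right)

lemma form_eq_0D: "x \<in> S \<Longrightarrow> B x x \<le> 0 \<Longrightarrow> x = 0"
  using coer[of x] c_pos by (smt (verit) mult_pos_pos zero_less_power2 norm_eq_zero)

lemma riesz_unique:
  assumes "x \<in> S" "x' \<in> S" "\<And>y. y \<in> S \<Longrightarrow> B x y = B x' y"
  shows "x = x'"
proof -
  have "x - x' \<in> S" using assms sub by (simp add: subspace_diff)
  moreover from this have "B (x - x') (x - x') = 0" using assms(3) by (simp add: diff_left)
  ultimately show ?thesis using form_eq_0D[of "x - x'"] by simp
qed

text \<open>The representing vector minimises \<open>B x x - 2 * l x\<close> on \<open>S\<close>. The form need not be the inner product of the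
  ambient space: the theorem is applied to several forms on the same space.\<close>

lemma riesz_exists:
  assumes l: "bounded_linear l"
  shows "\<exists>x\<in>S. \<forall>y\<in>S. B x y = l y"
proof -
  interpret l: bounded_linear l by (rule l)
  define J where "J x = B x x - 2 * l x" for x
  obtain K where K: "\<And>x. norm (l x) \<le> norm x * K" "K > 0" using l.pos_bounded by blast
  have lower: "J x \<ge> - (K\<^sup>2 / c)" if "x \<in> S" for x
  proof -
    have "0 \<le> (c * norm x - K)\<^sup>2 / c" using c_pos by simp
    also have "\<dots> = c * (norm x)\<^sup>2 - 2 * (norm x * K) + K\<^sup>2 / c"
      using c_pos by (simp add: power2_eq_square field_simps)
    finally have "0 \<le> c * (norm x)\<^sup>2 - 2 * (norm x * K) + K\<^sup>2 / c" .
    moreover have "l x \<le> norm x * K" using K(1)[of x] by simp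
    ultimately show ?thesis using coer[OF that] unfolding J_def by linarith
  qed
  define m where "m = Inf (J ` S)"
  have S0: "0 \<in> S" using sub by (rule subspace_0)
  have bdd: "bdd_below (J ` S)" using lower by (auto intro!: bdd_belowI2)
  have m_le: "m \<le> J x" if "x \<in> S" for x
    unfolding m_def using bdd that by (auto intro: cInf_lower)
  have "\<exists>x\<in>S. J x < m + 1 / (real n + 1)" for n
  proof -
    have "Inf (J ` S) < m + 1 / (real n + 1)" unfolding m_def by simp
    then show ?thesis using cInf_lessD[of "J ` S"] S0 by blast
  qed
  then obtain X where X: "\<And>n. X n \<in> S" "\<And>n. J (X n) < m + 1 / (real n + 1)" by metis
  \<comment> \<open>By the parallelogram identity a minimising sequence is a Cauchy sequence.\<close>
  have close: "c * (norm (X n - X k))\<^sup>2 \<le> 2 / (real n + 1) + 2 / (real k + 1)" for n k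
  proof -
    have mid: "(1/2) *\<^sub>R (X n + X k) \<in> S" using X sub by (simp add: subspace_add subspace_scale)
    have "c * (norm (X n - X k))\<^sup>2 \<le> B (X n - X k) (X n - X k)"
      using X sub by (intro coer) (simp add: subspace_diff)
    also have "\<dots> = 2 * J (X n) + 2 * J (X k) - 4 * J ((1/2) *\<^sub>R (X n + X k))"
      unfolding J_def using symm[of "X k" "X n"]
      by (simp add: form_diff form_add scaleR_left scaleR_right l.scaleR l.add algebra_simps)
    also have "\<dots> \<le> 2 * (m + 1 / (real n + 1)) + 2 * (m + 1 / (real k + 1)) - 4 * m"
      using X(2)[of n] X(2)[of k] m_le[OF mid] by (intro diff_mono add_mono) simp_all
    finally show ?thesis by (simp add: algebra_simps)
  qed
  have "Cauchy X"
  proof (rule metric_CauchyI)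
    fix e :: real assume "e > 0"
    then have "c * e\<^sup>2 / 4 > 0" using c_pos by simp
    then obtain N where N: "1 / (real N + 1) < c * e\<^sup>2 / 4"
      using reals_Archimedean by (metis add.commute inverse_eq_divide of_nat_Suc)
    have "dist (X n) (X k) < e" if "n \<ge> N" "k \<ge> N" for n k
    proof -
      have "1 / (real n + 1) \<le> 1 / (real N + 1)" "1 / (real k + 1) \<le> 1 / (real N + 1)"
        using that by (auto intro!: divide_left_mono)
      then have "c * (norm (X n - X k))\<^sup>2 < c * e\<^sup>2" using close[of n k] N by simp
      then have "norm (X n - X k) < e" using c_pos \<open>e > 0\<close>
        by (smt (verit) mult_less_cancel_left_pos power_less_imp_less_base)
      then show ?thesis by (simp add: dist_norm)
    qed
    then show "\<exists>N. \<forall>n\<ge>N. \<forall>k\<ge>N. dist (X n) (X k) < e" by blast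
  qed
  then obtain x where x: "X \<longlonglongrightarrow> x" using Cauchy_convergent convergent_def by blast
  have xS: "x \<in> S" using clos X(1) x closed_sequentially by blast
  have "(\<lambda>n. J (X n)) \<longlonglongrightarrow> J x"
    unfolding J_def by (intro tendsto_intros tendsto x l.tendsto)
  moreover have "(\<lambda>n. m + 1 / (real n + 1)) \<longlonglongrightarrow> m + 0"
    using LIMSEQ_inverse_real_of_nat by (intro tendsto_intros) (simp add: inverse_eq_divide add.commute)
  ultimately have "J x \<le> m + 0"
    by (rule LIMSEQ_le) (use X(2) less_imp_le in blast)
  then have Jx: "J x \<le> J y" if "y \<in> S" for y using m_le[OF that] by simp
  have "B x y = l y" if y: "y \<in> S" for y
  proof (cases "y = 0")
    case False
    define q where "q = B y y"
    have q: "q > 0" using coer[OF y] c_pos False unfolding q_def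
      by (smt (verit) mult_pos_pos zero_less_power2 norm_eq_zero)
    define s where "s = - (B x y - l y) / q"
    have "x + s *\<^sub>R y \<in> S" using xS y sub by (simp add: subspace_add subspace_scale)
    then have "0 \<le> J (x + s *\<^sub>R y) - J x" using Jx by fastforce
    also have "\<dots> = s\<^sup>2 * q + 2 * s * (B x y - l y)"
      unfolding J_def q_def
      by (simp add: form_add scaleR_left scaleR_right l.add l.scaleR power2_eq_square algebra_simps)
    also have "\<dots> = - ((B x y - l y)\<^sup>2 / q)"
      using q unfolding s_def by (simp add: power2_eq_square field_simps)
    finally show ?thesis using q by (simp add: divide_le_0_iff)
  qed (simp add: zero_right l.zero)
  then show ?thesis using xS by blast
qed

text \<open>The projection onto \<open>S\<close> that is orthogonal with respect to \<open>B\<close>.\<close>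

definition proj :: "'h \<Rightarrow> 'h" where
  "proj x = (THE p. p \<in> S \<and> (\<forall>y\<in>S. B p y = B x y))"

lemma proj: "proj x \<in> S" "y \<in> S \<Longrightarrow> B (proj x) y = B x y"
proof -
  have "\<exists>!p. p \<in> S \<and> (\<forall>y\<in>S. B p y = B x y)"
    using riesz_exists[OF bounded_linear_right[of x]] riesz_unique by metis
  from theI'[OF this] show "proj x \<in> S" "y \<in> S \<Longrightarrow> B (proj x) y = B x y"
    unfolding proj_def by auto
qed

lemma proj_eqI: "p \<in> S \<Longrightarrow> (\<And>y. y \<in> S \<Longrightarrow> B p y = B x y) \<Longrightarrow> proj x = p"
  by (rule riesz_unique) (auto simp: proj)

lemma proj_id: "x \<in> S \<Longrightarrow> proj x = x"
  by (rule proj_eqI) auto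

lemma bounded_linear_proj: "bounded_linear proj"
proof -
  obtain K where K: "\<And>a b. norm (B a b) \<le> norm a * norm b * K" "K > 0" using pos_bounded by blast
  show ?thesis
  proof (rule bounded_linear_intro)
    show "proj (x + y) = proj x + proj y" for x y
      by (rule proj_eqI) (auto simp: proj add_left sub subspace_add)
    show "proj (r *\<^sub>R x) = r *\<^sub>R proj x" for r x
      by (rule proj_eqI) (auto simp: proj scaleR_left sub subspace_scale)
    show "norm (proj x) \<le> norm x * (K / c)" for x
    proof (cases "proj x = 0")
      case False
      have "c * (norm (proj x))\<^sup>2 \<le> B (proj x) (proj x)" by (rule coer[OF proj(1)])
      also have "\<dots> = B x (proj x)" by (simp add: proj)
      also have "\<dots> \<le> norm x * norm (proj x) * K" using K(1)[of x "proj x"] by simp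
      finally have "(c * norm (proj x)) * norm (proj x) \<le> (norm x * K) * norm (proj x)"
        by (simp add: power2_eq_square mult_ac)
      then have "c * norm (proj x) \<le> norm x * K" using False by simp
      then show ?thesis using c_pos by (simp add: field_simps)
    qed (use K c_pos in auto)
  qed
qed

end

section \<open>Linear differential equations with bounded generator\<close>

text \<open>The fundamental theorem of calculus survives uniform limits of the derivatives. Uniformity on the compact
  subintervals is enough because differentiability is a local property.\<close>

lemma uniform_limit_vector_derivative:
  fixes f g :: "nat \<Rightarrow> real \<Rightarrow> 'h::banach"
  assumes der: "\<And>n t. t \<in> {0..<T} \<Longrightarrow> (f n has_vector_derivative g n t) (at t within {0..<T})"
    and cont: "\<And>n. continuous_on {0..<T} (g n)"
    and f: "\<And>t. t \<in> {0..<T} \<Longrightarrow> (\<lambda>n. f n t) \<longlonglongrightarrow> F t"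
    and g: "\<And>b. b < T \<Longrightarrow> uniform_limit {0..b} g G sequentially"
  shows "continuous_on {0..<T} G"
    and "\<And>t. t \<in> {0..<T} \<Longrightarrow> (F has_vector_derivative G t) (at t within {0..<T})"
proof -
  have contb: "continuous_on {0..b} (g n)" if "b < T" for n b
    by (rule continuous_on_subset[OF cont]) (use that in auto)
  have Gb: "continuous_on {0..b} G" if "b < T" for b
    by (rule uniform_limit_theorem[OF _ g[OF that]]) (use contb that in auto)
  have nbhd: "at t within {0..<T} = at t within {0..b}" if "0 \<le> t" "t < b" "b < T" for t b
    using that by (intro at_within_nhd[of t "{..<b}"]) auto
  show "continuous_on {0..<T} G"
    unfolding continuous_on_eq_continuous_within
  proof
    fix t assume t: "t \<in> {0..<T}"
    then obtain b where b: "t < b" "b < T" using dense by auto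
    then have "continuous (at t within {0..b}) G"
      using Gb[OF b(2)] t by (simp add: continuous_on_eq_continuous_within)
    then show "continuous (at t within {0..<T}) G" using nbhd[of t b] t b by simp
  qed
  fix t assume t: "t \<in> {0..<T}"
  then obtain b where b: "t < b" "b < T" using dense by auto
  have int: "F s = F 0 + integral {0..s} G" if s: "s \<in> {0..b}" for s
  proof -
    have sT: "s < T" using s b by simp
    obtain I J where IJ: "\<And>n. (g n has_integral I n) {0..s}" "(G has_integral J) {0..s}" "I \<longlonglongrightarrow> J"
      using uniform_limit_integral[OF g[OF sT] contb[OF sT]] by auto
    have gi: "(g n has_integral f n s - f n 0) {0..s}" for n
      using s b by (intro fundamental_theorem_of_calculus)
        (auto intro: has_vector_derivative_within_subset[OF der])
    have "I = (\<lambda>n. f n s - f n 0)" using has_integral_unique[OF IJ(1) gi] by (rule ext)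
    then have "(\<lambda>n. f n s - f n 0) \<longlonglongrightarrow> J" using IJ(3) by simp
    moreover have "(\<lambda>n. f n s - f n 0) \<longlonglongrightarrow> F s - F 0"
      using s b by (intro tendsto_diff f) auto
    ultimately have "J = F s - F 0" using LIMSEQ_unique by blast
    then show ?thesis using IJ(2) by (simp add: integral_unique)
  qed
  have "((\<lambda>s. F 0 + integral {0..s} G) has_vector_derivative 0 + G t) (at t within {0..b})"
    by (rule has_vector_derivative_add[OF has_vector_derivative_const integral_has_vector_derivative[OF Gb]])
      (use t b in auto)
  then have "(F has_vector_derivative G t) (at t within {0..b})"
    by (intro has_vector_derivative_transform[OF _ int]) (use t b in simp_all)
  then show "(F has_vector_derivative G t) (at t within {0..<T})"
    using nbhd[of t b] t b by simp
qed

text \<open>Picard iteration: on \<open>{0..b}\<close> the increment number \<open>n\<close> is at most \<open>C * (L * b) ^ n / fact n\<close>, where \<open>L\<close> bounds the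
  operator and \<open>C\<close> the first increment, so the iterates converge uniformly.\<close>

lemma linear_ode_exists:
  fixes A :: "'h::banach \<Rightarrow> 'h"
  assumes A: "bounded_linear A" and F: "continuous_on {0..<T} F"
  obtains w where "w 0 = w0"
    "\<And>t. t \<in> {0..<T} \<Longrightarrow> (w has_vector_derivative A (w t) + F t) (at t within {0..<T})"
proof -
  interpret A: bounded_linear A by (rule A)
  define W where "W = rec_nat (\<lambda>t::real. w0) (\<lambda>n V t. w0 + integral {0..t} (\<lambda>s. A (V s) + F s))"
  have W0: "W 0 = (\<lambda>t. w0)" and WS: "W (Suc n) = (\<lambda>t. w0 + integral {0..t} (\<lambda>s. A (W n s) + F s))" for n
    by (simp_all add: W_def)
  have nbhd: "at t within {0..<T} = at t within {0..b}" if "0 \<le> t" "t < b" "b < T" for t b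
    using that by (intro at_within_nhd[of t "{..<b}"]) auto
  have step: "(W (Suc n) has_vector_derivative A (W n t) + F t) (at t within {0..<T})"
    if c: "continuous_on {0..<T} (W n)" and t: "t \<in> {0..<T}" for n t
  proof -
    obtain b where b: "t < b" "b < T" using t dense by auto
    have "continuous_on {0..<T} (\<lambda>s. A (W n s) + F s)"
      by (intro continuous_intros A.continuous_on c F)
    then have "continuous_on {0..b} (\<lambda>s. A (W n s) + F s)"
      by (rule continuous_on_subset) (use b in auto)
    then have "((\<lambda>t. w0 + integral {0..t} (\<lambda>s. A (W n s) + F s)) has_vector_derivative 0 + (A (W n t) + F t)) (at t within {0..b})"
      by (rule has_vector_derivative_add[OF has_vector_derivative_const integral_has_vector_derivative])
        (use t b in auto)
    then show ?thesis using nbhd[of t b] t b by (simp add: WS)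
  qed
  have contW: "continuous_on {0..<T} (W n)" for n
  proof (induction n)
    case (Suc n)
    show ?case by (rule continuous_on_vector_derivative[OF step[OF Suc]])
  qed (simp add: W0)
  obtain L where L: "\<And>x. norm (A x) \<le> norm x * L" "L > 0" using A.pos_bounded by blast
  have conv: "\<exists>w. uniform_limit {0..b} W w sequentially" if b: "b < T" for b
  proof (cases "0 \<le> b")
    case True
    have sub: "{0..b} \<subseteq> {0..<T}" using b by auto
    have contb: "continuous_on {0..b} (W n)" for n using continuous_on_subset[OF contW sub] .
    have "compact ((\<lambda>t. W 1 t - W 0 t) ` {0..b})"
      by (intro compact_continuous_image continuous_intros contb) auto
    then obtain C where C: "\<And>t. t \<in> {0..b} \<Longrightarrow> norm (W 1 t - W 0 t) \<le> C"
      by (meson bounded_iff compact_imp_bounded imageI)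
    then have "C \<ge> 0" using True by (metis atLeastAtMost_iff norm_ge_zero order.trans order_refl)
    have bound: "norm (W (Suc n) t - W n t) \<le> C * (L * t) ^ n / fact n" if "t \<in> {0..b}" for n t
      using that
    proof (induction n arbitrary: t)
      case (Suc n)
      have i1: "(\<lambda>s. A (W m s) + F s) integrable_on {0..t}" for m
        using Suc.prems sub
        by (intro integrable_continuous_real continuous_intros A.continuous_on
            continuous_on_subset[OF contW] continuous_on_subset[OF F]) auto
      have i2: "(\<lambda>s. A (W (Suc n) s - W n s)) integrable_on {0..t}"
        using Suc.prems sub
        by (intro integrable_continuous_real continuous_intros A.continuous_on
            continuous_on_subset[OF contW]) auto
      have hi: "((\<lambda>s. L * (C * (L * s) ^ n / fact n)) has_integral
           C * (L * t) ^ Suc n / fact (Suc n) - C * (L * 0) ^ Suc n / fact (Suc n)) {0..t}"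
      proof (rule fundamental_theorem_of_calculus)
        show "0 \<le> t" using Suc.prems by simp
        fix s
        have "((\<lambda>s. C * (L * s) ^ Suc n / fact (Suc n)) has_real_derivative
               C * (real (Suc n) * (L * s) ^ n * L) / fact (Suc n)) (at s within {0..t})"
          by (rule DERIV_cong[OF DERIV_cdivide[OF DERIV_cmult[OF DERIV_power[OF DERIV_cmult_Id]]]])
            (simp del: of_nat_Suc power_Suc fact_Suc add: mult_ac)
        moreover have "C * (real (Suc n) * (L * s) ^ n * L) / fact (Suc n) = L * (C * (L * s) ^ n / fact n)"
          by (simp add: field_simps del: of_nat_Suc)
        ultimately show "((\<lambda>s. C * (L * s) ^ Suc n / fact (Suc n)) has_vector_derivative
               L * (C * (L * s) ^ n / fact n)) (at s within {0..t})"
          by (simp only: has_real_derivative_iff_has_vector_derivative)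
      qed
      have "W (Suc (Suc n)) t - W (Suc n) t = integral {0..t} (\<lambda>s. (A (W (Suc n) s) + F s) - (A (W n s) + F s))"
        using fun_cong[OF WS[of "Suc n"], of t] fun_cong[OF WS[of n], of t]
          integral_diff[OF i1[of "Suc n"] i1[of n]] by (simp only: add_diff_cancel_left)
      also have "\<dots> = integral {0..t} (\<lambda>s. A (W (Suc n) s - W n s))"
        by (simp add: A.diff)
      finally have "norm (W (Suc (Suc n)) t - W (Suc n) t) = norm \<dots>" by simp
      also have "\<dots> \<le> integral {0..t} (\<lambda>s. L * (C * (L * s) ^ n / fact n))"
      proof (rule integral_norm_bound_integral[OF i2])
        show "(\<lambda>s. L * (C * (L * s) ^ n / fact n)) integrable_on {0..t}" using hi by blast
        fix s assume s: "s \<in> {0..t}"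
        have "norm (A (W (Suc n) s - W n s)) \<le> norm (W (Suc n) s - W n s) * L" by (rule L)
        also have "\<dots> \<le> (C * (L * s) ^ n / fact n) * L"
          using s Suc.prems L(2) by (intro mult_right_mono Suc.IH) auto
        finally show "norm (A (W (Suc n) s - W n s)) \<le> L * (C * (L * s) ^ n / fact n)" by (simp add: mult_ac)
      qed
      also have "\<dots> = C * (L * t) ^ Suc n / fact (Suc n)" unfolding integral_unique[OF hi] by simp
      finally show ?case .
    qed (use C in simp)
    have sums: "summable (\<lambda>n. C * ((L * b) ^ n / fact n))"
      using summable_exp_generic[of "L * b"] by (intro summable_mult) (simp add: scaleR_conv_of_real divide_inverse mult.commute)
    have "uniform_limit {0..b} (\<lambda>n t. \<Sum>i<n. W (Suc i) t - W i t) (\<lambda>t. \<Sum>i. W (Suc i) t - W i t) sequentially"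
    proof (rule Weierstrass_m_test[OF _ sums])
      fix n t assume t: "t \<in> {0..b}"
      have "norm (W (Suc n) t - W n t) \<le> C * (L * t) ^ n / fact n" using bound[OF t] .
      also have "\<dots> \<le> C * (L * b) ^ n / fact n"
        using t L(2) \<open>C \<ge> 0\<close> by (intro divide_right_mono mult_left_mono power_mono) auto
      finally show "norm (W (Suc n) t - W n t) \<le> C * ((L * b) ^ n / fact n)" by simp
    qed
    then have "uniform_limit {0..b} (\<lambda>n t. (\<Sum>i<n. W (Suc i) t - W i t) + W 0 t)
        (\<lambda>t. (\<Sum>i. W (Suc i) t - W i t) + W 0 t) sequentially"
      by (intro uniform_limit_intros)
    then show ?thesis by (auto simp: sum_lessThan_telescope[of "\<lambda>i. W i _"])
  qed auto
  define w where "w t = lim (\<lambda>n. W n t)" for t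
  have unif: "uniform_limit {0..b} W w sequentially" if b: "b < T" for b
  proof -
    obtain v where v: "uniform_limit {0..b} W v sequentially" using conv[OF b] by blast
    then have "w t = v t" if "t \<in> {0..b}" for t
      using tendsto_uniform_limitI[OF v that] unfolding w_def by (simp add: limI)
    then show ?thesis using v by (metis uniform_limit_cong')
  qed
  have ptw: "(\<lambda>n. W n t) \<longlonglongrightarrow> w t" if "t \<in> {0..<T}" for t
    using tendsto_uniform_limitI[OF unif[of t], of t] that by auto
  have "(w has_vector_derivative A (w t) + F t) (at t within {0..<T})" if t: "t \<in> {0..<T}" for t
  proof (rule uniform_limit_vector_derivative(2)[where f="\<lambda>n. W (Suc n)" and g="\<lambda>n t. A (W n t) + F t", OF _ _ _ _ t])
    show "(W (Suc n) has_vector_derivative A (W n t) + F t) (at t within {0..<T})" if "t \<in> {0..<T}" for n t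
      by (rule step[OF contW that])
    show "continuous_on {0..<T} (\<lambda>t. A (W n t) + F t)" for n
      by (intro continuous_intros A.continuous_on contW F)
    show "(\<lambda>n. W (Suc n) t) \<longlonglongrightarrow> w t" if "t \<in> {0..<T}" for t using ptw[OF that] by (rule LIMSEQ_Suc)
    show "uniform_limit {0..b} (\<lambda>n t. A (W n t) + F t) (\<lambda>t. A (w t) + F t) sequentially" if "b < T" for b
      by (intro uniform_limit_intros A.uniform_limit unif[OF that])
  qed
  moreover have "w 0 = w0"
  proof -
    have "W n 0 = w0" for n by (cases n) (simp_all add: W0 WS)
    then show ?thesis unfolding w_def by simp
  qed
  ultimately show ?thesis using that by blast
qed

section \<open>Dissipative evolution equations\<close>

text \<open>By the mean value theorem \<open>exp (- \<kappa> * s) * \<phi> s - M * s\<close> does not increase.\<close>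

lemma linear_gronwall:
  fixes \<phi> \<phi>' :: "real \<Rightarrow> real"
  assumes der: "\<And>s. s \<in> {0..<T} \<Longrightarrow> (\<phi> has_real_derivative \<phi>' s) (at s within {0..<T})"
    and t: "t \<in> {0..<T}"
    and le: "\<And>s. s \<in> {0..t} \<Longrightarrow> \<phi>' s \<le> \<kappa> * \<phi> s + M"
    and nonneg: "\<kappa> \<ge> 0" "M \<ge> 0"
  shows "\<phi> t \<le> exp (\<kappa> * t) * (\<phi> 0 + t * M)"
proof (cases "t = 0")
  case False
  then have t0: "0 < t" using t by simp
  define \<psi> where "\<psi> s = exp (- \<kappa> * s) * \<phi> s - M * s" for s
  have "(\<psi> has_real_derivative exp (- \<kappa> * s) * \<phi>' s - \<kappa> * exp (- \<kappa> * s) * \<phi> s - M) (at s within {0..t})"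
    if "0 \<le> s" "s \<le> t" for s
  proof -
    have d: "(\<phi> has_real_derivative \<phi>' s) (at s within {0..t})"
      by (rule DERIV_subset[OF der]) (use that t in auto)
    show ?thesis unfolding \<psi>_def
      by (rule derivative_eq_intros refl d)+ (simp add: algebra_simps)
  qed
  then have "\<exists>x\<in>{0<..<t}. \<psi> t - \<psi> 0 = (\<lambda>h. (exp (- \<kappa> * x) * \<phi>' x - \<kappa> * exp (- \<kappa> * x) * \<phi> x - M) * h) (t - 0)"
    by (intro mvt_simple[OF t0]) (simp add: has_field_derivative_def)
  then obtain x where x: "x \<in> {0<..<t}"
    "\<psi> t - \<psi> 0 = (exp (- \<kappa> * x) * \<phi>' x - \<kappa> * exp (- \<kappa> * x) * \<phi> x - M) * t" by auto
  have "exp (- \<kappa> * x) * \<phi>' x \<le> exp (- \<kappa> * x) * (\<kappa> * \<phi> x + M)"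
    using le[of x] x(1) by (intro mult_left_mono) auto
  moreover have "exp (- \<kappa> * x) * M \<le> 1 * M"
    using nonneg x(1) by (intro mult_right_mono) (auto simp: mult_nonneg_nonneg)
  ultimately have "exp (- \<kappa> * x) * \<phi>' x - \<kappa> * exp (- \<kappa> * x) * \<phi> x - M \<le> 0"
    by (simp add: algebra_simps)
  then have "\<psi> t \<le> \<psi> 0" using x(2) t0 by (smt (verit) mult_nonpos_nonneg)
  then have "exp (- \<kappa> * t) * \<phi> t \<le> \<phi> 0 + t * M" unfolding \<psi>_def by (simp add: algebra_simps)
  then have "exp (\<kappa> * t) * (exp (- \<kappa> * t) * \<phi> t) \<le> exp (\<kappa> * t) * (\<phi> 0 + t * M)"
    by (intro mult_left_mono) auto
  moreover have "exp (\<kappa> * t) * (exp (- \<kappa> * t) * \<phi> t) = \<phi> t"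
    by (simp add: mult.assoc[symmetric] exp_add[symmetric])
  ultimately show ?thesis by metis
qed simp

lemma norm_diff_add_le: "norm (a - b + c) \<le> norm a + norm b + norm c" for a :: "'h::real_normed_vector"
  using norm_triangle_ineq[of "a - b" c] norm_triangle_ineq4[of a b] by linarith

lemma subspace_closure: "subspace (closure S)" if "subspace S" for S :: "'h::real_normed_vector set"
proof (rule subspaceI)
  show "0 \<in> closure S" using subspace_0[OF that] closure_subset by blast
  fix x y assume xy: "x \<in> closure S" "y \<in> closure S"
  then obtain f g where fg: "\<And>n. f n \<in> S" "f \<longlonglongrightarrow> x" "\<And>n. g n \<in> S" "g \<longlonglongrightarrow> y"
    unfolding closure_sequential by blast
  have "(\<lambda>n. f n + g n) \<longlonglongrightarrow> x + y" by (intro tendsto_add fg)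
  then show "x + y \<in> closure S"
    unfolding closure_sequential using fg subspace_add[OF that] by (intro exI[of _ "\<lambda>n. f n + g n"]) auto
  show "r *\<^sub>R x \<in> closure S" for r
  proof -
    have "(\<lambda>n. r *\<^sub>R f n) \<longlonglongrightarrow> r *\<^sub>R x" by (intro tendsto_intros fg)
    then show ?thesis
      unfolding closure_sequential using fg subspace_scale[OF that] by (intro exI[of _ "\<lambda>n. r *\<^sub>R f n"]) auto
  qed
qed

text \<open>An unbounded linear operator is given by its graph \<open>G\<close>. Besides the two hypotheses of the
  theorem of Lumer and Phillips, dissipativity up to \<open>\<omega>\<close> and surjectivity, it is only required to be single valued; this
  makes the domain dense, see \<open>domain_dense\<close>.\<close>

locale dissipative_graph = coercive_form "UNIV :: 'h::banach set" B c for B c +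
  fixes G :: "('h \<times> 'h) set" and \<omega> :: real
  assumes G_sub: "subspace G" and \<omega>: "\<omega> \<ge> 0"
    and diss: "\<And>x z. (x, z) \<in> G \<Longrightarrow> B z x \<le> \<omega> * B x x"
    and range: "\<And>\<alpha> y. \<alpha> > 0 \<Longrightarrow> \<exists>x z. (x, z) \<in> G \<and> x - \<alpha> *\<^sub>R z = y"
    and single: "\<And>z. (0, z) \<in> G \<Longrightarrow> z = 0"
begin

abbreviation q :: "'h \<Rightarrow> real" where "q x \<equiv> B x x"

lemma q_nonneg [simp]: "0 \<le> q x"
  using coer[of x] c_pos by (smt (verit) UNIV_I mult_nonneg_nonneg zero_le_power2)

lemma q_cross: "2 * B x y \<le> q x + q y"
  using form_diff[of x y] q_nonneg[of "x - y"] by linarith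

lemma q_cross_neg: "- 2 * B x y \<le> q x + q y"
  using form_add[of x y] q_nonneg[of "x + y"] by linarith

lemma q_add_le: "q (x + y) \<le> 2 * q x + 2 * q y"
  using form_add[of x y] q_cross[of x y] by linarith

lemma q_diff_le: "q (x - y) \<le> 2 * q x + 2 * q y"
  using form_diff[of x y] q_cross_neg[of x y] by linarith

lemma q_scale: "q (r *\<^sub>R x) = r\<^sup>2 * q x"
  by (simp add: scaleR_left scaleR_right power2_eq_square)

lemma q_le: "\<exists>K>0. \<forall>x. q x \<le> K * (norm x)\<^sup>2"
proof -
  obtain K where "\<And>a b. norm (B a b) \<le> norm a * norm b * K" "K > 0" using pos_bounded by blast
  then show ?thesis by (intro exI[of _ K]) (metis abs_le_D1 mult.commute power2_eq_square real_norm_def)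
qed

lemma G_add: "(x, z) \<in> G \<Longrightarrow> (x', z') \<in> G \<Longrightarrow> (x + x', z + z') \<in> G"
  using subspace_add[OF G_sub, of "(x, z)" "(x', z')"] by simp

lemma G_scale: "(x, z) \<in> G \<Longrightarrow> (r *\<^sub>R x, r *\<^sub>R z) \<in> G"
  using subspace_scale[OF G_sub, of "(x, z)" r] by simp

lemma G_diff: "(x, z) \<in> G \<Longrightarrow> (x', z') \<in> G \<Longrightarrow> (x - x', z - z') \<in> G"
  using subspace_diff[OF G_sub, of "(x, z)" "(x', z')"] by simp

text \<open>The bound keeps \<open>\<omega>\<close> out of the constants of the resolvent, such as the 2 in \<open>resolvent_estimate\<close>.\<close>

definition small :: "real \<Rightarrow> bool" where "small \<alpha> \<longleftrightarrow> 0 < \<alpha> \<and> 4 * \<alpha> * (\<omega> + 1) \<le> 1"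

lemma small: "small \<alpha> \<Longrightarrow> 0 < \<alpha>" "small \<alpha> \<Longrightarrow> 4 * \<alpha> * \<omega> \<le> 1"
  by (auto simp: small_def algebra_simps)

lemma resolvent_estimate:
  assumes "small \<alpha>" "(x, z) \<in> G"
  shows "q x \<le> 2 * q (x - \<alpha> *\<^sub>R z)"
proof -
  have "q x = B (x - \<alpha> *\<^sub>R z) x + \<alpha> * B z x" by (simp add: diff_left scaleR_left)
  also have "\<dots> \<le> (q (x - \<alpha> *\<^sub>R z) + q x) / 2 + \<alpha> * (\<omega> * q x)"
    using q_cross[of "x - \<alpha> *\<^sub>R z" x] diss[OF assms(2)] small(1)[OF assms(1)]
    by (intro add_mono mult_left_mono) auto
  finally have "q x \<le> (q (x - \<alpha> *\<^sub>R z) + q x) / 2 + \<alpha> * (\<omega> * q x)" .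
  moreover have "\<alpha> * (\<omega> * q x) \<le> q x / 4"
    using mult_right_mono[OF small(2)[OF assms(1)] q_nonneg[of x]] by (simp add: algebra_simps)
  moreover have "X \<le> 2 * a" if "X \<le> (a + X) / 2 + r" "r \<le> X / 4" for X a r :: real
    using that by (simp add: field_simps)
  ultimately show ?thesis by blast
qed

lemma resolvent_inj:
  assumes "small \<alpha>" "(x, z) \<in> G" "(x', z') \<in> G" "x - \<alpha> *\<^sub>R z = x' - \<alpha> *\<^sub>R z'"
  shows "x = x'"
proof -
  have "x - x' - \<alpha> *\<^sub>R (z - z') = 0" using assms(4) by (simp add: algebra_simps)
  then have "q (x - x') \<le> 0"
    using resolvent_estimate[OF assms(1) G_diff[OF assms(2,3)]] by (simp add: zero_left)
  then show ?thesis using form_eq_0D[of "x - x'"] by simp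
qed

text \<open>The resolvent \<open>J\<close>, and the Yosida approximation \<open>Y\<close>: a bounded operator that tends to the given one as
  \<open>\<alpha>\<close> tends to zero.\<close>

definition J :: "real \<Rightarrow> 'h \<Rightarrow> 'h" where
  "J \<alpha> y = (THE x. \<exists>z. (x, z) \<in> G \<and> x - \<alpha> *\<^sub>R z = y)"

definition Y :: "real \<Rightarrow> 'h \<Rightarrow> 'h" where
  "Y \<alpha> y = (1 / \<alpha>) *\<^sub>R (J \<alpha> y - y)"

lemma J_eqI: "small \<alpha> \<Longrightarrow> (x, z) \<in> G \<Longrightarrow> J \<alpha> (x - \<alpha> *\<^sub>R z) = x"
  unfolding J_def by (rule the_equality) (auto dest: resolvent_inj)

lemma Y_eqI: "small \<alpha> \<Longrightarrow> (x, z) \<in> G \<Longrightarrow> Y \<alpha> (x - \<alpha> *\<^sub>R z) = z"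
  using small(1)[of \<alpha>] by (simp add: Y_def J_eqI)

lemma J_Y_graph: assumes "small \<alpha>" shows "(J \<alpha> y, Y \<alpha> y) \<in> G"
proof -
  obtain x z where "(x, z) \<in> G" "x - \<alpha> *\<^sub>R z = y" using range[OF small(1)[OF assms]] by blast
  then show ?thesis using J_eqI[OF assms] Y_eqI[OF assms] by metis
qed

lemma J_Y: "small \<alpha> \<Longrightarrow> J \<alpha> y - \<alpha> *\<^sub>R Y \<alpha> y = y"
  using small(1)[of \<alpha>] by (simp add: Y_def)

lemma q_J: "small \<alpha> \<Longrightarrow> q (J \<alpha> y) \<le> 2 * q y"
  using resolvent_estimate[OF _ J_Y_graph] J_Y by metis

lemma J_add: assumes "small \<alpha>" shows "J \<alpha> (x + y) = J \<alpha> x + J \<alpha> y"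
proof -
  have "x + y = (J \<alpha> x + J \<alpha> y) - \<alpha> *\<^sub>R (Y \<alpha> x + Y \<alpha> y)"
    using J_Y[OF assms, of x] J_Y[OF assms, of y] by (simp add: algebra_simps)
  then show ?thesis using J_eqI[OF assms G_add[OF J_Y_graph[OF assms] J_Y_graph[OF assms]]] by metis
qed

lemma J_scaleR: assumes "small \<alpha>" shows "J \<alpha> (r *\<^sub>R x) = r *\<^sub>R J \<alpha> x"
proof -
  have "r *\<^sub>R x = (r *\<^sub>R J \<alpha> x) - \<alpha> *\<^sub>R (r *\<^sub>R Y \<alpha> x)"
    using arg_cong[OF J_Y[OF assms, of x], of "\<lambda>u. r *\<^sub>R u"] by (simp add: algebra_simps)
  then show ?thesis using J_eqI[OF assms G_scale[OF J_Y_graph[OF assms]]] by metis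
qed

lemma norm_J: "\<exists>C>0. \<forall>\<alpha> y. small \<alpha> \<longrightarrow> norm (J \<alpha> y) \<le> C * norm y"
proof -
  obtain K where K: "K > 0" "\<And>x. q x \<le> K * (norm x)\<^sup>2" using q_le by blast
  have "norm (J \<alpha> y) \<le> sqrt (2 * K / c) * norm y" if "small \<alpha>" for \<alpha> y
  proof -
    have "c * (norm (J \<alpha> y))\<^sup>2 \<le> q (J \<alpha> y)" by (simp add: coer)
    also have "\<dots> \<le> 2 * (K * (norm y)\<^sup>2)" using q_J[OF that, of y] K(2)[of y] by linarith
    finally have "(norm (J \<alpha> y))\<^sup>2 \<le> (2 * K / c) * (norm y)\<^sup>2" using c_pos by (simp add: field_simps)
    then have "sqrt ((norm (J \<alpha> y))\<^sup>2) \<le> sqrt ((2 * K / c) * (norm y)\<^sup>2)" by (rule real_sqrt_le_mono)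
    then show ?thesis by (simp only: real_sqrt_mult[of _ "(norm y)\<^sup>2"] real_sqrt_abs abs_norm_cancel)
  qed
  then show ?thesis using K c_pos by (intro exI[of _ "sqrt (2 * K / c)"]) auto
qed

lemma bounded_linear_J: assumes "small \<alpha>" shows "bounded_linear (J \<alpha>)"
proof -
  obtain C where "\<forall>\<alpha> y. small \<alpha> \<longrightarrow> norm (J \<alpha> y) \<le> C * norm y" using norm_J by blast
  then show ?thesis
    using assms by (intro bounded_linear_intro[where K = C]) (auto simp: J_add J_scaleR mult.commute)
qed

lemma bounded_linear_Y: "small \<alpha> \<Longrightarrow> bounded_linear (Y \<alpha>)"
  unfolding Y_def
  by (intro bounded_linear_scaleR_right[THEN bounded_linear_compose] bounded_linear_sub bounded_linear_J bounded_linear_ident)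

text \<open>On the domain the Yosida approximations are bounded uniformly in \<open>\<alpha>\<close>; this is what makes them converge there.\<close>

lemma Y_on_domain: assumes "small \<alpha>" "(x, z) \<in> G" shows "Y \<alpha> x = J \<alpha> z"
proof -
  interpret J: bounded_linear "J \<alpha>" by (rule bounded_linear_J[OF assms(1)])
  have "J \<alpha> x - \<alpha> *\<^sub>R J \<alpha> z = x" using J_eqI[OF assms] by (simp add: J.diff J.scaleR)
  then have "J \<alpha> x - x = \<alpha> *\<^sub>R J \<alpha> z" by (auto simp: diff_eq_eq add.commute)
  then show ?thesis using small(1)[OF assms(1)] by (simp add: Y_def)
qed

lemma Y_J_commute: "small \<alpha> \<Longrightarrow> small \<mu> \<Longrightarrow> Y \<alpha> (J \<mu> y) = J \<alpha> (Y \<mu> y)"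
  by (rule Y_on_domain) (auto intro: J_Y_graph)

text \<open>The Yosida approximation inherits dissipativity since \<open>y\<close> differs from \<open>J \<alpha> y\<close> by \<open>- \<alpha> Y \<alpha> y\<close>, which contributes a
  term of favourable sign.\<close>

lemma Y_dissipative: assumes "small \<alpha>" shows "B (Y \<alpha> y) y \<le> 2 * \<omega> * q y"
proof -
  have "B (Y \<alpha> y) y = B (Y \<alpha> y) (J \<alpha> y) - \<alpha> * q (Y \<alpha> y)"
    using arg_cong[OF J_Y[OF assms, of y], of "B (Y \<alpha> y)"] by (simp add: diff_right scaleR_right)
  also have "\<dots> \<le> \<omega> * q (J \<alpha> y)"
    using diss[OF J_Y_graph[OF assms, of y]] small(1)[OF assms] q_nonneg[of "Y \<alpha> y"]
    by (smt (verit) mult_nonneg_nonneg)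
  also have "\<dots> \<le> \<omega> * (2 * q y)" using \<omega> q_J[OF assms, of y] by (rule mult_left_mono[rotated])
  finally show ?thesis by simp
qed

text \<open>The graph is the zero set of a continuous function built from the resolvent.\<close>

lemma G_closed: "closed G"
proof -
  define \<alpha> where "\<alpha> = 1 / (4 * (\<omega> + 1))"
  have s: "small \<alpha>" using \<omega> by (auto simp: small_def \<alpha>_def)
  have "G = {p. J \<alpha> (fst p - \<alpha> *\<^sub>R snd p) = fst p}"
  proof (intro equalityI subsetI)
    fix p assume "p \<in> {p. J \<alpha> (fst p - \<alpha> *\<^sub>R snd p) = fst p}"
    then have j: "J \<alpha> (fst p - \<alpha> *\<^sub>R snd p) = fst p" by simp
    then have "Y \<alpha> (fst p - \<alpha> *\<^sub>R snd p) = snd p" using small(1)[OF s] by (simp add: Y_def)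
    then show "p \<in> G" using J_Y_graph[OF s, of "fst p - \<alpha> *\<^sub>R snd p"] j by simp
  next
    fix p assume "p \<in> G"
    then show "p \<in> {p. J \<alpha> (fst p - \<alpha> *\<^sub>R snd p) = fst p}" using J_eqI[OF s, of "fst p" "snd p"] by simp
  qed
  also have "closed \<dots>"
    by (intro closed_Collect_eq bounded_linear.continuous_on[OF bounded_linear_J[OF s]] continuous_intros)
  finally show ?thesis .
qed

text \<open>Let \<open>e\<close> be orthogonal to the domain. As \<open>J \<alpha> e\<close> lies in the domain, \<open>q (J \<alpha> e) = \<alpha> * B (Y \<alpha> e) (J \<alpha> e) \<le> q (J \<alpha> e) / 4\<close>, so
  \<open>J \<alpha> e = 0\<close>. Then \<open>Y \<alpha> e\<close> is a value of the operator at zero and vanishes too, and so does \<open>e = J \<alpha> e - \<alpha> Y \<alpha> e\<close>.\<close>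

lemma domain_dense: "closure (fst ` G) = UNIV"
proof (rule ccontr)
  define D where "D = closure (fst ` G)"
  have "subspace (fst ` G)" using linear_fst G_sub by (rule linear_subspace_image)
  then have "subspace D" unfolding D_def by (rule subspace_closure)
  interpret D: coercive_form D B c
    by unfold_locales (use \<open>subspace D\<close> bil symm c_pos coer in \<open>auto simp: D_def\<close>)
  assume "\<not> ?thesis"
  then obtain y where y: "y \<notin> D" by (auto simp: D_def)
  define \<alpha> where "\<alpha> = 1 / (4 * (\<omega> + 1))"
  have s: "small \<alpha>" using \<omega> by (auto simp: small_def \<alpha>_def)
  define e where "e = y - D.proj y"
  have orth: "B e v = 0" if "v \<in> D" for v using D.proj(2)[OF that] by (simp add: e_def diff_left)
  have JD: "J \<alpha> e \<in> D"
    unfolding D_def using J_Y_graph[OF s, of e] by (metis closure_subset fst_conv image_eqI subsetD)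
  have "0 = B (J \<alpha> e - \<alpha> *\<^sub>R Y \<alpha> e) (J \<alpha> e)" using orth[OF JD] J_Y[OF s] by simp
  also have "\<dots> = q (J \<alpha> e) - \<alpha> * B (Y \<alpha> e) (J \<alpha> e)" by (simp add: diff_left scaleR_left)
  finally have "q (J \<alpha> e) = \<alpha> * B (Y \<alpha> e) (J \<alpha> e)" by simp
  also have "\<dots> \<le> \<alpha> * (\<omega> * q (J \<alpha> e))"
    using diss[OF J_Y_graph[OF s, of e]] small(1)[OF s] by (intro mult_left_mono) auto
  also have "\<dots> \<le> q (J \<alpha> e) / 4"
    using mult_right_mono[OF small(2)[OF s] q_nonneg[of "J \<alpha> e"]] by (simp add: algebra_simps)
  finally have "q (J \<alpha> e) \<le> 0" by simp
  then have J0: "J \<alpha> e = 0" using form_eq_0D by blast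
  then have "Y \<alpha> e = 0" using single J_Y_graph[OF s, of e] by simp
  then have "e = 0" using J0 J_Y[OF s, of e] by simp
  then have "y = D.proj y" by (simp add: e_def)
  then show False using y D.proj(1)[of y] by simp
qed

text \<open>On the domain \<open>J \<mu> x - x = \<mu> *\<^sub>R J \<mu> z\<close>, which is small. The domain is dense and the resolvents are uniformly
  bounded, so finitely many points of the domain serve the whole compact set.\<close>

lemma J_approximates_identity:
  assumes K: "compact K" and e: "\<epsilon> > 0"
  shows "\<exists>m>0. \<forall>\<mu>. 0 < \<mu> \<and> \<mu> \<le> m \<longrightarrow> small \<mu> \<and> (\<forall>x\<in>K. norm (J \<mu> x - x) < \<epsilon>)"
proof -
  obtain C where C: "C > 0" "\<And>\<alpha> y. small \<alpha> \<Longrightarrow> norm (J \<alpha> y) \<le> C * norm y" using norm_J by blast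
  define \<delta> where "\<delta> = \<epsilon> / (2 * (C + 1))"
  have \<delta>: "\<delta> > 0" using e C by (simp add: \<delta>_def)
  have "K \<subseteq> (\<Union>d\<in>G. ball (fst d) \<delta>)"
  proof
    fix x assume "x \<in> K"
    have "x \<in> closure (fst ` G)" using domain_dense by simp
    then obtain d where "d \<in> G" "dist (fst d) x < \<delta>" using \<delta> unfolding closure_approachable by blast
    then show "x \<in> (\<Union>d\<in>G. ball (fst d) \<delta>)" by auto
  qed
  then obtain N where N: "N \<subseteq> G" "finite N" "K \<subseteq> (\<Union>d\<in>N. ball (fst d) \<delta>)"
    using compactE_image[OF K, of G "\<lambda>d. ball (fst d) \<delta>"] by auto
  define R where "R = 1 + C * (\<Sum>d\<in>N. norm (snd d))"
  have R: "R \<ge> 1" unfolding R_def using C by (simp add: sum_nonneg)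
  define m where "m = min (1 / (4 * (\<omega> + 1))) (\<epsilon> / (2 * R))"
  have m0: "m > 0" using \<omega> R e by (auto simp: m_def)
  have "small \<mu> \<and> (\<forall>x\<in>K. norm (J \<mu> x - x) < \<epsilon>)" if "0 < \<mu> \<and> \<mu> \<le> m" for \<mu>
  proof -
    have \<mu>0: "\<mu> > 0" and \<mu>m: "\<mu> \<le> 1 / (4 * (\<omega> + 1))" "\<mu> \<le> \<epsilon> / (2 * R)" using that by (auto simp: m_def)
    then have s: "small \<mu>" using \<omega> by (auto simp: small_def field_simps)
    interpret J: bounded_linear "J \<mu>" by (rule bounded_linear_J[OF s])
    have "norm (J \<mu> x - x) < \<epsilon>" if "x \<in> K" for x
    proof -
      obtain d where "d \<in> N" "x \<in> ball (fst d) \<delta>" using N(3) \<open>x \<in> K\<close> by blast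
      then have d: "d \<in> N" "norm (fst d - x) < \<delta>" by (auto simp: dist_norm)
      have dG: "(fst d, snd d) \<in> G" using d N by auto
      have "J \<mu> (fst d) - fst d = \<mu> *\<^sub>R Y \<mu> (fst d)"
        using J_Y[OF s, of "fst d"] by (simp add: algebra_simps)
      also have "\<dots> = \<mu> *\<^sub>R J \<mu> (snd d)" by (simp add: Y_on_domain[OF s dG])
      finally have "norm (J \<mu> (fst d) - fst d) = \<mu> * norm (J \<mu> (snd d))" using \<mu>0 by simp
      also have "\<dots> \<le> \<mu> * (C * norm (snd d))" using C(2)[OF s] \<mu>0 by (intro mult_left_mono) auto
      also have "\<dots> \<le> \<mu> * (C * (\<Sum>d\<in>N. norm (snd d)))"
        using \<mu>0 C d N by (intro mult_left_mono member_le_sum) auto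
      also have "\<dots> < \<mu> * R" unfolding R_def using \<mu>0 by (intro mult_strict_left_mono) auto
      also have "\<dots> \<le> (\<epsilon> / (2 * R)) * R" using R \<mu>m(2) by (intro mult_right_mono) auto
      also have "\<dots> = \<epsilon> / 2" using R by simp
      finally have 1: "norm (J \<mu> (fst d) - fst d) < \<epsilon> / 2" .
      have "J \<mu> x - x = (J \<mu> (fst d) - fst d) - J \<mu> (fst d - x) + (fst d - x)" by (simp add: J.diff)
      then have "norm (J \<mu> x - x) \<le> norm (J \<mu> (fst d) - fst d) + norm (J \<mu> (fst d - x)) + norm (fst d - x)"
        by (metis norm_diff_add_le)
      moreover have "norm (J \<mu> (fst d - x)) \<le> C * norm (fst d - x)" by (rule C(2)[OF s])
      moreover have "C * norm (fst d - x) + norm (fst d - x) \<le> (C + 1) * \<delta>"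
        using mult_left_mono[OF less_imp_le[OF d(2)], of "C + 1"] C by (simp add: algebra_simps)
      moreover have "(C + 1) * \<delta> = \<epsilon> / 2" using C by (simp add: \<delta>_def field_simps)
      ultimately show ?thesis using 1 by linarith
    qed
    then show ?thesis using s by blast
  qed
  then show ?thesis using m0 by blast
qed

lemma q_derivative:
  assumes "(w has_vector_derivative w') (at t within I)"
  shows "((\<lambda>t. q (w t)) has_real_derivative 2 * B w' (w t)) (at t within I)"
  using has_vector_derivative[OF assms assms] symm[of w' "w t"]
  by (simp add: has_real_derivative_iff_has_vector_derivative)

lemma yosida_energy:
  assumes s: "small \<alpha>"
    and w: "\<And>t. t \<in> {0..<T} \<Longrightarrow> (w has_vector_derivative Y \<alpha> (w t) + F t) (at t within {0..<T})"
    and t: "t \<in> {0..<T}" and M: "\<And>s. s \<in> {0..t} \<Longrightarrow> q (F s) \<le> M"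
  shows "q (w t) \<le> exp ((4 * \<omega> + 1) * t) * (q (w 0) + t * M)"
proof (rule linear_gronwall[OF q_derivative[OF w] t])
  show "0 \<le> 4 * \<omega> + 1" using \<omega> by simp
  have "0 \<in> {0..t}" using t by simp
  from M[OF this] show "0 \<le> M" using q_nonneg order_trans by blast
  fix r assume r: "r \<in> {0..t}"
  have "2 * B (Y \<alpha> (w r) + F r) (w r) = 2 * B (Y \<alpha> (w r)) (w r) + 2 * B (F r) (w r)"
    by (simp add: add_left)
  also have "\<dots> \<le> 2 * (2 * \<omega> * q (w r)) + (q (F r) + q (w r))"
    using Y_dissipative[OF s, of "w r"] q_cross[of "F r" "w r"] by linarith
  also have "\<dots> \<le> (4 * \<omega> + 1) * q (w r) + M" using M[OF r] by (simp add: algebra_simps)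
  finally show "2 * B (Y \<alpha> (w r) + F r) (w r) \<le> (4 * \<omega> + 1) * q (w r) + M" .
qed

text \<open>The estimate of Yosida. Write \<open>w = J \<alpha> w - \<alpha> Y \<alpha> w\<close> and \<open>v = J \<mu> v - \<mu> Y \<mu> v\<close>. The resolvent parts are governed by dissipativity,
  and the rest is of order \<open>\<alpha> + \<mu>\<close> as long as \<open>Y \<alpha> w\<close> and \<open>Y \<mu> v\<close> stay bounded.\<close>

lemma yosida_cauchy:
  assumes s: "small \<alpha>" "small \<mu>"
    and w: "\<And>t. t \<in> {0..<T} \<Longrightarrow> (w has_vector_derivative Y \<alpha> (w t) + F t) (at t within {0..<T})"
    and v: "\<And>t. t \<in> {0..<T} \<Longrightarrow> (v has_vector_derivative Y \<mu> (v t) + F t) (at t within {0..<T})"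
    and t: "t \<in> {0..<T}" and eq: "w 0 = v 0"
    and N: "\<And>s. s \<in> {0..t} \<Longrightarrow> q (Y \<alpha> (w s)) \<le> N" "\<And>s. s \<in> {0..t} \<Longrightarrow> q (Y \<mu> (v s)) \<le> N"
  shows "q (w t - v t) \<le> exp (4 * \<omega> * t) * (t * (4 * (\<alpha> + \<mu>) * N))"
proof -
  have d: "((\<lambda>t. w t - v t) has_vector_derivative Y \<alpha> (w t) - Y \<mu> (v t)) (at t within {0..<T})"
    if "t \<in> {0..<T}" for t
    using has_vector_derivative_diff[OF w[OF that] v[OF that]] by simp
  have "q (w t - v t) \<le> exp (4 * \<omega> * t) * (q (w 0 - v 0) + t * (4 * (\<alpha> + \<mu>) * N))"
  proof (rule linear_gronwall[OF q_derivative[OF d] t])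
    show "0 \<le> 4 * \<omega>" using \<omega> by simp
    have "q (Y \<alpha> (w 0)) \<le> N" using N(1)[of 0] t by simp
    then have N0: "0 \<le> N" using q_nonneg order_trans by blast
    then show "0 \<le> 4 * (\<alpha> + \<mu>) * N" using small(1) s by (simp add: add_nonneg_nonneg less_imp_le)
    fix r assume r: "r \<in> {0..t}"
    define x1 z1 x2 z2 where "x1 = J \<alpha> (w r)" "z1 = Y \<alpha> (w r)" "x2 = J \<mu> (v r)" "z2 = Y \<mu> (v r)"
    note defs = this
    have G: "(x1 - x2, z1 - z2) \<in> G" unfolding defs by (intro G_diff J_Y_graph s)
    have e: "w r - v r = (x1 - x2) - (\<alpha> *\<^sub>R z1 - \<mu> *\<^sub>R z2)"
      using J_Y[OF s(1), of "w r"] J_Y[OF s(2), of "v r"] unfolding defs by (simp add: algebra_simps)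
    have l: "0 < \<alpha>" "0 < \<mu>" "4 * \<alpha> * \<omega> \<le> 1" "4 * \<mu> * \<omega> \<le> 1" using small s by auto
    have qz: "q z1 \<le> N" "q z2 \<le> N" using N[OF r] unfolding defs by auto
    have q1: "q (\<alpha> *\<^sub>R z1 - \<mu> *\<^sub>R z2) \<le> 2 * (\<alpha>\<^sup>2 * N) + 2 * (\<mu>\<^sup>2 * N)"
    proof -
      have "q (\<alpha> *\<^sub>R z1 - \<mu> *\<^sub>R z2) \<le> 2 * q (\<alpha> *\<^sub>R z1) + 2 * q (\<mu> *\<^sub>R z2)" by (rule q_diff_le)
      also have "\<dots> \<le> 2 * (\<alpha>\<^sup>2 * N) + 2 * (\<mu>\<^sup>2 * N)"
        unfolding q_scale by (intro add_mono mult_left_mono qz) auto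
      finally show ?thesis .
    qed
    have q2: "q (x1 - x2) \<le> 2 * q (w r - v r) + 2 * (2 * (\<alpha>\<^sup>2 * N) + 2 * (\<mu>\<^sup>2 * N))"
      using q_add_le[of "w r - v r" "\<alpha> *\<^sub>R z1 - \<mu> *\<^sub>R z2"] q1 e by simp
    have cross: "- B (z1 - z2) (\<alpha> *\<^sub>R z1 - \<mu> *\<^sub>R z2) \<le> (\<alpha> + \<mu>) * N"
    proof -
      have "- B (z1 - z2) (\<alpha> *\<^sub>R z1 - \<mu> *\<^sub>R z2) = - \<alpha> * q z1 - \<mu> * q z2 + (\<alpha> + \<mu>) * B z1 z2"
        using symm[of z2 z1] by (simp add: diff_left diff_right scaleR_right algebra_simps)
      also have "\<dots> \<le> (\<alpha> + \<mu>) * B z1 z2"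
        using mult_nonneg_nonneg[OF less_imp_le[OF l(1)] q_nonneg[of z1]]
          mult_nonneg_nonneg[OF less_imp_le[OF l(2)] q_nonneg[of z2]] by simp
      also have "\<dots> \<le> (\<alpha> + \<mu>) * N" using q_cross[of z1 z2] qz l by (intro mult_left_mono) auto
      finally show ?thesis .
    qed
    have sq: "4 * (\<omega> * (\<nu>\<^sup>2 * N)) \<le> \<nu> * N" if "0 < \<nu>" "4 * \<nu> * \<omega> \<le> 1" for \<nu>
      using mult_right_mono[OF that(2), of "\<nu> * N"] that N0 by (simp add: power2_eq_square mult_ac)
    have "2 * B (Y \<alpha> (w r) - Y \<mu> (v r)) (w r - v r)
        = 2 * B (z1 - z2) (x1 - x2) + 2 * - B (z1 - z2) (\<alpha> *\<^sub>R z1 - \<mu> *\<^sub>R z2)"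
      unfolding e defs(2,4)[symmetric] by (simp add: diff_right)
    also have "\<dots> \<le> 2 * (\<omega> * q (x1 - x2)) + 2 * ((\<alpha> + \<mu>) * N)"
      using diss[OF G] cross by linarith
    also have "\<omega> * q (x1 - x2) \<le> \<omega> * (2 * q (w r - v r) + 2 * (2 * (\<alpha>\<^sup>2 * N) + 2 * (\<mu>\<^sup>2 * N)))"
      using q2 \<omega> by (rule mult_left_mono)
    also have "\<dots> = 2 * \<omega> * q (w r - v r) + 4 * (\<omega> * (\<alpha>\<^sup>2 * N)) + 4 * (\<omega> * (\<mu>\<^sup>2 * N))"
      by (simp add: algebra_simps)
    also have "\<dots> \<le> 2 * \<omega> * q (w r - v r) + \<alpha> * N + \<mu> * N" using sq[OF l(1,3)] sq[OF l(2,4)] by linarith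
    finally show "2 * B (Y \<alpha> (w r) - Y \<mu> (v r)) (w r - v r)
        \<le> 4 * \<omega> * q (w r - v r) + 4 * (\<alpha> + \<mu>) * N" by (simp add: algebra_simps)
  qed
  then show ?thesis using eq by (simp add: zero_left)
qed

text \<open>A sequence of admissible parameters that tends to zero.\<close>

definition lam :: "nat \<Rightarrow> real" where "lam n = 1 / (4 * (\<omega> + 1) * (real n + 1))"

lemma small_lam: "small (lam n)"
proof -
  have "4 * lam n * (\<omega> + 1) = 1 / (real n + 1)" using \<omega> by (simp add: lam_def)
  also have "\<dots> \<le> 1" by simp
  finally show ?thesis using \<omega> by (simp add: small_def lam_def)
qed

lemma lam_tendsto: "lam \<longlonglongrightarrow> 0"
proof -
  have "(\<lambda>n. (1 / (4 * (\<omega> + 1))) * inverse (real (Suc n))) \<longlonglongrightarrow> (1 / (4 * (\<omega> + 1))) * 0"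
    by (intro tendsto_intros LIMSEQ_inverse_real_of_nat)
  moreover have "lam = (\<lambda>n. (1 / (4 * (\<omega> + 1))) * inverse (real (Suc n)))"
    by (rule ext) (simp add: lam_def divide_inverse add.commute)
  ultimately show ?thesis by simp
qed

text \<open>The estimate \<open>yosida_cauchy\<close> needs bounds for \<open>Y (lam n) (w n t)\<close>, which are available when the initial
  value and the forcing lie in the domain. Both are therefore replaced by their images under one resolvent \<open>J \<mu>\<close>, which changes the
  solutions by an error that is small uniformly in \<open>n\<close> (\<open>yosida_energy\<close>). As
  \<open>Y (lam n) (J \<mu> x) = J (lam n) (Y \<mu> x)\<close> is bounded in \<open>n\<close>, the smoothed solutions \<open>v n\<close> satisfy the required bounds.\<close>

lemma yosida_solutions_converge:
  assumes F: "continuous_on {0..<T} F"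
    and w: "\<And>n t. t \<in> {0..<T} \<Longrightarrow> (w n has_vector_derivative Y (lam n) (w n t) + F t) (at t within {0..<T})"
    and w0: "\<And>n. w n 0 = x0" and b: "b < T"
  shows "uniformly_Cauchy_on {0..b} w"
proof (cases "0 \<le> b")
  case b0: True
  have T: "0 < T" using b0 b by simp
  obtain K where K: "K > 0" "\<And>x. q x \<le> K * (norm x)\<^sup>2" using q_le by blast
  have Fb: "continuous_on {0..b} F" by (rule continuous_on_subset[OF F]) (use b in auto)
  have comp: "compact (insert x0 (F ` {0..b}))" by (intro compact_insert compact_continuous_image Fb) auto
  show ?thesis
  proof (rule uniformly_Cauchy_onI)
    fix e :: real assume e: "e > 0"
    define E where "E = exp ((4 * \<omega> + 1) * b)"
    have E: "E > 0" "E \<ge> 1" using b0 \<omega> by (auto simp: E_def)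
    define \<eta> where "\<eta> = c * e\<^sup>2 / (20 * (E * (K * (1 + b))))"
    have \<eta>: "\<eta> > 0" using c_pos e E K b0 by (simp add: \<eta>_def)
    obtain \<mu> where \<mu>: "small \<mu>" "\<And>x. x \<in> insert x0 (F ` {0..b}) \<Longrightarrow> norm (J \<mu> x - x) < sqrt \<eta>"
      using J_approximates_identity[OF comp, of "sqrt \<eta>"] \<eta> by (metis order_refl real_sqrt_gt_zero)
    interpret Jm: bounded_linear "J \<mu>" by (rule bounded_linear_J[OF \<mu>(1)])
    interpret Ym: bounded_linear "Y \<mu>" by (rule bounded_linear_Y[OF \<mu>(1)])
    have qJ: "q (x - J \<mu> x) \<le> K * \<eta>" if "x \<in> insert x0 (F ` {0..b})" for x
    proof -
      have "(norm (x - J \<mu> x))\<^sup>2 \<le> (sqrt \<eta>)\<^sup>2"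
        using \<mu>(2)[OF that] by (intro power_mono) (auto simp: norm_minus_commute)
      then have "K * (norm (x - J \<mu> x))\<^sup>2 \<le> K * \<eta>" using \<eta> K by simp
      then show ?thesis using K(2)[of "x - J \<mu> x"] by linarith
    qed
    have JF: "continuous_on {0..<T} (\<lambda>t. J \<mu> (F t))" by (intro Jm.continuous_on F)
    have "\<exists>v. v 0 = J \<mu> x0 \<and> (\<forall>t\<in>{0..<T}. (v has_vector_derivative Y (lam n) (v t) + J \<mu> (F t)) (at t within {0..<T}))" for n
      using linear_ode_exists[OF bounded_linear_Y[OF small_lam[of n]] JF] by metis
    then obtain v where v0: "\<And>n. v n 0 = J \<mu> x0"
      and v: "\<And>n t. t \<in> {0..<T} \<Longrightarrow> (v n has_vector_derivative Y (lam n) (v n t) + J \<mu> (F t)) (at t within {0..<T})"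
      by metis
    have wv: "q (w n t - v n t) \<le> c * e\<^sup>2 / 20" if t: "t \<in> {0..b}" for n t
    proof -
      interpret Yn: bounded_linear "Y (lam n)" by (rule bounded_linear_Y[OF small_lam])
      have tT: "t \<in> {0..<T}" using t b by auto
      have der: "((\<lambda>t. w n t - v n t) has_vector_derivative Y (lam n) (w n t - v n t) + (F t - J \<mu> (F t))) (at t within {0..<T})"
        if "t \<in> {0..<T}" for t
        using has_vector_derivative_diff[OF w[OF that, of n] v[OF that, of n]] by (simp add: Yn.diff algebra_simps)
      have "q (w n t - v n t) \<le> exp ((4 * \<omega> + 1) * t) * (q (w n 0 - v n 0) + t * (K * \<eta>))"
        by (rule yosida_energy[OF small_lam der tT]) (use qJ t in auto)
      also have "\<dots> \<le> E * (K * \<eta> + b * (K * \<eta>))"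
        unfolding E_def using t \<omega> K \<eta> qJ[of x0]
        by (intro mult_mono add_mono mult_right_mono) (auto simp: w0 v0 intro!: mult_left_mono add_nonneg_nonneg)
      also have "\<dots> = E * (K * (1 + b)) * \<eta>" by (simp add: algebra_simps)
      also have "\<dots> = c * e\<^sup>2 / 20" using E K b0 by (simp add: \<eta>_def)
      finally show ?thesis .
    qed
    \<comment> \<open>\<open>Y (lam n) (v n t)\<close> solves the equation with forcing \<open>J (lam n) (Y \<mu> (F t))\<close>, which is bounded.\<close>
    have "continuous_on {0..b} (\<lambda>t. q (Y \<mu> (F t)))"
      by (intro continuous_on Ym.continuous_on Fb)
    then have "compact ((\<lambda>t. q (Y \<mu> (F t))) ` {0..b})" by (rule compact_continuous_image) auto
    then obtain M where "\<forall>r\<in>(\<lambda>t. q (Y \<mu> (F t))) ` {0..b}. norm r \<le> M"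
      using compact_imp_bounded bounded_iff by blast
    then have M: "q (Y \<mu> (F t)) \<le> M" if "t \<in> {0..b}" for t using that by auto
    have M0: "M \<ge> 0" using M[of 0] b0 q_nonneg[of "Y \<mu> (F 0)"] by (meson atLeastAtMost_iff order_refl order_trans)
    define N where "N = E * (2 * q (Y \<mu> x0) + b * (2 * M))"
    have N0: "N \<ge> 0" unfolding N_def using E b0 M0 by (simp add: add_nonneg_nonneg)
    have vN: "q (Y (lam n) (v n t)) \<le> N" if t: "t \<in> {0..b}" for n t
    proof -
      interpret Yn: bounded_linear "Y (lam n)" by (rule bounded_linear_Y[OF small_lam])
      have tT: "t \<in> {0..<T}" using t b by auto
      have com: "Y (lam n) (J \<mu> x) = J (lam n) (Y \<mu> x)" for x by (rule Y_J_commute[OF small_lam \<mu>(1)])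
      have der: "((\<lambda>t. Y (lam n) (v n t)) has_vector_derivative Y (lam n) (Y (lam n) (v n t)) + J (lam n) (Y \<mu> (F t))) (at t within {0..<T})"
        if "t \<in> {0..<T}" for t
        using Yn.has_vector_derivative[OF v[OF that, of n]] by (simp add: Yn.add com)
      have "q (Y (lam n) (v n t)) \<le> exp ((4 * \<omega> + 1) * t) * (q (Y (lam n) (v n 0)) + t * (2 * M))"
      proof (rule yosida_energy[OF small_lam der tT])
        fix s assume "s \<in> {0..t}"
        then have "q (Y \<mu> (F s)) \<le> M" using t by (intro M) auto
        then show "q (J (lam n) (Y \<mu> (F s))) \<le> 2 * M" using q_J[OF small_lam, of n "Y \<mu> (F s)"] by linarith
      qed
      also have "\<dots> \<le> N"
        unfolding N_def E_def using t \<omega> M0 q_J[OF small_lam, of n "Y \<mu> x0"]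
        by (intro mult_mono add_mono mult_right_mono) (auto simp: v0 com intro!: mult_left_mono add_nonneg_nonneg)
      finally show ?thesis .
    qed
    define H where "H = E * (b * (4 * N)) + 1"
    have H: "H > 0" unfolding H_def using E b0 N0 by (smt (verit) mult_nonneg_nonneg)
    have vv: "q (v n t - v m t) \<le> H * (lam n + lam m)" if t: "t \<in> {0..b}" for n m t
    proof -
      have tT: "t \<in> {0..<T}" using t b by auto
      have lp: "lam n + lam m > 0" using small(1)[OF small_lam] by (simp add: add_pos_pos)
      have "q (v n t - v m t) \<le> exp (4 * \<omega> * t) * (t * (4 * (lam n + lam m) * N))"
        by (rule yosida_cauchy[OF small_lam small_lam v v tT]) (use v0 vN t in auto)
      also have "\<dots> \<le> E * (b * (4 * (lam n + lam m) * N))"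
      proof -
        have "0 \<le> 4 * (lam n + lam m) * N" using N0 lp by (intro mult_nonneg_nonneg) auto
        moreover have "4 * \<omega> * t \<le> (4 * \<omega> + 1) * b"
          using t \<omega> b0 by (intro mult_mono) auto
        ultimately show ?thesis unfolding E_def using t by (intro mult_mono mult_right_mono) auto
      qed
      also have "\<dots> \<le> H * (lam n + lam m)" unfolding H_def using lp by (simp add: algebra_simps)
      finally show ?thesis .
    qed
    have "c * e\<^sup>2 / (20 * H) > 0" using c_pos e H by simp
    then obtain n0 where n0: "\<And>n. n \<ge> n0 \<Longrightarrow> lam n < c * e\<^sup>2 / (20 * H)"
      using lam_tendsto[THEN LIMSEQ_D] small(1)[OF small_lam] by (metis abs_of_pos diff_zero real_norm_def)
    have "dist (w n t) (w m t) < e" if t: "t \<in> {0..b}" and nm: "n \<ge> n0" "m \<ge> n0" for t n m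
    proof -
      have "H * (lam n + lam m) \<le> H * (c * e\<^sup>2 / (20 * H) + c * e\<^sup>2 / (20 * H))"
        using n0[OF nm(1)] n0[OF nm(2)] H by (intro mult_left_mono add_mono) auto
      also have "\<dots> = c * e\<^sup>2 / 10" using H by (simp add: field_simps)
      finally have 1: "q (v n t - v m t) \<le> c * e\<^sup>2 / 10" using vv[OF t, of n m] by linarith
      have eq: "w n t - w m t = (v n t - v m t) + ((w n t - v n t) - (w m t - v m t))" by simp
      have "c * (norm (w n t - w m t))\<^sup>2 \<le> q (w n t - w m t)" by (simp add: coer)
      also have "\<dots> \<le> 2 * q (v n t - v m t) + 2 * q ((w n t - v n t) - (w m t - v m t))"
        unfolding eq by (rule q_add_le)
      also have "\<dots> \<le> 12 * (c * e\<^sup>2 / 20)"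
      proof -
        have gen: "2 * A + 2 * D \<le> 12 * r" if "A \<le> 2 * r" "D \<le> 2 * X + 2 * X'" "X \<le> r" "X' \<le> r"
          for A D X X' r :: real
          using that by linarith
        show ?thesis by (rule gen[OF _ q_diff_le wv[OF t] wv[OF t]]) (use 1 in simp)
      qed
      also have "\<dots> < c * e\<^sup>2" using c_pos e by (simp add: field_simps)
      finally have "(norm (w n t - w m t))\<^sup>2 < e\<^sup>2" using c_pos by simp
      then have "norm (w n t - w m t) < e" using e by (simp add: power_less_imp_less_base)
      then show ?thesis by (simp add: dist_norm)
    qed
    then show "\<exists>M. \<forall>x\<in>{0..b}. \<forall>m\<ge>M. \<forall>n\<ge>M. dist (w m x) (w n x) < e" by blast
  qed
qed (auto simp: uniformly_Cauchy_on_def)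

lemma yosida_solutions_limit:
  assumes F: "continuous_on {0..<T} F"
    and w: "\<And>n t. t \<in> {0..<T} \<Longrightarrow> (w n has_vector_derivative Y (lam n) (w n t) + F t) (at t within {0..<T})"
    and w0: "\<And>n. w n 0 = x0" and b: "b < T"
  shows "uniform_limit {0..b} w (\<lambda>t. lim (\<lambda>n. w n t)) sequentially"
proof -
  have "uniformly_convergent_on {0..b} w"
    using yosida_solutions_converge[OF F w w0 b] by (rule Cauchy_uniformly_convergent)
  then show ?thesis by (simp add: uniformly_convergent_uniform_limit_iff)
qed

text \<open>The time derivative of a regularised solution solves the regularised equation with forcing \<open>F'\<close> and initial
  value \<open>J (lam n) z0 + F 0\<close>. This value converges, hence so do the derivatives, locally uniformly, and the
  equation passes to the limit because the graph is closed.\<close>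

theorem inhomogeneous_problem:
  assumes init: "(x0, z0) \<in> G"
    and F: "\<And>t. t \<in> {0..<T} \<Longrightarrow> (F has_vector_derivative F' t) (at t within {0..<T})"
    and F': "continuous_on {0..<T} F'"
  obtains w y where "w 0 = x0" "continuous_on {0..<T} y"
    "\<And>t. t \<in> {0..<T} \<Longrightarrow> (w has_vector_derivative y t) (at t within {0..<T})"
    "\<And>t. t \<in> {0..<T} \<Longrightarrow> (w t, y t - F t) \<in> G"
proof -
  have Fc: "continuous_on {0..<T} F" by (rule continuous_on_vector_derivative[OF F])
  have "\<exists>w. w 0 = x0 \<and> (\<forall>t\<in>{0..<T}. (w has_vector_derivative Y (lam n) (w t) + F t) (at t within {0..<T}))" for n
    using linear_ode_exists[OF bounded_linear_Y[OF small_lam[of n]] Fc] by metis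
  then obtain W where W0: "\<And>n. W n 0 = x0"
    and W: "\<And>n t. t \<in> {0..<T} \<Longrightarrow> (W n has_vector_derivative Y (lam n) (W n t) + F t) (at t within {0..<T})"
    by metis
  have "\<exists>w. w 0 = z0 + F 0 \<and> (\<forall>t\<in>{0..<T}. (w has_vector_derivative Y (lam n) (w t) + F' t) (at t within {0..<T}))" for n
    using linear_ode_exists[OF bounded_linear_Y[OF small_lam[of n]] F'] by metis
  then obtain V where V0: "\<And>n. V n 0 = z0 + F 0"
    and V: "\<And>n t. t \<in> {0..<T} \<Longrightarrow> (V n has_vector_derivative Y (lam n) (V n t) + F' t) (at t within {0..<T})"
    by metis
  define w y where "w t = lim (\<lambda>n. W n t)" and "y t = lim (\<lambda>n. V n t)" for t
  have limW: "uniform_limit {0..b} W w sequentially" if "b < T" for b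
    unfolding w_def by (rule yosida_solutions_limit[OF Fc W W0 that])
  have limV: "uniform_limit {0..b} V y sequentially" if "b < T" for b
    unfolding y_def by (rule yosida_solutions_limit[OF F' V V0 that])
  define D where "D n t = Y (lam n) (W n t) + F t" for n t
  have "(\<lambda>n. J (lam n) z0 - z0) \<longlonglongrightarrow> 0"
  proof (rule LIMSEQ_I)
    fix r :: real assume "r > 0"
    then obtain m where m: "m > 0" "\<And>\<mu>. 0 < \<mu> \<Longrightarrow> \<mu> \<le> m \<Longrightarrow> norm (J \<mu> z0 - z0) < r"
      using J_approximates_identity[of "{z0}" r] by auto
    obtain n0 where "\<And>n. n \<ge> n0 \<Longrightarrow> lam n < m"
      using order_tendstoD(2)[OF lam_tendsto m(1)] unfolding eventually_sequentially by blast
    then show "\<exists>n0. \<forall>n\<ge>n0. norm (J (lam n) z0 - z0 - 0) < r"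
      using m(2)[OF small(1)[OF small_lam]] by (auto intro!: exI[of _ n0] less_imp_le)
  qed
  from tendsto[OF this this] have init_conv: "(\<lambda>n. q (J (lam n) z0 - z0)) \<longlonglongrightarrow> 0" by (simp add: zero_left)
  \<comment> \<open>\<open>D n\<close> is the derivative of \<open>W n\<close>; it solves the equation of \<open>V n\<close> with the initial value \<open>J (lam n) z0 + F 0\<close>.\<close>
  have DV: "q (D n t - V n t) \<le> exp ((4 * \<omega> + 1) * t) * q (J (lam n) z0 - z0)" if t: "t \<in> {0..<T}" for n t
  proof -
    interpret Yn: bounded_linear "Y (lam n)" by (rule bounded_linear_Y[OF small_lam])
    have der: "((\<lambda>t. D n t - V n t) has_vector_derivative Y (lam n) (D n t - V n t) + 0) (at t within {0..<T})"
      if "t \<in> {0..<T}" for t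
    proof -
      have "(D n has_vector_derivative Y (lam n) (D n t) + F' t) (at t within {0..<T})"
        unfolding D_def by (intro has_vector_derivative_add Yn.has_vector_derivative W F that)
      from has_vector_derivative_diff[OF this V[OF that, of n]]
      show ?thesis by (simp add: Yn.diff)
    qed
    have "q (D n t - V n t) \<le> exp ((4 * \<omega> + 1) * t) * (q (D n 0 - V n 0) + t * 0)"
      by (rule yosida_energy[OF small_lam der t]) (simp_all add: zero_left)
    moreover have "D n 0 - V n 0 = J (lam n) z0 - z0"
      by (simp add: D_def W0 V0 Y_on_domain[OF small_lam init])
    ultimately show ?thesis by simp
  qed
  have limD: "uniform_limit {0..b} D y sequentially" if b: "b < T" for b
  proof (cases "0 \<le> b")
    case b0: True
    have "uniform_limit {0..b} (\<lambda>n t. D n t - V n t) (\<lambda>t. 0) sequentially"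
    proof (rule uniform_limitI)
      fix e :: real assume e: "e > 0"
      define E where "E = exp ((4 * \<omega> + 1) * b)"
      have E: "E > 0" by (simp add: E_def)
      have "c * e\<^sup>2 / E > 0" using c_pos e E by simp
      then have "\<forall>\<^sub>F n in sequentially. q (J (lam n) z0 - z0) < c * e\<^sup>2 / E"
        using init_conv by (rule order_tendstoD(2)[rotated])
      then show "\<forall>\<^sub>F n in sequentially. \<forall>t\<in>{0..b}. dist (D n t - V n t) 0 < e"
      proof eventually_elim
        case (elim n)
        show ?case
        proof
          fix t assume t: "t \<in> {0..b}"
          have "c * (norm (D n t - V n t))\<^sup>2 \<le> q (D n t - V n t)" by (simp add: coer)
          also have "\<dots> \<le> exp ((4 * \<omega> + 1) * t) * q (J (lam n) z0 - z0)" using t b by (intro DV) auto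
          also have "\<dots> \<le> E * q (J (lam n) z0 - z0)"
            unfolding E_def using t \<omega> by (intro mult_right_mono) (auto intro!: mult_left_mono)
          also have "\<dots> < c * e\<^sup>2" using elim E by (simp add: field_simps)
          finally have "(norm (D n t - V n t))\<^sup>2 < e\<^sup>2" using c_pos by simp
          then show "dist (D n t - V n t) 0 < e" using e by (simp add: power_less_imp_less_base)
        qed
      qed
    qed
    then have "uniform_limit {0..b} (\<lambda>n t. (D n t - V n t) + V n t) (\<lambda>t. 0 + y t) sequentially"
      by (intro uniform_limit_add limV b)
    then show ?thesis by simp
  qed (auto simp: uniform_limit_iff)
  have Wc: "continuous_on {0..<T} (W n)" for n by (rule continuous_on_vector_derivative[OF W])
  have Dc: "continuous_on {0..<T} (D n)" for n
    unfolding D_def by (intro continuous_intros bounded_linear.continuous_on[OF bounded_linear_Y[OF small_lam]] Wc Fc)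
  have WD: "(W n has_vector_derivative D n t) (at t within {0..<T})" if "t \<in> {0..<T}" for n t
    using W[OF that, of n] by (simp add: D_def)
  have Wt: "(\<lambda>n. W n t) \<longlonglongrightarrow> w t" if "t \<in> {0..<T}" for t
    using tendsto_uniform_limitI[OF limW, of t t] that by auto
  have Dt: "(\<lambda>n. D n t) \<longlonglongrightarrow> y t" if "t \<in> {0..<T}" for t
    using tendsto_uniform_limitI[OF limD, of t t] that by auto
  show ?thesis
  proof (rule that[of w y])
    show "w 0 = x0" by (simp add: w_def W0)
    show "continuous_on {0..<T} y"
      by (rule uniform_limit_vector_derivative(1)[OF WD Dc Wt limD])
    show "(w has_vector_derivative y t) (at t within {0..<T})" if "t \<in> {0..<T}" for t
      by (rule uniform_limit_vector_derivative(2)[OF WD Dc Wt limD that])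
    show "(w t, y t - F t) \<in> G" if t: "t \<in> {0..<T}" for t
    proof -
      have Yt: "(\<lambda>n. Y (lam n) (W n t)) \<longlonglongrightarrow> y t - F t"
        using tendsto_diff[OF Dt[OF t] tendsto_const[of "F t"]] by (simp add: D_def)
      have "(\<lambda>n. W n t + lam n *\<^sub>R Y (lam n) (W n t)) \<longlonglongrightarrow> w t + 0 *\<^sub>R (y t - F t)"
        by (intro tendsto_intros Wt Yt lam_tendsto t)
      moreover have "W n t + lam n *\<^sub>R Y (lam n) (W n t) = J (lam n) (W n t)" for n
        using J_Y[OF small_lam, of n "W n t"] by (metis diff_add_cancel)
      ultimately have "(\<lambda>n. J (lam n) (W n t)) \<longlonglongrightarrow> w t" by simp
      then have "(\<lambda>n. (J (lam n) (W n t), Y (lam n) (W n t))) \<longlonglongrightarrow> (w t, y t - F t)"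
        using Yt by (rule tendsto_Pair)
      then show ?thesis
        by (rule closed_sequentially[OF G_closed, rotated]) (rule J_Y_graph[OF small_lam])
    qed
  qed
qed

end

section \<open>Abstract second order evolution equations\<close>

lemma bounded_bilinear_plus:
  assumes "bounded_bilinear f" "bounded_bilinear g"
  shows "bounded_bilinear (\<lambda>x y. f x y + g x y)"
proof -
  interpret f: bounded_bilinear f by fact
  interpret g: bounded_bilinear g by fact
  obtain K where K: "\<And>a b. norm (f a b) \<le> norm a * norm b * K" using f.bounded by blast
  obtain L where L: "\<And>a b. norm (g a b) \<le> norm a * norm b * L" using g.bounded by blast
  have "norm (f a b + g a b) \<le> norm a * norm b * (K + L)" for a b
    using norm_triangle_ineq[of "f a b" "g a b"] K[of a b] L[of a b] by (simp add: algebra_simps)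
  then show ?thesis
    by unfold_locales (auto simp: f.add_left f.add_right g.add_left g.add_right f.scaleR_left
        f.scaleR_right g.scaleR_left g.scaleR_right scaleR_add_right)
qed

text \<open>The abstract setting of \<open>U'' + L U = F\<close>, where \<open>L\<close> is the operator of the form \<open>a\<close>. The form domain \<open>VV\<close> is embedded
  by \<open>\<iota>\<close> into the space \<open>HH\<close> of velocities. An explicit embedding is used because an element of \<open>VV\<close> will consist of a field
  and its weak derivatives, while \<open>\<iota>\<close> keeps the field only. The last assumption says that the range of \<open>\<iota>\<close> is dense in \<open>HH\<close>.\<close>

locale wave_form =
  fixes VV :: "'v::{real_inner,banach} set" and HH :: "'h::{real_inner,banach} set"
    and \<iota> :: "'v \<Rightarrow> 'h" and a :: "'v \<Rightarrow> 'v \<Rightarrow> real" and c :: real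
  assumes V: "subspace VV" "closed VV" and HH: "subspace HH" "closed HH"
    and \<iota>: "bounded_linear \<iota>" "\<And>U. U \<in> VV \<Longrightarrow> \<iota> U \<in> HH" "\<And>U. U \<in> VV \<Longrightarrow> \<iota> U = 0 \<Longrightarrow> U = 0"
    and a: "bounded_bilinear a" "\<And>U U'. a U U' = a U' U" "\<And>U. U \<in> VV \<Longrightarrow> 0 \<le> a U U"
    and c: "0 < c" "\<And>U. U \<in> VV \<Longrightarrow> c * (norm U)\<^sup>2 \<le> a U U + (norm (\<iota> U))\<^sup>2"
    and dense: "\<And>Y. Y \<in> HH \<Longrightarrow> (\<And>\<phi>. \<phi> \<in> VV \<Longrightarrow> Y \<bullet> \<iota> \<phi> = 0) \<Longrightarrow> Y = 0"
begin

text \<open>The graph of the operator \<open>(U, U') \<mapsto> (U', - L U)\<close>.\<close>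

definition wave_graph :: "(('v \<times> 'h) \<times> ('v \<times> 'h)) set" where
  "wave_graph = {((U, W), (Z, Y)) | U W Z Y. U \<in> VV \<and> Z \<in> VV \<and> Y \<in> HH \<and> W = \<iota> Z \<and>
     (\<forall>\<phi>\<in>VV. a U \<phi> = - (Y \<bullet> \<iota> \<phi>))}"

lemma wave_graph_iff:
  "((U, W), (Z, Y)) \<in> wave_graph \<longleftrightarrow>
     U \<in> VV \<and> Z \<in> VV \<and> Y \<in> HH \<and> W = \<iota> Z \<and> (\<forall>\<phi>\<in>VV. a U \<phi> = - (Y \<bullet> \<iota> \<phi>))"
  by (auto simp: wave_graph_def)

definition full_form :: "'v \<times> 'h \<Rightarrow> 'v \<times> 'h \<Rightarrow> real" where
  "full_form x y = a (fst x) (fst y) + \<iota> (fst x) \<bullet> \<iota> (fst y) + snd x \<bullet> snd y"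

lemma coercive_full_form: "coercive_form (VV \<times> HH) full_form (min c 1)"
proof (rule coercive_form.intro)
  interpret i: bounded_linear \<iota> by (rule \<iota>)
  show "subspace (VV \<times> HH)" using V(1) HH(1) by (rule subspace_Times)
  show "closed (VV \<times> HH)" using V(2) HH(2) by (rule closed_Times)
  show "bounded_bilinear full_form"
    unfolding full_form_def
    by (intro bounded_bilinear_plus bounded_bilinear.comp[OF a(1)] bounded_bilinear.comp[OF bounded_bilinear_inner]
        bounded_linear_fst bounded_linear_snd bounded_linear_compose[OF \<iota>(1)])
  show "full_form x y = full_form y x" for x y
    using a(2)[of "fst x" "fst y"] by (simp add: full_form_def inner_commute)
  show "0 < min c 1" using c by simp
  fix x assume x: "x \<in> VV \<times> HH"
  have "min c 1 * (norm x)\<^sup>2 = min c 1 * (norm (fst x))\<^sup>2 + min c 1 * (norm (snd x))\<^sup>2"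
    by (simp add: norm_prod_def algebra_simps)
  also have "\<dots> \<le> c * (norm (fst x))\<^sup>2 + 1 * (norm (snd x))\<^sup>2"
    by (intro add_mono mult_right_mono) auto
  also have "\<dots> \<le> full_form x x"
    using c(2)[of "fst x"] x by (auto simp: full_form_def dot_square_norm)
  finally show "min c 1 * (norm x)\<^sup>2 \<le> full_form x x" .
qed

lemma subspace_wave_graph: "subspace wave_graph"
proof -
  interpret i: bounded_linear \<iota> by (rule \<iota>)
  interpret a: bounded_bilinear a by (rule a)
  show ?thesis
  proof (rule subspaceI)
    show "0 \<in> wave_graph"
      using V HH by (auto simp: zero_prod_def wave_graph_iff subspace_0 i.zero a.zero_left)
    show "x + y \<in> wave_graph" if "x \<in> wave_graph" "y \<in> wave_graph" for x y
      using that V HH by (cases x; cases y) (auto simp: wave_graph_iff subspace_add i.add a.add_left inner_add_left)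
    show "r *\<^sub>R x \<in> wave_graph" if "x \<in> wave_graph" for r x
      using that V HH by (cases x) (auto simp: wave_graph_iff subspace_scale i.scaleR a.scaleR_left)
  qed
qed

lemma wave_graph_single:
  assumes "(0, z) \<in> wave_graph" shows "z = 0"
proof -
  interpret a: bounded_bilinear a by (rule a)
  obtain Z Y where z: "z = (Z, Y)" by (cases z)
  have "((0, 0), (Z, Y)) \<in> wave_graph" using assms z by (simp add: zero_prod_def)
  then have *: "Z \<in> VV" "Y \<in> HH" "\<iota> Z = 0" "\<And>\<phi>. \<phi> \<in> VV \<Longrightarrow> Y \<bullet> \<iota> \<phi> = 0"
    unfolding wave_graph_iff a.zero_left by auto
  then show ?thesis using \<iota>(3) dense z by (auto simp: zero_prod_def)
qed

text \<open>The contributions of \<open>a\<close> and of the kinetic energy cancel, as one sees with \<open>\<phi> = Z\<close>. What is left is the lower order term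
  \<open>\<iota> Z \<bullet> \<iota> U\<close>.\<close>

lemma wave_graph_dissipative:
  assumes "(x, z) \<in> wave_graph" shows "full_form z x \<le> full_form x x"
proof -
  obtain U W Z Y where xz: "x = (U, W)" "z = (Z, Y)" by (cases x, cases z)
  have *: "U \<in> VV" "Z \<in> VV" "W = \<iota> Z" "a U Z = - (Y \<bullet> \<iota> Z)"
    using assms unfolding xz wave_graph_iff by auto
  have "full_form z x = \<iota> Z \<bullet> \<iota> U"
    using * a(2)[of Z U] by (simp add: full_form_def xz)
  also have "\<dots> \<le> norm (\<iota> Z) * norm (\<iota> U)" by (rule norm_cauchy_schwarz)
  also have "\<dots> \<le> (norm (\<iota> Z))\<^sup>2 + (norm (\<iota> U))\<^sup>2"
    using sum_squares_bound[of "norm (\<iota> Z)" "norm (\<iota> U)"] zero_le_power2[of "norm (\<iota> Z)"]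
      zero_le_power2[of "norm (\<iota> U)"] mult_nonneg_nonneg[OF norm_ge_zero[of "\<iota> Z"] norm_ge_zero[of "\<iota> U"]] by linarith
  also have "\<dots> \<le> full_form x x" using * a(3)[of U] by (simp add: full_form_def xz dot_square_norm)
  finally show ?thesis .
qed

text \<open>Elimination of \<open>Z\<close> and \<open>Y\<close> leaves the elliptic problem \<open>U + l\<^sup>2 L U = f + l g\<close>, which is solved by the Riesz
  theorem for a coercive form.\<close>

lemma wave_graph_range:
  assumes l: "l > 0" and y: "y \<in> VV \<times> HH"
  shows "\<exists>x z. (x, z) \<in> wave_graph \<and> x - l *\<^sub>R z = y"
proof -
  interpret i: bounded_linear \<iota> by (rule \<iota>)
  obtain f g where fg: "y = (f, g)" "f \<in> VV" "g \<in> HH" using y by auto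
  define b where "b U \<phi> = \<iota> U \<bullet> \<iota> \<phi> + l\<^sup>2 * a U \<phi>" for U \<phi>
  interpret b: coercive_form VV b "min 1 (l\<^sup>2) * c"
  proof (rule coercive_form.intro)
    show "subspace VV" "closed VV" using V by auto
    have "bounded_bilinear (\<lambda>U \<phi>. \<iota> U \<bullet> \<iota> \<phi> + a (l\<^sup>2 *\<^sub>R U) \<phi>)"
      by (intro bounded_bilinear_plus bounded_bilinear.comp[OF bounded_bilinear_inner]
          bounded_bilinear.comp[OF a(1)] \<iota>(1) bounded_linear_scaleR_right bounded_linear_ident)
    then show "bounded_bilinear b"
      unfolding b_def bounded_bilinear.scaleR_left[OF a(1)] by simp
    show "b x y = b y x" for x y using a(2)[of x y] by (simp add: b_def inner_commute)
    show "0 < min 1 (l\<^sup>2) * c" using l c by simp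
    fix U assume U: "U \<in> VV"
    have "min 1 (l\<^sup>2) * c * (norm U)\<^sup>2 \<le> min 1 (l\<^sup>2) * (a U U + (norm (\<iota> U))\<^sup>2)"
      unfolding mult.assoc using c(2)[OF U] by (intro mult_left_mono) auto
    also have "\<dots> = min 1 (l\<^sup>2) * a U U + min 1 (l\<^sup>2) * (norm (\<iota> U))\<^sup>2" by (simp add: distrib_left)
    also have "\<dots> \<le> l\<^sup>2 * a U U + 1 * (norm (\<iota> U))\<^sup>2"
      using a(3)[OF U] by (intro add_mono mult_right_mono) auto
    finally show "min 1 (l\<^sup>2) * c * (norm U)\<^sup>2 \<le> b U U" by (simp add: b_def dot_square_norm)
  qed
  have "bounded_linear (\<lambda>\<phi>. \<iota> f \<bullet> \<iota> \<phi> + l * (g \<bullet> \<iota> \<phi>))"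
    by (intro bounded_linear_add bounded_linear_compose[OF bounded_linear_mult_right]
        bounded_linear_compose[OF bounded_linear_inner_right \<iota>(1)])
  then obtain U where U: "U \<in> VV" "\<And>\<phi>. \<phi> \<in> VV \<Longrightarrow> b U \<phi> = \<iota> f \<bullet> \<iota> \<phi> + l * (g \<bullet> \<iota> \<phi>)"
    using b.riesz_exists by blast
  define Z where "Z = (1 / l) *\<^sub>R (U - f)"
  define Y where "Y = (1 / l) *\<^sub>R (\<iota> Z - g)"
  have Z: "Z \<in> VV" unfolding Z_def using U fg V by (simp add: subspace_diff subspace_scale)
  have Y: "Y \<in> HH" unfolding Y_def using \<iota>(2)[OF Z] fg HH by (simp add: subspace_diff subspace_scale)
  have "a U \<phi> = - (Y \<bullet> \<iota> \<phi>)" if "\<phi> \<in> VV" for \<phi>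
  proof -
    have "\<iota> U \<bullet> \<iota> \<phi> + l\<^sup>2 * a U \<phi> = \<iota> f \<bullet> \<iota> \<phi> + l * (g \<bullet> \<iota> \<phi>)" using U(2)[OF that] by (simp add: b_def)
    moreover have "l\<^sup>2 * (Y \<bullet> \<iota> \<phi>) = \<iota> U \<bullet> \<iota> \<phi> - \<iota> f \<bullet> \<iota> \<phi> - l * (g \<bullet> \<iota> \<phi>)"
    proof -
      have "l *\<^sub>R Y = \<iota> Z - g" "l *\<^sub>R \<iota> Z = \<iota> U - \<iota> f"
        using l by (simp_all add: Y_def Z_def i.scaleR i.diff)
      then have "l * (Y \<bullet> \<iota> \<phi>) = \<iota> Z \<bullet> \<iota> \<phi> - g \<bullet> \<iota> \<phi>" "l * (\<iota> Z \<bullet> \<iota> \<phi>) = \<iota> U \<bullet> \<iota> \<phi> - \<iota> f \<bullet> \<iota> \<phi>"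
        by (metis inner_diff_left inner_scaleR_left)+
      then show ?thesis by (simp add: power2_eq_square mult.assoc right_diff_distrib)
    qed
    ultimately have "l\<^sup>2 * (a U \<phi> + Y \<bullet> \<iota> \<phi>) = 0" by (simp add: distrib_left)
    then show ?thesis using l by simp
  qed
  then have "((U, \<iota> Z), (Z, Y)) \<in> wave_graph" using U Z Y by (simp add: wave_graph_iff)
  moreover have "(U, \<iota> Z) - l *\<^sub>R (Z, Y) = y" using l by (simp add: fg Z_def Y_def)
  ultimately show ?thesis by blast
qed

text \<open>The state space is a closed subspace of a Hilbert space, whereas \<open>inhomogeneous_problem\<close> is about a whole space. So
  the operator is extended by zero to the orthogonal complement \<open>x - S.proj x\<close>. The right hand side stays in the state space;
  hence the complementary part of the solution is constant, and it is zero initially.\<close>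

theorem wave_problem:
  assumes init: "(x0, z0) \<in> wave_graph"
    and F: "\<And>t. t \<in> {0..<T} \<Longrightarrow> (F has_vector_derivative F' t) (at t within {0..<T})"
    and F': "continuous_on {0..<T} F'" and FH: "\<And>t. t \<in> {0..<T} \<Longrightarrow> F t \<in> HH"
  obtains w y where "w 0 = x0" "continuous_on {0..<T} y"
    "\<And>t. t \<in> {0..<T} \<Longrightarrow> (w has_vector_derivative y t) (at t within {0..<T})"
    "\<And>t. t \<in> {0..<T} \<Longrightarrow> (w t, y t - (0, F t)) \<in> wave_graph"
proof -
  define S where "S = VV \<times> HH"
  interpret S: coercive_form S full_form "min c 1" unfolding S_def by (rule coercive_full_form)
  interpret P: bounded_linear S.proj by (rule S.bounded_linear_proj)
  define B where "B x y = full_form (S.proj x) (S.proj y) + (x - S.proj x) \<bullet> (y - S.proj y)" for x y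
  define G where "G = {(x, z). (S.proj x, z) \<in> wave_graph}"
  have graph_S: "x \<in> S" "z \<in> S" if "(x, z) \<in> wave_graph" for x z
    using that \<iota>(2) unfolding wave_graph_def S_def by auto
  interpret G: dissipative_graph B "min c 1 / 2" G 1
  proof (intro dissipative_graph.intro coercive_form.intro dissipative_graph_axioms.intro)
    show "subspace (UNIV :: ('v \<times> 'h) set)" "closed (UNIV :: ('v \<times> 'h) set)" by auto
    show "bounded_bilinear B" unfolding B_def
      by (intro bounded_bilinear_plus bounded_bilinear.comp[OF S.bil] bounded_bilinear.comp[OF bounded_bilinear_inner]
          P.bounded_linear_axioms bounded_linear_sub bounded_linear_ident)
    show "B x y = B y x" for x y
      using S.symm[of "S.proj x" "S.proj y"] by (simp add: B_def inner_commute)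
    show m: "0 < min c 1 / 2" using c by simp
    show "min c 1 / 2 * (norm x)\<^sup>2 \<le> B x x" for x
    proof -
      have "norm x \<le> norm (S.proj x) + norm (x - S.proj x)"
        by (metis add.commute diff_add_cancel norm_triangle_ineq)
      then have "(norm x)\<^sup>2 \<le> (norm (S.proj x) + norm (x - S.proj x))\<^sup>2" by (intro power_mono) auto
      also have "\<dots> \<le> 2 * (norm (S.proj x))\<^sup>2 + 2 * (norm (x - S.proj x))\<^sup>2"
        using sum_squares_bound[of "norm (S.proj x)" "norm (x - S.proj x)"] by (simp add: power2_sum)
      finally have "min c 1 / 2 * (norm x)\<^sup>2 \<le> min c 1 / 2 * (2 * (norm (S.proj x))\<^sup>2 + 2 * (norm (x - S.proj x))\<^sup>2)"
        using m by (intro mult_left_mono) auto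
      also have "\<dots> = min c 1 * (norm (S.proj x))\<^sup>2 + min c 1 * (norm (x - S.proj x))\<^sup>2" by (simp add: algebra_simps)
      also have "\<dots> \<le> full_form (S.proj x) (S.proj x) + 1 * (norm (x - S.proj x))\<^sup>2"
        by (intro add_mono mult_right_mono S.coer S.proj) auto
      finally show ?thesis by (simp add: B_def dot_square_norm)
    qed
    show "subspace G"
    proof (rule subspaceI)
      show "0 \<in> G" using subspace_0[OF subspace_wave_graph] P.zero by (simp add: G_def zero_prod_def)
      show "x + y \<in> G" if "x \<in> G" "y \<in> G" for x y
        using that subspace_add[OF subspace_wave_graph, of "(S.proj (fst x), snd x)" "(S.proj (fst y), snd y)"]
        by (simp add: G_def P.add split_beta)
      show "r *\<^sub>R x \<in> G" if "x \<in> G" for r x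
        using that subspace_scale[OF subspace_wave_graph, of "(S.proj (fst x), snd x)" r]
        by (simp add: G_def P.scaleR split_beta)
    qed
    show "0 \<le> (1::real)" by simp
    fix x z assume xz: "(x, z) \<in> G"
    then have g: "(S.proj x, z) \<in> wave_graph" by (simp add: G_def)
    have "B z x = full_form z (S.proj x)" using S.proj_id[OF graph_S(2)[OF g]] by (simp add: B_def)
    also have "\<dots> \<le> full_form (S.proj x) (S.proj x)" by (rule wave_graph_dissipative[OF g])
    also have "\<dots> \<le> 1 * B x x" by (simp add: B_def)
    finally show "B z x \<le> 1 * B x x" .
  next
    fix l :: real and y assume l: "l > 0"
    obtain x z where xz: "(x, z) \<in> wave_graph" "x - l *\<^sub>R z = S.proj y"
      using wave_graph_range[OF l, of "S.proj y"] S.proj(1)[of y] unfolding S_def by blast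
    have "S.proj (x + (y - S.proj y)) = x"
      using S.proj_id[OF graph_S(1)[OF xz(1)]] S.proj_id[OF S.proj(1)[of y]] by (simp add: P.add P.diff)
    then have "(x + (y - S.proj y), z) \<in> G" using xz by (simp add: G_def)
    moreover have "x + (y - S.proj y) - l *\<^sub>R z = y" using xz(2) by (simp add: algebra_simps)
    ultimately show "\<exists>x z. (x, z) \<in> G \<and> x - l *\<^sub>R z = y" by blast
  next
    fix z assume "(0, z) \<in> G"
    then show "z = 0" by (intro wave_graph_single) (simp add: G_def P.zero)
  qed
  have x0: "S.proj x0 = x0" using S.proj_id graph_S(1)[OF init] by blast
  have init': "(x0, z0) \<in> G" using init by (simp add: G_def x0)
  have der: "((\<lambda>t. (0::'v, F t)) has_vector_derivative (0, F' t)) (at t within {0..<T})" if "t \<in> {0..<T}" for t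
    by (intro has_vector_derivative_Pair has_vector_derivative_const F that)
  have cont: "continuous_on {0..<T} (\<lambda>t. (0::'v, F' t))" by (intro continuous_intros F')
  obtain w y where wy: "w 0 = x0" "continuous_on {0..<T} y"
    "\<And>t. t \<in> {0..<T} \<Longrightarrow> (w has_vector_derivative y t) (at t within {0..<T})"
    "\<And>t. t \<in> {0..<T} \<Longrightarrow> (w t, y t - (0, F t)) \<in> G"
    using G.inhomogeneous_problem[OF init' der cont] by blast
  have g: "(S.proj (w t), y t - (0, F t)) \<in> wave_graph" if "t \<in> {0..<T}" for t
    using wy(4)[OF that] by (simp add: G_def)
  have yS: "y t \<in> S" if "t \<in> {0..<T}" for t
  proof -
    have "(0, F t) \<in> S" using FH[OF that] V by (simp add: S_def subspace_0)
    then have "(y t - (0, F t)) + (0, F t) \<in> S" using graph_S(2)[OF g[OF that]] S.sub by (intro subspace_add)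
    then show ?thesis by simp
  qed
  have "((\<lambda>t. w t - S.proj (w t)) has_vector_derivative 0) (at t within {0..<T})" if "t \<in> {0..<T}" for t
    using has_vector_derivative_diff[OF wy(3)[OF that] P.has_vector_derivative[OF wy(3)[OF that]]]
      S.proj_id[OF yS[OF that]] by simp
  then obtain k where k: "\<And>t. t \<in> {0..<T} \<Longrightarrow> w t - S.proj (w t) = k"
    by (rule has_vector_derivative_zero_constant[OF convex_real_interval(7)]) blast+
  have "w t = S.proj (w t)" if t: "t \<in> {0..<T}" for t
  proof -
    have "0 \<in> {0..<T}" using t by auto
    then have "k = 0" using k[of 0] wy(1) x0 by simp
    then show ?thesis using k[OF t] by simp
  qed
  then show ?thesis using that[of w y] wy g by metis
qed

end

section \<open>The Hilbert space of square integrable functions\<close>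

lemma L2_measurable: "f \<in> L2 \<Omega> \<Longrightarrow> f \<in> borel_measurable (lebesgue_on \<Omega>)"
  and L2_integrable: "f \<in> L2 \<Omega> \<Longrightarrow> integrable (lebesgue_on \<Omega>) (\<lambda>x. (norm (f x))\<^sup>2)"
  by (auto simp: L2_def)

lemma L2_zero [simp]: "(\<lambda>x. 0) \<in> L2 \<Omega>"
  by (simp add: L2_def)

lemma L2_bounded_by:
  assumes "g \<in> borel_measurable (lebesgue_on \<Omega>)" "integrable (lebesgue_on \<Omega>) h"
    and "\<And>x. x \<in> \<Omega> \<Longrightarrow> (norm (g x))\<^sup>2 \<le> h x"
  shows "g \<in> L2 \<Omega>"
proof -
  have "integrable (lebesgue_on \<Omega>) (\<lambda>x. (norm (g x))\<^sup>2)"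
    by (rule Bochner_Integration.integrable_bound[OF assms(2)])
      (use assms in \<open>auto simp: space_restrict_space intro!: AE_I2 order_trans[OF assms(3) abs_ge_self]\<close>)
  then show ?thesis using assms by (simp add: L2_def)
qed

lemma norm_add_sq_le: "(norm (x + y))\<^sup>2 \<le> 2 * (norm x)\<^sup>2 + 2 * (norm y)\<^sup>2" for x y :: "'a::real_normed_vector"
proof -
  have "(norm (x + y))\<^sup>2 \<le> (norm x + norm y)\<^sup>2" by (intro power_mono norm_triangle_ineq) auto
  also have "\<dots> \<le> 2 * (norm x)\<^sup>2 + 2 * (norm y)\<^sup>2"
    using sum_squares_bound[of "norm x" "norm y"] by (simp add: power2_sum)
  finally show ?thesis .
qed

lemma L2_add: assumes "f \<in> L2 \<Omega>" "g \<in> L2 \<Omega>" shows "(\<lambda>x. f x + g x) \<in> L2 \<Omega>"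
proof (rule L2_bounded_by[where h="\<lambda>x. 2 * (norm (f x))\<^sup>2 + 2 * (norm (g x))\<^sup>2"])
  show "(\<lambda>x. f x + g x) \<in> borel_measurable (lebesgue_on \<Omega>)"
    using assms[THEN L2_measurable] by measurable
  show "integrable (lebesgue_on \<Omega>) (\<lambda>x. 2 * (norm (f x))\<^sup>2 + 2 * (norm (g x))\<^sup>2)"
    using assms[THEN L2_integrable] by auto
qed (rule norm_add_sq_le)

lemma L2_scaleR: assumes "f \<in> L2 \<Omega>" shows "(\<lambda>x. r *\<^sub>R f x) \<in> L2 \<Omega>"
proof (rule L2_bounded_by[where h="\<lambda>x. r\<^sup>2 * (norm (f x))\<^sup>2"])
  show "(\<lambda>x. r *\<^sub>R f x) \<in> borel_measurable (lebesgue_on \<Omega>)"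
    using assms[THEN L2_measurable] by measurable
qed (use assms[THEN L2_integrable] in \<open>auto simp: power_mult_distrib\<close>)

lemma L2_minus: "f \<in> L2 \<Omega> \<Longrightarrow> (\<lambda>x. - f x) \<in> L2 \<Omega>"
  using L2_scaleR[of f \<Omega> "-1"] by simp

lemma L2_diff: "f \<in> L2 \<Omega> \<Longrightarrow> g \<in> L2 \<Omega> \<Longrightarrow> (\<lambda>x. f x - g x) \<in> L2 \<Omega>"
  using L2_add[OF _ L2_minus, of f \<Omega> g] by simp

lemma L2_inner_integrable:
  assumes "f \<in> L2 \<Omega>" "g \<in> L2 \<Omega>"
  shows "integrable (lebesgue_on \<Omega>) (\<lambda>x. f x \<bullet> g x)"
proof (rule Bochner_Integration.integrable_bound)
  show "integrable (lebesgue_on \<Omega>) (\<lambda>x. (norm (f x))\<^sup>2 + (norm (g x))\<^sup>2)"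
    using assms[THEN L2_integrable] by auto
  show "(\<lambda>x. f x \<bullet> g x) \<in> borel_measurable (lebesgue_on \<Omega>)"
    using assms[THEN L2_measurable] by measurable
  have "\<bar>f x \<bullet> g x\<bar> \<le> (norm (f x))\<^sup>2 + (norm (g x))\<^sup>2" for x
  proof -
    have "\<bar>f x \<bullet> g x\<bar> \<le> norm (f x) * norm (g x)" by (rule Cauchy_Schwarz_ineq2)
    also have "\<dots> \<le> (norm (f x))\<^sup>2 + (norm (g x))\<^sup>2"
      using sum_squares_bound[of "norm (f x)" "norm (g x)"] mult_nonneg_nonneg[OF norm_ge_zero[of "f x"] norm_ge_zero[of "g x"]]
      by linarith
    finally show ?thesis .
  qed
  then show "AE x in lebesgue_on \<Omega>. norm (f x \<bullet> g x) \<le> norm ((norm (f x))\<^sup>2 + (norm (g x))\<^sup>2)"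
    by (intro AE_I2) simp
qed

text \<open>A partial equivalence relation, whose domain is the set of square integrable functions. The quotient is then a type that can be
  an instance of the classes of Hilbert spaces.\<close>

definition eq_L2 :: "('a::euclidean_space \<Rightarrow> 'b::euclidean_space) \<Rightarrow> ('a \<Rightarrow> 'b) \<Rightarrow> bool" where
  "eq_L2 f g \<longleftrightarrow> f \<in> L2 UNIV \<and> g \<in> L2 UNIV \<and> (AE x in lebesgue. f x = g x)"

quotient_type (overloaded) ('a, 'b) l2 = "'a::euclidean_space \<Rightarrow> 'b::euclidean_space" / partial: eq_L2
proof (rule part_equivpI)
  show "\<exists>x. eq_L2 x x" by (intro exI[of _ "\<lambda>x. 0"]) (simp add: eq_L2_def)
  show "symp eq_L2" by (rule sympI) (auto simp: eq_L2_def)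
  show "transp eq_L2" by (rule transpI) (auto simp: eq_L2_def)
qed

instantiation l2 :: (euclidean_space, euclidean_space) real_vector
begin

lift_definition zero_l2 :: "('a, 'b) l2" is "\<lambda>x. 0" by (simp add: eq_L2_def)
lift_definition plus_l2 :: "('a, 'b) l2 \<Rightarrow> ('a, 'b) l2 \<Rightarrow> ('a, 'b) l2" is "\<lambda>f g x. f x + g x"
  by (auto simp: eq_L2_def intro: L2_add)
lift_definition minus_l2 :: "('a, 'b) l2 \<Rightarrow> ('a, 'b) l2 \<Rightarrow> ('a, 'b) l2" is "\<lambda>f g x. f x - g x"
  by (auto simp: eq_L2_def intro: L2_diff)
lift_definition uminus_l2 :: "('a, 'b) l2 \<Rightarrow> ('a, 'b) l2" is "\<lambda>f x. - f x"
  by (auto simp: eq_L2_def intro: L2_minus)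
lift_definition scaleR_l2 :: "real \<Rightarrow> ('a, 'b) l2 \<Rightarrow> ('a, 'b) l2" is "\<lambda>r f x. r *\<^sub>R f x"
  by (auto simp: eq_L2_def intro: L2_scaleR)

instance
proof
  fix a b c :: "('a, 'b) l2" and r s :: real
  show "a + b + c = a + (b + c)" by transfer (auto simp: eq_L2_def add.assoc intro!: L2_add)
  show "a + b = b + a" by transfer (auto simp: eq_L2_def add.commute intro!: L2_add)
  show "0 + a = a" by transfer (auto simp: eq_L2_def)
  show "- a + a = 0" by transfer (auto simp: eq_L2_def)
  show "a - b = a + - b" by transfer (auto simp: eq_L2_def intro!: L2_diff)
  show "r *\<^sub>R (a + b) = r *\<^sub>R a + r *\<^sub>R b"
    by transfer (auto simp: eq_L2_def scaleR_add_right intro!: L2_add L2_scaleR)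
  show "(r + s) *\<^sub>R a = r *\<^sub>R a + s *\<^sub>R a"
    by transfer (auto simp: eq_L2_def scaleR_add_left intro!: L2_add L2_scaleR)
  show "r *\<^sub>R s *\<^sub>R a = (r * s) *\<^sub>R a" by transfer (auto simp: eq_L2_def intro!: L2_scaleR)
  show "1 *\<^sub>R a = a" by transfer (auto simp: eq_L2_def)
qed

end

instantiation l2 :: (euclidean_space, euclidean_space) real_inner
begin

lift_definition inner_l2 :: "('a, 'b) l2 \<Rightarrow> ('a, 'b) l2 \<Rightarrow> real" is "\<lambda>f g. LINT x|lebesgue. f x \<bullet> g x"
proof -
  fix f1 f2 g1 g2 :: "'a \<Rightarrow> 'b"
  assume a: "eq_L2 f1 f2" "eq_L2 g1 g2"
  then have "f1 \<in> borel_measurable lebesgue" "f2 \<in> borel_measurable lebesgue"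
    "g1 \<in> borel_measurable lebesgue" "g2 \<in> borel_measurable lebesgue"
    by (auto simp: eq_L2_def L2_def lebesgue_on_UNIV_eq)
  then show "(LINT x|lebesgue. f1 x \<bullet> g1 x) = (LINT x|lebesgue. f2 x \<bullet> g2 x)"
    using a by (intro integral_cong_AE) (auto simp: eq_L2_def)
qed

definition norm_l2 :: "('a, 'b) l2 \<Rightarrow> real" where "norm_l2 x = sqrt (inner x x)"
definition dist_l2 :: "('a, 'b) l2 \<Rightarrow> ('a, 'b) l2 \<Rightarrow> real" where "dist_l2 x y = norm (x - y)"
definition sgn_l2 :: "('a, 'b) l2 \<Rightarrow> ('a, 'b) l2" where "sgn_l2 x = x /\<^sub>R norm x"
definition uniformity_l2 :: "(('a, 'b) l2 \<times> ('a, 'b) l2) filter" where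
  "uniformity_l2 = (INF e\<in>{0 <..}. principal {(x, y). dist x y < e})"
definition open_l2 :: "('a, 'b) l2 set \<Rightarrow> bool" where
  "open_l2 S \<longleftrightarrow> (\<forall>x\<in>S. \<forall>\<^sub>F (x', y) in uniformity. x' = x \<longrightarrow> y \<in> S)"

instance
proof
  fix x y z :: "('a, 'b) l2" and r :: real and S :: "('a, 'b) l2 set"
  show "dist x y = norm (x - y)" by (rule dist_l2_def)
  show "sgn x = x /\<^sub>R norm x" by (rule sgn_l2_def)
  show "uniformity = (INF e\<in>{0 <..}. principal {(x, y :: ('a, 'b) l2). dist x y < e})" by (rule uniformity_l2_def)
  show "open S \<longleftrightarrow> (\<forall>x\<in>S. \<forall>\<^sub>F (x', y) in uniformity. x' = x \<longrightarrow> y \<in> S)" by (rule open_l2_def)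
  show "norm x = sqrt (x \<bullet> x)" by (rule norm_l2_def)
  show "x \<bullet> y = y \<bullet> x" by transfer (simp add: inner_commute)
  show "(x + y) \<bullet> z = x \<bullet> z + y \<bullet> z"
  proof transfer
    fix f g h :: "'a \<Rightarrow> 'b" assume "eq_L2 f f" "eq_L2 g g" "eq_L2 h h"
    then have "integrable lebesgue (\<lambda>x. f x \<bullet> h x)" "integrable lebesgue (\<lambda>x. g x \<bullet> h x)"
      using L2_inner_integrable[of f UNIV h] L2_inner_integrable[of g UNIV h] by (auto simp: eq_L2_def lebesgue_on_UNIV_eq)
    then show "(LINT x|lebesgue. (f x + g x) \<bullet> h x) = (LINT x|lebesgue. f x \<bullet> h x) + (LINT x|lebesgue. g x \<bullet> h x)"
      by (simp add: inner_add_left)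
  qed
  show "r *\<^sub>R x \<bullet> y = r * (x \<bullet> y)" by transfer simp
  show "0 \<le> x \<bullet> x" by transfer simp
  show "x \<bullet> x = 0 \<longleftrightarrow> x = 0"
  proof transfer
    fix f :: "'a \<Rightarrow> 'b" assume f: "eq_L2 f f"
    then have i: "integrable lebesgue (\<lambda>x. f x \<bullet> f x)"
      using L2_inner_integrable[of f UNIV f] by (auto simp: eq_L2_def lebesgue_on_UNIV_eq)
    have "(LINT x|lebesgue. f x \<bullet> f x) = 0 \<longleftrightarrow> (AE x in lebesgue. f x \<bullet> f x = 0)"
      by (rule integral_nonneg_eq_0_iff_AE[OF i]) auto
    then show "(LINT x|lebesgue. f x \<bullet> f x) = 0 \<longleftrightarrow> eq_L2 f (\<lambda>x. 0)" using f by (simp add: eq_L2_def)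
  qed
qed

end

abbreviation rep :: "('a::euclidean_space, 'b::euclidean_space) l2 \<Rightarrow> 'a \<Rightarrow> 'b" where "rep \<equiv> rep_l2"

lemma eq_L2_rep: "eq_L2 (rep F) (rep F)"
  by (rule Quotient_rep_reflp[OF Quotient_l2])

lemma rep_L2: "rep F \<in> L2 UNIV"
  using eq_L2_rep[of F] by (simp add: eq_L2_def)

lemma rep_measurable [measurable]: "rep F \<in> borel_measurable lebesgue"
  using L2_measurable[OF rep_L2] by (simp add: lebesgue_on_UNIV_eq)

lemma rep_abs: "f \<in> L2 UNIV \<Longrightarrow> AE x in lebesgue. rep (abs_l2 f) x = f x"
  using Quotient_rep_abs[OF Quotient_l2, of f] by (simp add: eq_L2_def)

lemma abs_rep: "abs_l2 (rep F) = F"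
  by (rule Quotient_abs_rep[OF Quotient_l2])

lemma abs_eqI: "f \<in> L2 UNIV \<Longrightarrow> g \<in> L2 UNIV \<Longrightarrow> AE x in lebesgue. f x = g x \<Longrightarrow> abs_l2 f = abs_l2 g"
  by (rule Quotient_rel_abs[OF Quotient_l2]) (simp add: eq_L2_def)

lemma abs_eqD: "f \<in> L2 UNIV \<Longrightarrow> g \<in> L2 UNIV \<Longrightarrow> abs_l2 f = abs_l2 g \<Longrightarrow> AE x in lebesgue. f x = g x"
  using Quotient_rel[OF Quotient_l2, of f g] by (simp add: eq_L2_def)

lemma abs_add: "f \<in> L2 UNIV \<Longrightarrow> g \<in> L2 UNIV \<Longrightarrow> abs_l2 f + abs_l2 g = abs_l2 (\<lambda>x. f x + g x)"
  by (rule plus_l2.abs_eq) (auto simp: eq_L2_def)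

lemma abs_diff: "f \<in> L2 UNIV \<Longrightarrow> g \<in> L2 UNIV \<Longrightarrow> abs_l2 f - abs_l2 g = abs_l2 (\<lambda>x. f x - g x)"
  by (rule minus_l2.abs_eq) (auto simp: eq_L2_def)

lemma abs_scaleR: "f \<in> L2 UNIV \<Longrightarrow> r *\<^sub>R abs_l2 f = abs_l2 (\<lambda>x. r *\<^sub>R f x)"
  by (rule scaleR_l2.abs_eq) (auto simp: eq_L2_def)

lemma abs_inner: "f \<in> L2 UNIV \<Longrightarrow> g \<in> L2 UNIV \<Longrightarrow> abs_l2 f \<bullet> abs_l2 g = (LINT x|lebesgue. f x \<bullet> g x)"
  by (rule inner_l2.abs_eq) (auto simp: eq_L2_def)

lemma abs_norm: "f \<in> L2 UNIV \<Longrightarrow> (norm (abs_l2 f))\<^sup>2 = (LINT x|lebesgue. (norm (f x))\<^sup>2)"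
  unfolding dot_square_norm[symmetric] by (rule abs_inner)

lemma nn_integral_norm_abs:
  assumes "f \<in> L2 UNIV"
  shows "(\<integral>\<^sup>+x. ennreal ((norm (f x))\<^sup>2) \<partial>lebesgue) = ennreal ((norm (abs_l2 f))\<^sup>2)"
  unfolding abs_norm[OF assms]
  by (rule nn_integral_eq_integral) (use L2_integrable[OF assms] in \<open>auto simp: lebesgue_on_UNIV_eq\<close>)

text \<open>The theorem of Riesz and Fischer. A subsequence with rapidly decreasing distances converges almost everywhere,
  and Fatou's lemma estimates the distance to its limit.\<close>

instance l2 :: (euclidean_space, euclidean_space) complete_space
proof
  fix X :: "nat \<Rightarrow> ('a, 'b) l2" assume X: "Cauchy X"
  have "\<exists>N. \<forall>m\<ge>N. \<forall>k\<ge>N. norm (X m - X k) < (1/2)^n" for n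
    using metric_CauchyD[OF X, of "(1/2)^n"] by (auto simp: dist_norm)
  then obtain N where N: "\<And>n m k. m \<ge> N n \<Longrightarrow> k \<ge> N n \<Longrightarrow> norm (X m - X k) < (1/2)^n" by metis
  define r where "r n = (\<Sum>i\<le>n. N i)" for n
  have rN: "r m \<ge> N n" if "m \<ge> n" for m n
    unfolding r_def by (rule member_le_sum) (use that in auto)
  define f where "f n = rep (X (r n))" for n
  have fL: "f n \<in> L2 UNIV" for n by (simp add: f_def rep_L2)
  have fm [measurable]: "f n \<in> borel_measurable lebesgue" for n by (simp add: f_def)
  have absf: "abs_l2 (f n) = X (r n)" for n by (simp add: f_def abs_rep)
  have fint: "(\<integral>\<^sup>+x. ennreal ((norm (f m x - f k x))\<^sup>2) \<partial>lebesgue) \<le> ennreal (((1/2)^n)\<^sup>2)"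
    if "m \<ge> n" "k \<ge> n" for m k n
  proof -
    have "(\<integral>\<^sup>+x. ennreal ((norm (f m x - f k x))\<^sup>2) \<partial>lebesgue) = ennreal ((norm (X (r m) - X (r k)))\<^sup>2)"
      using nn_integral_norm_abs[OF L2_diff[OF fL fL], of m k] by (simp add: abs_diff[OF fL fL, symmetric] absf)
    also have "\<dots> \<le> ennreal (((1/2)^n)\<^sup>2)"
      using N[OF rN rN, OF that] by (intro ennreal_leI power_mono) auto
    finally show ?thesis .
  qed
  \<comment> \<open>The squared distances decay like \<open>4^-n\<close>, so that even with the weight \<open>2^n\<close> they have a finite sum almost everywhere.\<close>
  define d where "d n x = 2^n * (norm (f (Suc n) x - f n x))\<^sup>2" for n x
  have dm [measurable]: "d n \<in> borel_measurable lebesgue" for n unfolding d_def by measurable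
  have "(\<integral>\<^sup>+x. (\<Sum>n. ennreal (d n x)) \<partial>lebesgue) = (\<Sum>n. \<integral>\<^sup>+x. ennreal (d n x) \<partial>lebesgue)"
    by (rule nn_integral_suminf) measurable
  also have "\<dots> \<le> (\<Sum>n. ennreal ((1/2)^n))"
  proof (rule suminf_le)
    fix n
    have "(\<integral>\<^sup>+x. ennreal (d n x) \<partial>lebesgue) = (\<integral>\<^sup>+x. ennreal (2^n) * ennreal ((norm (f (Suc n) x - f n x))\<^sup>2) \<partial>lebesgue)"
      by (simp add: d_def ennreal_mult)
    also have "\<dots> = ennreal (2^n) * (\<integral>\<^sup>+x. ennreal ((norm (f (Suc n) x - f n x))\<^sup>2) \<partial>lebesgue)"
      by (rule nn_integral_cmult) measurable
    also have "\<dots> \<le> ennreal (2^n) * ennreal (((1/2)^n)\<^sup>2)" by (intro mult_left_mono fint) auto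
    also have "\<dots> = ennreal ((1/2)^n)"
      by (simp add: ennreal_mult[symmetric] power2_eq_square power_divide)
    finally show "(\<integral>\<^sup>+x. ennreal (d n x) \<partial>lebesgue) \<le> ennreal ((1/2)^n)" .
  qed auto
  also have "\<dots> = ennreal (\<Sum>n. (1/2)^n)" by (rule suminf_ennreal2) (auto intro: summable_geometric)
  finally have "(\<integral>\<^sup>+x. (\<Sum>n. ennreal (d n x)) \<partial>lebesgue) \<noteq> \<infinity>" by (auto simp: top_unique)
  then have "AE x in lebesgue. (\<Sum>n. ennreal (d n x)) \<noteq> \<infinity>"
    by (intro nn_integral_PInf_AE) measurable
  then have conv: "AE x in lebesgue. convergent (\<lambda>n. f n x)"
  proof eventually_elim
    case (elim x)
    have "summable (\<lambda>n. d n x)"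
      by (rule summable_suminf_not_top) (use elim in \<open>auto simp: d_def\<close>)
    then have "(\<lambda>n. d n x) \<longlonglongrightarrow> 0" by (rule summable_LIMSEQ_zero)
    then have "Bseq (\<lambda>n. d n x)" by (rule convergent_imp_Bseq[OF convergentI])
    then obtain C where C: "\<And>n. \<bar>d n x\<bar> \<le> C" by (auto simp: Bseq_def)
    have C0: "C \<ge> 0" using C[of 0] by linarith
    have "norm (f (Suc n) x - f n x) \<le> sqrt C * (1 / sqrt 2) ^ n" for n
    proof -
      have "(norm (f (Suc n) x - f n x))\<^sup>2 \<le> C / 2^n" using C[of n] by (simp add: d_def field_simps abs_mult)
      then have "norm (f (Suc n) x - f n x) \<le> sqrt (C / 2^n)" by (rule real_le_rsqrt)
      then show ?thesis by (simp add: real_sqrt_divide real_sqrt_power power_divide)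
    qed
    note le = this
    have "summable (\<lambda>n. sqrt C * (1 / sqrt 2) ^ n)"
      by (intro summable_mult summable_geometric) auto
    then have "summable (\<lambda>n. f (Suc n) x - f n x)" by (rule summable_comparison_test'[where N=0]) (rule le)
    then have "convergent (\<lambda>n. (\<Sum>i<n. f (Suc i) x - f i x) + f 0 x)"
      by (intro convergent_add) (auto simp: summable_iff_convergent convergent_const)
    then show ?case by (simp add: sum_lessThan_telescope[of "\<lambda>i. f i x"])
  qed
  define F where "F x = lim (\<lambda>n. f n x)" for x
  have Fm [measurable]: "F \<in> borel_measurable lebesgue" unfolding F_def by measurable
  have Fk: "(\<integral>\<^sup>+x. ennreal ((norm (F x - f k x))\<^sup>2) \<partial>lebesgue) \<le> ennreal (((1/2)^k)\<^sup>2)" for k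
  proof -
    have "(\<integral>\<^sup>+x. ennreal ((norm (F x - f k x))\<^sup>2) \<partial>lebesgue)
        = (\<integral>\<^sup>+x. liminf (\<lambda>m. ennreal ((norm (f m x - f k x))\<^sup>2)) \<partial>lebesgue)"
    proof (rule nn_integral_cong_AE, use conv in eventually_elim)
      case (elim x)
      then have "(\<lambda>m. f m x) \<longlonglongrightarrow> F x" by (simp add: F_def convergent_LIMSEQ_iff)
      then have "(\<lambda>m. ennreal ((norm (f m x - f k x))\<^sup>2)) \<longlonglongrightarrow> ennreal ((norm (F x - f k x))\<^sup>2)"
        by (intro tendsto_intros)
      from lim_imp_Liminf[OF _ this] show ?case by simp
    qed
    also have "\<dots> \<le> liminf (\<lambda>m. \<integral>\<^sup>+x. ennreal ((norm (f m x - f k x))\<^sup>2) \<partial>lebesgue)"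
      by (rule nn_integral_liminf) measurable
    also have "\<dots> \<le> liminf (\<lambda>m. ennreal (((1/2)^k)\<^sup>2))"
      by (rule Liminf_mono) (auto simp: eventually_sequentially intro!: exI[of _ k] fint)
    also have "\<dots> = ennreal (((1/2)^k)\<^sup>2)" by (simp add: Liminf_const)
    finally show ?thesis .
  qed
  have dL: "(\<lambda>x. F x - f k x) \<in> L2 UNIV" for k
  proof -
    have "integrable lebesgue (\<lambda>x. (norm (F x - f k x))\<^sup>2)"
      by (rule integrableI_bounded) (use Fk[of k] in \<open>auto simp: le_less_trans[OF _ ennreal_less_top]\<close>)
    then show ?thesis by (simp add: L2_def lebesgue_on_UNIV_eq)
  qed
  have FL: "F \<in> L2 UNIV" using L2_add[OF dL fL, of 0 0] by simp
  have lim: "norm (abs_l2 F - X (r k)) \<le> (1/2)^k" for k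
  proof -
    have "ennreal ((norm (abs_l2 F - X (r k)))\<^sup>2) \<le> ennreal (((1/2)^k)\<^sup>2)"
      using nn_integral_norm_abs[OF dL, of k] Fk[of k] by (simp add: abs_diff[OF FL fL, symmetric] absf)
    then have "(norm (abs_l2 F - X (r k)))\<^sup>2 \<le> ((1/2)^k)\<^sup>2" by (subst (asm) ennreal_le_iff) auto
    then show ?thesis by (rule power2_le_imp_le) auto
  qed
  have "X \<longlonglongrightarrow> abs_l2 F"
  proof (rule LIMSEQ_I)
    fix e :: real assume "e > 0"
    then obtain k where k: "(1/2)^k < e / 2" using real_arch_pow_inv[of "e/2" "1/2"] by auto
    have "norm (X n - abs_l2 F) < e" if "n \<ge> N k" for n
    proof -
      have "norm (X n - abs_l2 F) \<le> norm (X n - X (r k)) + norm (X (r k) - abs_l2 F)"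
        by (metis norm_diff_triangle_ineq diff_add_cancel add_diff_eq norm_triangle_sub order_refl dist_norm dist_triangle)
      also have "norm (X n - X (r k)) < (1/2)^k" using N[OF that rN] by simp
      also have "norm (X (r k) - abs_l2 F) \<le> (1/2)^k" using lim[of k] by (simp add: norm_minus_commute)
      finally show ?thesis using k by simp
    qed
    then show "\<exists>no. \<forall>n\<ge>no. norm (X n - abs_l2 F) < e" by blast
  qed
  then show "convergent X" by (rule convergentI)
qed

instance l2 :: (euclidean_space, euclidean_space) banach ..

text \<open>Extension by zero lets one type \<open>l2\<close> serve all domains. The classes of fields on \<open>\<Omega>\<close> are those \<open>F\<close>
  with \<open>cls \<Omega> (rep F) = F\<close>.\<close>

definition zext :: "'a set \<Rightarrow> ('a \<Rightarrow> 'b::zero) \<Rightarrow> 'a \<Rightarrow> 'b" where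
  "zext \<Omega> f x = (if x \<in> \<Omega> then f x else 0)"

definition cls :: "'a::euclidean_space set \<Rightarrow> ('a \<Rightarrow> 'b::euclidean_space) \<Rightarrow> ('a, 'b) l2" where
  "cls \<Omega> f = abs_l2 (zext \<Omega> f)"

lemma zext_L2:
  assumes "\<Omega> \<in> sets lebesgue" shows "zext \<Omega> f \<in> L2 UNIV \<longleftrightarrow> f \<in> L2 \<Omega>"
proof -
  have "(\<lambda>x. (norm (zext \<Omega> f x))\<^sup>2) = (\<lambda>x. if x \<in> \<Omega> then (norm (f x))\<^sup>2 else 0)" by (auto simp: zext_def)
  then show ?thesis
    using borel_measurable_if[OF assms, of f] Lebesgue_Measure.integrable_restrict_UNIV[OF assms, of "\<lambda>x. (norm (f x))\<^sup>2"]
    by (simp add: L2_def lebesgue_on_UNIV_eq zext_def[abs_def])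
qed

lemma L2_subset: assumes "\<Omega> \<in> sets lebesgue" "f \<in> L2 UNIV" shows "f \<in> L2 \<Omega>"
proof (rule L2_bounded_by[where h="\<lambda>x. (norm (f x))\<^sup>2"])
  show "f \<in> borel_measurable (lebesgue_on \<Omega>)"
    using L2_measurable[OF assms(2)] by (simp add: lebesgue_on_UNIV_eq measurable_restrict_space1)
  have "integrable lebesgue (\<lambda>x. indicator \<Omega> x *\<^sub>R (norm (f x))\<^sup>2)"
    using L2_integrable[OF assms(2)] assms(1) by (intro integrable_mult_indicator) (auto simp: lebesgue_on_UNIV_eq)
  then show "integrable (lebesgue_on \<Omega>) (\<lambda>x. (norm (f x))\<^sup>2)"
    using assms(1) by (simp add: integrable_restrict_space)
qed simp

context
  fixes \<Omega> :: "'a::euclidean_space set"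
  assumes \<Omega>: "\<Omega> \<in> sets lebesgue"
begin

lemma AE_on_iff: "(AE x in lebesgue_on \<Omega>. P x) \<longleftrightarrow> (AE x in lebesgue. x \<in> \<Omega> \<longrightarrow> P x)"
  using \<Omega> by (simp add: AE_restrict_space_iff)

lemma rep_cls: "f \<in> L2 \<Omega> \<Longrightarrow> AE x in lebesgue. rep (cls \<Omega> f) x = zext \<Omega> f x"
  unfolding cls_def using zext_L2[OF \<Omega>] by (intro rep_abs) auto

lemma rep_cls_on: assumes "f \<in> L2 \<Omega>" shows "AE x in lebesgue_on \<Omega>. rep (cls \<Omega> f) x = f x"
  unfolding AE_on_iff using rep_cls[OF assms] by eventually_elim (simp add: zext_def)

lemma rep_L2_on: "rep F \<in> L2 \<Omega>"
  by (rule L2_subset[OF \<Omega> rep_L2])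

lemma cls_eq_iff: 
  assumes "f \<in> L2 \<Omega>" "g \<in> L2 \<Omega>"
  shows "cls \<Omega> f = cls \<Omega> g \<longleftrightarrow> (AE x in lebesgue_on \<Omega>. f x = g x)"
proof -
  have "cls \<Omega> f = cls \<Omega> g \<longleftrightarrow> (AE x in lebesgue. zext \<Omega> f x = zext \<Omega> g x)"
    unfolding cls_def using zext_L2[OF \<Omega>] assms abs_eqI abs_eqD by blast
  also have "\<dots> \<longleftrightarrow> (AE x in lebesgue. x \<in> \<Omega> \<longrightarrow> f x = g x)"
    by (rule AE_cong) (simp add: zext_def)
  finally show ?thesis by (simp add: AE_on_iff)
qed

lemma cls_add: "f \<in> L2 \<Omega> \<Longrightarrow> g \<in> L2 \<Omega> \<Longrightarrow> cls \<Omega> (\<lambda>x. f x + g x) = cls \<Omega> f + cls \<Omega> g"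
  unfolding cls_def by (subst abs_add) (auto simp: zext_L2[OF \<Omega>] zext_def intro!: arg_cong[of _ _ abs_l2])

lemma cls_diff: "f \<in> L2 \<Omega> \<Longrightarrow> g \<in> L2 \<Omega> \<Longrightarrow> cls \<Omega> (\<lambda>x. f x - g x) = cls \<Omega> f - cls \<Omega> g"
  unfolding cls_def by (subst abs_diff) (auto simp: zext_L2[OF \<Omega>] zext_def intro!: arg_cong[of _ _ abs_l2])

lemma cls_scaleR: "f \<in> L2 \<Omega> \<Longrightarrow> cls \<Omega> (\<lambda>x. r *\<^sub>R f x) = r *\<^sub>R cls \<Omega> f"
  unfolding cls_def by (subst abs_scaleR) (auto simp: zext_L2[OF \<Omega>] zext_def intro!: arg_cong[of _ _ abs_l2])

lemma cls_zero: "cls \<Omega> (\<lambda>x. 0) = 0"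
  unfolding cls_def zero_l2_def by (auto simp: zext_def intro!: arg_cong[of _ _ abs_l2])

lemma cls_inner:
  assumes "f \<in> L2 \<Omega>" "g \<in> L2 \<Omega>"
  shows "cls \<Omega> f \<bullet> cls \<Omega> g = (LINT x|lebesgue_on \<Omega>. f x \<bullet> g x)"
proof -
  have "cls \<Omega> f \<bullet> cls \<Omega> g = (LINT x|lebesgue. zext \<Omega> f x \<bullet> zext \<Omega> g x)"
    unfolding cls_def using assms zext_L2[OF \<Omega>] by (intro abs_inner) auto
  also have "\<dots> = (LINT x|lebesgue. (if x \<in> \<Omega> then f x \<bullet> g x else 0))"
    by (rule Bochner_Integration.integral_cong) (auto simp: zext_def)
  also have "\<dots> = (LINT x|lebesgue_on \<Omega>. f x \<bullet> g x)" by (rule Lebesgue_Measure.integral_restrict_UNIV[OF \<Omega>])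
  finally show ?thesis .
qed

lemma cls_norm: assumes "f \<in> L2 \<Omega>" shows "norm (cls \<Omega> f) = L2_norm \<Omega> f"
  unfolding norm_eq_sqrt_inner[of "cls \<Omega> f"] cls_inner[OF assms assms]
  by (simp add: L2_norm_def dot_square_norm)

lemma cls_rep_cls: "f \<in> L2 \<Omega> \<Longrightarrow> cls \<Omega> (rep (cls \<Omega> f)) = cls \<Omega> f"
  using rep_cls_on rep_L2_on by (subst cls_eq_iff) auto

lemma inner_cls_rep: "f \<in> L2 \<Omega> \<Longrightarrow> cls \<Omega> f \<bullet> F = (LINT x|lebesgue_on \<Omega>. f x \<bullet> rep F x)"
proof -
  assume f: "f \<in> L2 \<Omega>"
  have "cls \<Omega> f \<bullet> F = abs_l2 (zext \<Omega> f) \<bullet> abs_l2 (rep F)" by (simp add: cls_def abs_rep)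
  also have "\<dots> = (LINT x|lebesgue. zext \<Omega> f x \<bullet> rep F x)"
    using f zext_L2[OF \<Omega>] rep_L2 by (intro abs_inner) auto
  also have "\<dots> = (LINT x|lebesgue. (if x \<in> \<Omega> then f x \<bullet> rep F x else 0))"
    by (rule Bochner_Integration.integral_cong) (auto simp: zext_def)
  also have "\<dots> = (LINT x|lebesgue_on \<Omega>. f x \<bullet> rep F x)" by (rule Lebesgue_Measure.integral_restrict_UNIV[OF \<Omega>])
  finally show ?thesis .
qed

end

definition op_field :: "'a::euclidean_space set \<Rightarrow> ('a \<Rightarrow> 'b::euclidean_space \<Rightarrow> 'c::euclidean_space) \<Rightarrow> real \<Rightarrow> bool" where
  "op_field \<Omega> A M \<longleftrightarrow> (\<forall>x\<in>\<Omega>. linear (A x) \<and> (\<forall>y. norm (A x y) \<le> M * norm y)) \<and>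
     (\<forall>y. (\<lambda>x. A x y) \<in> borel_measurable (lebesgue_on \<Omega>))"

definition mul :: "'a::euclidean_space set \<Rightarrow> ('a \<Rightarrow> 'b::euclidean_space \<Rightarrow> 'c::euclidean_space) \<Rightarrow> ('a, 'b) l2 \<Rightarrow> ('a, 'c) l2" where
  "mul \<Omega> A F = cls \<Omega> (\<lambda>x. A x (rep F x))"

text \<open>Measurability of the field of maps is demanded for constant arguments only; expanding the argument in a basis gives the rest.\<close>

lemma op_field_measurable:
  assumes A: "op_field \<Omega> A M" and f: "f \<in> borel_measurable (lebesgue_on \<Omega>)"
  shows "(\<lambda>x. A x (f x)) \<in> borel_measurable (lebesgue_on \<Omega>)"
proof -
  have meas: "(\<lambda>x. \<Sum>b\<in>Basis. (f x \<bullet> b) *\<^sub>R A x b) \<in> borel_measurable (lebesgue_on \<Omega>)"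
    using A f by (intro borel_measurable_sum borel_measurable_scaleR borel_measurable_inner) (auto simp: op_field_def)
  have eq: "(\<Sum>b\<in>Basis. (f x \<bullet> b) *\<^sub>R A x b) = A x (f x)" if "x \<in> space (lebesgue_on \<Omega>)" for x
  proof -
    interpret linear "A x" using A that by (auto simp: op_field_def space_restrict_space)
    have "A x (f x) = A x (\<Sum>b\<in>Basis. (f x \<bullet> b) *\<^sub>R b)" by (simp add: euclidean_representation)
    then show ?thesis by (simp add: sum scaleR)
  qed
  show ?thesis by (rule iffD1[OF measurable_cong, OF eq meas])
qed

lemma op_field_L2:
  assumes A: "op_field \<Omega> A M" and f: "f \<in> L2 \<Omega>"
  shows "(\<lambda>x. A x (f x)) \<in> L2 \<Omega>"
proof (rule L2_bounded_by[where h="\<lambda>x. M\<^sup>2 * (norm (f x))\<^sup>2"])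
  show "(\<lambda>x. A x (f x)) \<in> borel_measurable (lebesgue_on \<Omega>)" using op_field_measurable[OF A L2_measurable[OF f]] .
  show "integrable (lebesgue_on \<Omega>) (\<lambda>x. M\<^sup>2 * (norm (f x))\<^sup>2)" using L2_integrable[OF f] by simp
  show "(norm (A x (f x)))\<^sup>2 \<le> M\<^sup>2 * (norm (f x))\<^sup>2" if "x \<in> \<Omega>" for x
    using A that power_mono[of "norm (A x (f x))" "M * norm (f x)" 2] by (auto simp: op_field_def power_mult_distrib)
qed

lemma mul_cls:
  assumes \<Omega>: "\<Omega> \<in> sets lebesgue" and A: "op_field \<Omega> A M" and f: "f \<in> L2 \<Omega>"
  shows "mul \<Omega> A (cls \<Omega> f) = cls \<Omega> (\<lambda>x. A x (f x))"
  unfolding mul_def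
proof (subst cls_eq_iff[OF \<Omega>])
  show "(\<lambda>x. A x (rep (cls \<Omega> f) x)) \<in> L2 \<Omega>" "(\<lambda>x. A x (f x)) \<in> L2 \<Omega>"
    using op_field_L2[OF A] rep_L2_on[OF \<Omega>] f by auto
  show "AE x in lebesgue_on \<Omega>. A x (rep (cls \<Omega> f) x) = A x (f x)"
    using rep_cls_on[OF \<Omega> f] by eventually_elim simp
qed

lemma bounded_linear_mul:
  assumes \<Omega>: "\<Omega> \<in> sets lebesgue" and A: "op_field \<Omega> A M"
  shows "bounded_linear (mul \<Omega> A)"
proof (rule bounded_linear_intro)
  note AL = op_field_L2[OF A rep_L2_on[OF \<Omega>]]
  have lin: "linear (A x)" if "x \<in> \<Omega>" for x using A that by (simp add: op_field_def)
  have repadd: "AE x in lebesgue. rep (F + G) x = rep F x + rep G x" for F G :: "('a, 'b) l2"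
    using rep_abs[OF L2_add[OF rep_L2 rep_L2], of F G] abs_add[OF rep_L2 rep_L2, of F G] by (simp add: abs_rep)
  have repsc: "AE x in lebesgue. rep (r *\<^sub>R F) x = r *\<^sub>R rep F x" for r and F :: "('a, 'b) l2"
    using rep_abs[OF L2_scaleR[OF rep_L2], of r F] abs_scaleR[OF rep_L2, of r F] by (simp add: abs_rep)
  show "mul \<Omega> A (F + G) = mul \<Omega> A F + mul \<Omega> A G" for F G
    unfolding mul_def cls_add[OF \<Omega> AL AL, symmetric]
  proof (subst cls_eq_iff[OF \<Omega> AL L2_add[OF AL AL]], unfold AE_on_iff[OF \<Omega>], use repadd[of F G] in eventually_elim)
    case (elim x)
    then show ?case using linear_add[OF lin] by auto
  qed
  show "mul \<Omega> A (r *\<^sub>R F) = r *\<^sub>R mul \<Omega> A F" for r F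
    unfolding mul_def cls_scaleR[OF \<Omega> AL, symmetric]
  proof (subst cls_eq_iff[OF \<Omega> AL L2_scaleR[OF AL]], unfold AE_on_iff[OF \<Omega>], use repsc[of r F] in eventually_elim)
    case (elim x)
    then show ?case using linear_scale[OF lin] by auto
  qed
  show "norm (mul \<Omega> A F) \<le> norm F * \<bar>M\<bar>" for F
  proof -
    have "(norm (mul \<Omega> A F))\<^sup>2 = (LINT x|lebesgue_on \<Omega>. (norm (A x (rep F x)))\<^sup>2)"
      unfolding mul_def dot_square_norm[symmetric] cls_inner[OF \<Omega> AL AL] ..
    also have "\<dots> \<le> (LINT x|lebesgue_on \<Omega>. M\<^sup>2 * (norm (rep F x))\<^sup>2)"
    proof (rule integral_mono)
      show "integrable (lebesgue_on \<Omega>) (\<lambda>x. (norm (A x (rep F x)))\<^sup>2)" by (rule L2_integrable[OF AL])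
      show "integrable (lebesgue_on \<Omega>) (\<lambda>x. M\<^sup>2 * (norm (rep F x))\<^sup>2)"
        using L2_integrable[OF rep_L2_on[OF \<Omega>, of F]] by simp
      show "(norm (A x (rep F x)))\<^sup>2 \<le> M\<^sup>2 * (norm (rep F x))\<^sup>2" if "x \<in> space (lebesgue_on \<Omega>)" for x
        using A that power_mono[of "norm (A x (rep F x))" "M * norm (rep F x)" 2]
        by (auto simp: op_field_def power_mult_distrib space_restrict_space)
    qed
    also have "\<dots> = M\<^sup>2 * (LINT x|lebesgue. (if x \<in> \<Omega> then (norm (rep F x))\<^sup>2 else 0))"
      by (simp add: Lebesgue_Measure.integral_restrict_UNIV[OF \<Omega>])
    also have "\<dots> \<le> M\<^sup>2 * (LINT x|lebesgue. (norm (rep F x))\<^sup>2)"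
    proof (intro mult_left_mono integral_mono)
      show "integrable lebesgue (\<lambda>x. if x \<in> \<Omega> then (norm (rep F x))\<^sup>2 else 0)"
        using L2_integrable[OF rep_L2_on[OF \<Omega>, of F]] by (simp add: Lebesgue_Measure.integrable_restrict_UNIV[OF \<Omega>])
      show "integrable lebesgue (\<lambda>x. (norm (rep F x))\<^sup>2)"
        using L2_integrable[OF rep_L2, of F] by (simp add: lebesgue_on_UNIV_eq)
    qed auto
    also have "\<dots> = (norm F * \<bar>M\<bar>)\<^sup>2"
      using abs_norm[OF rep_L2, of F] by (simp add: abs_rep power_mult_distrib)
    finally show ?thesis by (rule power2_le_imp_le) simp
  qed
qed

section \<open>Smooth functions\<close>

lemma pd_eqI: "(f has_derivative f') (at x) \<Longrightarrow> pd b f x = f' b"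
  unfolding pd_def by (metis frechet_derivative_at)

lemma has_derivative_frechet: "f differentiable (at x) \<Longrightarrow> (f has_derivative (\<lambda>b. pd b f x)) (at x)"
  unfolding pd_def by (simp add: frechet_derivative_works)

text \<open>Smoothness by coinduction: a class of differentiable functions that is closed under partial derivatives consists of smooth
  functions. This dispenses with formulas for higher derivatives.\<close>

lemma smoothI_class:
  assumes "f \<in> Q" and diff: "\<And>f x. f \<in> Q \<Longrightarrow> f differentiable (at x)"
    and pd: "\<And>f b. f \<in> Q \<Longrightarrow> b \<in> Basis \<Longrightarrow> pd b f \<in> Q"
  shows "smooth_on UNIV f"
proof -
  have "Ck_on k UNIV f" if "f \<in> Q" for k f
    using that
  proof (induction k arbitrary: f)
    case 0
    have "isCont f x" for x
      by (rule differentiable_imp_continuous_within[OF diff[OF 0]])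
    then show ?case by (simp add: continuous_at_imp_continuous_on)
  next
    case (Suc k)
    then show ?case using diff pd by simp
  qed
  then show ?thesis using assms(1) by (simp add: smooth_on_def)
qed

lemma smooth_differentiable: "smooth_on UNIV f \<Longrightarrow> f differentiable (at x)"
  unfolding smooth_on_def by (metis Ck_on.simps(2) UNIV_I)

lemma smooth_pd: "smooth_on UNIV f \<Longrightarrow> b \<in> Basis \<Longrightarrow> smooth_on UNIV (pd b f)"
  unfolding smooth_on_def by (metis Ck_on.simps(2))

lemma smooth_continuous: "smooth_on UNIV f \<Longrightarrow> continuous_on S f"
  unfolding smooth_on_def by (metis Ck_on.simps(1) continuous_on_subset subset_UNIV)

lemma smooth_has_derivative: "smooth_on UNIV f \<Longrightarrow> (f has_derivative (\<lambda>b. pd b f x)) (at x)"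
  by (intro has_derivative_frechet smooth_differentiable)

lemma pd_add: "smooth_on UNIV f \<Longrightarrow> smooth_on UNIV g \<Longrightarrow> pd b (\<lambda>x. f x + g x) = (\<lambda>x. pd b f x + pd b g x)"
  by (rule ext, rule pd_eqI) (intro has_derivative_add smooth_has_derivative)

lemma pd_linear: "bounded_linear L \<Longrightarrow> smooth_on UNIV f \<Longrightarrow> pd b (\<lambda>x. L (f x)) = (\<lambda>x. L (pd b f x))"
  by (rule ext, rule pd_eqI) (rule bounded_linear.has_derivative[OF _ smooth_has_derivative])

lemma smooth_add:
  assumes "smooth_on UNIV f" "smooth_on UNIV g"
  shows "smooth_on UNIV (\<lambda>x. f x + g x)"
proof (rule smoothI_class[where Q="{(\<lambda>x. f x + g x) | f g. smooth_on UNIV f \<and> smooth_on UNIV g}"])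
  show "h differentiable (at x)" if h: "h \<in> {(\<lambda>x. f x + g x) | f g. smooth_on UNIV f \<and> smooth_on UNIV g}" for h x
  proof -
    from h obtain f g where "h = (\<lambda>x. f x + g x)" "smooth_on UNIV f" "smooth_on UNIV g" by auto
    then show ?thesis using differentiable_add[OF smooth_differentiable smooth_differentiable, of f g x] by simp
  qed
  show "pd b h \<in> {(\<lambda>x. f x + g x) | f g. smooth_on UNIV f \<and> smooth_on UNIV g}"
    if h: "h \<in> {(\<lambda>x. f x + g x) | f g. smooth_on UNIV f \<and> smooth_on UNIV g}" and "b \<in> Basis" for h b
  proof -
    from h obtain f g where "h = (\<lambda>x. f x + g x)" "smooth_on UNIV f" "smooth_on UNIV g" by auto
    then show ?thesis using pd_add smooth_pd[OF _ \<open>b \<in> Basis\<close>] by blast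
  qed
qed (use assms in blast)

lemma smooth_linear:
  assumes L: "bounded_linear L" and "smooth_on UNIV f"
  shows "smooth_on UNIV (\<lambda>x. L (f x))"
proof (rule smoothI_class[where Q="{(\<lambda>x. L (f x)) | f. smooth_on UNIV f}"])
  show "h differentiable (at x)" if h: "h \<in> {(\<lambda>x. L (f x)) | f. smooth_on UNIV f}" for h x
  proof -
    from h obtain f where "h = (\<lambda>x. L (f x))" "smooth_on UNIV f" by auto
    then show ?thesis using bounded_linear.has_derivative[OF L smooth_has_derivative, of f x] differentiableI by blast
  qed
  show "pd b h \<in> {(\<lambda>x. L (f x)) | f. smooth_on UNIV f}"
    if h: "h \<in> {(\<lambda>x. L (f x)) | f. smooth_on UNIV f}" and "b \<in> Basis" for h b
  proof -
    from h obtain f where "h = (\<lambda>x. L (f x))" "smooth_on UNIV f" by auto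
    then show ?thesis using pd_linear[OF L] smooth_pd[OF _ \<open>b \<in> Basis\<close>] by blast
  qed
qed (use assms in blast)

lemma translate_has_derivative:
  assumes "smooth_on UNIV f" shows "((\<lambda>x. f (x + c)) has_derivative (\<lambda>b. pd b f (x + c))) (at x)"
proof -
  have "(f has_derivative (\<lambda>b. pd b f (x + c))) (at (x + c))" by (rule smooth_has_derivative[OF assms])
  moreover have "((\<lambda>x. x + c) has_derivative (\<lambda>b. b)) (at x)" by (auto intro!: derivative_eq_intros)
  ultimately show ?thesis using has_derivative_compose[of "\<lambda>x. x + c" "\<lambda>b. b" x UNIV f] by simp
qed

lemma pd_translate: "smooth_on UNIV f \<Longrightarrow> pd b (\<lambda>x. f (x + c)) = (\<lambda>x. pd b f (x + c))"
  by (rule ext, rule pd_eqI) (rule translate_has_derivative)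

lemma smooth_translate:
  assumes "smooth_on UNIV f" shows "smooth_on UNIV (\<lambda>x. f (x + c))"
proof (rule smoothI_class[where Q="{(\<lambda>x. f (x + c)) | f. smooth_on UNIV f}"])
  show "h differentiable (at x)" if h: "h \<in> {(\<lambda>x. f (x + c)) | f. smooth_on UNIV f}" for h x
  proof -
    from h obtain f where "h = (\<lambda>x. f (x + c))" "smooth_on UNIV f" by auto
    then show ?thesis using translate_has_derivative[of f c x] differentiableI by blast
  qed
  show "pd b h \<in> {(\<lambda>x. f (x + c)) | f. smooth_on UNIV f}"
    if h: "h \<in> {(\<lambda>x. f (x + c)) | f. smooth_on UNIV f}" and "b \<in> Basis" for h b
  proof -
    from h obtain f where "h = (\<lambda>x. f (x + c))" "smooth_on UNIV f" by auto
    then show ?thesis using pd_translate smooth_pd[OF _ \<open>b \<in> Basis\<close>] by blast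
  qed
qed (use assms in blast)

text \<open>The smooth function \<open>exp (- 1 / s)\<close> on the positive half line, extended by zero, is \<open>flat 0\<close>. The powers of \<open>1 / s\<close> are included
  so that the derivative of a flat function is a combination of flat functions.\<close>

definition flat :: "nat \<Rightarrow> real \<Rightarrow> real" where
  "flat n s = (if s > 0 then (1 / s) ^ n * exp (- (1 / s)) else 0)"

lemma flat_derivative_pos:
  assumes "s > 0"
  shows "(flat n has_real_derivative (flat (n + 2) s - real n * flat (n + 1) s)) (at s)"
proof -
  have "((\<lambda>s. (1 / s) ^ n * exp (- (1 / s))) has_real_derivative
      (flat (n + 2) s - real n * flat (n + 1) s)) (at s)"
  proof (rule DERIV_cong)
    have i: "((\<lambda>s. 1 / s) has_real_derivative - (1 / s\<^sup>2)) (at s)"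
      using assms by (auto intro!: derivative_eq_intros simp: power2_eq_square)
    show "((\<lambda>s. (1 / s) ^ n * exp (- (1 / s))) has_real_derivative
        (1 / s) ^ n * (exp (- (1 / s)) * - (- (1 / s\<^sup>2))) + (real n * (- (1 / s\<^sup>2) * (1 / s) ^ (n - Suc 0))) * exp (- (1 / s))) (at s)"
      using DERIV_mult[OF DERIV_power[OF i, of n] DERIV_chain2[OF DERIV_exp DERIV_minus[OF i]]]
      by (simp add: algebra_simps)
    show "(1 / s) ^ n * (exp (- (1 / s)) * - (- (1 / s\<^sup>2))) + (real n * (- (1 / s\<^sup>2) * (1 / s) ^ (n - Suc 0))) * exp (- (1 / s))
        = flat (n + 2) s - real n * flat (n + 1) s"
      using assms by (cases n) (simp_all add: flat_def power2_eq_square algebra_simps)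
  qed
  then show ?thesis
  proof (rule has_field_derivative_transform_within_open[where S="{0<..}"])
    show "(1 / x) ^ n * exp (- (1 / x)) = flat n x" if "x \<in> {0<..}" for x using that by (simp add: flat_def)
  qed (use assms in auto)
qed

text \<open>The exponential function outgrows every power.\<close>

lemma flat_derivative_zero: "(flat n has_real_derivative 0) (at 0)"
proof -
  have "((\<lambda>y::real. y ^ Suc n / exp y) \<longlongrightarrow> 0) at_top" by (rule tendsto_power_div_exp_0)
  then have "((\<lambda>s::real. inverse s ^ Suc n / exp (inverse s)) \<longlongrightarrow> 0) (at_right 0)"
    by (rule filterlim_compose[OF _ filterlim_inverse_at_top_right])
  then have "((\<lambda>s. flat n s / s) \<longlongrightarrow> 0) (at_right 0)"
    by (rule Lim_transform_eventually)
      (auto simp: eventually_at_right_field flat_def exp_minus field_simps intro!: exI[of _ 1])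
  moreover have "((\<lambda>s. flat n s / s) \<longlongrightarrow> 0) (at_left 0)"
    by (rule Lim_transform_eventually[OF tendsto_const])
      (auto simp: eventually_at_left_field flat_def intro!: exI[of _ "-1"])
  ultimately have "((\<lambda>s. flat n s / s) \<longlongrightarrow> 0) (at 0)" by (simp add: filterlim_split_at)
  then show ?thesis by (simp add: has_field_derivative_iff flat_def)
qed

lemma flat_derivative: "(flat n has_real_derivative (flat (n + 2) s - real n * flat (n + 1) s)) (at s)"
proof -
  consider "s > 0" | "s = 0" | "s < 0" by linarith
  then show ?thesis
  proof cases
    case 2
    then show ?thesis using flat_derivative_zero by (simp add: flat_def)
  next
    case 3
    have "(flat n has_real_derivative 0) (at s)"
      by (rule has_field_derivative_transform_within_open[where S="{..<0}" and f="\<lambda>x. 0"])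
        (use 3 in \<open>auto simp: flat_def\<close>)
    then show ?thesis using 3 by (simp add: flat_def)
  qed (rule flat_derivative_pos)
qed

text \<open>The algebra generated by smooth functions and flat functions of one linear coordinate. It is closed under partial
  derivatives, hence \<open>smoothI_class\<close> applies.\<close>

inductive_set smooth_alg :: "('a::euclidean_space \<Rightarrow> real) set" where
  base: "smooth_on UNIV f \<Longrightarrow> f \<in> smooth_alg"
| flat: "(\<lambda>x. flat n (x \<bullet> v + c)) \<in> smooth_alg"
| const: "(\<lambda>x. c) \<in> smooth_alg"
| add: "f \<in> smooth_alg \<Longrightarrow> g \<in> smooth_alg \<Longrightarrow> (\<lambda>x. f x + g x) \<in> smooth_alg"
| mult: "f \<in> smooth_alg \<Longrightarrow> g \<in> smooth_alg \<Longrightarrow> (\<lambda>x. f x * g x) \<in> smooth_alg"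

lemma flat_has_derivative:
  "((\<lambda>x. flat n (x \<bullet> v + c)) has_derivative
     (\<lambda>b. (flat (n + 2) (x \<bullet> v + c) - real n * flat (n + 1) (x \<bullet> v + c)) * (b \<bullet> v))) (at x)"
proof -
  have "((\<lambda>x. x \<bullet> v + c) has_derivative (\<lambda>b. b \<bullet> v)) (at x)" by (auto intro!: derivative_eq_intros)
  from has_derivative_compose[OF this flat_derivative[of n "x \<bullet> v + c", unfolded has_field_derivative_def]]
  show ?thesis by simp
qed

lemma smooth_alg_derivative: "f \<in> smooth_alg \<Longrightarrow> (\<forall>x. f differentiable (at x)) \<and> (\<forall>b\<in>Basis. pd b f \<in> smooth_alg)"
proof (induction rule: smooth_alg.induct)
  case (base f)
  then show ?case using smooth_differentiable smooth_pd smooth_alg.base by blast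
next
  case (flat n v c)
  have pdf: "pd b (\<lambda>x. flat n (x \<bullet> v + c)) =
     (\<lambda>x. (flat (n + 2) (x \<bullet> v + c) + (- real n) * flat (n + 1) (x \<bullet> v + c)) * (b \<bullet> v))" for b
    by (rule ext, rule trans[OF pd_eqI[OF flat_has_derivative]]) simp
  have "pd b (\<lambda>x. flat n (x \<bullet> v + c)) \<in> smooth_alg" for b
    unfolding pdf by (intro smooth_alg.mult smooth_alg.add smooth_alg.const smooth_alg.flat)
  then show ?case using differentiableI[OF flat_has_derivative[of n v c]] by blast
next
  case (const c)
  have "pd b (\<lambda>x::'a. c) = (\<lambda>x. 0)" for b by (rule ext, rule pd_eqI) (rule has_derivative_const)
  then show ?case by (auto intro: smooth_alg.const)
next
  case (add f g)
  then have "pd b (\<lambda>x. f x + g x) = (\<lambda>x. pd b f x + pd b g x)" for b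
    by (intro ext pd_eqI has_derivative_add has_derivative_frechet) auto
  then show ?case using add by (auto intro!: smooth_alg.add)
next
  case (mult f g)
  then have "pd b (\<lambda>x. f x * g x) = (\<lambda>x. f x * pd b g x + pd b f x * g x)" for b
    by (intro ext pd_eqI has_derivative_mult has_derivative_frechet) auto
  then show ?case using mult by (auto intro!: smooth_alg.add smooth_alg.mult differentiable_mult)
qed

lemma smooth_alg_smooth: "f \<in> smooth_alg \<Longrightarrow> smooth_on UNIV f"
  by (rule smoothI_class[where Q=smooth_alg]) (auto dest: smooth_alg_derivative)

lemma smooth_alg_prod: "finite I \<Longrightarrow> (\<And>i. i \<in> I \<Longrightarrow> f i \<in> smooth_alg) \<Longrightarrow> (\<lambda>x. \<Prod>i\<in>I. f i x) \<in> smooth_alg"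
  by (induction I rule: finite_induct) (auto intro: smooth_alg.intros)

text \<open>These smooth functions tend to the indicator function of an open box; by dominated convergence a function that
  annihilates them has integral zero over the box.\<close>

definition box_bump :: "'a \<Rightarrow> 'a \<Rightarrow> nat \<Rightarrow> 'a::euclidean_space \<Rightarrow> real" where
  "box_bump a b n x = (\<Prod>i\<in>Basis. flat 0 (real n * (x \<bullet> i - a \<bullet> i)) * flat 0 (real n * (b \<bullet> i - x \<bullet> i)))"

lemma smooth_box_bump: "smooth_on UNIV (box_bump a b n)"
proof -
  have "(\<lambda>x. flat 0 (real n * (x \<bullet> i - a \<bullet> i)) * flat 0 (real n * (b \<bullet> i - x \<bullet> i))) \<in> smooth_alg" for i :: 'a
  proof -
    have "(\<lambda>x. flat 0 (x \<bullet> (real n *\<^sub>R i) + - real n * (a \<bullet> i)) * flat 0 (x \<bullet> (- real n *\<^sub>R i) + real n * (b \<bullet> i))) \<in> smooth_alg"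
      by (intro smooth_alg.mult smooth_alg.flat)
    then show ?thesis by (simp add: algebra_simps)
  qed
  then have "box_bump a b n \<in> smooth_alg" unfolding box_bump_def[abs_def] by (intro smooth_alg_prod) auto
  then show ?thesis by (rule smooth_alg_smooth)
qed

lemma flat_bounds: "0 \<le> flat 0 s" "flat 0 s \<le> 1"
  by (auto simp: flat_def)

lemma box_bump_bounds: "0 \<le> box_bump a b n x" "box_bump a b n x \<le> 1"
  unfolding box_bump_def by (auto intro!: prod_nonneg prod_le_1 mult_le_one mult_nonneg_nonneg flat_bounds)

lemma box_bump_outside: "x \<notin> box a b \<Longrightarrow> box_bump a b n x = 0"
proof -
  assume "x \<notin> box a b"
  then obtain i where i: "i \<in> Basis" "x \<bullet> i \<le> a \<bullet> i \<or> b \<bullet> i \<le> x \<bullet> i" by (auto simp: mem_box not_less)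
  then have "real n * (x \<bullet> i - a \<bullet> i) \<le> 0 \<or> real n * (b \<bullet> i - x \<bullet> i) \<le> 0"
    by (auto intro: mult_nonneg_nonpos)
  then show ?thesis unfolding box_bump_def using i by (intro prod_zero) (auto simp: flat_def intro!: bexI[of _ i])
qed

lemma box_bump_tendsto: "x \<in> box a b \<Longrightarrow> (\<lambda>n. box_bump a b n x) \<longlonglongrightarrow> 1"
proof -
  assume x: "x \<in> box a b"
  have f: "(\<lambda>n. flat 0 (real n * s)) \<longlonglongrightarrow> 1" if "s > 0" for s
  proof -
    have "(\<lambda>n. exp (- (1 / s * (1 / real n)))) \<longlonglongrightarrow> exp (- (1 / s * 0))"
      by (intro tendsto_intros lim_1_over_n)
    moreover have "\<forall>\<^sub>F n in sequentially. exp (- (1 / s * (1 / real n))) = flat 0 (real n * s)"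
      using eventually_gt_at_top[of 0] by eventually_elim (use that in \<open>simp add: flat_def mult.commute\<close>)
    ultimately show ?thesis by (simp add: Lim_transform_eventually)
  qed
  have "(\<lambda>n. box_bump a b n x) \<longlonglongrightarrow> (\<Prod>i\<in>(Basis::'a set). 1 * 1)"
    unfolding box_bump_def by (intro tendsto_prod tendsto_mult f) (use x in \<open>auto simp: mem_box\<close>)
  then show ?thesis by simp
qed

section \<open>Test functions\<close>

lemma test_smooth: "\<phi> \<in> test_funs \<Omega> \<Longrightarrow> smooth_on UNIV \<phi>"
  by (simp add: test_funs_def)

lemma test_funsI:
  assumes "smooth_on UNIV \<phi>" "compact K" "K \<subseteq> \<Omega>" "\<And>x. x \<notin> K \<Longrightarrow> \<phi> x = 0"
  shows "\<phi> \<in> test_funs \<Omega>"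
proof -
  have "{x. \<phi> x \<noteq> 0} \<subseteq> K" using assms(4) by blast
  then have "closure {x. \<phi> x \<noteq> 0} \<subseteq> K" using assms(2) by (simp add: closure_minimal compact_imp_closed)
  moreover from this have "compact (closure {x. \<phi> x \<noteq> 0})"
    using assms(2) by (meson bounded_subset closed_closure compact_eq_bounded_closed)
  ultimately show ?thesis using assms by (auto simp: test_funs_def)
qed

lemma test_support:
  assumes "\<phi> \<in> test_funs \<Omega>"
  shows "\<exists>K. compact K \<and> K \<subseteq> \<Omega> \<and> (\<forall>x. x \<notin> K \<longrightarrow> \<phi> x = 0 \<and> (\<forall>b. pd b \<phi> x = 0))"
proof -
  define K where "K = closure {x. \<phi> x \<noteq> 0}"
  have cl: "closed K" by (simp add: K_def)
  have 0: "\<phi> x = 0" if "x \<notin> K" for x using that closure_subset[of "{x. \<phi> x \<noteq> 0}"] by (auto simp: K_def)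
  have "pd b \<phi> x = 0" if "x \<notin> K" for b x
  proof (rule pd_eqI)
    show "(\<phi> has_derivative (\<lambda>b. 0)) (at x)"
      by (rule has_derivative_transform_within_open[of "\<lambda>x. 0" "\<lambda>b. 0" x UNIV "- K"])
        (use that cl in \<open>auto simp: 0\<close>)
  qed
  moreover have "compact K" "K \<subseteq> \<Omega>" using assms by (auto simp: test_funs_def K_def)
  ultimately show ?thesis using 0 by blast
qed

lemma test_mono: "\<phi> \<in> test_funs \<Omega> \<Longrightarrow> \<Omega> \<subseteq> \<Omega>' \<Longrightarrow> \<phi> \<in> test_funs \<Omega>'"
  by (auto simp: test_funs_def)

lemma test_zero: "(\<lambda>x. 0) \<in> test_funs \<Omega>"
proof (rule test_funsI[where K="{}"])
  have "(\<lambda>x::'a. 0::'b) = (\<lambda>x. (0::real) *\<^sub>R (0::'b))" by simp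
  have "smooth_on UNIV (\<lambda>x::'a. 0::real)" by (rule smooth_alg_smooth) (rule smooth_alg.const)
  from smooth_linear[OF bounded_linear_scaleR_left[of "0::'b"] this]
  show "smooth_on UNIV (\<lambda>x::'a. 0::'b)" by simp
qed auto

lemma test_add:
  assumes "\<phi> \<in> test_funs \<Omega>" "\<psi> \<in> test_funs \<Omega>" shows "(\<lambda>x. \<phi> x + \<psi> x) \<in> test_funs \<Omega>"
proof -
  obtain K where K: "compact K" "K \<subseteq> \<Omega>" "\<And>x. x \<notin> K \<Longrightarrow> \<phi> x = 0" "\<And>b x. x \<notin> K \<Longrightarrow> pd b \<phi> x = 0"
    using test_support[OF assms(1)] by blast
  obtain L where L: "compact L" "L \<subseteq> \<Omega>" "\<And>x. x \<notin> L \<Longrightarrow> \<psi> x = 0" "\<And>b x. x \<notin> L \<Longrightarrow> pd b \<psi> x = 0"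
    using test_support[OF assms(2)] by blast
  show ?thesis
    by (rule test_funsI[where K="K \<union> L"]) (use K L smooth_add[OF test_smooth[OF assms(1)] test_smooth[OF assms(2)]] in auto)
qed

lemma test_linear:
  assumes "\<phi> \<in> test_funs \<Omega>" and L: "bounded_linear L" shows "(\<lambda>x. L (\<phi> x)) \<in> test_funs \<Omega>"
proof -
  obtain K where K: "compact K" "K \<subseteq> \<Omega>" "\<And>x. x \<notin> K \<Longrightarrow> \<phi> x = 0" "\<And>b x. x \<notin> K \<Longrightarrow> pd b \<phi> x = 0"
    using test_support[OF assms(1)] by blast
  show ?thesis
    by (rule test_funsI[OF _ K(1,2)])
      (use K(3) in \<open>auto intro: smooth_linear[OF L test_smooth[OF assms(1)]] simp: linear_0[OF bounded_linear.linear[OF L]]\<close>)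
qed

lemma test_pd: 
  assumes "\<phi> \<in> test_funs \<Omega>" "b \<in> Basis" shows "pd b \<phi> \<in> test_funs \<Omega>"
proof -
  obtain K where K: "compact K" "K \<subseteq> \<Omega>" "\<And>x. x \<notin> K \<Longrightarrow> \<phi> x = 0" "\<And>b x. x \<notin> K \<Longrightarrow> pd b \<phi> x = 0"
    using test_support[OF assms(1)] by blast
  show ?thesis by (rule test_funsI[OF smooth_pd[OF test_smooth[OF assms(1)] assms(2)] K(1,2) K(4)])
qed

lemma test_translate:
  assumes "\<phi> \<in> test_funs UNIV" shows "(\<lambda>x. \<phi> (x + c)) \<in> test_funs UNIV"
proof -
  obtain K where K: "compact K" "K \<subseteq> UNIV" "\<And>x. x \<notin> K \<Longrightarrow> \<phi> x = 0" "\<And>b x. x \<notin> K \<Longrightarrow> pd b \<phi> x = 0"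
    using test_support[OF assms] by blast
  have "compact ((\<lambda>x. x - c) ` K)" by (intro compact_continuous_image continuous_intros K(1))
  moreover have "\<phi> (x + c) = 0" if "x \<notin> (\<lambda>x. x - c) ` K" for x
    using that K(3)[of "x + c"] by (force simp: image_iff)
  ultimately show ?thesis
    by (intro test_funsI[where K="(\<lambda>x. x - c) ` K"]) (use smooth_translate[OF test_smooth[OF assms]] in auto)
qed

lemma test_continuous: "\<phi> \<in> test_funs \<Omega> \<Longrightarrow> continuous_on S \<phi>"
  by (rule smooth_continuous[OF test_smooth])

lemma test_measurable:
  "(\<phi> :: 'a::euclidean_space \<Rightarrow> 'b::euclidean_space) \<in> test_funs \<Omega> \<Longrightarrow> \<phi> \<in> borel_measurable lebesgue"
proof -
  assume "\<phi> \<in> test_funs \<Omega>"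
  then have "\<phi> \<in> borel_measurable lborel" using borel_measurable_continuous_onI[OF test_continuous] by simp
  then show ?thesis by (rule measurable_completion)
qed

lemma continuous_compact_bounded:
  fixes \<phi> :: "'a::euclidean_space \<Rightarrow> 'b::euclidean_space"
  assumes "continuous_on UNIV \<phi>" "compact K" "\<And>x. x \<notin> K \<Longrightarrow> \<phi> x = 0"
  obtains C where "C \<ge> 0" "\<And>x. norm (\<phi> x) \<le> C"
proof -
  have "compact (\<phi> ` K)" by (rule compact_continuous_image[OF continuous_on_subset[OF assms(1)] assms(2)]) simp
  then obtain C where C: "\<And>x. x \<in> K \<Longrightarrow> norm (\<phi> x) \<le> C" by (meson bounded_iff compact_imp_bounded imageI)
  have "norm (\<phi> x) \<le> \<bar>C\<bar>" for x using C[of x] assms(3)[of x] by (cases "x \<in> K") auto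
  then show ?thesis using that[of "\<bar>C\<bar>"] by simp
qed

lemma test_bounded:
  fixes \<phi> :: "'a::euclidean_space \<Rightarrow> 'b::euclidean_space"
  assumes "\<phi> \<in> test_funs \<Omega>" obtains C where "C \<ge> 0" "\<And>x. norm (\<phi> x) \<le> C"
proof -
  obtain K where K: "compact K" "K \<subseteq> \<Omega>" "\<And>x. x \<notin> K \<Longrightarrow> \<phi> x = 0" "\<And>b x. x \<notin> K \<Longrightarrow> pd b \<phi> x = 0"
    using test_support[OF assms] by blast
  show ?thesis by (rule continuous_compact_bounded[OF test_continuous[OF assms] K(1) K(3)]) (auto intro: that)
qed

lemma compact_support_integrable:
  fixes \<phi> :: "'a::euclidean_space \<Rightarrow> 'b::euclidean_space"
  assumes c: "continuous_on UNIV \<phi>" and K: "compact K" "\<And>x. x \<notin> K \<Longrightarrow> \<phi> x = 0"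
  shows "integrable lebesgue \<phi>"
proof -
  have "integrable lborel (\<lambda>x. indicator K x *\<^sub>R \<phi> x)"
    by (rule borel_integrable_compact[OF K(1) continuous_on_subset[OF c]]) simp
  moreover have "(\<lambda>x. indicator K x *\<^sub>R \<phi> x) = \<phi>" using K by (auto simp: indicator_def)
  ultimately show ?thesis by (simp add: integrable_completion)
qed

lemma test_L2:
  fixes \<phi> :: "'a::euclidean_space \<Rightarrow> 'b::euclidean_space"
  assumes \<phi>: "\<phi> \<in> test_funs \<Omega>" shows "\<phi> \<in> L2 UNIV"
proof -
  obtain K where K: "compact K" "K \<subseteq> \<Omega>" "\<And>x. x \<notin> K \<Longrightarrow> \<phi> x = 0" "\<And>b x. x \<notin> K \<Longrightarrow> pd b \<phi> x = 0"
    using test_support[OF \<phi>] by blast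
  have "integrable lebesgue (\<lambda>x. (norm (\<phi> x))\<^sup>2)"
    by (rule compact_support_integrable[OF _ K(1)]) (use K(3) in \<open>auto intro!: continuous_intros test_continuous[OF \<phi>]\<close>)
  then show ?thesis using test_measurable[OF \<phi>] by (simp add: L2_def lebesgue_on_UNIV_eq)
qed

section \<open>The fundamental lemma of the calculus of variations\<close>

text \<open>The boxes form a generator of the Borel sets that is stable under intersection, so Dynkin's theorem applies.\<close>

lemma set_integral_zero_all:
  fixes f :: "'a::euclidean_space \<Rightarrow> 'b::euclidean_space"
  assumes f: "integrable lebesgue f"
    and box: "\<And>c d. (LINT x|lebesgue. indicator (box c d) x *\<^sub>R f x) = 0"
    and total: "(LINT x|lebesgue. f x) = 0"
    and A: "A \<in> sets lebesgue"
  shows "set_lebesgue_integral lebesgue A f = 0"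
proof -
  have int: "integrable lebesgue (\<lambda>x. indicator A x *\<^sub>R f x)" if "A \<in> sets lebesgue" for A
    using that f by (rule integrable_mult_indicator)
  have Int: "Int_stable (range (\<lambda>(a, b). box a b :: 'a set))"
  proof -
    have "box a b \<in> range (\<lambda>(a, b). box a b :: 'a set)" for a b
      by (rule range_eqI[of _ _ "(a, b)"]) simp
    then show ?thesis by (intro Int_stableI) (auto simp: box_Int_box)
  qed
  have Pow: "range (\<lambda>(a, b). box a b :: 'a set) \<subseteq> Pow UNIV" by simp
  have borel: "set_lebesgue_integral lebesgue S f = 0" if "S \<in> sigma_sets UNIV (range (\<lambda>(a, b). box a b :: 'a set))" for S
    using Int Pow that
  proof (induction rule: sigma_sets_induct_disjoint)
    case (basic A)
    then show ?case using box by (auto simp: set_lebesgue_integral_def)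
  next
    case empty
    then show ?case by (simp add: set_lebesgue_integral_def)
  next
    case (compl A)
    have A: "A \<in> sets lebesgue"
      using compl(1) by (metis borel_eq_box sets_completionI_sets sets_lborel sets_measure_of top_greatest Pow_UNIV)
    have "set_lebesgue_integral lebesgue (UNIV - A) f = (LINT x|lebesgue. f x - indicator A x *\<^sub>R f x)"
      unfolding set_lebesgue_integral_def
      by (rule Bochner_Integration.integral_cong) (auto simp: indicator_def)
    also have "\<dots> = (LINT x|lebesgue. f x) - set_lebesgue_integral lebesgue A f"
      unfolding set_lebesgue_integral_def using f int[OF A] by (rule Bochner_Integration.integral_diff)
    finally show ?case using compl total by simp
  next
    case (union A)
    have A: "A i \<in> sets lebesgue" for i
      using union(2) by (metis borel_eq_box sets_completionI_sets sets_lborel sets_measure_of top_greatest Pow_UNIV range_subsetD)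
    have "set_lebesgue_integral lebesgue (\<Union>i. A i) f = (\<Sum>i. set_lebesgue_integral lebesgue (A i) f)"
    proof (rule lebesgue_integral_countable_add[OF A])
      show "A i \<inter> A j = {}" if "i \<noteq> j" for i j using union(1) that by (simp add: disjoint_family_onD)
      show "set_integrable lebesgue (\<Union>i. A i) f"
        unfolding set_integrable_def by (rule int) (use A in auto)
    qed
    then show ?case using union by simp
  qed
  obtain S N N' where S: "A = S \<union> N" "N \<subseteq> N'" "N' \<in> null_sets lborel" "S \<in> sets lborel"
    using sets_completionE[OF A] by metis
  have "AE x in lebesgue. x \<notin> N'"
    using S(3) null_sets_completionI by (intro AE_not_in) blast
  then have "AE x in lebesgue. indicator A x *\<^sub>R f x = indicator S x *\<^sub>R f x"
    by eventually_elim (use S in \<open>auto simp: indicator_def\<close>)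
  moreover have Sl: "S \<in> sets lebesgue" using S(4) by (rule sets_completionI_sets)
  ultimately have "set_lebesgue_integral lebesgue A f = set_lebesgue_integral lebesgue S f"
    unfolding set_lebesgue_integral_def
    using borel_measurable_integrable[OF int[OF A]] borel_measurable_integrable[OF int[OF Sl]]
    by (intro integral_cong_AE) auto
  also have "\<dots> = 0"
    using S(4) by (intro borel) (metis borel_eq_box sets_lborel sets_measure_of top_greatest Pow_UNIV)
  finally show ?thesis .
qed

lemma sigma_finite_lebesgue: "sigma_finite_measure (lebesgue :: 'a::euclidean_space measure)"
proof
  obtain A :: "'a set set" where A: "countable A" "A \<subseteq> sets lborel" "\<Union> A = space lborel" "\<forall>a\<in>A. emeasure lborel a \<noteq> \<infinity>"
    using sigma_finite_measure.sigma_finite_countable[OF sigma_finite_lborel] by metis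
  then show "\<exists>A::'a set set. countable A \<and> A \<subseteq> sets lebesgue \<and> \<Union> A = space lebesgue \<and> (\<forall>a\<in>A. emeasure lebesgue a \<noteq> \<infinity>)"
    by (intro exI[of _ A]) (auto simp: subset_iff)
qed

lemma L2_integrable_bounded:
  assumes f: "f \<in> L2 UNIV" and S: "S \<in> lmeasurable"
  shows "integrable lebesgue (\<lambda>x. indicator S x *\<^sub>R f x)"
proof (rule Bochner_Integration.integrable_bound[where f="\<lambda>x. (norm (f x))\<^sup>2 + indicator S x"])
  have fm: "f \<in> borel_measurable lebesgue" using L2_measurable[OF f] by (simp add: lebesgue_on_UNIV_eq)
  show "integrable lebesgue (\<lambda>x. (norm (f x))\<^sup>2 + indicator S x)"
    using L2_integrable[OF f] S by (auto simp: lebesgue_on_UNIV_eq fmeasurable_def)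
  show "(\<lambda>x. indicator S x *\<^sub>R f x) \<in> borel_measurable lebesgue"
    using fm S by (intro borel_measurable_scaleR borel_measurable_indicator) (auto simp: fmeasurable_def)
  have "norm (f x) \<le> (norm (f x))\<^sup>2 + 1" for x
  proof -
    have "n \<le> m + 1" if "2 * n * 1 \<le> m + 1\<^sup>2" "0 \<le> n" for n m :: real using that by simp
    then show ?thesis using sum_squares_bound[of "norm (f x)" 1] norm_ge_zero[of "f x"] by blast
  qed
  then show "AE x in lebesgue. norm (indicator S x *\<^sub>R f x) \<le> norm ((norm (f x))\<^sup>2 + indicator S x)"
    by (intro AE_I2) (auto simp: indicator_def)
qed

text \<open>The bumps show that the integrals over boxes inside \<open>\<Omega>\<close> vanish, so \<open>f\<close> vanishes almost everywhere in every such box, and countably many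
  boxes cover \<open>\<Omega>\<close>.\<close>

lemma fundamental_lemma_UNIV:
  fixes f :: "'a::euclidean_space \<Rightarrow> 'b::euclidean_space"
  assumes \<Omega>: "open \<Omega>" and f: "f \<in> L2 UNIV"
    and zero: "\<And>\<phi>. \<phi> \<in> test_funs \<Omega> \<Longrightarrow> (LINT x|lebesgue. \<phi> x *\<^sub>R f x) = 0"
  shows "AE x in lebesgue. x \<in> \<Omega> \<longrightarrow> f x = 0"
proof -
  have fm: "f \<in> borel_measurable lebesgue" using L2_measurable[OF f] by (simp add: lebesgue_on_UNIV_eq)
  have boxint: "(LINT x|lebesgue. indicator (box a b) x *\<^sub>R f x) = 0" if "box a b \<noteq> {} \<Longrightarrow> cbox a b \<subseteq> \<Omega>" for a b
  proof (cases "box a b = {}")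
    case False
    then have sub: "cbox a b \<subseteq> \<Omega>" using that by simp
    have bump: "box_bump a b n \<in> test_funs \<Omega>" for n
      by (rule test_funsI[OF smooth_box_bump compact_cbox sub])
        (use box_bump_outside box_subset_cbox in blast)
    have "(\<lambda>n. LINT x|lebesgue. box_bump a b n x *\<^sub>R f x) \<longlonglongrightarrow> (LINT x|lebesgue. indicator (box a b) x *\<^sub>R f x)"
    proof (rule integral_dominated_convergence[where w="\<lambda>x. norm (indicator (box a b) x *\<^sub>R f x)"])
      show "(\<lambda>x. indicator (box a b) x *\<^sub>R f x) \<in> borel_measurable lebesgue"
        using fm by (intro borel_measurable_scaleR borel_measurable_indicator) auto
      show "(\<lambda>x. box_bump a b n x *\<^sub>R f x) \<in> borel_measurable lebesgue" for n
        by (intro borel_measurable_scaleR fm test_measurable[OF bump])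
      show "integrable lebesgue (\<lambda>x. norm (indicator (box a b) x *\<^sub>R f x))"
        by (intro integrable_norm L2_integrable_bounded f) auto
      show "AE x in lebesgue. (\<lambda>n. box_bump a b n x *\<^sub>R f x) \<longlonglongrightarrow> indicator (box a b) x *\<^sub>R f x"
      proof (rule AE_I2)
        fix x
        show "(\<lambda>n. box_bump a b n x *\<^sub>R f x) \<longlonglongrightarrow> indicator (box a b) x *\<^sub>R f x"
        proof (cases "x \<in> box a b")
          case True
          then have "(\<lambda>n. box_bump a b n x *\<^sub>R f x) \<longlonglongrightarrow> 1 *\<^sub>R f x"
            by (intro tendsto_intros box_bump_tendsto)
          then show ?thesis using True by simp
        qed (simp add: box_bump_outside)
      qed
      show "AE x in lebesgue. norm (box_bump a b n x *\<^sub>R f x) \<le> norm (indicator (box a b) x *\<^sub>R f x)" for n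
      proof (rule AE_I2)
        fix x show "norm (box_bump a b n x *\<^sub>R f x) \<le> norm (indicator (box a b) x *\<^sub>R f x)"
          using box_bump_bounds[of a b n x] mult_right_mono[of "\<bar>box_bump a b n x\<bar>" 1 "norm (f x)"]
          by (cases "x \<in> box a b") (auto simp: box_bump_outside)
      qed
    qed
    then show ?thesis using zero[OF bump] by (simp add: LIMSEQ_const_iff)
  qed simp
  have local: "AE x in lebesgue. x \<in> box a b \<longrightarrow> f x = 0" if sub: "cbox a b \<subseteq> \<Omega>" for a b
  proof -
    define F where "F x = indicator (box a b) x *\<^sub>R f x" for x
    have Fi: "integrable lebesgue F" unfolding F_def[abs_def] by (intro L2_integrable_bounded f) auto
    have "AE x in lebesgue. F x = 0"
    proof (rule sigma_finite_measure.density_zero[OF sigma_finite_lebesgue Fi set_integral_zero_all[OF Fi]])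
      show "(LINT x|lebesgue. F x) = 0" unfolding F_def by (rule boxint[OF sub])
      fix c d :: 'a
      obtain u v where uv: "box c d \<inter> box a b = box u v" using box_Int_box by blast
      have "cbox u v \<subseteq> \<Omega>" if "box u v \<noteq> {}"
      proof -
        have "cbox u v = closure (box u v)" using that by (rule closure_box[symmetric])
        also have "\<dots> \<subseteq> closure (box a b)" unfolding uv[symmetric] by (rule closure_mono) simp
        also have "\<dots> \<subseteq> cbox a b" by (simp add: box_subset_cbox closure_minimal closed_cbox)
        finally show ?thesis using sub by simp
      qed
      then have "(LINT x|lebesgue. indicator (box u v) x *\<^sub>R f x) = 0" by (rule boxint)
      moreover have "indicator (box c d) x *\<^sub>R F x = indicator (box u v) x *\<^sub>R f x" for x
        unfolding uv[symmetric] F_def by (simp add: indicator_inter_arith)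
      ultimately show "(LINT x|lebesgue. indicator (box c d) x *\<^sub>R F x) = 0" by simp
    qed
    then show ?thesis by eventually_elim (auto simp: F_def)
  qed
  define a' b' :: "('a \<Rightarrow> real \<times> real) \<Rightarrow> 'a"
    where "a' = (\<lambda>f. \<Sum>i\<in>Basis. fst (f i) *\<^sub>R i)" and "b' = (\<lambda>f. \<Sum>i\<in>Basis. snd (f i) *\<^sub>R i)"
  define I where "I = {f \<in> Basis \<rightarrow>\<^sub>E \<rat> \<times> \<rat>. cbox (a' f) (b' f) \<subseteq> \<Omega>}"
  have Om: "\<Omega> = (\<Union>f\<in>I. cbox (a' f) (b' f))"
    using open_UNION_cbox[OF \<Omega>] unfolding I_def a'_def b'_def .
  have "countable I"
    unfolding I_def
  proof (rule countable_subset)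
    show "countable ((Basis :: 'a set) \<rightarrow>\<^sub>E (\<rat> \<times> \<rat> :: (real \<times> real) set))"
      by (intro countable_PiE countable_SIGMA countable_rat) auto
  qed blast
  moreover have "AE x in lebesgue. x \<in> cbox (a' k) (b' k) \<longrightarrow> f x = 0" if "k \<in> I" for k
  proof -
    have "AE x in lebesgue. x \<in> box (a' k) (b' k) \<longrightarrow> f x = 0" using that by (intro local) (simp add: I_def)
    moreover have "AE x in lebesgue. x \<notin> cbox (a' k) (b' k) - box (a' k) (b' k)"
      using negligible_frontier_interval[of "a' k" "b' k"] negligible_iff_null_sets AE_not_in by blast
    ultimately show ?thesis by eventually_elim auto
  qed
  ultimately have "AE x in lebesgue. \<forall>k\<in>I. x \<in> cbox (a' k) (b' k) \<longrightarrow> f x = 0" by (subst AE_ball_countable) auto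
  then show ?thesis by eventually_elim (use Om in blast)
qed

lemma fundamental_lemma:
  fixes f :: "'a::euclidean_space \<Rightarrow> 'b::euclidean_space"
  assumes \<Omega>: "open \<Omega>" and f: "f \<in> L2 \<Omega>"
    and zero: "\<And>\<phi>. \<phi> \<in> test_funs \<Omega> \<Longrightarrow> (LINT x|lebesgue_on \<Omega>. \<phi> x *\<^sub>R f x) = 0"
  shows "AE x in lebesgue_on \<Omega>. f x = 0"
proof -
  have Om: "\<Omega> \<in> sets lebesgue" using \<Omega> by (simp add: lmeasurable_iff_integrable)
  have "AE x in lebesgue. x \<in> \<Omega> \<longrightarrow> zext \<Omega> f x = 0"
  proof (rule fundamental_lemma_UNIV[OF \<Omega>])
    show "zext \<Omega> f \<in> L2 UNIV" using f zext_L2[OF Om] by blast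
    fix \<phi> :: "'a \<Rightarrow> real" assume \<phi>: "\<phi> \<in> test_funs \<Omega>"
    have "(LINT x|lebesgue. \<phi> x *\<^sub>R zext \<Omega> f x) = (LINT x|lebesgue. (if x \<in> \<Omega> then \<phi> x *\<^sub>R f x else 0))"
      by (rule Bochner_Integration.integral_cong) (auto simp: zext_def)
    also have "\<dots> = (LINT x|lebesgue_on \<Omega>. \<phi> x *\<^sub>R f x)" by (rule Lebesgue_Measure.integral_restrict_UNIV[OF Om])
    finally show "(LINT x|lebesgue. \<phi> x *\<^sub>R zext \<Omega> f x) = 0" using zero[OF \<phi>] by simp
  qed
  then show ?thesis unfolding AE_on_iff[OF Om] by eventually_elim (simp add: zext_def)
qed

section \<open>Integration by parts\<close>

lemma increment_bound:
  fixes f :: "'a::euclidean_space \<Rightarrow> 'b::euclidean_space"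
  assumes diff: "\<And>x. f differentiable (at x)" and C: "\<And>x. norm (pd e f x) \<le> C"
  shows "norm (f (x + s *\<^sub>R e) - f x) \<le> C * \<bar>s\<bar>"
proof -
  have d: "((\<lambda>t. f (x + t *\<^sub>R e)) has_derivative (\<lambda>h. h *\<^sub>R pd e f (x + t *\<^sub>R e))) (at t within UNIV)" for t
  proof -
    have "((\<lambda>t. x + t *\<^sub>R e) has_derivative (\<lambda>h. h *\<^sub>R e)) (at t)" by (auto intro!: derivative_eq_intros)
    from has_derivative_compose[OF this has_derivative_frechet[OF diff]]
    have "((\<lambda>t. f (x + t *\<^sub>R e)) has_derivative (\<lambda>h. pd (h *\<^sub>R e) f (x + t *\<^sub>R e))) (at t)" .
    moreover have "pd (h *\<^sub>R e) f y = h *\<^sub>R pd e f y" for h y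
      by (rule linear_scale[OF bounded_linear.linear[OF has_derivative_bounded_linear[OF has_derivative_frechet[OF diff]]]])
    ultimately show ?thesis by simp
  qed
  have "norm (f (x + s *\<^sub>R e) - f (x + 0 *\<^sub>R e)) \<le> C * norm (s - 0)"
  proof (rule differentiable_bound[OF convex_UNIV d])
    show "onorm (\<lambda>h. h *\<^sub>R pd e f (x + t *\<^sub>R e)) \<le> C" for t
    proof (rule onorm_le)
      show "norm (h *\<^sub>R pd e f (x + t *\<^sub>R e)) \<le> C * norm h" for h
        using mult_right_mono[OF C[of "x + t *\<^sub>R e"], of "\<bar>h\<bar>"] by (simp add: mult.commute)
    qed
  qed auto
  then show ?thesis by simp
qed

text \<open>The mean value theorem bounds the difference quotients by \<open>C\<close>, so dominated convergence applies.\<close>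

lemma difference_quotient_integral:
  fixes f :: "'a::euclidean_space \<Rightarrow> 'b::euclidean_space" and g :: "'a \<Rightarrow> real"
  assumes diff: "\<And>x. f differentiable (at x)" and C: "\<And>x. norm (pd e f x) \<le> C"
    and g: "integrable lebesgue g"
  shows "((\<lambda>s. LINT x|lebesgue. g x *\<^sub>R ((f (x + s *\<^sub>R e) - f x) /\<^sub>R s)) \<longlongrightarrow> (LINT x|lebesgue. g x *\<^sub>R pd e f x)) (at 0)"
  unfolding tendsto_at_iff_sequentially o_def
proof (intro allI impI)
  fix X :: "nat \<Rightarrow> real" assume X0: "\<forall>i. X i \<in> UNIV - {0}" and X: "X \<longlonglongrightarrow> 0"
  have fc: "continuous_on UNIV f"
    using differentiable_imp_continuous_within[OF diff] by (simp add: continuous_at_imp_continuous_on)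
  have meas: "(\<lambda>x. (f (x + s *\<^sub>R e) - f x) /\<^sub>R s) \<in> borel_measurable lebesgue" for s
  proof -
    have "continuous_on UNIV (\<lambda>x. f (x + s *\<^sub>R e))"
      by (rule continuous_on_compose2[OF fc]) (auto intro!: continuous_intros)
    then have "continuous_on UNIV (\<lambda>x. (f (x + s *\<^sub>R e) - f x) /\<^sub>R s)"
      by (intro continuous_intros fc)
    then have "(\<lambda>x. (f (x + s *\<^sub>R e) - f x) /\<^sub>R s) \<in> borel_measurable lborel"
      using borel_measurable_continuous_onI by simp
    then show ?thesis by (rule measurable_completion)
  qed
  have lim: "(\<lambda>i. (f (x + X i *\<^sub>R e) - f x) /\<^sub>R X i) \<longlonglongrightarrow> pd e f x" for x
  proof -
    have "((\<lambda>t. x + t *\<^sub>R e) has_derivative (\<lambda>h. h *\<^sub>R e)) (at 0)" by (auto intro!: derivative_eq_intros)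
    moreover have "(f has_derivative (\<lambda>b. pd b f x)) (at (x + 0 *\<^sub>R e))" using has_derivative_frechet[OF diff] by simp
    ultimately have "((\<lambda>t. f (x + t *\<^sub>R e)) has_derivative (\<lambda>h. pd (h *\<^sub>R e) f x)) (at 0)"
      by (rule has_derivative_compose)
    moreover have "pd (h *\<^sub>R e) f x = h *\<^sub>R pd e f x" for h
      by (rule linear_scale[OF bounded_linear.linear[OF has_derivative_bounded_linear[OF has_derivative_frechet[OF diff]]]])
    ultimately have "((\<lambda>t. f (x + t *\<^sub>R e)) has_vector_derivative pd e f x) (at 0)"
      by (simp add: has_vector_derivative_def)
    then have "((\<lambda>t. norm (f (x + (0 + t) *\<^sub>R e) - f (x + 0 *\<^sub>R e) - t *\<^sub>R pd e f x) / norm t) \<longlongrightarrow> 0) (at 0)"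
      unfolding has_vector_derivative_def has_derivative_at by blast
    then have "((\<lambda>t. norm ((f (x + t *\<^sub>R e) - f x) /\<^sub>R t - pd e f x)) \<longlongrightarrow> 0) (at 0)"
    proof (rule Lim_transform_eventually)
      show "\<forall>\<^sub>F t in at 0. norm (f (x + (0 + t) *\<^sub>R e) - f (x + 0 *\<^sub>R e) - t *\<^sub>R pd e f x) / norm t
          = norm ((f (x + t *\<^sub>R e) - f x) /\<^sub>R t - pd e f x)"
        unfolding eventually_at_filter
      proof (rule always_eventually, intro allI impI)
        fix t :: real assume t: "t \<noteq> 0"
        then have "(f (x + t *\<^sub>R e) - f x) /\<^sub>R t - pd e f x = (f (x + t *\<^sub>R e) - f x - t *\<^sub>R pd e f x) /\<^sub>R t"
          by (simp add: scaleR_diff_right)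
        then show "norm (f (x + (0 + t) *\<^sub>R e) - f (x + 0 *\<^sub>R e) - t *\<^sub>R pd e f x) / norm t
            = norm ((f (x + t *\<^sub>R e) - f x) /\<^sub>R t - pd e f x)"
          by (simp add: divide_inverse_commute del: scaleR_diff_right)
      qed
    qed
    then have "((\<lambda>t. (f (x + t *\<^sub>R e) - f x) /\<^sub>R t) \<longlongrightarrow> pd e f x) (at 0)"
      by (rule tendsto_norm_zero_cancel[THEN Lim_null[THEN iffD2]])
    then show ?thesis using X X0 by (simp add: tendsto_at_iff_sequentially o_def)
  qed
  show "(\<lambda>i. LINT x|lebesgue. g x *\<^sub>R ((f (x + X i *\<^sub>R e) - f x) /\<^sub>R X i)) \<longlonglongrightarrow> (LINT x|lebesgue. g x *\<^sub>R pd e f x)"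
  proof (rule integral_dominated_convergence[where w="\<lambda>x. C * norm (g x)"])
    have gm: "g \<in> borel_measurable lebesgue" using g by auto
    show "(\<lambda>x. g x *\<^sub>R ((f (x + X i *\<^sub>R e) - f x) /\<^sub>R X i)) \<in> borel_measurable lebesgue" for i
      by (intro borel_measurable_scaleR gm meas)
    have "pd e f \<in> borel_measurable lebesgue" by (rule borel_measurable_LIMSEQ_metric[OF meas lim])
    then show "(\<lambda>x. g x *\<^sub>R pd e f x) \<in> borel_measurable lebesgue"
      by (intro borel_measurable_scaleR gm)
    show "integrable lebesgue (\<lambda>x. C * norm (g x))" using g by simp
    show "AE x in lebesgue. (\<lambda>i. g x *\<^sub>R ((f (x + X i *\<^sub>R e) - f x) /\<^sub>R X i)) \<longlonglongrightarrow> g x *\<^sub>R pd e f x"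
      by (intro AE_I2 tendsto_intros lim)
    show "AE x in lebesgue. norm (g x *\<^sub>R ((f (x + X i *\<^sub>R e) - f x) /\<^sub>R X i)) \<le> C * norm (g x)" for i
    proof (rule AE_I2)
      fix x
      have "norm ((f (x + X i *\<^sub>R e) - f x) /\<^sub>R X i) \<le> C"
      proof -
        have "norm ((f (x + X i *\<^sub>R e) - f x) /\<^sub>R X i) = norm (f (x + X i *\<^sub>R e) - f x) / \<bar>X i\<bar>"
          by (simp only: norm_scaleR abs_inverse divide_inverse_commute)
        also have "\<dots> \<le> C"
          using increment_bound[OF diff C, of x "X i"] X0[rule_format, of i] by (subst pos_divide_le_eq) auto
        finally show ?thesis .
      qed
      then show "norm (g x *\<^sub>R ((f (x + X i *\<^sub>R e) - f x) /\<^sub>R X i)) \<le> C * norm (g x)"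
        by (metis mult.commute mult_left_mono norm_ge_zero norm_scaleR real_norm_def)
    qed
  qed
qed

lemma integral_translation:
  fixes f :: "'a::euclidean_space \<Rightarrow> 'b::euclidean_space"
  assumes "continuous_on UNIV f"
  shows "(LINT x|lebesgue. f (x + c)) = (LINT x|lebesgue. f x)"
proof -
  have fm: "f \<in> borel_measurable borel" using assms by (rule borel_measurable_continuous_onI)
  have "(LINT x|lborel. f x) = (LINT x|distr lborel borel ((+) c). f x)" by (simp add: lborel_distr_plus)
  also have "\<dots> = (LINT x|lborel. f (c + x))" by (rule integral_distr) (use fm in auto)
  finally have "(LINT x|lborel. f (x + c)) = (LINT x|lborel. f x)" by (simp add: add.commute)
  moreover have "(\<lambda>x. f (x + c)) \<in> borel_measurable borel" using fm by measurable
  ultimately show ?thesis using fm by (simp add: integral_completion)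
qed

text \<open>The integrals of the difference quotients vanish by translation invariance. The indicator function of a large ball is inserted
  as an integrable weight.\<close>

lemma integral_pd_zero:
  fixes f :: "'a::euclidean_space \<Rightarrow> 'b::euclidean_space"
  assumes diff: "\<And>x. f differentiable (at x)" and cont: "continuous_on UNIV (pd e f)"
    and K: "compact K" "\<And>x. x \<notin> K \<Longrightarrow> f x = 0" "\<And>x. x \<notin> K \<Longrightarrow> pd e f x = 0"
  shows "(LINT x|lebesgue. pd e f x) = 0"
proof -
  have fc: "continuous_on UNIV f"
    using differentiable_imp_continuous_within[OF diff] by (simp add: continuous_at_imp_continuous_on)
  obtain C where C: "C \<ge> 0" "\<And>x. norm (pd e f x) \<le> C"
    using continuous_compact_bounded[OF cont K(1) K(3)] by metis
  obtain R where R: "\<And>x. x \<in> K \<Longrightarrow> norm x \<le> R" using compact_imp_bounded[OF K(1)] bounded_iff by blast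
  define B where "B = cball (0::'a) (R + norm e)"
  define g :: "'a \<Rightarrow> real" where "g = indicator B"
  have gi: "integrable lebesgue g" unfolding g_def B_def by (rule lmeasurable_iff_integrable[THEN iffD1, OF lmeasurable_cball])
  have KB: "x \<in> B" if "x \<in> K" for x using R[OF that] by (simp add: B_def add_increasing2)
  have zero: "(LINT x|lebesgue. g x *\<^sub>R ((f (x + s *\<^sub>R e) - f x) /\<^sub>R s)) = 0" if s: "\<bar>s\<bar> < 1" for s
  proof -
    have sh: "x \<in> B" if "x + s *\<^sub>R e \<in> K" for x
    proof -
      have "norm x \<le> norm (x + s *\<^sub>R e) + norm (s *\<^sub>R e)" by (metis add_diff_cancel norm_triangle_ineq4)
      also have "norm (s *\<^sub>R e) \<le> 1 * norm e" unfolding norm_scaleR using s by (intro mult_right_mono) auto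
      finally have "norm x \<le> norm (x + s *\<^sub>R e) + norm e" by simp
      then show ?thesis using R[OF that] by (simp add: B_def)
    qed
    have e1: "g x *\<^sub>R ((f (x + s *\<^sub>R e) - f x) /\<^sub>R s) = (f (x + s *\<^sub>R e) - f x) /\<^sub>R s" for x
    proof (cases "x \<in> B")
      case False
      then have "x \<notin> K" "x + s *\<^sub>R e \<notin> K" using KB sh by auto
      then show ?thesis by (simp add: K(2))
    qed (simp add: g_def)
    have i1: "integrable lebesgue f" by (rule compact_support_integrable[OF fc K(1) K(2)])
    have i2: "integrable lebesgue (\<lambda>x. f (x + s *\<^sub>R e))"
    proof (rule compact_support_integrable[where K="(\<lambda>x. x - s *\<^sub>R e) ` K"])
      show "continuous_on UNIV (\<lambda>x. f (x + s *\<^sub>R e))"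
        by (rule continuous_on_compose2[OF fc]) (auto intro!: continuous_intros)
      show "compact ((\<lambda>x. x - s *\<^sub>R e) ` K)" by (intro compact_continuous_image continuous_intros K(1))
      show "f (x + s *\<^sub>R e) = 0" if "x \<notin> (\<lambda>x. x - s *\<^sub>R e) ` K" for x
        using that K(2)[of "x + s *\<^sub>R e"] by (force simp: image_iff)
    qed
    have "(LINT x|lebesgue. g x *\<^sub>R ((f (x + s *\<^sub>R e) - f x) /\<^sub>R s)) = (LINT x|lebesgue. (f (x + s *\<^sub>R e) - f x) /\<^sub>R s)"
      by (simp only: e1)
    also have "\<dots> = (LINT x|lebesgue. f (x + s *\<^sub>R e) - f x) /\<^sub>R s" by (rule integral_scaleR_right)
    also have "\<dots> = 0"
      using Bochner_Integration.integral_diff[OF i2 i1] integral_translation[OF fc, of "s *\<^sub>R e"] by simp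
    finally show ?thesis .
  qed
  have "((\<lambda>s. LINT x|lebesgue. g x *\<^sub>R ((f (x + s *\<^sub>R e) - f x) /\<^sub>R s)) \<longlongrightarrow> (LINT x|lebesgue. g x *\<^sub>R pd e f x)) (at 0)"
    by (rule difference_quotient_integral[OF diff C(2) gi])
  moreover have "((\<lambda>s. LINT x|lebesgue. g x *\<^sub>R ((f (x + s *\<^sub>R e) - f x) /\<^sub>R s)) \<longlongrightarrow> 0) (at 0)"
    by (rule tendsto_eventually) (use zero in \<open>auto simp: eventually_at dist_real_def intro!: exI[of _ 1]\<close>)
  ultimately have "(LINT x|lebesgue. g x *\<^sub>R pd e f x) = 0" using tendsto_unique trivial_limit_at by blast
  moreover have "g x *\<^sub>R pd e f x = pd e f x" for x
    using KB[of x] K(3)[of x] by (cases "x \<in> B") (auto simp: g_def)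
  ultimately show ?thesis by simp
qed

text \<open>For a general product, since scalar multiplication and inner products are both needed.\<close>

lemma integration_by_parts_test:
  fixes \<phi> :: "'a::euclidean_space \<Rightarrow> 'b::euclidean_space" and \<psi> :: "'a \<Rightarrow> 'c::euclidean_space"
    and h :: "'b \<Rightarrow> 'c \<Rightarrow> 'd::euclidean_space"
  assumes h: "bounded_bilinear h" and \<phi>: "smooth_on UNIV \<phi>" and \<psi>: "\<psi> \<in> test_funs \<Omega>" and e: "e \<in> Basis"
  shows "(LINT x|lebesgue. h (pd e \<phi> x) (\<psi> x)) = - (LINT x|lebesgue. h (\<phi> x) (pd e \<psi> x))"
proof -
  interpret h: bounded_bilinear h by (rule h)
  obtain K where K: "compact K" "\<And>x. x \<notin> K \<Longrightarrow> \<psi> x = 0" "\<And>b x. x \<notin> K \<Longrightarrow> pd b \<psi> x = 0"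
    using test_support[OF \<psi>] by blast
  have d: "((\<lambda>x. h (\<phi> x) (\<psi> x)) has_derivative (\<lambda>b. h (\<phi> x) (pd b \<psi> x) + h (pd b \<phi> x) (\<psi> x))) (at x)" for x
    by (intro h.FDERIV smooth_has_derivative \<phi> test_smooth[OF \<psi>])
  have pd: "pd e (\<lambda>x. h (\<phi> x) (\<psi> x)) = (\<lambda>x. h (\<phi> x) (pd e \<psi> x) + h (pd e \<phi> x) (\<psi> x))"
    by (rule ext, rule pd_eqI[OF d])
  have c: "continuous_on UNIV \<phi>" "continuous_on UNIV (pd e \<phi>)" "continuous_on UNIV \<psi>" "continuous_on UNIV (pd e \<psi>)"
    using smooth_continuous \<phi> smooth_pd[OF \<phi> e] test_smooth[OF \<psi>] smooth_pd[OF test_smooth[OF \<psi>] e] by auto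
  have "(LINT x|lebesgue. pd e (\<lambda>x. h (\<phi> x) (\<psi> x)) x) = 0"
  proof (rule integral_pd_zero[OF _ _ K(1)])
    show "(\<lambda>x. h (\<phi> x) (\<psi> x)) differentiable (at x)" for x using d by (rule differentiableI)
    show "continuous_on UNIV (pd e (\<lambda>x. h (\<phi> x) (\<psi> x)))" unfolding pd by (intro continuous_intros h.continuous_on c)
  qed (use K in \<open>auto simp: pd h.zero_right\<close>)
  moreover have "integrable lebesgue (\<lambda>x. h (\<phi> x) (pd e \<psi> x))" "integrable lebesgue (\<lambda>x. h (pd e \<phi> x) (\<psi> x))"
    by (rule compact_support_integrable[OF _ K(1)]; use K c in \<open>auto intro!: h.continuous_on simp: h.zero_right\<close>)+
  ultimately show ?thesis unfolding pd by (simp add: eq_neg_iff_add_eq_0 add.commute)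
qed

text \<open>Two integrations by parts would need the symmetry of second derivatives. Here \<open>pd i f\<close> is replaced by a difference
  quotient while the derivative in direction \<open>j\<close> is moved from \<open>g\<close> to \<open>f\<close>.\<close>

lemma cross_derivatives:
  fixes f g :: "'a::euclidean_space \<Rightarrow> real"
  assumes f: "f \<in> test_funs UNIV" and g: "g \<in> test_funs UNIV" and ij: "i \<in> Basis" "j \<in> Basis"
  shows "(LINT x|lebesgue. pd i f x * pd j g x) = (LINT x|lebesgue. pd j f x * pd i g x)"
proof -
  have int: "integrable lebesgue h" if "h \<in> test_funs UNIV" for h :: "'a \<Rightarrow> real"
    using test_support[OF that] compact_support_integrable[OF test_continuous[OF that]] by blast
  have intm: "integrable lebesgue (\<lambda>x. h x * k x)" if h: "h \<in> test_funs UNIV" and k: "k \<in> test_funs UNIV" for h k :: "'a \<Rightarrow> real"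
  proof -
    obtain K where K: "compact K" "\<And>x. x \<notin> K \<Longrightarrow> h x = 0" using test_support[OF h] by blast
    show ?thesis
      by (rule compact_support_integrable[OF _ K(1)]) (use K in \<open>auto intro!: continuous_intros test_continuous[OF h] test_continuous[OF k]\<close>)
  qed
  define D where "D h s x = (h (x + s *\<^sub>R i) - h x) / s" for h :: "'a \<Rightarrow> real" and s x
  have lim: "((\<lambda>s. LINT x|lebesgue. k x * D h s x) \<longlongrightarrow> (LINT x|lebesgue. k x * pd i h x)) (at 0)"
    if h: "h \<in> test_funs UNIV" and k: "k \<in> test_funs UNIV" for h k
  proof -
    obtain C where "\<And>x. norm (pd i h x) \<le> C" using test_bounded[OF test_pd[OF h ij(1)]] by metis
    from difference_quotient_integral[OF smooth_differentiable[OF test_smooth[OF h]] this int[OF k]]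
    show ?thesis by (simp add: D_def divide_inverse_commute)
  qed
  have eq: "(LINT x|lebesgue. pd j g x * D f s x) = - (LINT x|lebesgue. g x * D (pd j f) s x)" for s
  proof -
    have sh: "(LINT x|lebesgue. pd j g x * f (x + c)) = - (LINT x|lebesgue. g x * pd j f (x + c))" for c
      using integration_by_parts_test[OF bounded_bilinear_mult test_smooth[OF g] test_translate[OF f, of c] ij(2)]
      by (simp add: pd_translate[OF test_smooth[OF f]])
    have t1: "integrable lebesgue (\<lambda>x. pd j g x * f (x + c))" for c
      by (rule intm[OF test_pd[OF g ij(2)] test_translate[OF f]])
    have t2: "integrable lebesgue (\<lambda>x. g x * pd j f (x + c))" for c
      by (rule intm[OF g test_translate[OF test_pd[OF f ij(2)]]])
    have "(LINT x|lebesgue. pd j g x * D f s x) = (LINT x|lebesgue. (pd j g x * f (x + s *\<^sub>R i) - pd j g x * f (x + 0)) / s)"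
      by (simp add: D_def right_diff_distrib)
    also have "\<dots> = ((LINT x|lebesgue. pd j g x * f (x + s *\<^sub>R i)) - (LINT x|lebesgue. pd j g x * f (x + 0))) / s"
      using Bochner_Integration.integral_diff[OF t1[of "s *\<^sub>R i"] t1[of 0]] by simp
    also have "\<dots> = - (((LINT x|lebesgue. g x * pd j f (x + s *\<^sub>R i)) - (LINT x|lebesgue. g x * pd j f (x + 0))) / s)"
      unfolding sh by (simp add: diff_divide_distrib)
    also have "\<dots> = - (LINT x|lebesgue. (g x * pd j f (x + s *\<^sub>R i) - g x * pd j f (x + 0)) / s)"
      using Bochner_Integration.integral_diff[OF t2[of "s *\<^sub>R i"] t2[of 0]] by simp
    also have "\<dots> = - (LINT x|lebesgue. g x * D (pd j f) s x)" by (simp add: D_def right_diff_distrib)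
    finally show ?thesis .
  qed
  have "((\<lambda>s. LINT x|lebesgue. pd j g x * D f s x) \<longlongrightarrow> - (LINT x|lebesgue. g x * pd i (pd j f) x)) (at 0)"
    unfolding eq by (intro tendsto_minus lim g test_pd[OF f ij(2)])
  then have "(LINT x|lebesgue. pd j g x * pd i f x) = - (LINT x|lebesgue. g x * pd i (pd j f) x)"
    using lim[OF f test_pd[OF g ij(2)]] tendsto_unique trivial_limit_at by blast
  also have "\<dots> = (LINT x|lebesgue. pd i g x * pd j f x)"
    using integration_by_parts_test[OF bounded_bilinear_mult test_smooth[OF g] test_pd[OF f ij(2)] ij(1)] by simp
  finally show ?thesis by (simp add: mult.commute)
qed

text \<open>The integral of \<open>g\<close> against a translate of a test function along \<open>e\<close> does not depend on the translation; and
  it is zero once the test function has been moved off the support of \<open>g\<close>.\<close>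

lemma weak_directional_derivative_zero:
  fixes g :: "'a::euclidean_space \<Rightarrow> real"
  assumes g: "g \<in> L2 UNIV" and bd: "bounded S" "\<And>x. x \<notin> S \<Longrightarrow> g x = 0"
    and e: "e \<in> Basis"
    and zero: "\<And>\<phi>. \<phi> \<in> test_funs UNIV \<Longrightarrow> (LINT x|lebesgue. g x * pd e \<phi> x) = 0"
  shows "AE x in lebesgue. g x = 0"
proof -
  obtain R where R: "\<And>x. x \<in> S \<Longrightarrow> norm x \<le> R" using bd(1) bounded_iff by blast
  have "integrable lebesgue (\<lambda>x. indicator (cball 0 R) x *\<^sub>R g x)"
    by (rule L2_integrable_bounded[OF g]) simp
  note cut = this
  have e1: "indicator (cball 0 R) x *\<^sub>R g x = g x" for x
    using bd(2)[of x] R[of x] by (cases "x \<in> S") (auto simp: indicator_def)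
  have gi: "integrable lebesgue g" using cut by (simp only: e1)
  have "(LINT x|lebesgue. \<phi> x *\<^sub>R g x) = 0" if \<phi>: "\<phi> \<in> test_funs UNIV" for \<phi>
  proof -
    define h where "h s = (LINT x|lebesgue. g x * \<phi> (x + s *\<^sub>R e))" for s
    obtain M where M: "\<And>x. norm (\<phi> x) \<le> M" using test_bounded[OF \<phi>] by metis
    obtain C where C: "\<And>x. norm (pd e \<phi> x) \<le> C" using test_bounded[OF test_pd[OF \<phi> e]] by metis
    have gint: "integrable lebesgue (\<lambda>x. g x * \<phi> (x + c))" for c
    proof (rule Bochner_Integration.integrable_bound[where f="\<lambda>x. M * g x"])
      show "(\<lambda>x. g x * \<phi> (x + c)) \<in> borel_measurable lebesgue"
        using gi test_measurable[OF test_translate[OF \<phi>, of c]] by (intro borel_measurable_times) auto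
      show "AE x in lebesgue. norm (g x * \<phi> (x + c)) \<le> norm (M * g x)"
      proof (rule AE_I2)
        fix x
        have "\<bar>\<phi> (x + c)\<bar> \<le> \<bar>M\<bar>" using M[of "x + c"] by simp
        then show "norm (g x * \<phi> (x + c)) \<le> norm (M * g x)"
          using mult_right_mono[of "\<bar>\<phi> (x + c)\<bar>" "\<bar>M\<bar>" "\<bar>g x\<bar>"] by (simp add: abs_mult mult.commute)
      qed
    qed (use gi in simp)
    have "(h has_real_derivative 0) (at s)" for s
    proof -
      define \<psi> where "\<psi> x = \<phi> (x + s *\<^sub>R e)" for x
      have \<psi>: "\<psi> \<in> test_funs UNIV" unfolding \<psi>_def[abs_def] by (rule test_translate[OF \<phi>])
      have "norm (pd e \<psi> x) \<le> C" for x
        unfolding \<psi>_def[abs_def] pd_translate[OF test_smooth[OF \<phi>]] by (rule C)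
      from difference_quotient_integral[OF smooth_differentiable[OF test_smooth[OF \<psi>]] this gi]
      have "((\<lambda>r. LINT x|lebesgue. g x * ((\<psi> (x + r *\<^sub>R e) - \<psi> x) / r)) \<longlongrightarrow> 0) (at 0)"
        using zero[OF \<psi>] by (simp add: divide_inverse_commute)
      moreover have "(LINT x|lebesgue. g x * ((\<psi> (x + r *\<^sub>R e) - \<psi> x) / r)) = (h (s + r) - h s) / r" for r
      proof -
        have "(LINT x|lebesgue. g x * ((\<psi> (x + r *\<^sub>R e) - \<psi> x) / r))
            = (LINT x|lebesgue. (g x * \<phi> (x + (s + r) *\<^sub>R e) - g x * \<phi> (x + s *\<^sub>R e)) / r)"
          by (rule Bochner_Integration.integral_cong) (simp_all add: \<psi>_def algebra_simps diff_divide_distrib)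
        also have "\<dots> = (h (s + r) - h s) / r"
          unfolding h_def using Bochner_Integration.integral_diff[OF gint gint] by simp
        finally show ?thesis .
      qed
      ultimately show ?thesis by (simp only: DERIV_def)
    qed
    then have const: "h 0 = h s" for s by (rule DERIV_isconst_all[rule_format])
    obtain K where K: "compact K" "\<And>x. x \<notin> K \<Longrightarrow> \<phi> x = 0" using test_support[OF \<phi>] by blast
    obtain L where L: "\<And>x. x \<in> K \<Longrightarrow> norm x \<le> L" using compact_imp_bounded[OF K(1)] bounded_iff by blast
    define s where "s = \<bar>R\<bar> + \<bar>L\<bar> + 1"
    have gz: "g x * \<phi> (x + s *\<^sub>R e) = 0" for x
    proof (cases "x \<in> S")
      case True
      have "x + s *\<^sub>R e \<notin> K"
      proof
        assume "x + s *\<^sub>R e \<in> K"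
        then have "norm (x + s *\<^sub>R e) \<le> L" by (rule L)
        moreover have "norm (s *\<^sub>R e) \<le> norm (x + s *\<^sub>R e) + norm x" by (metis add_diff_cancel_left' norm_triangle_ineq4)
        moreover have "norm (s *\<^sub>R e) = s" using e by (simp add: s_def)
        ultimately show False using R[OF True] s_def by linarith
      qed
      then show ?thesis using K(2) by simp
    qed (use bd(2) in simp)
    have "h s = 0" unfolding h_def by (simp only: gz Bochner_Integration.integral_zero)
    then show ?thesis using const[of s] by (simp add: h_def mult.commute)
  qed
  then have "AE x in lebesgue. x \<in> UNIV \<longrightarrow> g x = 0" by (intro fundamental_lemma_UNIV[OF open_UNIV g])
  then show ?thesis by simp
qed

section \<open>First order differential operators and their spaces\<close>

text \<open>Gradient, divergence and curl all have the form \<open>\<Sum>j. T\<^sub>j \<partial>\<^sub>j\<close> with constant linear maps \<open>T\<^sub>j\<close>. Treating this form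
  once, in the sense of distributions (\<open>dop\<close>) and for smooth fields (\<open>sop\<close>), covers \<open>H\<^sub>0\<^sup>1\<close> and \<open>H\<^sub>0(Curl)\<close> alike.\<close>

definition dop :: "(3 \<Rightarrow> 'b::real_vector \<Rightarrow> 'c::real_vector) \<Rightarrow> 'b distribution \<Rightarrow> 'c distribution" where
  "dop T D = (\<lambda>\<phi>. \<Sum>j\<in>UNIV. T j (dpd j D \<phi>))"

definition sop :: "(3 \<Rightarrow> 'b::real_normed_vector \<Rightarrow> 'c::real_vector) \<Rightarrow> (vec3 \<Rightarrow> 'b) \<Rightarrow> vec3 \<Rightarrow> 'c" where
  "sop T \<psi> x = (\<Sum>j\<in>UNIV. T j (pd (axis j 1) \<psi> x))"

lemma axis_Basis: "axis j (1::real) \<in> Basis"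
  by (simp add: axis_in_Basis_iff)

lemma zext_id: "(\<And>x. x \<notin> \<Omega> \<Longrightarrow> f x = 0) \<Longrightarrow> zext \<Omega> f = f"
  by (auto simp: zext_def)

lemma open_lebesgue: "open \<Omega> \<Longrightarrow> \<Omega> \<in> sets lebesgue"
  by simp

lemma test_outside: "\<phi> \<in> test_funs \<Omega> \<Longrightarrow> x \<notin> \<Omega> \<Longrightarrow> \<phi> x = 0"
  using test_support by blast

lemma test_cls: "\<psi> \<in> test_funs \<Omega> \<Longrightarrow> cls \<Omega> \<psi> = abs_l2 \<psi>"
  unfolding cls_def by (subst zext_id) (auto dest: test_outside)

lemma test_L2_on: "open \<Omega> \<Longrightarrow> \<psi> \<in> test_funs \<Omega>' \<Longrightarrow> \<psi> \<in> L2 \<Omega>"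
  for \<psi> :: "'a::euclidean_space \<Rightarrow> 'b::euclidean_space"
  by (rule L2_subset[OF open_lebesgue test_L2])

lemma test_mult_integrable:
  fixes f :: "vec3 \<Rightarrow> 'd::euclidean_space"
  assumes op: "open \<Omega>" and f: "f \<in> L2 \<Omega>" and \<phi>: "\<phi> \<in> test_funs \<Omega>"
  shows "integrable (lebesgue_on \<Omega>) (\<lambda>x. \<phi> x *\<^sub>R f x)"
proof (rule Bochner_Integration.integrable_bound)
  have \<phi>L: "\<phi> \<in> L2 \<Omega>" by (rule test_L2_on[OF op \<phi>])
  show "integrable (lebesgue_on \<Omega>) (\<lambda>x. (norm (\<phi> x))\<^sup>2 + (norm (f x))\<^sup>2)"
    using L2_integrable[OF \<phi>L] L2_integrable[OF f] by (rule Bochner_Integration.integrable_add)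
  show "(\<lambda>x. \<phi> x *\<^sub>R f x) \<in> borel_measurable (lebesgue_on \<Omega>)"
    using L2_measurable[OF \<phi>L] L2_measurable[OF f] by (rule borel_measurable_scaleR)
  have "norm (\<phi> x *\<^sub>R f x) \<le> (norm (\<phi> x))\<^sup>2 + (norm (f x))\<^sup>2" for x
    using sum_squares_bound[of "norm (\<phi> x)" "norm (f x)"] mult_nonneg_nonneg[OF norm_ge_zero[of "\<phi> x"] norm_ge_zero[of "f x"]]
    unfolding norm_scaleR real_norm_def by linarith
  then show "AE x in lebesgue_on \<Omega>. norm (\<phi> x *\<^sub>R f x) \<le> norm ((norm (\<phi> x))\<^sup>2 + (norm (f x))\<^sup>2)"
    by (intro AE_I2) simp
qed

lemma test_sum:
  "finite I \<Longrightarrow> (\<And>i. i \<in> I \<Longrightarrow> f i \<in> test_funs \<Omega>) \<Longrightarrow> (\<lambda>x. \<Sum>i\<in>I. f i x) \<in> test_funs \<Omega>"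
  by (induction I rule: finite_induct) (auto intro: test_zero test_add)

lemma test_scaleR: "\<psi> \<in> test_funs \<Omega> \<Longrightarrow> (\<lambda>x. r *\<^sub>R \<psi> x) \<in> test_funs \<Omega>"
  by (rule test_linear[OF _ bounded_linear_scaleR_right])

lemma test_vec: "\<phi> \<in> test_funs \<Omega> \<Longrightarrow> (\<lambda>x. \<phi> x *\<^sub>R c) \<in> test_funs \<Omega>"
  by (rule test_linear[OF _ bounded_linear_scaleR_left])

lemma test_inner: "\<psi> \<in> test_funs \<Omega> \<Longrightarrow> (\<lambda>x. \<psi> x \<bullet> c) \<in> test_funs \<Omega>"
  by (rule test_linear[OF _ bounded_linear_inner_left])

text \<open>With \<open>T'\<close> the pointwise adjoint of \<open>T\<close>, the formal adjoint of the operator is \<open>- (\<Sum>j. T'\<^sub>j \<partial>\<^sub>j)\<close>.\<close>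

locale diff_op =
  fixes \<Omega> :: "vec3 set" and T :: "3 \<Rightarrow> 'b::euclidean_space \<Rightarrow> 'c::euclidean_space" and T' :: "3 \<Rightarrow> 'c \<Rightarrow> 'b"
  assumes op: "open \<Omega>" and lin: "\<And>j. bounded_linear (T j)" and lin': "\<And>j. bounded_linear (T' j)"
    and adj: "\<And>j x y. T j x \<bullet> y = x \<bullet> T' j y"
begin

lemmas Om = open_lebesgue[OF op]

lemma sop_test: "\<psi> \<in> test_funs S \<Longrightarrow> sop T \<psi> \<in> test_funs S"
  unfolding sop_def[abs_def] by (intro test_sum test_linear[OF test_pd lin] axis_Basis) auto

lemma sop'_test: "\<psi> \<in> test_funs S \<Longrightarrow> sop T' \<psi> \<in> test_funs S"
  unfolding sop_def[abs_def] by (intro test_sum test_linear[OF test_pd lin'] axis_Basis) auto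

lemma sop_add: "\<phi> \<in> test_funs S \<Longrightarrow> \<psi> \<in> test_funs S \<Longrightarrow> sop T (\<lambda>x. \<phi> x + \<psi> x) x = sop T \<phi> x + sop T \<psi> x"
  by (simp add: sop_def pd_add[OF test_smooth test_smooth] linear_add[OF bounded_linear.linear[OF lin]] sum.distrib)

lemma sop_scaleR: "\<psi> \<in> test_funs S \<Longrightarrow> sop T (\<lambda>x. r *\<^sub>R \<psi> x) x = r *\<^sub>R sop T \<psi> x"
  by (simp add: sop_def pd_linear[OF bounded_linear_scaleR_right test_smooth]
      linear_scale[OF bounded_linear.linear[OF lin]] scaleR_right.sum)

lemma regular_dist_inner:
  fixes b :: "'d::euclidean_space"
  assumes f: "f \<in> L2 \<Omega>" and \<phi>: "\<phi> \<in> test_funs \<Omega>"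
  shows "regular_dist \<Omega> f \<phi> \<bullet> b = cls \<Omega> f \<bullet> cls \<Omega> (\<lambda>x. \<phi> x *\<^sub>R b)"
proof -
  have b: "(\<lambda>x. \<phi> x *\<^sub>R b) \<in> L2 \<Omega>" for b :: 'd by (rule test_L2_on[OF op test_vec[OF \<phi>]])
  have "regular_dist \<Omega> f \<phi> \<bullet> b = (LINT x|lebesgue_on \<Omega>. (\<phi> x *\<^sub>R f x) \<bullet> b)"
    unfolding regular_dist_def using test_mult_integrable[OF op f \<phi>] by (intro integral_inner_left[symmetric])
  also have "\<dots> = (LINT x|lebesgue_on \<Omega>. f x \<bullet> (\<phi> x *\<^sub>R b))" by (simp add: inner_commute)
  also have "\<dots> = cls \<Omega> f \<bullet> cls \<Omega> (\<lambda>x. \<phi> x *\<^sub>R b)" by (rule cls_inner[OF Om f b, symmetric])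
  finally show ?thesis .
qed

lemma cls_sum:
  "finite I \<Longrightarrow> (\<And>i. i \<in> I \<Longrightarrow> f i \<in> L2 \<Omega>) \<Longrightarrow>
    (\<lambda>x. \<Sum>i\<in>I. f i x) \<in> L2 \<Omega> \<and> cls \<Omega> (\<lambda>x. \<Sum>i\<in>I. f i x) = (\<Sum>i\<in>I. cls \<Omega> (f i))"
  by (induction I rule: finite_induct) (auto simp: cls_zero[OF Om] cls_add[OF Om] intro: L2_add)

lemma dop_inner:
  assumes f: "f \<in> L2 \<Omega>" and \<phi>: "\<phi> \<in> test_funs \<Omega>"
  shows "dop T (regular_dist \<Omega> f) \<phi> \<bullet> c = - (cls \<Omega> f \<bullet> cls \<Omega> (sop T' (\<lambda>x. \<phi> x *\<^sub>R c)))"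
proof -
  have pd: "pd (axis j 1) \<phi> \<in> test_funs \<Omega>" for j by (rule test_pd[OF \<phi> axis_Basis])
  have pdv: "pd (axis j 1) (\<lambda>x. \<phi> x *\<^sub>R c) x = pd (axis j 1) \<phi> x *\<^sub>R c" for j x
    by (simp add: pd_linear[OF bounded_linear_scaleR_left test_smooth[OF \<phi>]])
  have "dop T (regular_dist \<Omega> f) \<phi> \<bullet> c = (\<Sum>j\<in>UNIV. - (regular_dist \<Omega> f (pd (axis j 1) \<phi>) \<bullet> T' j c))"
    unfolding dop_def dpd_def inner_sum_left adj by simp
  also have "\<dots> = - (\<Sum>j\<in>UNIV. cls \<Omega> f \<bullet> cls \<Omega> (\<lambda>x. pd (axis j 1) \<phi> x *\<^sub>R T' j c))"
    unfolding sum_negf regular_dist_inner[OF f pd] ..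
  also have "\<dots> = - (cls \<Omega> f \<bullet> (\<Sum>j\<in>UNIV. cls \<Omega> (\<lambda>x. pd (axis j 1) \<phi> x *\<^sub>R T' j c)))"
    by (simp add: inner_sum_right)
  also have "(\<Sum>j\<in>UNIV. cls \<Omega> (\<lambda>x. pd (axis j 1) \<phi> x *\<^sub>R T' j c)) = cls \<Omega> (sop T' (\<lambda>x. \<phi> x *\<^sub>R c))"
    unfolding sop_def[abs_def] pdv linear_scale[OF bounded_linear.linear[OF lin']]
    by (rule conjunct2[OF cls_sum, symmetric]) (auto intro: test_L2_on[OF op test_vec[OF pd]])
  finally show ?thesis .
qed

text \<open>Weak derivatives in terms of inner products with vector valued test fields. Distributions act on scalar test functions; the two kinds of tests
  are related by expansion in a basis.\<close>

lemma represents_iff: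
  assumes f: "f \<in> L2 \<Omega>" and g: "g \<in> L2 \<Omega>"
  shows "represents \<Omega> g (dop T (regular_dist \<Omega> f)) \<longleftrightarrow>
    (\<forall>\<psi>\<in>test_funs \<Omega>. cls \<Omega> g \<bullet> cls \<Omega> \<psi> = - (cls \<Omega> f \<bullet> cls \<Omega> (sop T' \<psi>)))"
proof
  assume rep: "represents \<Omega> g (dop T (regular_dist \<Omega> f))"
  have basic: "cls \<Omega> g \<bullet> cls \<Omega> (\<lambda>x. \<phi> x *\<^sub>R c) = - (cls \<Omega> f \<bullet> cls \<Omega> (sop T' (\<lambda>x. \<phi> x *\<^sub>R c)))"
    if \<phi>: "\<phi> \<in> test_funs \<Omega>" for \<phi> c
    using rep \<phi> dop_inner[OF f \<phi>, of c] regular_dist_inner[OF g \<phi>, of c] unfolding represents_def by simp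
  show "\<forall>\<psi>\<in>test_funs \<Omega>. cls \<Omega> g \<bullet> cls \<Omega> \<psi> = - (cls \<Omega> f \<bullet> cls \<Omega> (sop T' \<psi>))"
  proof
    fix \<psi> :: "vec3 \<Rightarrow> 'c" assume \<psi>: "\<psi> \<in> test_funs \<Omega>"
    define \<psi>c where "\<psi>c c x = (\<psi> x \<bullet> c) *\<^sub>R c" for c x
    have t: "\<psi>c c \<in> test_funs \<Omega>" for c unfolding \<psi>c_def[abs_def] by (intro test_vec test_inner \<psi>)
    have e: "\<psi> x = (\<Sum>c\<in>Basis. \<psi>c c x)" for x by (simp add: \<psi>c_def euclidean_representation)
    have "cls \<Omega> \<psi> = cls \<Omega> (\<lambda>x. \<Sum>c\<in>Basis. \<psi>c c x)" by (rule arg_cong[of _ _ "cls \<Omega>"]) (rule ext, rule e)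
    also have "\<dots> = (\<Sum>c\<in>Basis. cls \<Omega> (\<psi>c c))" using cls_sum[of Basis \<psi>c] test_L2_on[OF op t] by auto
    finally have 1: "cls \<Omega> \<psi> = (\<Sum>c\<in>Basis. cls \<Omega> (\<psi>c c))" .
    have "sop T' \<psi> x = (\<Sum>c\<in>Basis. sop T' (\<psi>c c) x)" for x
    proof -
      have "pd b (\<psi>c c) x = (pd b \<psi> x \<bullet> c) *\<^sub>R c" for b c
        unfolding \<psi>c_def[abs_def]
        using pd_linear[OF bounded_linear_compose[OF bounded_linear_scaleR_left[of c] bounded_linear_inner_left[of c]] test_smooth[OF \<psi>], of b]
        by simp
      then have "(\<Sum>c\<in>Basis. sop T' (\<psi>c c) x) = (\<Sum>j\<in>UNIV. \<Sum>c\<in>Basis. T' j ((pd (axis j 1) \<psi> x \<bullet> c) *\<^sub>R c))"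
        unfolding sop_def by (subst sum.swap) simp
      also have "\<dots> = (\<Sum>j\<in>UNIV. T' j (\<Sum>c\<in>Basis. (pd (axis j 1) \<psi> x \<bullet> c) *\<^sub>R c))"
        by (simp add: linear_sum[OF bounded_linear.linear[OF lin']])
      finally show ?thesis by (simp add: euclidean_representation sop_def)
    qed
    then have "cls \<Omega> (sop T' \<psi>) = cls \<Omega> (\<lambda>x. \<Sum>c\<in>Basis. sop T' (\<psi>c c) x)"
      by (intro arg_cong[of _ _ "cls \<Omega>"] ext)
    also have "\<dots> = (\<Sum>c\<in>Basis. cls \<Omega> (sop T' (\<psi>c c)))"
      using cls_sum[of Basis "\<lambda>c. sop T' (\<psi>c c)"] test_L2_on[OF op sop'_test[OF t]] by auto
    finally have 2: "cls \<Omega> (sop T' \<psi>) = (\<Sum>c\<in>Basis. cls \<Omega> (sop T' (\<psi>c c)))" .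
    have "cls \<Omega> g \<bullet> cls \<Omega> (\<psi>c c) = - (cls \<Omega> f \<bullet> cls \<Omega> (sop T' (\<psi>c c)))" for c
      unfolding \<psi>c_def[abs_def] by (rule basic[OF test_inner[OF \<psi>]])
    then show "cls \<Omega> g \<bullet> cls \<Omega> \<psi> = - (cls \<Omega> f \<bullet> cls \<Omega> (sop T' \<psi>))"
      unfolding 1 2 inner_sum_right by (simp add: sum_negf)
  qed
next
  assume w: "\<forall>\<psi>\<in>test_funs \<Omega>. cls \<Omega> g \<bullet> cls \<Omega> \<psi> = - (cls \<Omega> f \<bullet> cls \<Omega> (sop T' \<psi>))"
  show "represents \<Omega> g (dop T (regular_dist \<Omega> f))"
    unfolding represents_def
  proof
    fix \<phi> :: "vec3 \<Rightarrow> real" assume \<phi>: "\<phi> \<in> test_funs \<Omega>"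
    have "dop T (regular_dist \<Omega> f) \<phi> \<bullet> c = regular_dist \<Omega> g \<phi> \<bullet> c" for c
      using dop_inner[OF f \<phi>, of c] regular_dist_inner[OF g \<phi>, of c] w test_vec[OF \<phi>, of c] by simp
    then show "dop T (regular_dist \<Omega> f) \<phi> = regular_dist \<Omega> g \<phi>"
      by (simp add: euclidean_eq_iff[of _ "regular_dist \<Omega> g \<phi>"])
  qed
qed

lemma represents_unique:
  fixes g g' :: "vec3 \<Rightarrow> 'd::euclidean_space"
  assumes g: "g \<in> L2 \<Omega>" "g' \<in> L2 \<Omega>" and rep: "represents \<Omega> g D" "represents \<Omega> g' D"
  shows "AE x in lebesgue_on \<Omega>. g x = g' x"
proof -
  have "AE x in lebesgue_on \<Omega>. g x - g' x = 0"
  proof (rule fundamental_lemma[OF op L2_diff[OF g]])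
    fix \<phi> :: "vec3 \<Rightarrow> real" assume \<phi>: "\<phi> \<in> test_funs \<Omega>"
    have "regular_dist \<Omega> (\<lambda>x. g x - g' x) \<phi> \<bullet> b = 0" for b
    proof -
      have "regular_dist \<Omega> (\<lambda>x. g x - g' x) \<phi> \<bullet> b = regular_dist \<Omega> g \<phi> \<bullet> b - regular_dist \<Omega> g' \<phi> \<bullet> b"
        unfolding regular_dist_inner[OF L2_diff[OF g] \<phi>] regular_dist_inner[OF g(1) \<phi>] regular_dist_inner[OF g(2) \<phi>]
          cls_diff[OF Om g] by (simp add: inner_diff_left)
      also have "\<dots> = 0" using rep \<phi> by (simp add: represents_def)
      finally show ?thesis .
    qed
    then have "regular_dist \<Omega> (\<lambda>x. g x - g' x) \<phi> = 0" by (metis inner_eq_zero_iff)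
    then show "(LINT x|lebesgue_on \<Omega>. \<phi> x *\<^sub>R (g x - g' x)) = 0" by (simp add: regular_dist_def)
  qed
  then show ?thesis by simp
qed

text \<open>The assumption \<open>cls \<Omega> (rep Y) = Y\<close> makes \<open>Y\<close> vanish outside \<open>\<Omega>\<close>, where the test functions see nothing.\<close>

lemma test_total:
  fixes Y :: "(vec3, 'd::euclidean_space) l2"
  assumes Y: "cls \<Omega> (rep Y) = Y" and zero: "\<And>\<psi>. \<psi> \<in> test_funs \<Omega> \<Longrightarrow> Y \<bullet> cls \<Omega> \<psi> = 0"
  shows "Y = 0"
proof -
  have L: "rep Y \<in> L2 \<Omega>" by (rule rep_L2_on[OF Om])
  have "AE x in lebesgue_on \<Omega>. rep Y x = 0"
  proof (rule fundamental_lemma[OF op L])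
    fix \<phi> :: "vec3 \<Rightarrow> real" assume \<phi>: "\<phi> \<in> test_funs \<Omega>"
    have "regular_dist \<Omega> (rep Y) \<phi> \<bullet> b = 0" for b
      unfolding regular_dist_inner[OF L \<phi>] Y by (rule zero[OF test_vec[OF \<phi>]])
    then have "regular_dist \<Omega> (rep Y) \<phi> = 0" by (metis inner_eq_zero_iff)
    then show "(LINT x|lebesgue_on \<Omega>. \<phi> x *\<^sub>R rep Y x) = 0" by (simp add: regular_dist_def)
  qed
  then have "cls \<Omega> (rep Y) = cls \<Omega> (\<lambda>x. 0)" by (subst cls_eq_iff[OF Om L]) auto
  then show ?thesis using Y cls_zero[OF Om, where ?'b='d] by simp
qed

lemma green_test:
  assumes \<psi>: "\<psi> \<in> test_funs S" and \<eta>: "\<eta> \<in> test_funs S'"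
  shows "abs_l2 (sop T \<psi>) \<bullet> abs_l2 \<eta> = - (abs_l2 \<psi> \<bullet> abs_l2 (sop T' \<eta>))"
proof -
  note L = test_L2
  have T\<psi>: "(\<lambda>x. T j (\<psi> x)) \<in> test_funs S" for j by (rule test_linear[OF \<psi> lin])
  have pT: "T j (pd b \<psi> x) = pd b (\<lambda>x. T j (\<psi> x)) x" for j b x
    by (simp add: pd_linear[OF lin test_smooth[OF \<psi>]])
  have i1: "integrable lebesgue (\<lambda>x. pd (axis j 1) (\<lambda>x. T j (\<psi> x)) x \<bullet> \<eta> x)" for j
    using L2_inner_integrable[OF L[OF test_pd[OF T\<psi> axis_Basis]] L[OF \<eta>]] by (simp add: lebesgue_on_UNIV_eq)
  have i2: "integrable lebesgue (\<lambda>x. T j (\<psi> x) \<bullet> pd (axis j 1) \<eta> x)" for j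
    using L2_inner_integrable[OF L[OF T\<psi>] L[OF test_pd[OF \<eta> axis_Basis]]] by (simp add: lebesgue_on_UNIV_eq)
  have "abs_l2 (sop T \<psi>) \<bullet> abs_l2 \<eta> = (LINT x|lebesgue. sop T \<psi> x \<bullet> \<eta> x)"
    by (rule abs_inner[OF L[OF sop_test[OF \<psi>]] L[OF \<eta>]])
  also have "\<dots> = (LINT x|lebesgue. (\<Sum>j\<in>UNIV. pd (axis j 1) (\<lambda>x. T j (\<psi> x)) x \<bullet> \<eta> x))"
    by (simp add: sop_def inner_sum_left pT)
  also have "\<dots> = (\<Sum>j\<in>UNIV. LINT x|lebesgue. pd (axis j 1) (\<lambda>x. T j (\<psi> x)) x \<bullet> \<eta> x)"
    by (rule Bochner_Integration.integral_sum) (rule i1)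
  also have "\<dots> = (\<Sum>j\<in>UNIV. - (LINT x|lebesgue. T j (\<psi> x) \<bullet> pd (axis j 1) \<eta> x))"
    by (intro sum.cong refl integration_by_parts_test[OF bounded_bilinear_inner test_smooth[OF T\<psi>] \<eta> axis_Basis])
  also have "\<dots> = - (LINT x|lebesgue. (\<Sum>j\<in>UNIV. T j (\<psi> x) \<bullet> pd (axis j 1) \<eta> x))"
    unfolding sum_negf by (subst Bochner_Integration.integral_sum) (auto intro: i2)
  also have "\<dots> = - (LINT x|lebesgue. \<psi> x \<bullet> sop T' \<eta> x)"
    by (simp add: sop_def inner_sum_right adj)
  also have "(LINT x|lebesgue. \<psi> x \<bullet> sop T' \<eta> x) = abs_l2 \<psi> \<bullet> abs_l2 (sop T' \<eta>)"
    by (rule abs_inner[OF L[OF \<psi>] L[OF sop'_test[OF \<eta>]], symmetric])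
  finally show ?thesis .
qed

definition emb :: "(vec3 \<Rightarrow> 'b) \<Rightarrow> (vec3, 'b) l2 \<times> (vec3, 'c) l2" where
  "emb \<psi> = (cls \<Omega> \<psi>, cls \<Omega> (sop T \<psi>))"

text \<open>The space \<open>H\<^sub>0\<close> of the operator, with the derivative recorded next to the field. As a closed subspace of a product of Hilbert
  spaces it inherits completeness and the graph norm.\<close>

definition W0 :: "((vec3, 'b) l2 \<times> (vec3, 'c) l2) set" where
  "W0 = closure (emb ` test_funs \<Omega>)"

lemma emb_W0: "\<psi> \<in> test_funs \<Omega> \<Longrightarrow> emb \<psi> \<in> W0"
  unfolding W0_def by (rule subsetD[OF closure_subset imageI])

lemma closed_W0: "closed W0" by (simp add: W0_def)

lemma subspace_W0: "subspace W0"
  unfolding W0_def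
proof (rule subspace_closure, rule subspaceI)
  note L = test_L2_on[OF op]
  have "emb (\<lambda>x. 0) = 0"
  proof -
    have "sop T (\<lambda>x. 0) = (\<lambda>x. 0)"
      by (rule ext) (use sop_scaleR[OF test_zero[of \<Omega>], of 0] in simp)
    then show ?thesis by (simp add: emb_def cls_zero[OF Om] zero_prod_def)
  qed
  then show "0 \<in> emb ` test_funs \<Omega>" using test_zero by (metis image_eqI)
  fix x y assume "x \<in> emb ` test_funs \<Omega>" "y \<in> emb ` test_funs \<Omega>"
  then obtain \<phi> \<psi> where p: "\<phi> \<in> test_funs \<Omega>" "x = emb \<phi>" "\<psi> \<in> test_funs \<Omega>" "y = emb \<psi>" by auto
  have "sop T (\<lambda>x. \<phi> x + \<psi> x) = (\<lambda>x. sop T \<phi> x + sop T \<psi> x)" by (rule ext) (rule sop_add[OF p(1,3)])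
  then have "x + y = emb (\<lambda>x. \<phi> x + \<psi> x)"
    unfolding p emb_def using cls_add[OF Om L[OF p(1)] L[OF p(3)]] cls_add[OF Om L[OF sop_test[OF p(1)]] L[OF sop_test[OF p(3)]]] by simp
  then show "x + y \<in> emb ` test_funs \<Omega>" using test_add[OF p(1,3)] by blast
  show "r *\<^sub>R x \<in> emb ` test_funs \<Omega>" for r
  proof -
    have "sop T (\<lambda>x. r *\<^sub>R \<phi> x) = (\<lambda>x. r *\<^sub>R sop T \<phi> x)" by (rule ext) (rule sop_scaleR[OF p(1)])
    then have "r *\<^sub>R x = emb (\<lambda>x. r *\<^sub>R \<phi> x)"
      unfolding p emb_def using cls_scaleR[OF Om L[OF p(1)]] cls_scaleR[OF Om L[OF sop_test[OF p(1)]]] by simp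
    then show ?thesis using test_scaleR[OF p(1)] by blast
  qed
qed

lemma W0_closed_property:
  assumes "p \<in> W0" "closed {p. P p}" "\<And>\<psi>. \<psi> \<in> test_funs \<Omega> \<Longrightarrow> P (emb \<psi>)"
  shows "P p"
proof -
  have "W0 \<subseteq> {p. P p}" unfolding W0_def using assms(2,3) by (intro closure_minimal) auto
  then show ?thesis using assms(1) by blast
qed

text \<open>The test field \<open>\<eta>\<close> may be any test field on the whole space: an element of \<open>W0\<close> is a limit of test fields on \<open>\<Omega>\<close>, so extension
  by zero commutes with the operator. This is how the boundary condition enters.\<close>

lemma W0_green:
  assumes "(u, G) \<in> W0" and \<eta>: "\<eta> \<in> test_funs S"
  shows "G \<bullet> abs_l2 \<eta> = - (u \<bullet> abs_l2 (sop T' \<eta>))"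
proof -
  have "(\<lambda>p. snd p \<bullet> abs_l2 \<eta> = - (fst p \<bullet> abs_l2 (sop T' \<eta>))) (u, G)"
  proof (rule W0_closed_property[OF assms(1)])
    show "closed {p. snd p \<bullet> abs_l2 \<eta> = - (fst p \<bullet> abs_l2 (sop T' \<eta>))}"
      by (intro closed_Collect_eq continuous_intros)
    fix \<psi> :: "vec3 \<Rightarrow> 'b" assume \<psi>: "\<psi> \<in> test_funs \<Omega>"
    show "snd (emb \<psi>) \<bullet> abs_l2 \<eta> = - (fst (emb \<psi>) \<bullet> abs_l2 (sop T' \<eta>))"
      using green_test[OF \<psi> \<eta>] by (simp add: emb_def test_cls[OF \<psi>] test_cls[OF sop_test[OF \<psi>]])
  qed
  then show ?thesis by simp
qed

lemma bounded_linear_restrict: "bounded_linear (\<lambda>F :: (vec3, 'd::euclidean_space) l2. cls \<Omega> (rep F))"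
  using bounded_linear_mul[OF Om, of "\<lambda>x y. y" 1] unfolding mul_def[abs_def]
  by (simp add: op_field_def linear_iff)

lemma W0_restrict: assumes "(u, G) \<in> W0" shows "cls \<Omega> (rep u) = u" "cls \<Omega> (rep G) = G"
proof -
  have "(\<lambda>p. cls \<Omega> (rep (fst p)) = fst p \<and> cls \<Omega> (rep (snd p)) = snd p) (u, G)"
  proof (rule W0_closed_property[OF assms])
    show "closed {p :: (vec3, 'b) l2 \<times> (vec3, 'c) l2. cls \<Omega> (rep (fst p)) = fst p \<and> cls \<Omega> (rep (snd p)) = snd p}"
      by (intro closed_Collect_conj closed_Collect_eq continuous_intros bounded_linear.continuous_on[OF bounded_linear_restrict])
    fix \<psi> :: "vec3 \<Rightarrow> 'b" assume \<psi>: "\<psi> \<in> test_funs \<Omega>"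
    show "cls \<Omega> (rep (fst (emb \<psi>))) = fst (emb \<psi>) \<and> cls \<Omega> (rep (snd (emb \<psi>))) = snd (emb \<psi>)"
      using cls_rep_cls[OF Om test_L2_on[OF op \<psi>]] cls_rep_cls[OF Om test_L2_on[OF op sop_test[OF \<psi>]]]
      by (simp add: emb_def)
  qed
  then show "cls \<Omega> (rep u) = u" "cls \<Omega> (rep G) = G" by auto
qed

lemma W0_represents:
  assumes u: "u \<in> L2 \<Omega>" and W: "(cls \<Omega> u, G) \<in> W0"
  shows "represents \<Omega> (rep G) (dop T (regular_dist \<Omega> u))"
  unfolding represents_iff[OF u rep_L2_on[OF Om]] W0_restrict[OF W]
  using W0_green[OF W] by (auto simp: test_cls test_cls[OF sop'_test])

lemma W0_unique:
  assumes W: "(u, G) \<in> W0" "(u, G') \<in> W0" shows "G = G'"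
proof -
  have "(0, G - G') \<in> W0" using subspace_diff[OF subspace_W0 W] by simp
  then have "G - G' = 0"
  proof (intro test_total[OF W0_restrict(2)])
    fix \<psi> :: "vec3 \<Rightarrow> 'c" assume \<psi>: "\<psi> \<in> test_funs \<Omega>" and "(0, G - G') \<in> W0"
    then show "(G - G') \<bullet> cls \<Omega> \<psi> = 0" using W0_green[of 0 "G - G'" \<psi>] by (simp add: test_cls)
  qed
  then show ?thesis by simp
qed

text \<open>The common form of \<open>H1_0\<close> and \<open>HCurl_0\<close>.\<close>

definition H0 :: "(vec3 \<Rightarrow> 'b) set" where
  "H0 = {u \<in> L2 \<Omega>. in_L2 \<Omega> (dop T (regular_dist \<Omega> u)) \<and>
     (\<forall>\<epsilon>>0. \<exists>\<phi>\<in>test_funs \<Omega>. sqrt ((L2_norm \<Omega> (\<lambda>x. u x - \<phi> x))\<^sup>2 +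
        (L2_norm \<Omega> (L2_density \<Omega> (dop T (regular_dist \<Omega> (\<lambda>x. u x - \<phi> x)))))\<^sup>2) < \<epsilon>)}"

abbreviation dens :: "(vec3 \<Rightarrow> 'b) \<Rightarrow> vec3 \<Rightarrow> 'c" where
  "dens u \<equiv> L2_density \<Omega> (dop T (regular_dist \<Omega> u))"

lemma dens:
  assumes "in_L2 \<Omega> (dop T (regular_dist \<Omega> u))"
  shows "dens u \<in> L2 \<Omega>" "represents \<Omega> (dens u) (dop T (regular_dist \<Omega> u))"
proof -
  have "dens u \<in> L2 \<Omega> \<and> represents \<Omega> (dens u) (dop T (regular_dist \<Omega> u))"
    unfolding L2_density_def
    by (rule someI_ex[of "\<lambda>f. f \<in> L2 \<Omega> \<and> represents \<Omega> f (dop T (regular_dist \<Omega> u))"])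
      (use assms in \<open>auto simp: in_L2_def\<close>)
  then show "dens u \<in> L2 \<Omega>" "represents \<Omega> (dens u) (dop T (regular_dist \<Omega> u))" by auto
qed

lemma cls_dens:
  assumes "g \<in> L2 \<Omega>" "represents \<Omega> g (dop T (regular_dist \<Omega> u))"
  shows "dens u \<in> L2 \<Omega>" "cls \<Omega> (dens u) = cls \<Omega> g"
proof -
  have i: "in_L2 \<Omega> (dop T (regular_dist \<Omega> u))" using assms by (auto simp: in_L2_def)
  show "dens u \<in> L2 \<Omega>" by (rule dens(1)[OF i])
  then show "cls \<Omega> (dens u) = cls \<Omega> g"
    using represents_unique[OF dens(1)[OF i] assms(1) dens(2)[OF i] assms(2)] assms(1) by (subst cls_eq_iff[OF Om])
qed

text \<open>The norm in the definition of \<open>H0\<close> is the distance in the product space, so that closures in the two norms agree.\<close>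

lemma dens_diff_test:
  assumes u: "u \<in> L2 \<Omega>" "in_L2 \<Omega> (dop T (regular_dist \<Omega> u))" and \<phi>: "\<phi> \<in> test_funs \<Omega>"
  shows "(L2_norm \<Omega> (\<lambda>x. u x - \<phi> x))\<^sup>2 + (L2_norm \<Omega> (dens (\<lambda>x. u x - \<phi> x)))\<^sup>2
    = (norm ((cls \<Omega> u, cls \<Omega> (dens u)) - emb \<phi>))\<^sup>2"
proof -
  have \<phi>L: "\<phi> \<in> L2 \<Omega>" "sop T \<phi> \<in> L2 \<Omega>" using test_L2_on[OF op] \<phi> sop_test by auto
  have dL: "(\<lambda>x. u x - \<phi> x) \<in> L2 \<Omega>" "(\<lambda>x. dens u x - sop T \<phi> x) \<in> L2 \<Omega>"
    using L2_diff u \<phi>L dens by auto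
  have "represents \<Omega> (\<lambda>x. dens u x - sop T \<phi> x) (dop T (regular_dist \<Omega> (\<lambda>x. u x - \<phi> x)))"
    unfolding represents_iff[OF dL]
  proof
    fix \<psi> :: "vec3 \<Rightarrow> 'c" assume \<psi>: "\<psi> \<in> test_funs \<Omega>"
    have "cls \<Omega> (dens u) \<bullet> cls \<Omega> \<psi> = - (cls \<Omega> u \<bullet> cls \<Omega> (sop T' \<psi>))"
      using dens(2)[OF u(2)] \<psi> unfolding represents_iff[OF u(1) dens(1)[OF u(2)]] by blast
    moreover have "cls \<Omega> (sop T \<phi>) \<bullet> cls \<Omega> \<psi> = - (cls \<Omega> \<phi> \<bullet> cls \<Omega> (sop T' \<psi>))"
      using W0_green[OF emb_W0[OF \<phi>, unfolded emb_def] \<psi>] by (simp add: test_cls[OF \<psi>] test_cls[OF sop'_test[OF \<psi>]])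
    ultimately show "cls \<Omega> (\<lambda>x. dens u x - sop T \<phi> x) \<bullet> cls \<Omega> \<psi> = - (cls \<Omega> (\<lambda>x. u x - \<phi> x) \<bullet> cls \<Omega> (sop T' \<psi>))"
      by (simp add: cls_diff[OF Om dens(1)[OF u(2)] \<phi>L(2)] cls_diff[OF Om u(1) \<phi>L(1)] inner_diff_left)
  qed
  from cls_dens[OF dL(2) this]
  have "(L2_norm \<Omega> (dens (\<lambda>x. u x - \<phi> x)))\<^sup>2 = (norm (cls \<Omega> (dens u) - cls \<Omega> (sop T \<phi>)))\<^sup>2"
    using cls_norm[OF Om, symmetric] by (metis cls_diff[OF Om dens(1)[OF u(2)] \<phi>L(2)])
  moreover have "(L2_norm \<Omega> (\<lambda>x. u x - \<phi> x))\<^sup>2 = (norm (cls \<Omega> u - cls \<Omega> \<phi>))\<^sup>2"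
    using cls_norm[OF Om dL(1)] by (simp add: cls_diff[OF Om u(1) \<phi>L(1)])
  ultimately show ?thesis by (simp add: emb_def norm_prod_def)
qed

lemma H0_iff: "u \<in> H0 \<longleftrightarrow> u \<in> L2 \<Omega> \<and> (\<exists>G. (cls \<Omega> u, G) \<in> W0)"
  and H0_dens: "u \<in> H0 \<Longrightarrow> dens u \<in> L2 \<Omega>" "u \<in> H0 \<Longrightarrow> (cls \<Omega> u, cls \<Omega> (dens u)) \<in> W0"
proof -
  show 1: "dens u \<in> L2 \<Omega>" if "u \<in> H0" for u using dens that by (auto simp: H0_def)
  show 2: "(cls \<Omega> u, cls \<Omega> (dens u)) \<in> W0" if u: "u \<in> H0" for u
    unfolding W0_def closure_approachable
  proof (intro allI impI)
    fix \<epsilon> :: real assume "\<epsilon> > 0"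
    then obtain \<phi> where \<phi>: "\<phi> \<in> test_funs \<Omega>"
      "sqrt ((L2_norm \<Omega> (\<lambda>x. u x - \<phi> x))\<^sup>2 + (L2_norm \<Omega> (dens (\<lambda>x. u x - \<phi> x)))\<^sup>2) < \<epsilon>"
      using u unfolding H0_def by blast
    have "norm ((cls \<Omega> u, cls \<Omega> (dens u)) - emb \<phi>) < \<epsilon>"
      using \<phi>(2) dens_diff_test[OF _ _ \<phi>(1), of u] u by (simp add: H0_def)
    then show "\<exists>y\<in>emb ` test_funs \<Omega>. dist y (cls \<Omega> u, cls \<Omega> (dens u)) < \<epsilon>"
      using \<phi>(1) by (auto simp: dist_norm norm_minus_commute)
  qed
  show "u \<in> H0 \<longleftrightarrow> u \<in> L2 \<Omega> \<and> (\<exists>G. (cls \<Omega> u, G) \<in> W0)"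
  proof
    assume "u \<in> H0" then show "u \<in> L2 \<Omega> \<and> (\<exists>G. (cls \<Omega> u, G) \<in> W0)" using 2 by (auto simp: H0_def)
  next
    assume "u \<in> L2 \<Omega> \<and> (\<exists>G. (cls \<Omega> u, G) \<in> W0)"
    then obtain G where u: "u \<in> L2 \<Omega>" and G: "(cls \<Omega> u, G) \<in> W0" by blast
    note rep = W0_represents[OF u G]
    have i: "in_L2 \<Omega> (dop T (regular_dist \<Omega> u))" using rep rep_L2_on[OF Om] by (auto simp: in_L2_def)
    have "cls \<Omega> (dens u) = G" using cls_dens(2)[OF rep_L2_on[OF Om] rep] W0_restrict(2)[OF G] by simp
    then have cl: "(cls \<Omega> u, cls \<Omega> (dens u)) \<in> closure (emb ` test_funs \<Omega>)" using G by (simp add: W0_def)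
    have "\<exists>\<phi>\<in>test_funs \<Omega>. sqrt ((L2_norm \<Omega> (\<lambda>x. u x - \<phi> x))\<^sup>2 + (L2_norm \<Omega> (dens (\<lambda>x. u x - \<phi> x)))\<^sup>2) < \<epsilon>"
      if e: "\<epsilon> > 0" for \<epsilon>
    proof -
      obtain \<phi> where "\<phi> \<in> test_funs \<Omega>" "dist (emb \<phi>) (cls \<Omega> u, cls \<Omega> (dens u)) < \<epsilon>"
        using cl e unfolding closure_approachable by blast
      then show ?thesis using dens_diff_test[OF u i] by (intro bexI[of _ \<phi>]) (auto simp: dist_norm norm_minus_commute)
    qed
    then show "u \<in> H0" using u i by (simp add: H0_def)
  qed
qed

end

section \<open>Gradient, divergence and curl\<close>

definition gradT :: "3 \<Rightarrow> vec3 \<Rightarrow> mat3" where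
  "gradT j v = (\<chi> i k. if k = j then v $ i else 0)"

definition divT :: "3 \<Rightarrow> mat3 \<Rightarrow> vec3" where
  "divT j X = (\<chi> i. X $ i $ j)"

definition curlT :: "3 \<Rightarrow> mat3 \<Rightarrow> mat3" where
  "curlT j X = (\<chi> i. vector
     [(if j = 2 then X $ i $ 3 else 0) - (if j = 3 then X $ i $ 2 else 0),
      (if j = 3 then X $ i $ 1 else 0) - (if j = 1 then X $ i $ 3 else 0),
      (if j = 1 then X $ i $ 2 else 0) - (if j = 2 then X $ i $ 1 else 0)])"

lemma dGrad_eq: "dGrad = dop gradT"
  by (simp add: fun_eq_iff dGrad_def dop_def gradT_def vec_eq_iff)

lemma dDiv_eq: "dDiv = dop divT"
  by (simp add: fun_eq_iff dDiv_def dop_def divT_def vec_eq_iff)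

lemma dCurl_eq: "dCurl = dop curlT"
  by (simp add: fun_eq_iff dCurl_def dop_def curlT_def vec_eq_iff forall_3 sum_3)

lemma linear_gradT: "bounded_linear (gradT j)"
  by (intro linear_conv_bounded_linear[THEN iffD1] linearI) (auto simp: gradT_def vec_eq_iff)

lemma linear_divT: "bounded_linear (divT j)"
  by (intro linear_conv_bounded_linear[THEN iffD1] linearI) (auto simp: divT_def vec_eq_iff)

lemma linear_curlT: "bounded_linear (curlT j)"
  by (intro linear_conv_bounded_linear[THEN iffD1] linearI)
    (auto simp: curlT_def vec_eq_iff forall_3 algebra_simps)

lemma grad_div_adjoint: "gradT j v \<bullet> X = v \<bullet> divT j X"
proof -
  have "(\<Sum>k\<in>UNIV. (if k = j then v $ i else 0) * X $ i $ k) = v $ i * X $ i $ j" for i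
  proof -
    have "(\<Sum>k\<in>UNIV. (if k = j then v $ i else 0) * X $ i $ k) = (\<Sum>k\<in>UNIV. if k = j then v $ i * X $ i $ k else 0)"
      by (rule sum.cong) auto
    then show ?thesis by simp
  qed
  then show ?thesis by (simp add: gradT_def divT_def inner_vec_def)
qed

lemma curl_adjoint: "curlT j X \<bullet> Y = - (X \<bullet> curlT j Y)"
proof -
  have "j = 1 \<or> j = 2 \<or> j = 3" using exhaust_3 by blast
  then show ?thesis
    by (elim disjE) (simp_all add: curlT_def inner_vec_def sum_3 algebra_simps)
qed

lemma diff_op_grad: "open \<Omega> \<Longrightarrow> diff_op \<Omega> gradT divT"
  by (intro diff_op.intro linear_gradT linear_divT grad_div_adjoint)

lemma diff_op_div: "open \<Omega> \<Longrightarrow> diff_op \<Omega> divT gradT"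
  by (intro diff_op.intro linear_gradT linear_divT)
    (simp_all add: inner_commute[of "divT _ _"] grad_div_adjoint[symmetric] inner_commute[of "gradT _ _"])

lemma diff_op_curl: "open \<Omega> \<Longrightarrow> diff_op \<Omega> curlT (\<lambda>j X. - curlT j X)"
  by (intro diff_op.intro linear_curlT bounded_linear_minus) (simp_all add: curl_adjoint)

lemma H1_0_eq: "open \<Omega> \<Longrightarrow> H1_0 \<Omega> = diff_op.H0 \<Omega> gradT"
  by (subst diff_op.H0_def[OF diff_op_grad]) (auto simp: H1_0_def H1_def H1_norm_def Grad_def dGrad_eq)

lemma HCurl_0_eq: "open \<Omega> \<Longrightarrow> HCurl_0 \<Omega> = diff_op.H0 \<Omega> curlT"
  by (subst diff_op.H0_def[OF diff_op_curl]) (auto simp: HCurl_0_def HCurl_def HCurl_norm_def Curl_def dCurl_eq)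

section \<open>Symmetric parts and Korn's inequality\<close>

lemma sym_part_linear: "linear sym_part"
  by (rule linearI) (auto simp: sym_part_def transpose_def vec_eq_iff algebra_simps)

lemma inner_transpose: "transpose X \<bullet> Y = X \<bullet> transpose Y" for X Y :: mat3
  unfolding inner_vec_def transpose_def by (simp add: sum_3)

lemma norm_transpose_mat3: "norm (transpose X) = norm X" for X :: mat3
  by (simp add: norm_eq_sqrt_inner inner_transpose)

lemma norm_sym_part: "(norm (sym_part X))\<^sup>2 = (norm X)\<^sup>2 / 2 + (X \<bullet> transpose X) / 2"
proof -
  have "(norm (X + transpose X))\<^sup>2 = (norm X)\<^sup>2 + 2 * (X \<bullet> transpose X) + (norm (transpose X))\<^sup>2"
    unfolding dot_square_norm[symmetric] by (simp add: inner_add_left inner_add_right inner_commute)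
  then show ?thesis by (simp add: sym_part_def power_mult_distrib norm_transpose_mat3 power2_eq_square)
qed

lemma norm_sym_part_le: "norm (sym_part X) \<le> norm X"
proof -
  have "norm (sym_part X) \<le> (1/2) * (norm X + norm (transpose X))"
    unfolding sym_part_def norm_scaleR using norm_triangle_ineq[of X "transpose X"] by simp
  then show ?thesis by (simp add: norm_transpose_mat3)
qed

lemma sym_part_Sym3: "sym_part X \<in> Sym3"
  by (simp add: Sym3_def sym_part_def transpose_def vec_eq_iff add.commute)

lemma inner_sym_part: "X \<in> Sym3 \<Longrightarrow> X \<bullet> sym_part Y = X \<bullet> Y"
  using inner_transpose[of X Y] by (simp add: sym_part_def Sym3_def inner_add_right)

lemma op_field_sym: "op_field \<Omega> (\<lambda>x. sym_part) 1"
  by (simp add: op_field_def sym_part_linear norm_sym_part_le)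

definition symL :: "vec3 set \<Rightarrow> (vec3, mat3) l2 \<Rightarrow> (vec3, mat3) l2" where
  "symL \<Omega> = mul \<Omega> (\<lambda>x. sym_part)"

text \<open>Twice the squared norm of \<open>sym(\<nabla>\<psi>)\<close> exceeds that of \<open>\<nabla>\<psi>\<close> by the integral of \<open>\<Sum>i k. \<partial>\<^sub>k \<psi>\<^sub>i \<partial>\<^sub>i \<psi>\<^sub>k\<close>. Exchanging the
  derivatives turns this into the integral of \<open>(div \<psi>)\<^sup>2\<close>, which is nonnegative.\<close>

lemma korn_test:
  assumes \<psi>: "\<psi> \<in> test_funs UNIV"
  shows "(LINT x|lebesgue. (norm (sop gradT \<psi> x))\<^sup>2) \<le> 2 * (LINT x|lebesgue. (norm (sym_part (sop gradT \<psi> x)))\<^sup>2)"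
proof -
  interpret grad: diff_op UNIV gradT divT by (rule diff_op_grad) simp
  define D where "D k i = pd (axis k 1) (\<lambda>x. \<psi> x $ i)" for k i :: 3
  have comp: "(\<lambda>x. \<psi> x $ i) \<in> test_funs UNIV" for i
    using test_linear[OF \<psi> bounded_linear_vec_nth[of i]] .
  have Dt: "D k i \<in> test_funs UNIV" for k i unfolding D_def by (rule test_pd[OF comp axis_Basis])
  have sop: "sop gradT \<psi> x $ i $ k = D k i x" for x i k
    by (simp add: sop_def gradT_def D_def pd_linear[OF bounded_linear_vec_nth test_smooth[OF \<psi>]])
  have int: "integrable lebesgue (\<lambda>x. D k i x * D m n x)" for k i m n
    using L2_inner_integrable[OF test_L2[OF Dt] test_L2[OF Dt], of k i m n] by (simp add: lebesgue_on_UNIV_eq)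
  have "(LINT x|lebesgue. sop gradT \<psi> x \<bullet> transpose (sop gradT \<psi> x)) = (LINT x|lebesgue. (\<Sum>i\<in>UNIV. \<Sum>k\<in>UNIV. D k i x * D i k x))"
    by (rule Bochner_Integration.integral_cong) (simp_all add: inner_vec_def transpose_def sop)
  also have "\<dots> = (\<Sum>i\<in>UNIV. \<Sum>k\<in>UNIV. LINT x|lebesgue. D k i x * D i k x)"
    by (simp add: Bochner_Integration.integral_sum int)
  also have "\<dots> = (\<Sum>i\<in>UNIV. \<Sum>k\<in>UNIV. LINT x|lebesgue. D i i x * D k k x)"
    unfolding D_def by (intro sum.cong refl cross_derivatives comp axis_Basis)
  also have "\<dots> = (LINT x|lebesgue. (\<Sum>i\<in>UNIV. \<Sum>k\<in>UNIV. D i i x * D k k x))"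
    by (simp add: Bochner_Integration.integral_sum int)
  also have "\<dots> = (LINT x|lebesgue. (\<Sum>i\<in>UNIV. D i i x)\<^sup>2)"
    by (simp add: power2_eq_square sum_product)
  also have "\<dots> \<ge> 0" by simp
  finally have nn: "0 \<le> (LINT x|lebesgue. sop gradT \<psi> x \<bullet> transpose (sop gradT \<psi> x))" .
  have L: "sop gradT \<psi> \<in> L2 UNIV" by (rule test_L2[OF grad.sop_test[OF \<psi>]])
  have Ls: "(\<lambda>x. sym_part (sop gradT \<psi> x)) \<in> L2 UNIV" using op_field_L2[OF op_field_sym L] .
  have i1: "integrable lebesgue (\<lambda>x. (norm (sop gradT \<psi> x))\<^sup>2)" using L2_integrable[OF L] by (simp add: lebesgue_on_UNIV_eq)
  have i2: "integrable lebesgue (\<lambda>x. (norm (sym_part (sop gradT \<psi> x)))\<^sup>2)" using L2_integrable[OF Ls] by (simp add: lebesgue_on_UNIV_eq)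
  have eq: "X \<bullet> transpose X = 2 * (norm (sym_part X))\<^sup>2 - (norm X)\<^sup>2" for X :: mat3
    using norm_sym_part[of X] by simp
  have "(LINT x|lebesgue. sop gradT \<psi> x \<bullet> transpose (sop gradT \<psi> x))
      = 2 * (LINT x|lebesgue. (norm (sym_part (sop gradT \<psi> x)))\<^sup>2) - (LINT x|lebesgue. (norm (sop gradT \<psi> x))\<^sup>2)"
    unfolding eq using i1 i2 by simp
  then show ?thesis using nn by simp
qed

context
  fixes \<Omega> :: "vec3 set"
  assumes op: "open \<Omega>"
begin

interpretation grad: diff_op \<Omega> gradT divT by (rule diff_op_grad[OF op])
interpretation curl: diff_op \<Omega> curlT "\<lambda>j X. - curlT j X" by (rule diff_op_curl[OF op])

lemma bounded_linear_symL: "bounded_linear (symL \<Omega>)"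
  unfolding symL_def by (rule bounded_linear_mul[OF grad.Om op_field_sym])

lemma symL_cls: "f \<in> L2 \<Omega> \<Longrightarrow> symL \<Omega> (cls \<Omega> f) = cls \<Omega> (\<lambda>x. sym_part (f x))"
  unfolding symL_def by (rule mul_cls[OF grad.Om op_field_sym])

lemma korn:
  assumes "(u, G) \<in> grad.W0"
  shows "(norm G)\<^sup>2 \<le> 2 * (norm (symL \<Omega> G))\<^sup>2"
proof -
  have "(\<lambda>p. (norm (snd p))\<^sup>2 \<le> 2 * (norm (symL \<Omega> (snd p)))\<^sup>2) (u, G)"
  proof (rule grad.W0_closed_property[OF assms])
    show "closed {p :: (vec3, vec3) l2 \<times> (vec3, mat3) l2. (norm (snd p))\<^sup>2 \<le> 2 * (norm (symL \<Omega> (snd p)))\<^sup>2}"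
      by (intro closed_Collect_le continuous_intros bounded_linear.continuous_on[OF bounded_linear_symL])
    fix \<psi> :: "vec3 \<Rightarrow> vec3" assume \<psi>: "\<psi> \<in> test_funs \<Omega>"
    have t: "sop gradT \<psi> \<in> test_funs \<Omega>" by (rule grad.sop_test[OF \<psi>])
    have ts: "(\<lambda>x. sym_part (sop gradT \<psi> x)) \<in> test_funs \<Omega>"
      by (rule test_linear[OF t]) (simp add: linear_conv_bounded_linear[symmetric] sym_part_linear)
    have "snd (grad.emb \<psi>) = abs_l2 (sop gradT \<psi>)" by (simp add: grad.emb_def test_cls[OF t])
    moreover have "symL \<Omega> (snd (grad.emb \<psi>)) = abs_l2 (\<lambda>x. sym_part (sop gradT \<psi> x))"
      using symL_cls[OF test_L2_on[OF op t]] test_cls[OF ts] by (simp add: grad.emb_def)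
    ultimately show "(norm (snd (grad.emb \<psi>)))\<^sup>2 \<le> 2 * (norm (symL \<Omega> (snd (grad.emb \<psi>))))\<^sup>2"
      using korn_test[OF test_mono[OF \<psi>]] abs_norm[OF test_L2[OF t]] abs_norm[OF test_L2[OF ts]] by simp
  qed
  then show ?thesis by simp
qed

context
  assumes bd: "bounded \<Omega>"
begin

lemma component_zero:
  fixes p :: "vec3 \<Rightarrow> real"
  assumes "p \<in> L2 UNIV" "\<And>x. x \<notin> \<Omega> \<Longrightarrow> p x = 0"
    and "\<And>\<phi>. \<phi> \<in> test_funs UNIV \<Longrightarrow> (LINT x|lebesgue. p x * pd (axis j 1) \<phi> x) = 0"
  shows "AE x in lebesgue. p x = 0"
  by (rule weak_directional_derivative_zero[OF assms(1) bd assms(2) axis_Basis assms(3)])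

lemma L2_nth: "f \<in> L2 S \<Longrightarrow> (\<lambda>x. f x $ i) \<in> L2 S" for f :: "vec3 \<Rightarrow> 'b::euclidean_space ^ 3"
proof -
  have "op_field S (\<lambda>x (v :: 'b ^ 3). v $ i) 1"
    by (auto simp: op_field_def linear_iff Finite_Cartesian_Product.norm_nth_le)
  from op_field_L2[OF this] show "f \<in> L2 S \<Longrightarrow> (\<lambda>x. f x $ i) \<in> L2 S" .
qed

lemma pd_scaleR_const: "\<phi> \<in> test_funs S \<Longrightarrow> pd b (\<lambda>x. \<phi> x *\<^sub>R c) x = pd b \<phi> x *\<^sub>R c"
  by (simp add: pd_linear[OF bounded_linear_scaleR_left test_smooth])

text \<open>The extension by zero of each component has a vanishing weak derivative in the first direction.\<close>

lemma grad_zero: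
  assumes "(u, 0) \<in> grad.W0" shows "u = 0"
proof -
  define p where "p = zext \<Omega> (rep u)"
  have u: "u = abs_l2 p" using grad.W0_restrict(1)[OF assms] by (simp add: p_def cls_def)
  have pL: "p \<in> L2 UNIV" unfolding p_def using zext_L2[OF grad.Om] rep_L2_on[OF grad.Om] by blast
  have "AE x in lebesgue. p x $ i = 0" for i
  proof (rule component_zero[where j=1])
    show "(\<lambda>x. p x $ i) \<in> L2 UNIV" by (rule L2_nth[OF pL])
    show "p x $ i = 0" if "x \<notin> \<Omega>" for x using that by (simp add: p_def zext_def)
    fix \<phi> :: "vec3 \<Rightarrow> real" assume \<phi>: "\<phi> \<in> test_funs UNIV"
    define E :: mat3 where "E = axis i (axis 1 1)"
    have t: "(\<lambda>x. \<phi> x *\<^sub>R E) \<in> test_funs UNIV" by (rule test_vec[OF \<phi>])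
    have s: "p x \<bullet> sop divT (\<lambda>x. \<phi> x *\<^sub>R E) x = p x $ i * pd (axis 1 1) \<phi> x" for x
    proof -
      have "p x \<bullet> sop divT (\<lambda>x. \<phi> x *\<^sub>R E) x = (\<Sum>j\<in>UNIV. gradT j (p x) \<bullet> (pd (axis j 1) \<phi> x *\<^sub>R E))"
        by (simp add: sop_def inner_sum_right pd_scaleR_const[OF \<phi>] grad_div_adjoint[symmetric])
      also have "\<dots> = p x $ i * pd (axis 1 1) \<phi> x"
        by (simp add: sum_3 E_def inner_axis gradT_def)
      finally show ?thesis .
    qed
    have "0 = u \<bullet> abs_l2 (sop divT (\<lambda>x. \<phi> x *\<^sub>R E))" using grad.W0_green[OF assms t] by simp
    also have "\<dots> = (LINT x|lebesgue. p x \<bullet> sop divT (\<lambda>x. \<phi> x *\<^sub>R E) x)"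
      unfolding u by (rule abs_inner[OF pL test_L2[OF grad.sop'_test[OF t]]])
    finally show "(LINT x|lebesgue. p x $ i * pd (axis 1 1) \<phi> x) = 0" unfolding s by simp
  qed
  then have "AE x in lebesgue. \<forall>i. p x $ i = 0" by (simp add: AE_all_countable)
  then have "AE x in lebesgue. p x = 0" by eventually_elim (simp add: vec_eq_iff)
  then have "abs_l2 p = abs_l2 (\<lambda>x. 0)" by (intro abs_eqI[OF pL L2_zero])
  then show ?thesis unfolding u by (simp add: zero_l2_def)
qed

text \<open>In a row of a skew symmetric matrix field the diagonal entry is zero. Hence some entries of the curl consist of a single term, namely
  \<open>- \<partial>\<^sub>1 P\<^sub>1\<^sub>3\<close>, \<open>\<partial>\<^sub>1 P\<^sub>1\<^sub>2\<close> and \<open>\<partial>\<^sub>2 P\<^sub>2\<^sub>3\<close>. The extensions by zero of these three entries of \<open>P\<close> therefore have a vanishing weak derivative in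
  one direction.\<close>

lemma curl_sym_zero:
  assumes W: "(P, 0) \<in> curl.W0" and sym: "symL \<Omega> P = 0" shows "P = 0"
proof -
  define p where "p = zext \<Omega> (rep P)"
  have P: "P = abs_l2 p" using curl.W0_restrict(1)[OF W] by (simp add: p_def cls_def)
  have pL: "p \<in> L2 UNIV" unfolding p_def using zext_L2[OF grad.Om] rep_L2_on[OF grad.Om] by blast
  have "cls \<Omega> (\<lambda>x. sym_part (rep P x)) = cls \<Omega> (\<lambda>x. 0)"
    using sym symL_cls[OF rep_L2_on[OF grad.Om], of P] curl.W0_restrict(1)[OF W] cls_zero[OF grad.Om, where ?'b=mat3] by simp
  then have "AE x in lebesgue. x \<in> \<Omega> \<longrightarrow> sym_part (rep P x) = 0"
    using cls_eq_iff[OF grad.Om op_field_L2[OF op_field_sym rep_L2_on[OF grad.Om]] L2_zero, of P]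
    by (simp add: AE_on_iff[OF grad.Om])
  then have skew: "AE x in lebesgue. \<forall>a b. p x $ a $ b = - p x $ b $ a"
  proof eventually_elim
    case (elim x)
    have "sym_part (p x) = 0" using elim linear_0[OF sym_part_linear] by (auto simp: p_def zext_def)
    then have "(p x + transpose (p x)) $ a $ b = 0" for a b by (simp add: sym_part_def)
    then show ?case by (simp add: transpose_def eq_neg_iff_add_eq_0)
  qed
  have green: "(LINT x|lebesgue. (\<Sum>j\<in>UNIV. pd (axis j 1) \<phi> x * curlT j (p x) $ a $ b)) = 0"
    if \<phi>: "\<phi> \<in> test_funs UNIV" for \<phi> a b
  proof -
    define E :: mat3 where "E = axis a (axis b 1)"
    have t: "(\<lambda>x. \<phi> x *\<^sub>R E) \<in> test_funs UNIV" by (rule test_vec[OF \<phi>])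
    have s: "p x \<bullet> sop (\<lambda>j X. - curlT j X) (\<lambda>x. \<phi> x *\<^sub>R E) x = (\<Sum>j\<in>UNIV. pd (axis j 1) \<phi> x * curlT j (p x) $ a $ b)" for x
    proof -
      have "p x \<bullet> sop (\<lambda>j X. - curlT j X) (\<lambda>x. \<phi> x *\<^sub>R E) x = (\<Sum>j\<in>UNIV. curlT j (p x) \<bullet> (pd (axis j 1) \<phi> x *\<^sub>R E))"
        by (simp add: sop_def inner_sum_right pd_scaleR_const[OF \<phi>] curl_adjoint
            linear_scale[OF bounded_linear.linear[OF linear_curlT]])
      then show ?thesis by (simp add: E_def inner_axis)
    qed
    have "0 = P \<bullet> abs_l2 (sop (\<lambda>j X. - curlT j X) (\<lambda>x. \<phi> x *\<^sub>R E))" using curl.W0_green[OF W t] by simp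
    also have "\<dots> = (LINT x|lebesgue. p x \<bullet> sop (\<lambda>j X. - curlT j X) (\<lambda>x. \<phi> x *\<^sub>R E) x)"
      unfolding P by (rule abs_inner[OF pL test_L2[OF curl.sop'_test[OF t]]])
    finally show ?thesis unfolding s by simp
  qed
  have diag: "X $ a $ a = 0" if "\<forall>a b. X $ a $ b = - X $ b $ a" for X :: mat3 and a
    using that by (metis equal_neg_zero)
  have diag0: "AE x in lebesgue. \<forall>i. p x $ i $ i = 0"
    using skew by eventually_elim (use diag in blast)
  have entry: "AE x in lebesgue. p x $ a $ b = 0"
    if ab: "\<And>x \<phi>. \<phi> \<in> test_funs UNIV \<Longrightarrow> \<forall>i. p x $ i $ i = 0 \<Longrightarrow>
        (\<Sum>j\<in>UNIV. pd (axis j 1) \<phi> x * curlT j (p x) $ a $ c) = s * (p x $ a $ b * pd (axis k 1) \<phi> x)"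
      and s: "s \<noteq> 0" for a b c k and s :: real
  proof (rule component_zero[where j=k])
    have pe: "(\<lambda>x. p x $ i $ j) \<in> L2 UNIV" for i j by (rule L2_nth[OF L2_nth[OF pL]])
    show "(\<lambda>x. p x $ a $ b) \<in> L2 UNIV" by (rule pe)
    show "p x $ a $ b = 0" if "x \<notin> \<Omega>" for x using that by (simp add: p_def zext_def)
    fix \<phi> :: "vec3 \<Rightarrow> real" assume \<phi>: "\<phi> \<in> test_funs UNIV"
    have m: "(\<lambda>x. p x $ i $ j) \<in> borel_measurable lebesgue" for i j
      using L2_measurable[OF pe] by (simp add: lebesgue_on_UNIV_eq)
    have mp: "pd (axis j 1) \<phi> \<in> borel_measurable lebesgue" for j
      by (rule test_measurable[OF test_pd[OF \<phi> axis_Basis]])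
    have mc: "(\<lambda>x. curlT j (p x) $ a $ c) \<in> borel_measurable lebesgue" for j
    proof -
      have pm: "p \<in> borel_measurable lebesgue" using L2_measurable[OF pL] by (simp add: lebesgue_on_UNIV_eq)
      have "continuous_on UNIV (\<lambda>X. curlT j X $ a $ c)"
        by (intro continuous_intros bounded_linear.continuous_on[OF linear_curlT])
      then show ?thesis using measurable_compose[OF pm borel_measurable_continuous_onI] by blast
    qed
    have "(LINT x|lebesgue. s * (p x $ a $ b * pd (axis k 1) \<phi> x)) = (LINT x|lebesgue. (\<Sum>j\<in>UNIV. pd (axis j 1) \<phi> x * curlT j (p x) $ a $ c))"
    proof (rule integral_cong_AE)
      show "(\<lambda>x. s * (p x $ a $ b * pd (axis k 1) \<phi> x)) \<in> borel_measurable lebesgue"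
        by (intro borel_measurable_times borel_measurable_const m mp)
      show "(\<lambda>x. \<Sum>j\<in>UNIV. pd (axis j 1) \<phi> x * curlT j (p x) $ a $ c) \<in> borel_measurable lebesgue"
        by (intro borel_measurable_sum borel_measurable_times mp mc)
      show "AE x in lebesgue. s * (p x $ a $ b * pd (axis k 1) \<phi> x) = (\<Sum>j\<in>UNIV. pd (axis j 1) \<phi> x * curlT j (p x) $ a $ c)"
        using diag0 by eventually_elim (rule ab[OF \<phi>, symmetric])
    qed
    then show "(LINT x|lebesgue. p x $ a $ b * pd (axis k 1) \<phi> x) = 0"
      using green[OF \<phi>] s by simp
  qed
  have "AE x in lebesgue. p x $ 1 $ 3 = 0"
    by (rule entry[where c=2 and k=1 and s="-1"]) (auto simp: sum_3 curlT_def)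
  moreover have "AE x in lebesgue. p x $ 1 $ 2 = 0"
    by (rule entry[where c=3 and k=1 and s=1]) (auto simp: sum_3 curlT_def)
  moreover have "AE x in lebesgue. p x $ 2 $ 3 = 0"
    by (rule entry[where c=1 and k=2 and s=1]) (auto simp: sum_3 curlT_def)
  ultimately have "AE x in lebesgue. p x = 0"
    using skew diag0
  proof eventually_elim
    case (elim x)
    have "p x $ 3 $ 1 = - p x $ 1 $ 3" "p x $ 2 $ 1 = - p x $ 1 $ 2" "p x $ 3 $ 2 = - p x $ 2 $ 3"
      using elim(4) by blast+
    then show ?case using elim(1-3,5) by (simp add: vec_eq_iff forall_3)
  qed
  then have "abs_l2 p = abs_l2 (\<lambda>x. 0)" by (intro abs_eqI[OF pL L2_zero])
  then show ?thesis unfolding P by (simp add: zero_l2_def)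
qed

end

end

section \<open>Elasticity tensors as bounded operators\<close>

lemma tensor_act_linear: "linear (tensor_act A)"
  by (rule linearI) (auto simp: tensor_act_def vec_eq_iff algebra_simps sum.distrib sum_distrib_left)

lemma tensor_act_linear_tensor: "linear (\<lambda>A. tensor_act A X)"
  by (rule linearI) (auto simp: tensor_act_def vec_eq_iff algebra_simps sum.distrib sum_distrib_left)

lemma tensor_act_symmetric:
  assumes "\<And>i j r s. A $ i $ j $ r $ s = A $ r $ s $ i $ j"
  shows "tensor_act A X \<bullet> Y = X \<bullet> tensor_act A Y"
proof -
  have "tensor_act A X \<bullet> Y = (\<Sum>i\<in>UNIV. \<Sum>j\<in>UNIV. \<Sum>k\<in>UNIV. \<Sum>l\<in>UNIV. A $ i $ j $ k $ l * X $ k $ l * Y $ i $ j)"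
    by (simp add: inner_vec_def tensor_act_def sum_distrib_right)
  also have "\<dots> = (\<Sum>i\<in>UNIV. \<Sum>k\<in>UNIV. \<Sum>j\<in>UNIV. \<Sum>l\<in>UNIV. A $ i $ j $ k $ l * X $ k $ l * Y $ i $ j)"
    by (rule sum.cong[OF refl], rule sum.swap)
  also have "\<dots> = (\<Sum>k\<in>UNIV. \<Sum>i\<in>UNIV. \<Sum>j\<in>UNIV. \<Sum>l\<in>UNIV. A $ i $ j $ k $ l * X $ k $ l * Y $ i $ j)"
    by (rule sum.swap)
  also have "\<dots> = (\<Sum>k\<in>UNIV. \<Sum>i\<in>UNIV. \<Sum>l\<in>UNIV. \<Sum>j\<in>UNIV. A $ i $ j $ k $ l * X $ k $ l * Y $ i $ j)"
    by (rule sum.cong[OF refl], rule sum.cong[OF refl], rule sum.swap)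
  also have "\<dots> = (\<Sum>k\<in>UNIV. \<Sum>l\<in>UNIV. \<Sum>i\<in>UNIV. \<Sum>j\<in>UNIV. A $ i $ j $ k $ l * X $ k $ l * Y $ i $ j)"
    by (rule sum.cong[OF refl], rule sum.swap)
  also have "\<dots> = (\<Sum>k\<in>UNIV. \<Sum>l\<in>UNIV. \<Sum>i\<in>UNIV. \<Sum>j\<in>UNIV. A $ k $ l $ i $ j * Y $ i $ j * X $ k $ l)"
    by (intro sum.cong refl) (subst assms, simp add: mult_ac)
  also have "\<dots> = X \<bullet> tensor_act A Y"
    by (simp add: inner_vec_def tensor_act_def sum_distrib_left mult_ac)
  finally show ?thesis .
qed

lemma tensor_act_Sym3:
  assumes "\<And>i j r s. A $ i $ j $ r $ s = A $ j $ i $ r $ s"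
  shows "tensor_act A X \<in> Sym3"
  unfolding Sym3_def using assms by (simp add: transpose_def tensor_act_def vec_eq_iff)

text \<open>Positive definiteness bounds quadratic forms, but multiplication of square integrable fields needs bounds of operators. They follow
  by polarisation with \<open>Y\<close>, the multiple of \<open>A X\<close> that is as long as \<open>X\<close>.\<close>

lemma form_operator_bound:
  fixes A :: "'a::real_inner \<Rightarrow> 'a"
  assumes lin: "linear A" and V: "subspace V" and inv: "A X \<in> V" and X: "X \<in> V"
    and symm: "\<And>X Y. A X \<bullet> Y = X \<bullet> A Y"
    and pos: "\<And>X. X \<in> V \<Longrightarrow> 0 \<le> A X \<bullet> X" and bnd: "\<And>X. X \<in> V \<Longrightarrow> A X \<bullet> X \<le> M * (norm X)\<^sup>2" and M: "M \<ge> 0"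
  shows "norm (A X) \<le> M * norm X"
proof (cases "A X = 0 \<or> X = 0")
  case False
  define r where "r = norm X / norm (A X)"
  define Y where "Y = r *\<^sub>R A X"
  have r: "r > 0" using False by (simp add: r_def)
  have nY: "norm Y = norm X" using False by (simp add: Y_def r_def)
  have Y: "Y \<in> V" unfolding Y_def using inv V by (rule subspace_scale[rotated])
  have "4 * (A X \<bullet> Y) = A (X + Y) \<bullet> (X + Y) - A (X - Y) \<bullet> (X - Y)"
    using symm[of X Y] symm[of Y X]
    by (simp add: linear_add[OF lin] linear_diff[OF lin] inner_add_left inner_add_right inner_diff_left inner_diff_right inner_commute)
  also have "\<dots> \<le> M * (norm (X + Y))\<^sup>2"
    using bnd[OF subspace_add[OF V X Y]] pos[OF subspace_diff[OF V X Y]] by linarith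
  also have "\<dots> \<le> M * (norm X + norm Y)\<^sup>2"
    using M by (intro mult_left_mono power_mono norm_triangle_ineq) auto
  also have "\<dots> = 4 * (M * (norm X * norm X))" unfolding nY by (simp add: power2_eq_square algebra_simps)
  finally have "A X \<bullet> Y \<le> M * (norm X * norm X)" by simp
  moreover have "A X \<bullet> Y = norm X * norm (A X)"
    using False by (simp add: Y_def r_def dot_square_norm power2_eq_square)
  ultimately have "norm X * norm (A X) \<le> norm X * (M * norm X)" by (simp add: mult_ac)
  then show ?thesis using False by simp
qed (use M linear_0[OF lin] in auto)

lemma subspace_Sym3: "subspace Sym3"
  by (rule subspaceI) (auto simp: Sym3_def transpose_def vec_eq_iff)

lemma tensor_field_measurable:
  assumes "open \<Omega>" "Ck_on 1 \<Omega> A"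
  shows "(\<lambda>x. tensor_act (A x) Y) \<in> borel_measurable (lebesgue_on \<Omega>)"
proof -
  have "\<forall>x\<in>\<Omega>. A differentiable (at x)" using assms(2) by simp
  then have "continuous_on \<Omega> A"
    by (meson continuous_at_imp_continuous_on differentiable_imp_continuous_within)
  then have "continuous_on \<Omega> (\<lambda>x. tensor_act (A x) Y)"
    using tensor_act_linear_tensor by (intro bounded_linear.continuous_on[of "\<lambda>A. tensor_act A Y"]) (simp_all add: linear_conv_bounded_linear)
  then show ?thesis using assms(1) by (intro continuous_imp_measurable_on_sets_lebesgue) auto
qed

section \<open>Quadratic forms on the space of square integrable fields\<close>

lemma mul_inner:
  assumes \<Omega>: "\<Omega> \<in> sets lebesgue" and A: "op_field \<Omega> A M"
  shows "mul \<Omega> A F \<bullet> F' = (LINT x|lebesgue_on \<Omega>. A x (rep F x) \<bullet> rep F' x)"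
  unfolding mul_def by (rule inner_cls_rep[OF \<Omega> op_field_L2[OF A rep_L2_on[OF \<Omega>]]])

lemma mul_symmetric:
  assumes \<Omega>: "\<Omega> \<in> sets lebesgue" and A: "op_field \<Omega> A M"
    and symm: "\<And>x X Y. x \<in> \<Omega> \<Longrightarrow> A x X \<bullet> Y = X \<bullet> A x Y"
  shows "mul \<Omega> A F \<bullet> F' = mul \<Omega> A F' \<bullet> F"
  unfolding mul_inner[OF \<Omega> A]
proof (rule Bochner_Integration.integral_cong[OF refl])
  fix x assume "x \<in> space (lebesgue_on \<Omega>)"
  then have "A x (rep F x) \<bullet> rep F' x = rep F x \<bullet> A x (rep F' x)" by (intro symm) (simp add: space_restrict_space)
  then show "A x (rep F x) \<bullet> rep F' x = A x (rep F' x) \<bullet> rep F x" by (simp only: inner_commute)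
qed

lemma mul_lower:
  assumes \<Omega>: "\<Omega> \<in> sets lebesgue" and A: "op_field \<Omega> A M" and B: "op_field \<Omega> B N"
    and le: "\<And>x X. x \<in> \<Omega> \<Longrightarrow> m * (norm (B x X))\<^sup>2 \<le> A x X \<bullet> X"
  shows "m * (norm (mul \<Omega> B F))\<^sup>2 \<le> mul \<Omega> A F \<bullet> F"
proof -
  note L = rep_L2_on[OF \<Omega>, of F] and BL = op_field_L2[OF B rep_L2_on[OF \<Omega>, of F]]
  have "m * (norm (mul \<Omega> B F))\<^sup>2 = (LINT x|lebesgue_on \<Omega>. m * (norm (B x (rep F x)))\<^sup>2)"
    unfolding mul_def dot_square_norm[symmetric] cls_inner[OF \<Omega> BL BL] by simp
  also have "\<dots> \<le> (LINT x|lebesgue_on \<Omega>. A x (rep F x) \<bullet> rep F x)"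
    by (rule integral_mono)
      (use L2_integrable[OF BL] L2_inner_integrable[OF op_field_L2[OF A L] L] le in \<open>auto simp: space_restrict_space\<close>)
  also have "\<dots> = mul \<Omega> A F \<bullet> F" by (rule mul_inner[OF \<Omega> A, symmetric])
  finally show ?thesis .
qed

section \<open>The relaxed micromorphic operator\<close>

type_synonym energy_val = "((vec3, vec3) l2 \<times> (vec3, mat3) l2) \<times> ((vec3, mat3) l2 \<times> (vec3, mat3) l2)"
type_synonym kinetic_val = "(vec3, vec3) l2 \<times> (vec3, mat3) l2"

locale micromorphic =
  fixes \<Omega> :: "vec3 set" and CC HH LL :: "vec3 \<Rightarrow> tensor4"
  assumes op: "open \<Omega>" and bd: "bounded \<Omega>"
    and C1: "Ck_on 1 \<Omega> CC" "Ck_on 1 \<Omega> HH" "Ck_on 1 \<Omega> LL"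
    and pos: "pos_def_on Sym3 \<Omega> CC" "pos_def_on Sym3 \<Omega> HH" "pos_def_on UNIV \<Omega> LL"
    and symmetries: "major_sym \<Omega> CC" "minor_sym \<Omega> CC" "major_sym \<Omega> HH" "minor_sym \<Omega> HH" "major_sym \<Omega> LL"
begin

sublocale grad: diff_op \<Omega> gradT divT by (rule diff_op_grad[OF op])
sublocale curl: diff_op \<Omega> curlT "\<lambda>j X. - curlT j X" by (rule diff_op_curl[OF op])
sublocale div: diff_op \<Omega> divT gradT by (rule diff_op_div[OF op])

abbreviation opC :: "vec3 \<Rightarrow> mat3 \<Rightarrow> mat3" where "opC x X \<equiv> tensor_act (CC x) (sym_part X)"
abbreviation opH :: "vec3 \<Rightarrow> mat3 \<Rightarrow> mat3" where "opH x X \<equiv> tensor_act (HH x) (sym_part X)"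
abbreviation opL :: "vec3 \<Rightarrow> mat3 \<Rightarrow> mat3" where "opL x X \<equiv> tensor_act (LL x) X"

lemma sym_tensor_field:
  assumes A1: "Ck_on 1 \<Omega> A" and Apos: "pos_def_on Sym3 \<Omega> A" and Asym: "major_sym \<Omega> A" "minor_sym \<Omega> A"
  shows "\<exists>M. op_field \<Omega> (\<lambda>x X. tensor_act (A x) (sym_part X)) M"
    and "\<exists>m>0. \<forall>x\<in>\<Omega>. \<forall>X. m * (norm (sym_part X))\<^sup>2 \<le> tensor_act (A x) (sym_part X) \<bullet> X"
    and "\<And>x X Y. x \<in> \<Omega> \<Longrightarrow> tensor_act (A x) (sym_part X) \<bullet> sym_part Y = tensor_act (A x) (sym_part X) \<bullet> Y"
    and "\<And>x X Y. x \<in> \<Omega> \<Longrightarrow> tensor_act (A x) (sym_part X) \<bullet> Y = X \<bullet> tensor_act (A x) (sym_part Y)"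
proof -
  obtain m M where mM: "m > 0" "M > 0" "\<And>x X. x \<in> \<Omega> \<Longrightarrow> X \<in> Sym3 \<Longrightarrow> m * (norm X)\<^sup>2 \<le> tensor_act (A x) X \<bullet> X"
    "\<And>x X. x \<in> \<Omega> \<Longrightarrow> X \<in> Sym3 \<Longrightarrow> tensor_act (A x) X \<bullet> X \<le> M * (norm X)\<^sup>2"
    using Apos unfolding pos_def_on_def by blast
  have S: "tensor_act (A x) X \<in> Sym3" if "x \<in> \<Omega>" for x X
    by (rule tensor_act_Sym3) (use Asym(2) that in \<open>simp add: minor_sym_def\<close>)
  have sm: "tensor_act (A x) X \<bullet> Y = X \<bullet> tensor_act (A x) Y" if "x \<in> \<Omega>" for x X Y
    by (rule tensor_act_symmetric) (use Asym(1) that in \<open>simp add: major_sym_def\<close>)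
  show 3: "tensor_act (A x) (sym_part X) \<bullet> sym_part Y = tensor_act (A x) (sym_part X) \<bullet> Y" if "x \<in> \<Omega>" for x X Y
    by (rule inner_sym_part[OF S[OF that]])
  show "tensor_act (A x) (sym_part X) \<bullet> Y = X \<bullet> tensor_act (A x) (sym_part Y)" if x: "x \<in> \<Omega>" for x X Y
  proof -
    have "tensor_act (A x) (sym_part X) \<bullet> Y = tensor_act (A x) (sym_part X) \<bullet> sym_part Y"
      by (rule 3[OF x, symmetric])
    also have "\<dots> = sym_part X \<bullet> tensor_act (A x) (sym_part Y)" by (rule sm[OF x])
    also have "\<dots> = X \<bullet> tensor_act (A x) (sym_part Y)" using 3[OF x, of Y X] by (simp add: inner_commute)
    finally show ?thesis .
  qed
  show "\<exists>m>0. \<forall>x\<in>\<Omega>. \<forall>X. m * (norm (sym_part X))\<^sup>2 \<le> tensor_act (A x) (sym_part X) \<bullet> X"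
  proof (intro exI[of _ m] conjI ballI allI mM(1))
    fix x X assume x: "x \<in> \<Omega>"
    show "m * (norm (sym_part X))\<^sup>2 \<le> tensor_act (A x) (sym_part X) \<bullet> X"
      using mM(3)[OF x sym_part_Sym3[of X]] 3[OF x, of X X] by simp
  qed
  have bound: "norm (tensor_act (A x) (sym_part X)) \<le> M * norm X" if x: "x \<in> \<Omega>" for x X
  proof -
    have "norm (tensor_act (A x) (sym_part X)) \<le> M * norm (sym_part X)"
    proof (rule form_operator_bound[OF tensor_act_linear subspace_Sym3 S[OF x] sym_part_Sym3 sm[OF x]])
      show "0 \<le> tensor_act (A x) X \<bullet> X" if "X \<in> Sym3" for X
        by (rule order_trans[OF _ mM(3)[OF x that]]) (use mM(1) in simp)
      show "tensor_act (A x) X \<bullet> X \<le> M * (norm X)\<^sup>2" if "X \<in> Sym3" for X using mM(4)[OF x that] .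
    qed (use mM(2) in simp)
    also have "\<dots> \<le> M * norm X" using mM(2) norm_sym_part_le by (intro mult_left_mono) auto
    finally show ?thesis .
  qed
  show "\<exists>M. op_field \<Omega> (\<lambda>x X. tensor_act (A x) (sym_part X)) M"
    unfolding op_field_def
  proof (intro exI[of _ M] conjI ballI allI bound)
    show "linear (\<lambda>X. tensor_act (A x) (sym_part X))" for x
      using linear_compose[OF sym_part_linear tensor_act_linear] by (simp add: o_def)
    show "(\<lambda>x. tensor_act (A x) (sym_part y)) \<in> borel_measurable (lebesgue_on \<Omega>)" for y
      by (rule tensor_field_measurable[OF op A1])
  qed
qed

lemmas C_field = sym_tensor_field[OF C1(1) pos(1) symmetries(1,2)]
lemmas H_field = sym_tensor_field[OF C1(2) pos(2) symmetries(3,4)]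

lemma L_field: "\<exists>M. op_field \<Omega> opL M"
    "\<exists>m>0. \<forall>x\<in>\<Omega>. \<forall>X. m * (norm X)\<^sup>2 \<le> opL x X \<bullet> X"
    "\<And>x X Y. x \<in> \<Omega> \<Longrightarrow> opL x X \<bullet> Y = X \<bullet> opL x Y"
proof -
  obtain m M where mM: "m > 0" "M > 0" "\<And>x X. x \<in> \<Omega> \<Longrightarrow> m * (norm X)\<^sup>2 \<le> opL x X \<bullet> X"
    "\<And>x X. x \<in> \<Omega> \<Longrightarrow> opL x X \<bullet> X \<le> M * (norm X)\<^sup>2"
    using pos(3) unfolding pos_def_on_def by blast
  show sm: "opL x X \<bullet> Y = X \<bullet> opL x Y" if "x \<in> \<Omega>" for x X Y
    by (rule tensor_act_symmetric) (use symmetries(5) that in \<open>simp add: major_sym_def\<close>)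
  show "\<exists>m>0. \<forall>x\<in>\<Omega>. \<forall>X. m * (norm X)\<^sup>2 \<le> opL x X \<bullet> X" using mM by blast
  have bound: "norm (opL x X) \<le> M * norm X" if x: "x \<in> \<Omega>" for x X
  proof (rule form_operator_bound[OF tensor_act_linear subspace_UNIV UNIV_I UNIV_I sm[OF x]])
    show "0 \<le> opL x X \<bullet> X" for X
      by (rule order_trans[OF _ mM(3)[OF x]]) (use mM(1) in simp)
  qed (use mM(2) mM(4)[OF x] in auto)
  show "\<exists>M. op_field \<Omega> opL M"
    unfolding op_field_def
    by (intro exI[of _ M] conjI ballI allI bound tensor_act_linear tensor_field_measurable[OF op C1(3)])
qed

abbreviation VV :: "energy_val set" where "VV \<equiv> grad.W0 \<times> curl.W0"

text \<open>The classes of fields that vanish outside \<open>\<Omega>\<close>.\<close>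

definition HHs :: "kinetic_val set" where
  "HHs = {W. cls \<Omega> (rep (fst W)) = fst W \<and> cls \<Omega> (rep (snd W)) = snd W}"

definition inc :: "energy_val \<Rightarrow> kinetic_val" where
  "inc U = (fst (fst U), fst (snd U))"

text \<open>The elastic energy of \<open>((u, \<nabla>u), (P, Curl P))\<close>.\<close>

definition aform :: "energy_val \<Rightarrow> energy_val \<Rightarrow> real" where
  "aform U U' = mul \<Omega> opC (snd (fst U) - fst (snd U)) \<bullet> (snd (fst U') - fst (snd U'))
     + mul \<Omega> opH (fst (snd U)) \<bullet> fst (snd U') + mul \<Omega> opL (snd (snd U)) \<bullet> snd (snd U')"

lemma aform_simp: "aform ((u, G), (P, C)) ((u', G'), (P', C')) =
   mul \<Omega> opC (G - P) \<bullet> (G' - P') + mul \<Omega> opH P \<bullet> P' + mul \<Omega> opL C \<bullet> C'"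
  by (simp add: aform_def)

lemma inc_simp: "inc ((u, G), (P, C)) = (u, P)"
  by (simp add: inc_def)

lemma bounded_linear_muls: "bounded_linear (mul \<Omega> opC)" "bounded_linear (mul \<Omega> opH)" "bounded_linear (mul \<Omega> opL)"
  using C_field(1) H_field(1) L_field(1) bounded_linear_mul[OF grad.Om] by blast+

lemma bounded_linear_inc: "bounded_linear inc"
  unfolding inc_def[abs_def]
  by (intro bounded_linear_Pair bounded_linear_fst_comp bounded_linear_snd_comp bounded_linear_fst bounded_linear_snd
      bounded_linear_compose[OF bounded_linear_fst] bounded_linear_compose[OF bounded_linear_snd])

lemma bounded_bilinear_aform: "bounded_bilinear aform"
  unfolding aform_def[abs_def]
  by (intro bounded_bilinear_plus bounded_bilinear.comp[OF bounded_bilinear_inner]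
      bounded_linear_compose[OF bounded_linear_muls(1)] bounded_linear_compose[OF bounded_linear_muls(2)]
      bounded_linear_compose[OF bounded_linear_muls(3)] bounded_linear_sub
      bounded_linear_compose[OF bounded_linear_fst] bounded_linear_compose[OF bounded_linear_snd]
      bounded_linear_fst bounded_linear_snd)

lemma aform_sym: "aform U U' = aform U' U"
proof -
  obtain M1 M2 M3 where "op_field \<Omega> opC M1" "op_field \<Omega> opH M2" "op_field \<Omega> opL M3"
    using C_field(1) H_field(1) L_field(1) by blast
  from mul_symmetric[OF grad.Om this(1) C_field(4)] mul_symmetric[OF grad.Om this(2) H_field(4)]
    mul_symmetric[OF grad.Om this(3) L_field(3)]
  show ?thesis unfolding aform_def by presburger
qed

lemma aform_lower:
  "\<exists>m>0. \<forall>u G P C. m * ((norm (symL \<Omega> (G - P)))\<^sup>2 + (norm (symL \<Omega> P))\<^sup>2 + (norm (cls \<Omega> (rep C)))\<^sup>2)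
       \<le> aform ((u, G), (P, C)) ((u, G), (P, C))"
proof -
  obtain M1 M2 M3 where M: "op_field \<Omega> opC M1" "op_field \<Omega> opH M2" "op_field \<Omega> opL M3"
    using C_field(1) H_field(1) L_field(1) by blast
  obtain m1 m2 m3 where m: "m1 > 0" "\<And>x X. x \<in> \<Omega> \<Longrightarrow> m1 * (norm (sym_part X))\<^sup>2 \<le> opC x X \<bullet> X"
     "m2 > 0" "\<And>x X. x \<in> \<Omega> \<Longrightarrow> m2 * (norm (sym_part X))\<^sup>2 \<le> opH x X \<bullet> X"
     "m3 > 0" "\<And>x X. x \<in> \<Omega> \<Longrightarrow> m3 * (norm X)\<^sup>2 \<le> opL x X \<bullet> X"
    using C_field(2) H_field(2) L_field(2) by blast
  have idf: "op_field \<Omega> (\<lambda>x (X::mat3). X) 1" by (simp add: op_field_def linear_iff)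
  define m where "m = min m1 (min m2 m3)"
  show ?thesis
  proof (intro exI[of _ m] conjI allI)
    show "m > 0" using m by (simp add: m_def)
    fix u G P C
    have "m * (norm (symL \<Omega> (G - P)))\<^sup>2 \<le> mul \<Omega> opC (G - P) \<bullet> (G - P)"
      by (rule order_trans[OF mult_right_mono mul_lower[OF grad.Om M(1) op_field_sym m(2), folded symL_def]])
        (auto simp: m_def)
    moreover have "m * (norm (symL \<Omega> P))\<^sup>2 \<le> mul \<Omega> opH P \<bullet> P"
      by (rule order_trans[OF mult_right_mono mul_lower[OF grad.Om M(2) op_field_sym m(4), folded symL_def]])
        (auto simp: m_def)
    moreover have "m * (norm (cls \<Omega> (rep C)))\<^sup>2 \<le> mul \<Omega> opL C \<bullet> C"
      by (rule order_trans[OF mult_right_mono mul_lower[OF grad.Om M(3) idf m(6), unfolded mul_def[of \<Omega> "\<lambda>x X. X"]]])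
        (auto simp: m_def)
    ultimately show "m * ((norm (symL \<Omega> (G - P)))\<^sup>2 + (norm (symL \<Omega> P))\<^sup>2 + (norm (cls \<Omega> (rep C)))\<^sup>2)
       \<le> aform ((u, G), (P, C)) ((u, G), (P, C))"
      unfolding aform_simp distrib_left by linarith
  qed
qed

lemma aform_nonneg: "0 \<le> aform U U"
proof -
  obtain m where m: "m > 0" "\<And>u G P C. m * ((norm (symL \<Omega> (G - P)))\<^sup>2 + (norm (symL \<Omega> P))\<^sup>2 + (norm (cls \<Omega> (rep C)))\<^sup>2)
       \<le> aform ((u, G), (P, C)) ((u, G), (P, C))"
    using aform_lower by blast
  obtain u G P C where U: "U = ((u, G), (P, C))" by (metis prod.exhaust)
  show ?thesis unfolding U by (rule order_trans[OF _ m(2)]) (use m(1) in simp)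
qed

lemma symL_add_bound: "(norm (symL \<Omega> G))\<^sup>2 \<le> 2 * (norm (symL \<Omega> (G - P)))\<^sup>2 + 2 * (norm (symL \<Omega> P))\<^sup>2"
proof -
  interpret bounded_linear "symL \<Omega>" by (rule bounded_linear_symL[OF op])
  have "symL \<Omega> G = symL \<Omega> (G - P) + symL \<Omega> P" by (simp add: diff)
  then show ?thesis using norm_add_sq_le by metis
qed

text \<open>Korn's inequality gives \<open>\<parallel>\<nabla>u\<parallel>\<^sup>2 \<le> 2 \<parallel>sym(\<nabla>u)\<parallel>\<^sup>2 \<le> 4 \<parallel>sym(\<nabla>u - P)\<parallel>\<^sup>2 + 4 \<parallel>sym P\<parallel>\<^sup>2\<close>. The fields \<open>u\<close> and \<open>P\<close> themselves are
  supplied by the norm of \<open>inc U\<close>.\<close>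

lemma aform_coercive: "\<exists>c>0. \<forall>U\<in>VV. c * (norm U)\<^sup>2 \<le> aform U U + (norm (inc U))\<^sup>2"
proof -
  obtain m where m: "m > 0" "\<And>u G P C. m * ((norm (symL \<Omega> (G - P)))\<^sup>2 + (norm (symL \<Omega> P))\<^sup>2 + (norm (cls \<Omega> (rep C)))\<^sup>2)
       \<le> aform ((u, G), (P, C)) ((u, G), (P, C))"
    using aform_lower by blast
  define c where "c = min 1 (m / 4)"
  have c: "c > 0" "c \<le> 1" "4 * c \<le> m" using m(1) by (auto simp: c_def)
  show ?thesis
  proof (intro exI[of _ c] conjI ballI c(1))
    fix U assume UV: "U \<in> VV"
    obtain u G P C where U: "U = ((u, G), (P, C))" by (metis prod.exhaust)
    have W: "(u, G) \<in> grad.W0" "(P, C) \<in> curl.W0" using UV U by auto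
    define X Y Z where "X = (norm (symL \<Omega> (G - P)))\<^sup>2" "Y = (norm (symL \<Omega> P))\<^sup>2" "Z = (norm C)\<^sup>2"
    have nn: "0 \<le> X" "0 \<le> Y" "0 \<le> Z" "0 \<le> (norm u)\<^sup>2" "0 \<le> (norm P)\<^sup>2" by (auto simp: X_Y_Z_def)
    have G: "(norm G)\<^sup>2 \<le> 4 * X + 4 * Y"
      using korn[OF op W(1)] symL_add_bound[of G P] unfolding X_Y_Z_def by linarith
    have a: "m * (X + Y + Z) \<le> aform U U"
      using m(2)[where u=u and G=G and P=P and C=C] unfolding U X_Y_Z_def curl.W0_restrict(2)[OF W(2)] .
    have "c * (norm U)\<^sup>2 = c * (norm u)\<^sup>2 + c * (norm G)\<^sup>2 + c * (norm P)\<^sup>2 + c * Z"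
      by (simp add: U norm_prod_def X_Y_Z_def algebra_simps)
    also have "\<dots> \<le> 1 * (norm u)\<^sup>2 + c * (4 * X + 4 * Y) + 1 * (norm P)\<^sup>2 + c * (4 * Z)"
      using c nn by (intro add_mono mult_right_mono mult_left_mono G) auto
    also have "\<dots> = (norm u)\<^sup>2 + (norm P)\<^sup>2 + 4 * c * (X + Y + Z)" by (simp add: algebra_simps)
    also have "\<dots> \<le> (norm u)\<^sup>2 + (norm P)\<^sup>2 + m * (X + Y + Z)"
      using c nn by (intro add_left_mono mult_right_mono) auto
    also have "\<dots> \<le> (norm u)\<^sup>2 + (norm P)\<^sup>2 + aform U U" using a by simp
    also have "\<dots> = aform U U + (norm (inc U))\<^sup>2" by (simp add: U inc_simp norm_prod_def)
    finally show "c * (norm U)\<^sup>2 \<le> aform U U + (norm (inc U))\<^sup>2" .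
  qed
qed

text \<open>Vanishing energy means \<open>sym(\<nabla>u - P) = 0\<close>, \<open>sym P = 0\<close> and \<open>Curl P = 0\<close>. The last two give \<open>P = 0\<close>, then the first gives \<open>\<nabla>u = 0\<close> by Korn's
  inequality.\<close>

lemma aform_definite:
  assumes UV: "U \<in> VV" and zero: "aform U U = 0" shows "U = 0"
proof -
  obtain m where m: "m > 0" "\<And>u G P C. m * ((norm (symL \<Omega> (G - P)))\<^sup>2 + (norm (symL \<Omega> P))\<^sup>2 + (norm (cls \<Omega> (rep C)))\<^sup>2)
       \<le> aform ((u, G), (P, C)) ((u, G), (P, C))"
    using aform_lower by blast
  obtain u G P C where U: "U = ((u, G), (P, C))" by (metis prod.exhaust)
  have W: "(u, G) \<in> grad.W0" "(P, C) \<in> curl.W0" using UV U by auto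
  have "m * ((norm (symL \<Omega> (G - P)))\<^sup>2 + (norm (symL \<Omega> P))\<^sup>2 + (norm C)\<^sup>2) \<le> 0"
    using m(2)[where u=u and G=G and P=P and C=C] zero unfolding U curl.W0_restrict(2)[OF W(2)] by simp
  then have s: "(norm (symL \<Omega> (G - P)))\<^sup>2 + (norm (symL \<Omega> P))\<^sup>2 + (norm C)\<^sup>2 \<le> 0"
    using m(1) by (simp add: mult_le_0_iff)
  have "(norm (symL \<Omega> (G - P)))\<^sup>2 = 0" "(norm (symL \<Omega> P))\<^sup>2 = 0" "(norm C)\<^sup>2 = 0"
    using s zero_le_power2[of "norm (symL \<Omega> (G - P))"] zero_le_power2[of "norm (symL \<Omega> P)"] zero_le_power2[of "norm C"]
    by linarith+
  then have z: "symL \<Omega> (G - P) = 0" "symL \<Omega> P = 0" "C = 0" by auto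
  have P: "P = 0" by (rule curl_sym_zero[OF op bd]) (use W z in auto)
  have "symL \<Omega> G = 0" using z P by simp
  then have G: "G = 0" using korn[OF op W(1)] by simp
  then have "u = 0" using grad_zero[OF op bd] W(1) by simp
  then show ?thesis using G P z by (simp add: U zero_prod_def)
qed

lemma kinetic_closed: "subspace HHs" "closed HHs"
proof -
  interpret R: bounded_linear "\<lambda>F :: (vec3, vec3) l2. cls \<Omega> (rep F)" by (rule grad.bounded_linear_restrict)
  interpret R': bounded_linear "\<lambda>F :: (vec3, mat3) l2. cls \<Omega> (rep F)" by (rule grad.bounded_linear_restrict)
  show "subspace HHs"
    by (rule subspaceI) (auto simp: HHs_def R.zero R'.zero R.add R'.add R.scaleR R'.scaleR)
  show "closed HHs" unfolding HHs_def
    by (intro closed_Collect_conj closed_Collect_eq continuous_intros R.continuous_on R'.continuous_on)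
qed

lemma energy_closed: "subspace VV" "closed VV"
  by (auto intro!: subspace_Times closed_Times grad.subspace_W0 curl.subspace_W0 grad.closed_W0 curl.closed_W0)

text \<open>A constant as in \<open>aform_coercive\<close>; the parameters of \<open>wave_form\<close> include one.\<close>

definition coer_const :: real where
  "coer_const = (SOME c. c > 0 \<and> (\<forall>U\<in>VV. c * (norm U)\<^sup>2 \<le> aform U U + (norm (inc U))\<^sup>2))"

lemma coer_const: "coer_const > 0" "U \<in> VV \<Longrightarrow> coer_const * (norm U)\<^sup>2 \<le> aform U U + (norm (inc U))\<^sup>2"
proof -
  have "coer_const > 0 \<and> (\<forall>U\<in>VV. coer_const * (norm U)\<^sup>2 \<le> aform U U + (norm (inc U))\<^sup>2)"
    unfolding coer_const_def using aform_coercive by (rule someI_ex)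
  then show "coer_const > 0" "U \<in> VV \<Longrightarrow> coer_const * (norm U)\<^sup>2 \<le> aform U U + (norm (inc U))\<^sup>2" by auto
qed

sublocale wave: wave_form VV HHs inc aform coer_const
proof (rule wave_form.intro)
  show "subspace VV" "closed VV" by (rule energy_closed)+
  show "subspace HHs" "closed HHs" by (rule kinetic_closed)+
  show "bounded_linear inc" by (rule bounded_linear_inc)
  show "inc U \<in> HHs" if "U \<in> VV" for U
  proof -
    obtain u G P C where U: "U = ((u, G), (P, C))" by (metis prod.exhaust)
    then have "(u, G) \<in> grad.W0" "(P, C) \<in> curl.W0" using that by auto
    then show ?thesis using grad.W0_restrict(1) curl.W0_restrict(1) by (simp add: U inc_simp HHs_def)
  qed
  show "U = 0" if UV: "U \<in> VV" and z: "inc U = 0" for U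
  proof -
    obtain u G P C where U: "U = ((u, G), (P, C))" by (metis prod.exhaust)
    have "(0, G) \<in> grad.W0" "(0, C) \<in> curl.W0" using UV z by (auto simp: U inc_simp zero_prod_def)
    moreover have "(0, 0) \<in> grad.W0" "(0, 0) \<in> curl.W0"
      using subspace_0[OF grad.subspace_W0] subspace_0[OF curl.subspace_W0] by (auto simp: zero_prod_def)
    ultimately have "G = 0" "C = 0" using grad.W0_unique curl.W0_unique by blast+
    then show ?thesis using z by (simp add: U inc_simp zero_prod_def)
  qed
  show "bounded_bilinear aform" by (rule bounded_bilinear_aform)
  show "aform U U' = aform U' U" for U U' by (rule aform_sym)
  show "0 \<le> aform U U" for U by (rule aform_nonneg)
  show "0 < coer_const" by (rule coer_const)
  show "coer_const * (norm U)\<^sup>2 \<le> aform U U + (norm (inc U))\<^sup>2" if "U \<in> VV" for U using that by (rule coer_const(2))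
  show "Y = 0" if Y: "Y \<in> HHs" and z: "\<And>\<phi>. \<phi> \<in> VV \<Longrightarrow> Y \<bullet> inc \<phi> = 0" for Y
  proof -
    obtain v K where vK: "Y = (v, K)" by (cases Y)
    have 0: "0 \<in> grad.W0" "0 \<in> curl.W0" using subspace_0 grad.subspace_W0 curl.subspace_W0 by auto
    have "v = 0"
    proof (rule grad.test_total)
      show "cls \<Omega> (rep v) = v" using Y by (simp add: vK HHs_def)
      show "v \<bullet> cls \<Omega> \<psi> = 0" if "\<psi> \<in> test_funs \<Omega>" for \<psi>
        using z[of "(grad.emb \<psi>, 0)"] grad.emb_W0[OF that] 0 by (simp add: vK inc_def grad.emb_def)
    qed
    moreover have "K = 0"
    proof (rule curl.test_total)
      show "cls \<Omega> (rep K) = K" using Y by (simp add: vK HHs_def)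
      show "K \<bullet> cls \<Omega> \<psi> = 0" if "\<psi> \<in> test_funs \<Omega>" for \<psi>
        using z[of "(0, curl.emb \<psi>)"] curl.emb_W0[OF that] 0 by (simp add: vK inc_def curl.emb_def)
    qed
    ultimately show ?thesis by (simp add: vK zero_prod_def)
  qed
qed

end

section \<open>States as elements of a Hilbert space\<close>

lemma integral_Pair:
  fixes f :: "'a \<Rightarrow> 'b::euclidean_space" and g :: "'a \<Rightarrow> 'c::euclidean_space"
  assumes "integrable M f" "integrable M g"
  shows "(LINT x|M. (f x, g x)) = (LINT x|M. f x, LINT x|M. g x)" and "integrable M (\<lambda>x. (f x, g x))"
proof -
  have b1: "bounded_linear (\<lambda>a::'b. (a, 0::'c))" and b2: "bounded_linear (\<lambda>b::'c. (0::'b, b))"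
    by (intro bounded_linear_Pair bounded_linear_ident bounded_linear_zero)+
  have i: "integrable M (\<lambda>x. (f x, 0::'c))" "integrable M (\<lambda>x. (0::'b, g x))"
    using integrable_bounded_linear[OF b1 assms(1)] integrable_bounded_linear[OF b2 assms(2)] by auto
  have eq: "(f x, g x) = (f x, 0) + (0, g x)" for x by simp
  show "integrable M (\<lambda>x. (f x, g x))" unfolding eq using i by (rule Bochner_Integration.integrable_add)
  show "(LINT x|M. (f x, g x)) = (LINT x|M. f x, LINT x|M. g x)"
    unfolding eq Bochner_Integration.integral_add[OF i]
    using integral_bounded_linear[OF b1 assms(1)] integral_bounded_linear[OF b2 assms(2)] by simp
qed

context micromorphic
begin

abbreviation XO :: "state set" where "XO \<equiv> XX \<Omega>"

text \<open>The coordinates of a state in the Hilbert space: the weak derivatives are listed with the fields, positions are separated from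
  velocities.\<close>

definition Phi :: "state \<Rightarrow> energy_val \<times> kinetic_val" where
  "Phi w = (((cls \<Omega> (u_of w), cls \<Omega> (Grad \<Omega> (u_of w))), (cls \<Omega> (P_of w), cls \<Omega> (Curl \<Omega> (P_of w)))),
     (cls \<Omega> (v_of w), cls \<Omega> (K_of w)))"

definition SS :: "(energy_val \<times> kinetic_val) set" where "SS = VV \<times> HHs"

definition field_of :: "energy_val \<times> kinetic_val \<Rightarrow> state" where
  "field_of s x = (rep (fst (fst (fst s))) x, rep (fst (snd s)) x, rep (fst (snd (fst s))) x, rep (snd (snd s)) x)"

lemma XX_iff: "w \<in> XO \<longleftrightarrow> u_of w \<in> grad.H0 \<and> v_of w \<in> L2 \<Omega> \<and> P_of w \<in> curl.H0 \<and> K_of w \<in> L2 \<Omega>"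
  by (simp add: XX_def H1_0_eq[OF op] HCurl_0_eq[OF op])

lemma XX_L2:
  assumes "w \<in> XO"
  shows "u_of w \<in> L2 \<Omega>" "v_of w \<in> L2 \<Omega>" "P_of w \<in> L2 \<Omega>" "K_of w \<in> L2 \<Omega>"
    "Grad \<Omega> (u_of w) \<in> L2 \<Omega>" "Curl \<Omega> (P_of w) \<in> L2 \<Omega>"
  using assms grad.H0_iff curl.H0_iff grad.H0_dens(1) curl.H0_dens(1)
  unfolding XX_iff Grad_def Curl_def dGrad_eq dCurl_eq by auto

lemma XX_W0:
  assumes "w \<in> XO"
  shows "(cls \<Omega> (u_of w), cls \<Omega> (Grad \<Omega> (u_of w))) \<in> grad.W0" "(cls \<Omega> (P_of w), cls \<Omega> (Curl \<Omega> (P_of w))) \<in> curl.W0"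
  using assms grad.H0_dens(2) curl.H0_dens(2) unfolding XX_iff Grad_def Curl_def dGrad_eq dCurl_eq by auto

lemma Phi_SS: "w \<in> XO \<Longrightarrow> Phi w \<in> SS"
  using XX_W0 XX_L2 cls_rep_cls[OF grad.Om, where ?'b=vec3] cls_rep_cls[OF grad.Om, where ?'b=mat3]
  by (simp add: Phi_def SS_def HHs_def)

text \<open>The weak derivatives are determined by the fields, so it suffices to compare the fields.\<close>

lemma Phi_eqI:
  assumes s: "(((u, G), (P, C)), (v, K)) \<in> SS"
    and L: "u_of w \<in> L2 \<Omega>" "v_of w \<in> L2 \<Omega>" "P_of w \<in> L2 \<Omega>" "K_of w \<in> L2 \<Omega>"
    and eq: "cls \<Omega> (u_of w) = u" "cls \<Omega> (v_of w) = v" "cls \<Omega> (P_of w) = P" "cls \<Omega> (K_of w) = K"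
  shows "w \<in> XO" "Phi w = (((u, G), (P, C)), (v, K))"
proof -
  have W: "(u, G) \<in> grad.W0" "(P, C) \<in> curl.W0" using s by (auto simp: SS_def)
  have "u_of w \<in> grad.H0" "P_of w \<in> curl.H0"
    using grad.H0_iff curl.H0_iff L eq W by blast+
  then show X: "w \<in> XO" using L by (simp add: XX_iff)
  have "cls \<Omega> (Grad \<Omega> (u_of w)) = G" "cls \<Omega> (Curl \<Omega> (P_of w)) = C"
    using grad.W0_unique[OF XX_W0(1)[OF X, unfolded eq] W(1)] curl.W0_unique[OF XX_W0(2)[OF X, unfolded eq] W(2)] by auto
  then show "Phi w = (((u, G), (P, C)), (v, K))" by (simp add: Phi_def eq)
qed

lemma field_of: assumes "s \<in> SS" shows "field_of s \<in> XO" "Phi (field_of s) = s"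
proof -
  obtain u G P C v K where s: "s = (((u, G), (P, C)), (v, K))" by (metis prod.exhaust)
  have parts: "u_of (field_of s) = rep u" "v_of (field_of s) = rep v" "P_of (field_of s) = rep P" "K_of (field_of s) = rep K"
    by (auto simp: fun_eq_iff u_of_def v_of_def P_of_def K_of_def field_of_def s)
  have W: "(u, G) \<in> grad.W0" "(P, C) \<in> curl.W0" using assms by (auto simp: SS_def s)
  have vK: "cls \<Omega> (rep v) = v" "cls \<Omega> (rep K) = K" using assms by (auto simp: SS_def HHs_def s)
  have "field_of s \<in> XO \<and> Phi (field_of s) = (((u, G), (P, C)), (v, K))"
    using Phi_eqI[OF assms[unfolded s], of "field_of s"] rep_L2_on[OF grad.Om, where ?'b=vec3] rep_L2_on[OF grad.Om, where ?'b=mat3]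
      grad.W0_restrict(1)[OF W(1)] curl.W0_restrict(1)[OF W(2)] vK unfolding parts by blast
  then show "field_of s \<in> XO" "Phi (field_of s) = s" by (auto simp: s)
qed

lemma subspace_SS: "subspace SS" "closed SS"
  unfolding SS_def using energy_closed kinetic_closed by (auto intro: subspace_Times closed_Times)

lemma parts_arith:
  "u_of (\<lambda>x. w x + w' x) = (\<lambda>x. u_of w x + u_of w' x)" "v_of (\<lambda>x. w x + w' x) = (\<lambda>x. v_of w x + v_of w' x)"
  "P_of (\<lambda>x. w x + w' x) = (\<lambda>x. P_of w x + P_of w' x)" "K_of (\<lambda>x. w x + w' x) = (\<lambda>x. K_of w x + K_of w' x)"
  "u_of (\<lambda>x. r *\<^sub>R w x) = (\<lambda>x. r *\<^sub>R u_of w x)" "v_of (\<lambda>x. r *\<^sub>R w x) = (\<lambda>x. r *\<^sub>R v_of w x)"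
  "P_of (\<lambda>x. r *\<^sub>R w x) = (\<lambda>x. r *\<^sub>R P_of w x)" "K_of (\<lambda>x. r *\<^sub>R w x) = (\<lambda>x. r *\<^sub>R K_of w x)"
  by (auto simp: fun_eq_iff u_of_def v_of_def P_of_def K_of_def)

lemma Phi_add:
  assumes "w \<in> XO" "w' \<in> XO"
  shows "(\<lambda>x. w x + w' x) \<in> XO" "Phi (\<lambda>x. w x + w' x) = Phi w + Phi w'"
proof -
  note L = XX_L2[OF assms(1)] and L' = XX_L2[OF assms(2)]
  have "Phi w + Phi w' \<in> SS" using Phi_SS assms subspace_SS(1) by (intro subspace_add)
  then have s: "(((cls \<Omega> (u_of w) + cls \<Omega> (u_of w'), cls \<Omega> (Grad \<Omega> (u_of w)) + cls \<Omega> (Grad \<Omega> (u_of w'))),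
      (cls \<Omega> (P_of w) + cls \<Omega> (P_of w'), cls \<Omega> (Curl \<Omega> (P_of w)) + cls \<Omega> (Curl \<Omega> (P_of w')))),
      (cls \<Omega> (v_of w) + cls \<Omega> (v_of w'), cls \<Omega> (K_of w) + cls \<Omega> (K_of w'))) \<in> SS"
    by (simp add: Phi_def)
  note res = Phi_eqI[OF s, of "\<lambda>x. w x + w' x", unfolded parts_arith,
      OF L2_add[OF L(1) L'(1)] L2_add[OF L(2) L'(2)] L2_add[OF L(3) L'(3)] L2_add[OF L(4) L'(4)]
         cls_add[OF grad.Om L(1) L'(1)] cls_add[OF grad.Om L(2) L'(2)] cls_add[OF grad.Om L(3) L'(3)] cls_add[OF grad.Om L(4) L'(4)]]
  show "(\<lambda>x. w x + w' x) \<in> XO" by (rule res(1))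
  show "Phi (\<lambda>x. w x + w' x) = Phi w + Phi w'" unfolding res(2) by (simp add: Phi_def)
qed

lemma Phi_scaleR:
  assumes "w \<in> XO"
  shows "(\<lambda>x. r *\<^sub>R w x) \<in> XO" "Phi (\<lambda>x. r *\<^sub>R w x) = r *\<^sub>R Phi w"
proof -
  note L = XX_L2[OF assms(1)]
  have "r *\<^sub>R Phi w \<in> SS" using Phi_SS assms subspace_SS(1) by (intro subspace_scale)
  then have s: "(((r *\<^sub>R cls \<Omega> (u_of w), r *\<^sub>R cls \<Omega> (Grad \<Omega> (u_of w))),
      (r *\<^sub>R cls \<Omega> (P_of w), r *\<^sub>R cls \<Omega> (Curl \<Omega> (P_of w)))),
      (r *\<^sub>R cls \<Omega> (v_of w), r *\<^sub>R cls \<Omega> (K_of w))) \<in> SS"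
    by (simp add: Phi_def)
  note res = Phi_eqI[OF s, of "\<lambda>x. r *\<^sub>R w x", unfolded parts_arith,
      OF L2_scaleR[OF L(1)] L2_scaleR[OF L(2)] L2_scaleR[OF L(3)] L2_scaleR[OF L(4)]
         cls_scaleR[OF grad.Om L(1)] cls_scaleR[OF grad.Om L(2)] cls_scaleR[OF grad.Om L(3)] cls_scaleR[OF grad.Om L(4)]]
  show "(\<lambda>x. r *\<^sub>R w x) \<in> XO" by (rule res(1))
  show "Phi (\<lambda>x. r *\<^sub>R w x) = r *\<^sub>R Phi w" unfolding res(2) by (simp add: Phi_def)
qed

lemma Phi_diff:
  assumes "w \<in> XO" "w' \<in> XO"
  shows "(\<lambda>x. w x - w' x) \<in> XO" "Phi (\<lambda>x. w x - w' x) = Phi w - Phi w'"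
  using Phi_add[OF assms(1) Phi_scaleR(1)[OF assms(2), of "-1"]] Phi_scaleR(2)[OF assms(2), of "-1"] by simp_all

lemma Phi_eq_AE:
  assumes X: "w \<in> XO" "w' \<in> XO" and eq: "Phi w = Phi w'"
  shows "AE x in lebesgue_on \<Omega>. w x = w' x"
proof -
  note L = XX_L2[OF X(1)] and L' = XX_L2[OF X(2)]
  have "AE x in lebesgue_on \<Omega>. u_of w x = u_of w' x" "AE x in lebesgue_on \<Omega>. v_of w x = v_of w' x"
    "AE x in lebesgue_on \<Omega>. P_of w x = P_of w' x" "AE x in lebesgue_on \<Omega>. K_of w x = K_of w' x"
    using eq cls_eq_iff[OF grad.Om L(1) L'(1)] cls_eq_iff[OF grad.Om L(2) L'(2)]
      cls_eq_iff[OF grad.Om L(3) L'(3)] cls_eq_iff[OF grad.Om L(4) L'(4)] by (auto simp: Phi_def)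
  then show ?thesis
    by eventually_elim (auto simp: u_of_def v_of_def P_of_def K_of_def prod_eq_iff)
qed

lemma Phi_AE_eq:
  assumes X: "w \<in> XO" "w' \<in> XO" and eq: "AE x in lebesgue_on \<Omega>. w x = w' x"
  shows "Phi w = Phi w'"
proof -
  note L = XX_L2[OF X(1)] and L' = XX_L2[OF X(2)]
  have "AE x in lebesgue_on \<Omega>. u_of w x = u_of w' x" "AE x in lebesgue_on \<Omega>. v_of w x = v_of w' x"
    "AE x in lebesgue_on \<Omega>. P_of w x = P_of w' x" "AE x in lebesgue_on \<Omega>. K_of w x = K_of w' x"
    using eq by (eventually_elim, simp add: u_of_def v_of_def P_of_def K_of_def)+
  then have e: "cls \<Omega> (u_of w) = cls \<Omega> (u_of w')" "cls \<Omega> (v_of w) = cls \<Omega> (v_of w')"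
    "cls \<Omega> (P_of w) = cls \<Omega> (P_of w')" "cls \<Omega> (K_of w) = cls \<Omega> (K_of w')"
    using cls_eq_iff[OF grad.Om L(1) L'(1)] cls_eq_iff[OF grad.Om L(2) L'(2)]
      cls_eq_iff[OF grad.Om L(3) L'(3)] cls_eq_iff[OF grad.Om L(4) L'(4)] by auto
  show ?thesis
    by (rule Phi_eqI(2)[OF Phi_SS[OF X(2), unfolded Phi_def] L(1-4) e, folded Phi_def])
qed

definition sigma :: "state \<Rightarrow> vec3 \<Rightarrow> mat3" where "sigma w x = tensor_act (CC x) (strain \<Omega> w x)"
definition tau :: "state \<Rightarrow> vec3 \<Rightarrow> mat3" where "tau w x = tensor_act (HH x) (sym_part (P_of w x))"
definition moment :: "state \<Rightarrow> vec3 \<Rightarrow> mat3" where "moment w x = tensor_act (LL x) (Curl \<Omega> (P_of w) x)"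

lemma stresses:
  assumes w: "w \<in> XO"
  shows "sigma w \<in> L2 \<Omega>" "tau w \<in> L2 \<Omega>" "moment w \<in> L2 \<Omega>"
    "cls \<Omega> (sigma w) = mul \<Omega> opC (cls \<Omega> (Grad \<Omega> (u_of w)) - cls \<Omega> (P_of w))"
    "cls \<Omega> (tau w) = mul \<Omega> opH (cls \<Omega> (P_of w))"
    "cls \<Omega> (moment w) = mul \<Omega> opL (cls \<Omega> (Curl \<Omega> (P_of w)))"
proof -
  obtain M1 M2 M3 where M: "op_field \<Omega> opC M1" "op_field \<Omega> opH M2" "op_field \<Omega> opL M3"
    using C_field(1) H_field(1) L_field(1) by blast
  note L = XX_L2[OF w]
  have d: "(\<lambda>x. Grad \<Omega> (u_of w) x - P_of w x) \<in> L2 \<Omega>" by (rule L2_diff[OF L(5,3)])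
  show "sigma w \<in> L2 \<Omega>" unfolding sigma_def[abs_def] strain_def by (rule op_field_L2[OF M(1) d])
  show "tau w \<in> L2 \<Omega>" unfolding tau_def[abs_def] by (rule op_field_L2[OF M(2) L(3)])
  show "moment w \<in> L2 \<Omega>" unfolding moment_def[abs_def] by (rule op_field_L2[OF M(3) L(6)])
  show "cls \<Omega> (sigma w) = mul \<Omega> opC (cls \<Omega> (Grad \<Omega> (u_of w)) - cls \<Omega> (P_of w))"
    unfolding cls_diff[OF grad.Om L(5,3), symmetric] mul_cls[OF grad.Om M(1) d] sigma_def[abs_def] strain_def ..
  show "cls \<Omega> (tau w) = mul \<Omega> opH (cls \<Omega> (P_of w))"
    unfolding mul_cls[OF grad.Om M(2) L(3)] tau_def[abs_def] ..
  show "cls \<Omega> (moment w) = mul \<Omega> opL (cls \<Omega> (Curl \<Omega> (P_of w)))"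
    unfolding mul_cls[OF grad.Om M(3) L(6)] moment_def[abs_def] ..
qed

definition Eform :: "energy_val \<times> kinetic_val \<Rightarrow> energy_val \<times> kinetic_val \<Rightarrow> real" where
  "Eform s s' = aform (fst s) (fst s') + snd s \<bullet> snd s'"

text \<open>The stresses are symmetric, so the symmetric part can be dropped from the second factor.\<close>

lemma X_inner_eq:
  assumes X: "w \<in> XO" "w' \<in> XO"
  shows "X_inner \<Omega> CC HH LL w w' = Eform (Phi w) (Phi w')"
proof -
  note L = XX_L2[OF X(1)] and L' = XX_L2[OF X(2)] and S = stresses[OF X(1)]
  have d: "(\<lambda>x. Grad \<Omega> (u_of w') x - P_of w' x) \<in> L2 \<Omega>" by (rule L2_diff[OF L'(5,3)])
  note i = L2_inner_integrable[OF L(2) L'(2)] L2_inner_integrable[OF L(4) L'(4)]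
    L2_inner_integrable[OF S(1) d] L2_inner_integrable[OF S(2) L'(3)] L2_inner_integrable[OF S(3) L'(6)]
  have "X_inner \<Omega> CC HH LL w w' = (LINT x|lebesgue_on \<Omega>.
      v_of w x \<bullet> v_of w' x + K_of w x \<bullet> K_of w' x + sigma w x \<bullet> (Grad \<Omega> (u_of w') x - P_of w' x)
      + tau w x \<bullet> P_of w' x + moment w x \<bullet> Curl \<Omega> (P_of w') x)"
    unfolding X_inner_def
  proof (rule Bochner_Integration.integral_cong[OF refl])
    fix x assume "x \<in> space (lebesgue_on \<Omega>)"
    then have x: "x \<in> \<Omega>" by (simp add: space_restrict_space)
    show "v_of w x \<bullet> v_of w' x + K_of w x \<bullet> K_of w' x + tensor_act (CC x) (strain \<Omega> w x) \<bullet> strain \<Omega> w' x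
      + tensor_act (HH x) (sym_part (P_of w x)) \<bullet> sym_part (P_of w' x)
      + tensor_act (LL x) (Curl \<Omega> (P_of w) x) \<bullet> Curl \<Omega> (P_of w') x =
      v_of w x \<bullet> v_of w' x + K_of w x \<bullet> K_of w' x + sigma w x \<bullet> (Grad \<Omega> (u_of w') x - P_of w' x)
      + tau w x \<bullet> P_of w' x + moment w x \<bullet> Curl \<Omega> (P_of w') x"
      unfolding sigma_def tau_def moment_def strain_def C_field(3)[OF x] H_field(3)[OF x] ..
  qed
  also have "\<dots> = cls \<Omega> (v_of w) \<bullet> cls \<Omega> (v_of w') + cls \<Omega> (K_of w) \<bullet> cls \<Omega> (K_of w')
      + cls \<Omega> (sigma w) \<bullet> cls \<Omega> (\<lambda>x. Grad \<Omega> (u_of w') x - P_of w' x)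
      + cls \<Omega> (tau w) \<bullet> cls \<Omega> (P_of w') + cls \<Omega> (moment w) \<bullet> cls \<Omega> (Curl \<Omega> (P_of w'))"
    unfolding cls_inner[OF grad.Om L(2) L'(2)] cls_inner[OF grad.Om L(4) L'(4)] cls_inner[OF grad.Om S(1) d]
      cls_inner[OF grad.Om S(2) L'(3)] cls_inner[OF grad.Om S(3) L'(6)]
    by (simp only: Bochner_Integration.integral_add Bochner_Integration.integrable_add i)
  also have "\<dots> = Eform (Phi w) (Phi w')"
    unfolding S(4-6) cls_diff[OF grad.Om L'(5,3)] by (simp add: Eform_def Phi_def aform_def)
  finally show ?thesis .
qed

lemma bounded_bilinear_Eform: "bounded_bilinear Eform"
  unfolding Eform_def[abs_def]
  by (intro bounded_bilinear_plus bounded_bilinear.comp[OF bounded_bilinear_aform] bounded_bilinear.comp[OF bounded_bilinear_inner]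
      bounded_linear_fst bounded_linear_snd)

lemma Eform_sym: "Eform s s' = Eform s' s"
  unfolding Eform_def using aform_sym[of "fst s" "fst s'"] by (simp add: inner_commute)

lemma Eform_nonneg: "0 \<le> Eform s s"
  unfolding Eform_def using aform_nonneg[of "fst s"] by simp

lemma Eform_definite: "s \<in> SS \<Longrightarrow> Eform s s = 0 \<Longrightarrow> s = 0"
proof -
  assume s: "s \<in> SS" and z: "Eform s s = 0"
  have "aform (fst s) (fst s) = 0" "snd s \<bullet> snd s = 0"
    using z aform_nonneg[of "fst s"] inner_ge_zero[of "snd s"] unfolding Eform_def by linarith+
  then have "fst s = 0" "snd s = 0" using aform_definite[of "fst s"] s by (auto simp: SS_def)
  then show "s = 0" by (simp add: prod_eq_iff)
qed

lemma X_norm_sq: "w \<in> XO \<Longrightarrow> (X_norm \<Omega> CC HH LL w)\<^sup>2 = Eform (Phi w) (Phi w)"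
  by (simp add: X_norm_def X_inner_eq Eform_nonneg)

lemma X_norm_le: "\<exists>K>0. \<forall>w\<in>XO. X_norm \<Omega> CC HH LL w \<le> K * norm (Phi w)"
proof -
  obtain K where K: "\<And>a b. norm (Eform a b) \<le> norm a * norm b * K" "K > 0"
    using bounded_bilinear.pos_bounded[OF bounded_bilinear_Eform] by blast
  have "X_norm \<Omega> CC HH LL w \<le> sqrt K * norm (Phi w)" if "w \<in> XO" for w
  proof (rule power2_le_imp_le)
    show "(X_norm \<Omega> CC HH LL w)\<^sup>2 \<le> (sqrt K * norm (Phi w))\<^sup>2"
    proof -
      have "(sqrt K * norm (Phi w))\<^sup>2 = norm (Phi w) * norm (Phi w) * K"
        using K(2) by (simp add: power_mult_distrib power2_eq_square[of "norm (Phi w)"])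
      then show ?thesis
        unfolding X_norm_sq[OF that] using abs_le_D1[OF K(1)[of "Phi w" "Phi w", unfolded real_norm_def]] by simp
    qed
  qed (use K in simp)
  then show ?thesis using K by (intro exI[of _ "sqrt K"]) auto
qed

section \<open>The operator in weak form\<close>

text \<open>Distributions with values in the product space are compared componentwise.\<close>

lemma represents_prod:
  assumes z: "z \<in> XO"
  shows "represents \<Omega> z D \<longleftrightarrow> (\<forall>\<phi>\<in>test_funs \<Omega>. D \<phi> =
    (regular_dist \<Omega> (u_of z) \<phi>, regular_dist \<Omega> (v_of z) \<phi>, regular_dist \<Omega> (P_of z) \<phi>, regular_dist \<Omega> (K_of z) \<phi>))"
proof -
  note L = XX_L2[OF z]
  have "regular_dist \<Omega> z \<phi> = (regular_dist \<Omega> (u_of z) \<phi>, regular_dist \<Omega> (v_of z) \<phi>, regular_dist \<Omega> (P_of z) \<phi>, regular_dist \<Omega> (K_of z) \<phi>)"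
    if \<phi>: "\<phi> \<in> test_funs \<Omega>" for \<phi>
  proof -
    note i = test_mult_integrable[OF op L(1) \<phi>] test_mult_integrable[OF op L(2) \<phi>]
      test_mult_integrable[OF op L(3) \<phi>] test_mult_integrable[OF op L(4) \<phi>]
    have "\<phi> x *\<^sub>R z x = (\<phi> x *\<^sub>R u_of z x, \<phi> x *\<^sub>R v_of z x, \<phi> x *\<^sub>R P_of z x, \<phi> x *\<^sub>R K_of z x)" for x
      by (simp add: prod_eq_iff u_of_def v_of_def P_of_def K_of_def)
    then have "regular_dist \<Omega> z \<phi> = (LINT x|lebesgue_on \<Omega>. (\<phi> x *\<^sub>R u_of z x, \<phi> x *\<^sub>R v_of z x, \<phi> x *\<^sub>R P_of z x, \<phi> x *\<^sub>R K_of z x))"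
      unfolding regular_dist_def by presburger
    then show ?thesis
      unfolding regular_dist_def integral_Pair(1)[OF i(1) integral_Pair(2)[OF i(2) integral_Pair(2)[OF i(3) i(4)]]]
        integral_Pair(1)[OF i(2) integral_Pair(2)[OF i(3) i(4)]] integral_Pair(1)[OF i(3) i(4)] .
  qed
  then show ?thesis unfolding represents_def by simp
qed

lemma regular_represents_iff:
  fixes f g :: "vec3 \<Rightarrow> 'd::euclidean_space"
  assumes "f \<in> L2 \<Omega>" "g \<in> L2 \<Omega>"
  shows "(\<forall>\<phi>\<in>test_funs \<Omega>. regular_dist \<Omega> f \<phi> = regular_dist \<Omega> g \<phi>) \<longleftrightarrow> cls \<Omega> f = cls \<Omega> g"
proof
  assume "\<forall>\<phi>\<in>test_funs \<Omega>. regular_dist \<Omega> f \<phi> = regular_dist \<Omega> g \<phi>"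
  then have "represents \<Omega> f (regular_dist \<Omega> f)" "represents \<Omega> g (regular_dist \<Omega> f)" by (auto simp: represents_def)
  then show "cls \<Omega> f = cls \<Omega> g" using grad.represents_unique[OF assms] cls_eq_iff[OF grad.Om assms] by blast
next
  assume "cls \<Omega> f = cls \<Omega> g"
  then have ae: "AE x in lebesgue_on \<Omega>. f x = g x" using cls_eq_iff[OF grad.Om assms] by blast
  show "\<forall>\<phi>\<in>test_funs \<Omega>. regular_dist \<Omega> f \<phi> = regular_dist \<Omega> g \<phi>"
  proof
    fix \<phi> :: "vec3 \<Rightarrow> real" assume \<phi>: "\<phi> \<in> test_funs \<Omega>"
    show "regular_dist \<Omega> f \<phi> = regular_dist \<Omega> g \<phi>"
      unfolding regular_dist_def
    proof (rule integral_cong_AE)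
      show "AE x in lebesgue_on \<Omega>. \<phi> x *\<^sub>R f x = \<phi> x *\<^sub>R g x" using ae by eventually_elim simp
    qed (use test_mult_integrable[OF op assms(1) \<phi>] test_mult_integrable[OF op assms(2) \<phi>] in auto)
  qed
qed

text \<open>The first and third components say that the velocities are \<open>(u, P)\<close> of the image. By \<open>represents_iff\<close> the second and
  fourth are the equation \<open>aform U \<phi> = - (Y \<bullet> inc \<phi>)\<close> for test fields in \<open>u\<close> and in \<open>P\<close>, respectively; both sides are
  continuous in \<open>\<phi>\<close>, and the test fields are dense in the energy space.\<close>

lemma A_dist_iff:
  assumes w: "w \<in> XO" and z: "z \<in> XO"
  shows "represents \<Omega> z (A_dist \<Omega> CC HH LL w) \<longleftrightarrow> (Phi w, Phi z) \<in> wave.wave_graph"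
proof -
  note Lw = XX_L2[OF w] and Lz = XX_L2[OF z] and S = stresses[OF w]
  define \<rho> where "\<rho> x = sigma w x - tau w x - K_of z x" for x
  \<comment> \<open>The fourth component, solved for the curl of the moment stress.\<close>
  have \<rho>L: "\<rho> \<in> L2 \<Omega>" unfolding \<rho>_def[abs_def] by (intro L2_diff S Lz)
  have \<rho>: "cls \<Omega> \<rho> = cls \<Omega> (sigma w) - cls \<Omega> (tau w) - cls \<Omega> (K_of z)"
    unfolding \<rho>_def[abs_def] cls_diff[OF grad.Om L2_diff[OF S(1,2)] Lz(4)] cls_diff[OF grad.Om S(1,2)] ..
  have reg: "regular_dist \<Omega> \<rho> \<phi> = regular_dist \<Omega> (sigma w) \<phi> - regular_dist \<Omega> (tau w) \<phi> - regular_dist \<Omega> (K_of z) \<phi>"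
    if \<phi>: "\<phi> \<in> test_funs \<Omega>" for \<phi>
    using test_mult_integrable[OF op S(1) \<phi>] test_mult_integrable[OF op S(2) \<phi>] test_mult_integrable[OF op Lz(4) \<phi>]
    by (simp add: regular_dist_def \<rho>_def scaleR_diff_right)
  have "represents \<Omega> z (A_dist \<Omega> CC HH LL w) \<longleftrightarrow>
      (\<forall>\<phi>\<in>test_funs \<Omega>. regular_dist \<Omega> (v_of w) \<phi> = regular_dist \<Omega> (u_of z) \<phi>) \<and>
      (\<forall>\<phi>\<in>test_funs \<Omega>. regular_dist \<Omega> (K_of w) \<phi> = regular_dist \<Omega> (P_of z) \<phi>) \<and>
      (\<forall>\<phi>\<in>test_funs \<Omega>. dDiv (regular_dist \<Omega> (sigma w)) \<phi> = regular_dist \<Omega> (v_of z) \<phi>) \<and>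
      (\<forall>\<phi>\<in>test_funs \<Omega>. dCurl (regular_dist \<Omega> (moment w)) \<phi> = regular_dist \<Omega> \<rho> \<phi>)"
  proof -
    have stress_eqs: "(\<lambda>x. tensor_act (CC x) (strain \<Omega> w x)) = sigma w"
      "(\<lambda>x. tensor_act (HH x) (sym_part (P_of w x))) = tau w"
      "(\<lambda>x. tensor_act (LL x) (Curl \<Omega> (P_of w) x)) = moment w"
      by (simp_all add: fun_eq_iff sigma_def tau_def moment_def)
    have alg: "- c + s - t = k \<longleftrightarrow> c = s - t - k" for c s t k :: mat3 by (auto simp: algebra_simps)
    have last: "(\<forall>\<phi>\<in>test_funs \<Omega>. - dCurl (regular_dist \<Omega> (moment w)) \<phi> + regular_dist \<Omega> (sigma w) \<phi>
          - regular_dist \<Omega> (tau w) \<phi> = regular_dist \<Omega> (K_of z) \<phi>)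
        = (\<forall>\<phi>\<in>test_funs \<Omega>. dCurl (regular_dist \<Omega> (moment w)) \<phi> = regular_dist \<Omega> \<rho> \<phi>)"
      by (rule ball_cong[OF refl]) (simp only: alg reg)
    show ?thesis
      unfolding represents_prod[OF z] A_dist_def stress_eqs prod.inject ball_conj_distrib last by blast
  qed
  also have "\<dots> \<longleftrightarrow> cls \<Omega> (v_of w) = cls \<Omega> (u_of z) \<and> cls \<Omega> (K_of w) = cls \<Omega> (P_of z) \<and>
      represents \<Omega> (v_of z) (dop divT (regular_dist \<Omega> (sigma w))) \<and>
      represents \<Omega> \<rho> (dop curlT (regular_dist \<Omega> (moment w)))"
    unfolding regular_represents_iff[OF Lw(2) Lz(1)] regular_represents_iff[OF Lw(4) Lz(3)] dDiv_eq dCurl_eq represents_def ..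
  also have "\<dots> \<longleftrightarrow> cls \<Omega> (v_of w) = cls \<Omega> (u_of z) \<and> cls \<Omega> (K_of w) = cls \<Omega> (P_of z) \<and>
      (\<forall>\<psi>\<in>test_funs \<Omega>. cls \<Omega> (v_of z) \<bullet> cls \<Omega> \<psi> = - (cls \<Omega> (sigma w) \<bullet> cls \<Omega> (sop gradT \<psi>))) \<and>
      (\<forall>\<eta>\<in>test_funs \<Omega>. cls \<Omega> \<rho> \<bullet> cls \<Omega> \<eta> = cls \<Omega> (moment w) \<bullet> cls \<Omega> (sop curlT \<eta>))"
  proof -
    have "cls \<Omega> (sop (\<lambda>j X. - curlT j X) \<eta>) = - cls \<Omega> (sop curlT \<eta>)" if "\<eta> \<in> test_funs \<Omega>" for \<eta>
    proof -
      have "sop (\<lambda>j X. - curlT j X) \<eta> = (\<lambda>x. (-1) *\<^sub>R sop curlT \<eta> x)" by (rule ext) (simp add: sop_def sum_negf)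
      then show ?thesis using cls_scaleR[OF grad.Om test_L2_on[OF op curl.sop_test[OF that]], of "-1"] by simp
    qed
    then show ?thesis
      unfolding div.represents_iff[OF S(1) Lz(2)] curl.represents_iff[OF S(3) \<rho>L] by auto
  qed
  also have "\<dots> \<longleftrightarrow> (Phi w, Phi z) \<in> wave.wave_graph"
  proof -
    let ?U = "fst (Phi w)" and ?Y = "snd (Phi z)"
    have aU: "aform ?U ((p, q), (p', q')) = cls \<Omega> (sigma w) \<bullet> (q - p') + cls \<Omega> (tau w) \<bullet> p' + cls \<Omega> (moment w) \<bullet> q'" for p q p' q'
      unfolding S(4-6) by (simp add: Phi_def aform_def)
    have Yi: "?Y \<bullet> inc ((p, q), (p', q')) = cls \<Omega> (v_of z) \<bullet> p + cls \<Omega> (K_of z) \<bullet> p'" for p q p' q'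
      by (simp add: Phi_def inc_def)
    have "(\<forall>\<phi>\<in>VV. aform ?U \<phi> = - (?Y \<bullet> inc \<phi>)) \<longleftrightarrow>
      (\<forall>\<psi>\<in>test_funs \<Omega>. cls \<Omega> (v_of z) \<bullet> cls \<Omega> \<psi> = - (cls \<Omega> (sigma w) \<bullet> cls \<Omega> (sop gradT \<psi>))) \<and>
      (\<forall>\<eta>\<in>test_funs \<Omega>. cls \<Omega> \<rho> \<bullet> cls \<Omega> \<eta> = cls \<Omega> (moment w) \<bullet> cls \<Omega> (sop curlT \<eta>))" (is "?L \<longleftrightarrow> ?R1 \<and> ?R2")
    proof
      assume L: ?L
      have 0: "(0, 0) \<in> grad.W0" "(0, 0) \<in> curl.W0"
        using subspace_0[OF grad.subspace_W0] subspace_0[OF curl.subspace_W0] by (auto simp: zero_prod_def)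
      show "?R1 \<and> ?R2"
      proof (intro conjI ballI)
        fix \<psi> :: "vec3 \<Rightarrow> vec3" assume \<psi>: "\<psi> \<in> test_funs \<Omega>"
        have "((cls \<Omega> \<psi>, cls \<Omega> (sop gradT \<psi>)), (0, 0)) \<in> VV" using grad.emb_W0[OF \<psi>] 0 by (simp add: grad.emb_def)
        from L[rule_format, OF this] show "cls \<Omega> (v_of z) \<bullet> cls \<Omega> \<psi> = - (cls \<Omega> (sigma w) \<bullet> cls \<Omega> (sop gradT \<psi>))"
          unfolding aU Yi by simp
      next
        fix \<eta> :: "vec3 \<Rightarrow> mat3" assume \<eta>: "\<eta> \<in> test_funs \<Omega>"
        have "((0, 0), (cls \<Omega> \<eta>, cls \<Omega> (sop curlT \<eta>))) \<in> VV" using curl.emb_W0[OF \<eta>] 0 by (simp add: curl.emb_def)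
        from L[rule_format, OF this] show "cls \<Omega> \<rho> \<bullet> cls \<Omega> \<eta> = cls \<Omega> (moment w) \<bullet> cls \<Omega> (sop curlT \<eta>)"
          unfolding aU Yi \<rho> by (simp add: inner_diff_left)
      qed
    next
      assume R: "?R1 \<and> ?R2"
      have g: "cls \<Omega> (sigma w) \<bullet> q = - (cls \<Omega> (v_of z) \<bullet> p)" if "(p, q) \<in> grad.W0" for p q
      proof -
        have "(\<lambda>a. cls \<Omega> (sigma w) \<bullet> snd a = - (cls \<Omega> (v_of z) \<bullet> fst a)) (p, q)"
          by (rule grad.W0_closed_property[OF that])
            (use R in \<open>auto simp: grad.emb_def intro!: closed_Collect_eq continuous_intros\<close>)
        then show ?thesis by simp
      qed
      have c: "cls \<Omega> (moment w) \<bullet> q = cls \<Omega> \<rho> \<bullet> p" if "(p, q) \<in> curl.W0" for p q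
      proof -
        have "(\<lambda>a. cls \<Omega> (moment w) \<bullet> snd a = cls \<Omega> \<rho> \<bullet> fst a) (p, q)"
          by (rule curl.W0_closed_property[OF that])
            (use R in \<open>auto simp: curl.emb_def intro!: closed_Collect_eq continuous_intros\<close>)
        then show ?thesis by simp
      qed
      show ?L
      proof
        fix \<phi> assume "\<phi> \<in> VV"
        then obtain p q p' q' where \<phi>: "\<phi> = ((p, q), (p', q'))" "(p, q) \<in> grad.W0" "(p', q') \<in> curl.W0" by (metis SigmaE prod.exhaust)
        show "aform ?U \<phi> = - (?Y \<bullet> inc \<phi>)"
          unfolding \<phi>(1) aU Yi using g[OF \<phi>(2)] c[OF \<phi>(3)] by (simp add: \<rho> inner_diff_left inner_diff_right)
      qed
    qed
    moreover have "(Phi w, Phi z) \<in> wave.wave_graph \<longleftrightarrow> (snd (Phi w) = inc (fst (Phi z)) \<and> (\<forall>\<phi>\<in>VV. aform ?U \<phi> = - (?Y \<bullet> inc \<phi>)))"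
      using Phi_SS[OF w] Phi_SS[OF z] wave.wave_graph_iff[of "fst (Phi w)" "snd (Phi w)" "fst (Phi z)" "snd (Phi z)"]
      unfolding SS_def by auto
    moreover have "snd (Phi w) = inc (fst (Phi z)) \<longleftrightarrow> cls \<Omega> (v_of w) = cls \<Omega> (u_of z) \<and> cls \<Omega> (K_of w) = cls \<Omega> (P_of z)"
      by (simp add: Phi_def inc_def)
    ultimately show ?thesis by blast
  qed
  finally show ?thesis .
qed

lemma A_dom_iff: "w \<in> A_dom \<Omega> CC HH LL \<longleftrightarrow> w \<in> XO \<and> (\<exists>s. (Phi w, s) \<in> wave.wave_graph)"
proof
  assume "w \<in> A_dom \<Omega> CC HH LL"
  then show "w \<in> XO \<and> (\<exists>s. (Phi w, s) \<in> wave.wave_graph)" unfolding A_dom_def using A_dist_iff by blast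
next
  assume "w \<in> XO \<and> (\<exists>s. (Phi w, s) \<in> wave.wave_graph)"
  then obtain s where w: "w \<in> XO" and s: "(Phi w, s) \<in> wave.wave_graph" by blast
  have "s \<in> SS" using s unfolding wave.wave_graph_def SS_def by auto
  then show "w \<in> A_dom \<Omega> CC HH LL"
    unfolding A_dom_def using w s field_of[of s] A_dist_iff[OF w, of "field_of s"] by auto
qed

lemma A_op:
  assumes w: "w \<in> A_dom \<Omega> CC HH LL"
  shows "A_op \<Omega> CC HH LL w \<in> XO" "(Phi w, Phi (A_op \<Omega> CC HH LL w)) \<in> wave.wave_graph"
proof -
  have wX: "w \<in> XO" using w by (simp add: A_dom_def)
  have "\<exists>z. z \<in> XO \<and> represents \<Omega> z (A_dist \<Omega> CC HH LL w)" using w unfolding A_dom_def by blast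
  then have a: "A_op \<Omega> CC HH LL w \<in> XO \<and> represents \<Omega> (A_op \<Omega> CC HH LL w) (A_dist \<Omega> CC HH LL w)"
    unfolding A_op_def by (rule someI_ex)
  then show "A_op \<Omega> CC HH LL w \<in> XO" by blast
  show "(Phi w, Phi (A_op \<Omega> CC HH LL w)) \<in> wave.wave_graph" using a A_dist_iff[OF wX] by blast
qed

lemma wave_graph_unique:
  assumes "(s, a) \<in> wave.wave_graph" "(s, b) \<in> wave.wave_graph" shows "a = b"
proof -
  have "(0, a - b) \<in> wave.wave_graph" using subspace_diff[OF wave.subspace_wave_graph assms] by simp
  then show ?thesis using wave.wave_graph_single by fastforce
qed

lemma A_op_eq: "w \<in> XO \<Longrightarrow> (Phi w, s) \<in> wave.wave_graph \<Longrightarrow> w \<in> A_dom \<Omega> CC HH LL \<and> Phi (A_op \<Omega> CC HH LL w) = s"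
  using A_op A_dom_iff wave_graph_unique by blast

text \<open>Insert \<open>\<phi> = Z\<close> in the definition of the graph.\<close>

lemma energy_conservation: "(s, a) \<in> wave.wave_graph \<Longrightarrow> Eform a s = 0"
proof -
  assume "(s, a) \<in> wave.wave_graph"
  then have "((fst s, snd s), (fst a, snd a)) \<in> wave.wave_graph" by simp
  then have Z: "fst a \<in> VV" and W: "snd s = inc (fst a)" and "\<forall>\<phi>\<in>VV. aform (fst s) \<phi> = - (snd a \<bullet> inc \<phi>)"
    unfolding wave.wave_graph_iff by blast+
  from this(3)[rule_format, OF Z] show "Eform a s = 0"
    unfolding Eform_def W aform_sym[of "fst a" "fst s"] by simp
qed

end

section \<open>Curves in function spaces\<close>

text \<open>The form in which derivatives of curves in function spaces are defined.\<close>

lemma has_vector_derivative_iff_quotient: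
  fixes f :: "real \<Rightarrow> 'a::real_normed_vector"
  shows "(f has_vector_derivative D) (at t within I) \<longleftrightarrow>
    ((\<lambda>s. norm ((f s - f t) /\<^sub>R (s - t) - D)) \<longlongrightarrow> 0) (at t within I)"
proof -
  have "norm ((f s - f t) - (s - t) *\<^sub>R D) / norm (s - t) = norm ((f s - f t) /\<^sub>R (s - t) - D)" if "s \<noteq> t" for s
  proof -
    have "(f s - f t) /\<^sub>R (s - t) - D = inverse (s - t) *\<^sub>R ((f s - f t) - (s - t) *\<^sub>R D)"
      using that by (simp add: scaleR_diff_right)
    then show ?thesis by (simp add: divide_inverse mult.commute)
  qed
  then have "((\<lambda>s. norm ((f s - f t) - (s - t) *\<^sub>R D) / norm (s - t)) \<longlongrightarrow> 0) (at t within I) \<longleftrightarrow>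
      ((\<lambda>s. norm ((f s - f t) /\<^sub>R (s - t) - D)) \<longlongrightarrow> 0) (at t within I)"
    by (intro Lim_cong_within) auto
  then show ?thesis
    unfolding has_vector_derivative_def has_derivative_iff_norm by (simp add: bounded_linear_scaleR_left)
qed

lemma cls_curve_derivative:
  assumes \<Omega>: "\<Omega> \<in> sets lebesgue" and f: "\<And>s. s \<in> I \<Longrightarrow> f s \<in> L2 \<Omega>" and t: "t \<in> I"
    and d: "has_curve_deriv I (L2 \<Omega>) (L2_norm \<Omega>) f d t"
  shows "((\<lambda>s. cls \<Omega> (f s)) has_vector_derivative cls \<Omega> d) (at t within I)"
  unfolding has_vector_derivative_iff_quotient
proof (rule Lim_cong_within[THEN iffD2, OF refl refl refl])
  have dL: "d \<in> L2 \<Omega>" and lim: "((\<lambda>s. L2_norm \<Omega> (\<lambda>x. (f s x - f t x) /\<^sub>R (s - t) - d x)) \<longlongrightarrow> 0) (at t within I)"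
    using d by (auto simp: has_curve_deriv_def)
  show "((\<lambda>s. L2_norm \<Omega> (\<lambda>x. (f s x - f t x) /\<^sub>R (s - t) - d x)) \<longlongrightarrow> 0) (at t within I)" by (rule lim)
  fix s assume "s \<in> I"
  then have st: "(\<lambda>x. f s x - f t x) \<in> L2 \<Omega>" using f t by (intro L2_diff)
  show "norm ((cls \<Omega> (f s) - cls \<Omega> (f t)) /\<^sub>R (s - t) - cls \<Omega> d)
      = L2_norm \<Omega> (\<lambda>x. (f s x - f t x) /\<^sub>R (s - t) - d x)"
    unfolding cls_norm[OF \<Omega> L2_diff[OF L2_scaleR[OF st] dL], symmetric] cls_diff[OF \<Omega> L2_scaleR[OF st] dL]
      cls_scaleR[OF \<Omega> st] cls_diff[OF \<Omega> f[OF \<open>s \<in> I\<close>] f[OF t]] ..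
qed

lemma cls_curve_continuous:
  assumes \<Omega>: "\<Omega> \<in> sets lebesgue" and f: "C0_curve I (L2 \<Omega>) (L2_norm \<Omega>) f"
  shows "continuous_on I (\<lambda>s. cls \<Omega> (f s))"
  unfolding continuous_on_def
proof
  fix t assume t: "t \<in> I"
  have fL: "f s \<in> L2 \<Omega>" if "s \<in> I" for s using f that by (simp add: C0_curve_def)
  have "((\<lambda>s. norm (cls \<Omega> (f s) - cls \<Omega> (f t))) \<longlongrightarrow> 0) (at t within I)"
  proof (rule Lim_cong_within[THEN iffD2, OF refl refl refl])
    show "((\<lambda>s. L2_norm \<Omega> (\<lambda>x. f s x - f t x)) \<longlongrightarrow> 0) (at t within I)" using f t by (simp add: C0_curve_def)
    show "norm (cls \<Omega> (f s) - cls \<Omega> (f t)) = L2_norm \<Omega> (\<lambda>x. f s x - f t x)" if "s \<in> I" for s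
      unfolding cls_norm[OF \<Omega> L2_diff[OF fL[OF that] fL[OF t]], symmetric] cls_diff[OF \<Omega> fL[OF that] fL[OF t]] ..
  qed
  then show "((\<lambda>s. cls \<Omega> (f s)) \<longlongrightarrow> cls \<Omega> (f t)) (at t within I)"
    unfolding tendsto_norm_zero_iff by (rule LIM_zero_cancel)
qed

section \<open>Nonnegative forms along curves\<close>

text \<open>The polynomial \<open>E (a + r b) (a + r b)\<close> in \<open>r\<close> is nonnegative. The form may be degenerate, and if \<open>E b b = 0\<close> this polynomial is
  linear, hence constant.\<close>

lemma nonneg_form_Cauchy_Schwarz:
  assumes E: "bounded_bilinear E" and sym: "\<And>x y. E x y = E y x" and nonneg: "\<And>x. (0::real) \<le> E x x"
  shows "\<bar>E a b\<bar> \<le> sqrt (E a a) * sqrt (E b b)"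
proof -
  interpret E: bounded_bilinear E by (rule E)
  have quad: "0 \<le> E a a + 2 * r * E a b + r * r * E b b" for r
    using nonneg[of "a + r *\<^sub>R b"] sym[of b a] by (simp add: E.add_left E.add_right E.scaleR_left E.scaleR_right algebra_simps)
  have "(E a b)\<^sup>2 \<le> E a a * E b b"
  proof (cases "E b b = 0")
    case True
    have "E a b = 0"
    proof (rule ccontr)
      assume "E a b \<noteq> 0"
      then show False using quad[of "- (E a a + 1) / (2 * E a b)"] True by (simp add: field_simps)
    qed
    then show ?thesis using True by simp
  next
    case False
    then have pos: "E b b > 0" using nonneg[of b] by simp
    have "0 \<le> E a a - (E a b)\<^sup>2 / E b b"
      using quad[of "- E a b / E b b"] False by (simp add: power2_eq_square field_simps)
    then show ?thesis using pos by (simp add: field_simps)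
  qed
  then show ?thesis unfolding real_sqrt_mult[symmetric] by (rule real_le_rsqrt[of "\<bar>E a b\<bar>", simplified])
qed

lemma nonneg_form_diff_le:
  assumes E: "bounded_bilinear E" and nonneg: "\<And>x. (0::real) \<le> E x x"
  shows "E (a - b) (a - b) \<le> 2 * E a a + 2 * E b b"
proof -
  interpret E: bounded_bilinear E by (rule E)
  show ?thesis
    using nonneg[of "a + b"] by (simp add: E.add_left E.add_right E.diff_left E.diff_right)
qed

text \<open>The chain rule for the quadratic form, when the difference quotients converge in the seminorm of the form alone: with \<open>a s\<close> the difference
  between the quotient and \<open>D\<close>, the difference quotient of the form is \<open>2 * E (a s) (z t) + (s - t) * E (D + a s) (D + a s)\<close>.\<close>

lemma conserved_form_derivative:
  assumes E: "bounded_bilinear E" and sym: "\<And>x y. E x y = E y x" and nonneg: "\<And>x. (0::real) \<le> E x x"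
    and lim: "((\<lambda>s. E ((z s - z t) /\<^sub>R (s - t) - D) ((z s - z t) /\<^sub>R (s - t) - D)) \<longlongrightarrow> 0) (at t within I)"
    and orth: "E D (z t) = 0"
  shows "((\<lambda>s. E (z s) (z s)) has_field_derivative 0) (at t within I)"
  unfolding has_field_derivative_iff
proof (rule tendsto_rabs_zero_cancel)
  interpret E: bounded_bilinear E by (rule E)
  define a where "a s = (z s - z t) /\<^sub>R (s - t) - D" for s
  define h where "h s = 2 * (sqrt (E (a s) (a s)) * sqrt (E (z t) (z t))) + \<bar>s - t\<bar> * (2 * E D D + 2 * E (a s) (a s))" for s
  have lim: "((\<lambda>s. E (a s) (a s)) \<longlongrightarrow> 0) (at t within I)" unfolding a_def by (rule lim)
  have "(h \<longlongrightarrow> 2 * (sqrt 0 * sqrt (E (z t) (z t))) + \<bar>t - t\<bar> * (2 * E D D + 2 * 0)) (at t within I)"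
    unfolding h_def by (intro tendsto_intros lim)
  then have h: "(h \<longlongrightarrow> 0) (at t within I)" by simp
  have "\<bar>(E (z s) (z s) - E (z t) (z t)) / (s - t)\<bar> \<le> h s" if "s \<noteq> t" for s
  proof -
    define r where "r = s - t"
    have r: "r \<noteq> 0" using that by (simp add: r_def)
    have z: "z s = z t + r *\<^sub>R (D + a s)" using r by (simp add: a_def r_def scaleR_diff_right)
    have "E (z s) (z s) - E (z t) (z t) = r * (2 * E (a s) (z t) + r * E (D + a s) (D + a s))"
      unfolding z E.add_left[of "z t"] E.add_right[of _ "z t"] E.scaleR_left E.scaleR_right
      using orth sym[of "z t" D] sym[of "z t" "a s"]
      by (simp add: E.add_left E.add_right algebra_simps)
    then have eq: "(E (z s) (z s) - E (z t) (z t)) / r = 2 * E (a s) (z t) + r * E (D + a s) (D + a s)"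
      using r by simp
    have "\<bar>r * E (D + a s) (D + a s)\<bar> = \<bar>r\<bar> * E (D + a s) (D + a s)" using nonneg by (simp add: abs_mult)
    also have "\<dots> \<le> \<bar>r\<bar> * (2 * E D D + 2 * E (a s) (a s))"
      using nonneg_form_diff_le[OF E nonneg, of D "- a s"] by (intro mult_left_mono) (auto simp: E.minus_left E.minus_right)
    finally show ?thesis
      unfolding h_def r_def[symmetric] eq using nonneg_form_Cauchy_Schwarz[OF E sym nonneg, of "a s" "z t"] by linarith
  qed
  then have "\<forall>\<^sub>F s in at t within I. \<bar>(E (z s) (z s) - E (z t) (z t)) / (s - t)\<bar> \<le> h s"
    by (auto simp: eventually_at_filter)
  then show "((\<lambda>s. \<bar>(E (z s) (z s) - E (z t) (z t)) / (s - t)\<bar>) \<longlongrightarrow> 0) (at t within I)"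
    by (intro tendsto_sandwich[OF _ _ tendsto_const[of 0] h]) (auto intro: always_eventually)
qed

section \<open>Existence and uniqueness\<close>

context micromorphic
begin

abbreviation XN :: "state \<Rightarrow> real" where "XN \<equiv> X_norm \<Omega> CC HH LL"
abbreviation DA :: "state set" where "DA \<equiv> A_dom \<Omega> CC HH LL"
abbreviation AA :: "state \<Rightarrow> state" where "AA \<equiv> A_op \<Omega> CC HH LL"

lemma X_norm_nonneg: "w \<in> XO \<Longrightarrow> 0 \<le> XN w"
  by (simp add: X_norm_def X_inner_eq Eform_nonneg)

text \<open>Limits are obtained in the product norm and carried over to the norm of \<open>\<X>\<close> by \<open>X_norm_le\<close>.\<close>

lemma X_norm_tendsto_0:
  assumes "\<And>s. s \<in> I \<Longrightarrow> h s \<in> XO" "((\<lambda>s. norm (Phi (h s))) \<longlongrightarrow> 0) (at t within I)"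
  shows "((\<lambda>s. XN (h s)) \<longlongrightarrow> 0) (at t within I)"
proof -
  obtain K where K: "K > 0" "\<forall>w\<in>XO. XN w \<le> K * norm (Phi w)" using X_norm_le by blast
  show ?thesis
  proof (rule tendsto_0_le[OF assms(2), of _ K])
    have "norm (XN (h s)) \<le> norm (norm (Phi (h s))) * K" if "s \<in> I" for s
      using K(2) X_norm_nonneg[OF assms(1)[OF that]] assms(1)[OF that] by (simp add: mult.commute)
    then show "\<forall>\<^sub>F s in at t within I. norm (XN (h s)) \<le> norm (norm (Phi (h s))) * K"
      by (auto simp: eventually_at_filter)
  qed
qed

lemma Phi_quotient:
  assumes "w \<in> XO" "w' \<in> XO" "d \<in> XO"
  shows "(\<lambda>x. (w x - w' x) /\<^sub>R r - d x) \<in> XO" "Phi (\<lambda>x. (w x - w' x) /\<^sub>R r - d x) = (Phi w - Phi w') /\<^sub>R r - Phi d"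
  using Phi_diff[OF Phi_scaleR(1)[OF Phi_diff(1)[OF assms(1,2)]] assms(3), of "inverse r"]
    Phi_scaleR(2)[OF Phi_diff(1)[OF assms(1,2)]] Phi_diff(2)[OF assms(1,2)] by simp_all

lemma Phi_force:
  assumes "f \<in> L2 \<Omega>" "M \<in> L2 \<Omega>"
  shows "(\<lambda>x. (0, f x, 0, M x)) \<in> XO" "Phi (\<lambda>x. (0, f x, 0, M x)) = (0, (cls \<Omega> f, cls \<Omega> M))"
proof -
  let ?w = "\<lambda>x. (0, f x, 0, M x)"
  have parts: "u_of ?w = (\<lambda>x. 0)" "v_of ?w = f" "P_of ?w = (\<lambda>x. 0)" "K_of ?w = M"
    by (auto simp: fun_eq_iff u_of_def v_of_def P_of_def K_of_def)
  have "(((0, 0), (0, 0)), (cls \<Omega> f, cls \<Omega> M)) \<in> SS"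
    using subspace_0[OF energy_closed(1)] assms by (simp add: SS_def HHs_def cls_rep_cls[OF grad.Om] zero_prod_def)
  from Phi_eqI[OF this, of ?w, unfolded parts, OF L2_zero assms(1) L2_zero assms(2) cls_zero[OF grad.Om] refl cls_zero[OF grad.Om] refl]
  show "?w \<in> XO" "Phi ?w = (0, (cls \<Omega> f, cls \<Omega> M))" by (auto simp: zero_prod_def)
qed

lemma wave_graph_SS: assumes "(s, a) \<in> wave.wave_graph" shows "s \<in> SS"
proof -
  have "((fst s, snd s), (fst a, snd a)) \<in> wave.wave_graph" using assms by simp
  then have "fst s \<in> VV" "fst a \<in> VV" "snd s = inc (fst a)" unfolding wave.wave_graph_iff by blast+
  then show ?thesis using wave.\<iota>(2)[of "fst a"] by (metis SS_def SigmaI prod.collapse)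
qed

text \<open>The solution of the abstract problem is turned into a curve of fields by \<open>field_of\<close>; its derivative \<open>y\<close> and the values \<open>y t - (0, g t)\<close> of the
  generator are continuous, which gives continuity in the graph norm.\<close>

theorem solution_exists:
  assumes T: "T > 0" and w0: "w0 \<in> DA"
    and f: "C1_curve {0..<T} (L2 \<Omega>) (L2_norm \<Omega>) f" and M: "C1_curve {0..<T} (L2 \<Omega>) (L2_norm \<Omega>) M"
  shows "\<exists>w. is_solution \<Omega> CC HH LL T (\<lambda>t x. (0, f t x, 0, M t x)) w0 w"
proof -
  define I where "I = {0..<T}"
  define J where "J = {0<..<T}"
  have JI: "J \<subseteq> I" and I0: "0 \<in> I" using T by (auto simp: I_def J_def)
  obtain f' where fL: "\<And>t. t \<in> I \<Longrightarrow> f t \<in> L2 \<Omega>"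
    and f': "\<And>t. t \<in> I \<Longrightarrow> has_curve_deriv I (L2 \<Omega>) (L2_norm \<Omega>) f (f' t) t" "C0_curve I (L2 \<Omega>) (L2_norm \<Omega>) f'"
    using f unfolding C1_curve_def I_def by blast
  obtain M' where mL2: "\<And>t. t \<in> I \<Longrightarrow> M t \<in> L2 \<Omega>"
    and M': "\<And>t. t \<in> I \<Longrightarrow> has_curve_deriv I (L2 \<Omega>) (L2_norm \<Omega>) M (M' t) t" "C0_curve I (L2 \<Omega>) (L2_norm \<Omega>) M'"
    using M unfolding C1_curve_def I_def by blast
  define g where "g t = (cls \<Omega> (f t), cls \<Omega> (M t))" for t
  define g' where "g' t = (cls \<Omega> (f' t), cls \<Omega> (M' t))" for t
  define F where "F t x = (0::vec3, f t x, 0::mat3, M t x)" for t x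
  have gd: "(g has_vector_derivative g' t) (at t within I)" if "t \<in> I" for t
    unfolding g_def[abs_def] g'_def
    by (intro has_vector_derivative_Pair cls_curve_derivative[OF grad.Om] fL mL2 f' M' that)
  have g'c: "continuous_on I g'" unfolding g'_def[abs_def]
    by (intro continuous_on_Pair cls_curve_continuous[OF grad.Om] f' M')
  have gc: "continuous_on I g"
    by (rule continuous_on_vector_derivative[OF gd])
  have gH: "g t \<in> HHs" if "t \<in> I" for t
    using fL[OF that] mL2[OF that] by (simp add: g_def HHs_def cls_rep_cls[OF grad.Om])
  have F: "F t \<in> XO" "Phi (F t) = (0, g t)" if "t \<in> I" for t
    using Phi_force[OF fL[OF that] mL2[OF that]] by (simp_all add: F_def[abs_def] g_def)
  obtain s y where s0: "s 0 = Phi w0" and yc: "continuous_on I y"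
    and sd: "\<And>t. t \<in> I \<Longrightarrow> (s has_vector_derivative y t) (at t within I)"
    and G: "\<And>t. t \<in> I \<Longrightarrow> (s t, y t - (0, g t)) \<in> wave.wave_graph"
    using wave.wave_problem[OF A_op(2)[OF w0], where F=g and F'=g' and T=T, folded I_def, OF gd g'c gH] by metis
  have SSt: "s t \<in> SS" if "t \<in> I" for t
    by (rule wave_graph_SS[OF G[OF that]])
  define w where "w t = field_of (s t)" for t
  have w: "w t \<in> XO" "Phi (w t) = s t" if "t \<in> I" for t
    unfolding w_def using field_of[OF SSt[OF that]] by auto
  have A: "w t \<in> DA" "AA (w t) \<in> XO" "Phi (AA (w t)) = y t - (0, g t)" if "t \<in> I" for t
  proof -
    show "w t \<in> DA" "Phi (AA (w t)) = y t - (0, g t)"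
      using A_op_eq[OF w(1)[OF that], of "y t - (0, g t)"] G[OF that] w(2)[OF that] by auto
    then show "AA (w t) \<in> XO" using A_op(1) by blast
  qed
  define d where "d t x = AA (w t) x + F t x" for t x
  have d: "d t \<in> XO" "Phi (d t) = y t" if "t \<in> I" for t
    using Phi_add[OF A(2)[OF that] F(1)[OF that]] A(3)[OF that] F(2)[OF that] by (simp_all add: d_def[abs_def])
  have deriv: "has_curve_deriv J XO XN w (d t) t" if t: "t \<in> J" for t
    unfolding has_curve_deriv_def
  proof (intro conjI X_norm_tendsto_0)
    have tI: "t \<in> I" using t JI by blast
    show "d t \<in> XO" by (rule d(1)[OF tI])
    show "(\<lambda>x. (w s x - w t x) /\<^sub>R (s - t) - d t x) \<in> XO" if "s \<in> J" for s
      using that JI by (intro Phi_quotient w d tI) auto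
    have "((\<lambda>r. norm ((s r - s t) /\<^sub>R (r - t) - y t)) \<longlongrightarrow> 0) (at t within J)"
      using has_vector_derivative_within_subset[OF sd[OF tI] JI] unfolding has_vector_derivative_iff_quotient .
    moreover have "norm (Phi (\<lambda>x. (w r x - w t x) /\<^sub>R (r - t) - d t x)) = norm ((s r - s t) /\<^sub>R (r - t) - y t)" if "r \<in> J" for r
    proof -
      have rI: "r \<in> I" using that JI by blast
      show ?thesis unfolding Phi_quotient(2)[OF w(1)[OF rI] w(1)[OF tI] d(1)[OF tI]] w(2)[OF rI] w(2)[OF tI] d(2)[OF tI] ..
    qed
    ultimately show "((\<lambda>r. norm (Phi (\<lambda>x. (w r x - w t x) /\<^sub>R (r - t) - d t x))) \<longlongrightarrow> 0) (at t within J)"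
      by (subst Lim_cong_within[OF refl refl refl]) auto
  qed
  have lim0: "((\<lambda>r. norm (h r - h t)) \<longlongrightarrow> 0) (at t within K)"
    if "continuous_on K h" "t \<in> K" for h :: "real \<Rightarrow> energy_val \<times> kinetic_val" and t K
    using that unfolding continuous_on_def tendsto_norm_zero_iff by (simp add: LIM_zero)
  have curve: "((\<lambda>r. XN (h r)) \<longlongrightarrow> 0) (at t within K)"
    if "\<And>r. r \<in> K \<Longrightarrow> h r \<in> XO" "\<And>r. r \<in> K \<Longrightarrow> Phi (h r) = k r - k t" "continuous_on K k" "t \<in> K"
    for h and k :: "real \<Rightarrow> energy_val \<times> kinetic_val" and t K
  proof (rule X_norm_tendsto_0[OF that(1)])
    show "((\<lambda>r. norm (Phi (h r))) \<longlongrightarrow> 0) (at t within K)"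
      by (subst Lim_cong_within[OF refl refl refl, of t K _ "\<lambda>r. norm (k r - k t)"]) (use that lim0 in auto)
  qed
  have "C0_curve J XO XN d"
    unfolding C0_curve_def
  proof (intro ballI conjI)
    fix t assume t: "t \<in> J"
    then have tI: "t \<in> I" using JI by blast
    show "d t \<in> XO" by (rule d(1)[OF tI])
    show "((\<lambda>s. XN (\<lambda>x. d s x - d t x)) \<longlongrightarrow> 0) (at t within J)"
    proof (rule curve[OF _ _ continuous_on_subset[OF yc JI] t])
      fix r assume "r \<in> J"
      then have rI: "r \<in> I" using JI by blast
      show "(\<lambda>x. d r x - d t x) \<in> XO" "Phi (\<lambda>x. d r x - d t x) = y r - y t"
        using Phi_diff[OF d(1)[OF rI] d(1)[OF tI]] d(2)[OF rI] d(2)[OF tI] by auto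
    qed
  qed
  then have C1: "C1_curve J XO XN w"
    unfolding C1_curve_def using deriv w(1) JI by blast
  have C0: "C0_curve I DA (graph_norm \<Omega> CC HH LL) w"
    unfolding C0_curve_def
  proof (intro ballI conjI A(1))
    fix t assume t: "t \<in> I"
    have diff: "(\<lambda>x. w r x - w t x) \<in> XO" "Phi (\<lambda>x. w r x - w t x) = s r - s t"
      "AA (\<lambda>x. w r x - w t x) \<in> XO" "Phi (AA (\<lambda>x. w r x - w t x)) = (y r - (0, g r)) - (y t - (0, g t))" if r: "r \<in> I" for r
    proof -
      show X: "(\<lambda>x. w r x - w t x) \<in> XO" and P: "Phi (\<lambda>x. w r x - w t x) = s r - s t"
        using Phi_diff[OF w(1)[OF r] w(1)[OF t]] w(2)[OF r] w(2)[OF t] by auto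
      have "(Phi (\<lambda>x. w r x - w t x), (y r - (0, g r)) - (y t - (0, g t))) \<in> wave.wave_graph"
        unfolding P using subspace_diff[OF wave.subspace_wave_graph G[OF r] G[OF t]] by simp
      from A_op_eq[OF X this] show "AA (\<lambda>x. w r x - w t x) \<in> XO"
        "Phi (AA (\<lambda>x. w r x - w t x)) = (y r - (0, g r)) - (y t - (0, g t))" using A_op(1) by auto
    qed
    have sc: "continuous_on I s" by (rule continuous_on_vector_derivative[OF sd])
    have "((\<lambda>r. XN (\<lambda>x. w r x - w t x)) \<longlongrightarrow> 0) (at t within I)"
      by (rule curve[OF diff(1,2) sc t])
    moreover have "((\<lambda>r. XN (AA (\<lambda>x. w r x - w t x))) \<longlongrightarrow> 0) (at t within I)"
      by (rule curve[where k="\<lambda>r. y r - (0, g r)", OF diff(3,4) _ t]) (auto intro!: continuous_intros yc gc)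
    ultimately have "((\<lambda>r. graph_norm \<Omega> CC HH LL (\<lambda>x. w r x - w t x)) \<longlongrightarrow> sqrt (0\<^sup>2 + 0\<^sup>2)) (at t within I)"
      unfolding graph_norm_def by (intro tendsto_intros)
    then show "((\<lambda>r. graph_norm \<Omega> CC HH LL (\<lambda>x. w r x - w t x)) \<longlongrightarrow> 0) (at t within I)" by simp
  qed
  have init: "AE x in lebesgue_on \<Omega>. w 0 x = w0 x"
    using w0 w[OF I0] s0 by (intro Phi_eq_AE) (auto simp: A_dom_def)
  have "is_solution \<Omega> CC HH LL T F w0 w"
    unfolding is_solution_def I_def[symmetric] J_def[symmetric]
    using C1 C0 deriv init by (simp add: d_def[abs_def])
  then show ?thesis unfolding F_def[abs_def] by blast
qed

text \<open>The energy \<open>e\<close> of the difference is differentiable at positive times with derivative zero, and the graph norm makes it continuous at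
  time zero, where it vanishes.\<close>

theorem solution_unique:
  assumes w: "is_solution \<Omega> CC HH LL T F w0 w" and w': "is_solution \<Omega> CC HH LL T F w0 w'" and t: "t \<in> {0..<T}"
  shows "AE x in lebesgue_on \<Omega>. w' t x = w t x"
proof -
  have D: "w s \<in> DA" "w' s \<in> DA" and
    lim: "((\<lambda>r. graph_norm \<Omega> CC HH LL (\<lambda>x. w r x - w s x)) \<longlongrightarrow> 0) (at s within {0..<T})"
      "((\<lambda>r. graph_norm \<Omega> CC HH LL (\<lambda>x. w' r x - w' s x)) \<longlongrightarrow> 0) (at s within {0..<T})" if "s \<in> {0..<T}" for s
    using w w' that unfolding is_solution_def C0_curve_def by auto
  then have X: "w s \<in> XO" "w' s \<in> XO" if "s \<in> {0..<T}" for s using that by (auto simp: A_dom_def)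
  have T: "0 \<in> {0..<T}" using t by auto
  define z where "z s = Phi (w' s) - Phi (w s)" for s
  define e where "e s = Eform (z s) (z s)" for s
  interpret E: bounded_bilinear Eform by (rule bounded_bilinear_Eform)
  have diff_le: "Eform (a - b) (a - b) \<le> 2 * Eform a a + 2 * Eform b b" for a b
    by (rule nonneg_form_diff_le[OF bounded_bilinear_Eform Eform_nonneg])
  have "AE x in lebesgue_on \<Omega>. w 0 x = w0 x" "AE x in lebesgue_on \<Omega>. w' 0 x = w0 x"
    using w w' by (auto simp: is_solution_def)
  then have "AE x in lebesgue_on \<Omega>. w' 0 x = w 0 x" by eventually_elim simp
  then have z0: "z 0 = 0" using Phi_AE_eq[OF X(2)[OF T] X(1)[OF T]] by (simp add: z_def)
  have deriv: "(e has_field_derivative 0) (at s)" if s: "0 < s" "s < T" for s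
  proof -
    define J where "J = {0<..<T}"
    have sI: "s \<in> {0..<T}" and sJ: "s \<in> J" using s by (auto simp: J_def)
    have JI: "r \<in> {0..<T}" if "r \<in> J" for r using that by (auto simp: J_def)
    define d where "d x = AA (w s) x + F s x" for x
    define d' where "d' x = AA (w' s) x + F s x" for x
    have dX: "d \<in> XO" "d' \<in> XO"
      and l: "((\<lambda>r. XN (\<lambda>x. (w r x - w s x) /\<^sub>R (r - s) - d x)) \<longlongrightarrow> 0) (at s within J)"
        "((\<lambda>r. XN (\<lambda>x. (w' r x - w' s x) /\<^sub>R (r - s) - d' x)) \<longlongrightarrow> 0) (at s within J)"
      using w w' sJ unfolding is_solution_def has_curve_deriv_def J_def d_def[abs_def] d'_def[abs_def] by blast+
    define D1 where "D1 = Phi (AA (w' s)) - Phi (AA (w s))"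
    have "(\<lambda>x. d' x - d x) = (\<lambda>x. AA (w' s) x - AA (w s) x)" by (simp add: d_def d'_def)
    then have D1: "D1 = Phi d' - Phi d"
      using Phi_diff(2)[OF dX(2,1)] Phi_diff(2)[OF A_op(1)[OF D(2)[OF sI]] A_op(1)[OF D(1)[OF sI]]] by (simp add: D1_def)
    have "Eform D1 (z s) = 0"
      unfolding D1_def z_def
      using subspace_diff[OF wave.subspace_wave_graph A_op(2)[OF D(2)[OF sI]] A_op(2)[OF D(1)[OF sI]]]
      by (intro energy_conservation) simp
    moreover have "((\<lambda>r. Eform ((z r - z s) /\<^sub>R (r - s) - D1) ((z r - z s) /\<^sub>R (r - s) - D1)) \<longlongrightarrow> 0) (at s within J)"
    proof (rule tendsto_sandwich[OF _ _ tendsto_const])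
      have "((\<lambda>r. 2 * (XN (\<lambda>x. (w' r x - w' s x) /\<^sub>R (r - s) - d' x))\<^sup>2
          + 2 * (XN (\<lambda>x. (w r x - w s x) /\<^sub>R (r - s) - d x))\<^sup>2) \<longlongrightarrow> 2 * 0\<^sup>2 + 2 * 0\<^sup>2) (at s within J)"
        by (intro tendsto_intros l)
      then show "((\<lambda>r. 2 * (XN (\<lambda>x. (w' r x - w' s x) /\<^sub>R (r - s) - d' x))\<^sup>2
          + 2 * (XN (\<lambda>x. (w r x - w s x) /\<^sub>R (r - s) - d x))\<^sup>2) \<longlongrightarrow> 0) (at s within J)" by simp
      have "Eform ((z r - z s) /\<^sub>R (r - s) - D1) ((z r - z s) /\<^sub>R (r - s) - D1)
          \<le> 2 * (XN (\<lambda>x. (w' r x - w' s x) /\<^sub>R (r - s) - d' x))\<^sup>2 + 2 * (XN (\<lambda>x. (w r x - w s x) /\<^sub>R (r - s) - d x))\<^sup>2"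
        if r: "r \<in> J" for r
      proof -
        note q = Phi_quotient[OF X(1)[OF JI[OF r]] X(1)[OF sI] dX(1), of "r - s"]
        note q' = Phi_quotient[OF X(2)[OF JI[OF r]] X(2)[OF sI] dX(2), of "r - s"]
        have "(z r - z s) /\<^sub>R (r - s) - D1 = ((Phi (w' r) - Phi (w' s)) /\<^sub>R (r - s) - Phi d')
            - ((Phi (w r) - Phi (w s)) /\<^sub>R (r - s) - Phi d)"
          unfolding z_def D1 by (simp add: algebra_simps)
        then show ?thesis unfolding X_norm_sq[OF q(1)] X_norm_sq[OF q'(1)] q(2) q'(2) using diff_le by presburger
      qed
      then show "\<forall>\<^sub>F r in at s within J. Eform ((z r - z s) /\<^sub>R (r - s) - D1) ((z r - z s) /\<^sub>R (r - s) - D1)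
          \<le> 2 * (XN (\<lambda>x. (w' r x - w' s x) /\<^sub>R (r - s) - d' x))\<^sup>2 + 2 * (XN (\<lambda>x. (w r x - w s x) /\<^sub>R (r - s) - d x))\<^sup>2"
        by (auto simp: eventually_at_filter)
    qed (simp add: Eform_nonneg)
    ultimately have "(e has_field_derivative 0) (at s within J)"
      unfolding e_def[abs_def]
      by (intro conserved_form_derivative[OF bounded_bilinear_Eform Eform_sym Eform_nonneg])
    then show ?thesis using at_within_open[OF sJ] by (simp add: J_def)
  qed
  have at0: "((\<lambda>r. e r) \<longlongrightarrow> e 0) (at 0 within {0..<T})"
  proof (rule tendsto_sandwich[of "\<lambda>_. 0"])
    let ?g = "\<lambda>r. 2 * (graph_norm \<Omega> CC HH LL (\<lambda>x. w' r x - w' 0 x))\<^sup>2 + 2 * (graph_norm \<Omega> CC HH LL (\<lambda>x. w r x - w 0 x))\<^sup>2"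
    have "(?g \<longlongrightarrow> 2 * 0\<^sup>2 + 2 * 0\<^sup>2) (at 0 within {0..<T})" by (intro tendsto_intros lim T)
    then show "(?g \<longlongrightarrow> e 0) (at 0 within {0..<T})" by (simp add: e_def z0 E.zero_left)
    show "((\<lambda>_. 0) \<longlongrightarrow> e 0) (at 0 within {0..<T})" by (simp add: e_def z0 E.zero_left)
    have "e r \<le> ?g r" if r: "r \<in> {0..<T}" for r
    proof -
      have q: "(XN (\<lambda>x. v r x - v 0 x))\<^sup>2 \<le> (graph_norm \<Omega> CC HH LL (\<lambda>x. v r x - v 0 x))\<^sup>2" for v
        by (simp add: graph_norm_def)
      have "z r = (Phi (w' r) - Phi (w' 0)) - (Phi (w r) - Phi (w 0))" using z0 by (simp add: z_def)
      then have "e r \<le> 2 * Eform (Phi (w' r) - Phi (w' 0)) (Phi (w' r) - Phi (w' 0)) + 2 * Eform (Phi (w r) - Phi (w 0)) (Phi (w r) - Phi (w 0))"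
        unfolding e_def using diff_le by presburger
      also have "\<dots> = 2 * (XN (\<lambda>x. w' r x - w' 0 x))\<^sup>2 + 2 * (XN (\<lambda>x. w r x - w 0 x))\<^sup>2"
        using X_norm_sq[OF Phi_diff(1)[OF X(2)[OF r] X(2)[OF T]]] X_norm_sq[OF Phi_diff(1)[OF X(1)[OF r] X(1)[OF T]]]
          Phi_diff(2)[OF X(2)[OF r] X(2)[OF T]] Phi_diff(2)[OF X(1)[OF r] X(1)[OF T]] by simp
      also have "\<dots> \<le> ?g r" using q[of w] q[of w'] by simp
      finally show ?thesis .
    qed
    then show "\<forall>\<^sub>F r in at 0 within {0..<T}. e r \<le> ?g r" by (auto simp: eventually_at_filter)
  qed (simp add: e_def Eform_nonneg)
  have "e t = e 0"
  proof (cases "t = 0")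
    case False
    show ?thesis
    proof (rule DERIV_isconst2[of 0 t])
      show "0 < t" "0 \<le> t" "t \<le> t" using False t by auto
      show "DERIV e s :> 0" if "0 < s" "s < t" for s using deriv that t by auto
      show "continuous_on {0..t} e"
        unfolding continuous_on_def
      proof
        fix s assume s: "s \<in> {0..t}"
        show "(e \<longlongrightarrow> e s) (at s within {0..t})"
        proof (cases "s = 0")
          case True
          have "{0..t} \<subseteq> {0..<T}" using t by auto
          then show ?thesis unfolding True by (rule tendsto_within_subset[OF at0])
        next
          case False
          then have "isCont e s" using s t by (intro DERIV_isCont[OF deriv]) auto
          then show ?thesis by (simp add: continuous_at tendsto_within_subset[of _ _ _ UNIV])
        qed
      qed
    qed
  qed simp
  then have "Eform (z t) (z t) = 0" by (simp add: e_def z0 E.zero_left)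
  moreover have "z t \<in> SS"
    unfolding z_def using subspace_SS(1) Phi_SS X[OF t] by (intro subspace_diff)
  ultimately have "z t = 0" using Eform_definite by blast
  then show ?thesis using Phi_eq_AE[OF X(2)[OF t] X(1)[OF t]] by (simp add: z_def)
qed

end

theorem theorem5p9:
  fixes \<Omega> :: "(real^3) set"
    and T :: real
    and CC HH LL :: "real^3 \<Rightarrow> real^3^3^3^3"
    and f :: "real \<Rightarrow> real^3 \<Rightarrow> real^3"
    and M :: "real \<Rightarrow> real^3 \<Rightarrow> real^3^3"
    and u0 du0 :: "real^3 \<Rightarrow> real^3"
    and P0 dP0 :: "real^3 \<Rightarrow> real^3^3"
  assumes "bounded_domain \<Omega>" and "piecewise_smooth_boundary \<Omega>" and "T > 0"
    and "Ck_on 1 \<Omega> CC" and "Ck_on 1 \<Omega> HH" and "Ck_on 1 \<Omega> LL"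
    and "pos_def_on Sym3 \<Omega> CC" and "pos_def_on Sym3 \<Omega> HH" and "pos_def_on UNIV \<Omega> LL"
    and "major_sym \<Omega> CC" and "minor_sym \<Omega> CC"
    and "major_sym \<Omega> HH" and "minor_sym \<Omega> HH"
    and "major_sym \<Omega> LL"
    and "C1_curve {0..<T} (L2 \<Omega>) (L2_norm \<Omega>) f"
    and "C1_curve {0..<T} (L2 \<Omega>) (L2_norm \<Omega>) M"
    and "(\<lambda>x. (u0 x, du0 x, P0 x, dP0 x)) \<in> A_dom \<Omega> CC HH LL"
  defines "F \<equiv> \<lambda>t x. (0, f t x, 0, M t x)"
    and "w0 \<equiv> \<lambda>x. (u0 x, du0 x, P0 x, dP0 x)"
  shows "\<exists>w. is_solution \<Omega> CC HH LL T F w0 w \<and>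
             (\<forall>w'. is_solution \<Omega> CC HH LL T F w0 w' \<longrightarrow>
                   (\<forall>t\<in>{0..<T}. AE x in lebesgue_on \<Omega>. w' t x = w t x))"
proof -
  interpret micromorphic \<Omega> CC HH LL
    using assms(1,4-14) by (intro micromorphic.intro) (auto simp: bounded_domain_def)
  obtain w where "is_solution \<Omega> CC HH LL T F w0 w"
    using solution_exists[OF assms(3) assms(17,15,16)] unfolding F_def w0_def by blast
  then show ?thesis using solution_unique by blast
qed

end
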